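(* Let $s>0$, let $(R,\mathfrak n)$ be an artinian local ring, let $S=\bigoplus_{n_1,\ldots,n_s\ge 0}S_{(n_1,\ldots,n_s)}$ be a finitely generated standard $\mathbb N^s$-graded algebra over $R$, and let $M=\bigoplus_{n_1,\ldots,n_s\ge 0}M_{(n_1,\ldots,n_s)}$ be a finitely generated $\mathbb N^s$-graded $S$-module with $M_{(n_1,\ldots,n_s)}=S_{(n_1,\ldots,n_s)}M_{(0,\ldots,0)}$ for all $n_1,\ldots,n_s\ge 0$. Assume that $M$ has positive rank over $S$ and that $S_{(1,1,\ldots,1)}\not\subseteq\sqrt{\mathrm{Ann}_S M}$. Then for every $\mathbf k=(k_1,\ldots,k_s)\in\mathbb N^s$ with $k_1+\cdots+k_s=\dim \mathrm{Supp}_{++}M$, $$e(M;\mathbf k)=e(S;\mathbf k)\,\mathrm{rank}_S M .$$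
   Context: Rings are commutative. A finitely generated standard $\mathbb N^s$-graded algebra $S$ over $R$ is one with $S_{(0,\ldots,0)}=R$ that is generated over $R$ by finitely many homogeneous elements of total degree $1$. Rank: if $\mathcal A$ is a commutative ring with total ring of fractions $Q$, an $\mathcal A$-module $\mathcal M$ has rank $r$ if $\mathcal M\otimes_{\mathcal A} Q$ is a free $Q$-module of rank $r$. Set $S_{++}=\bigoplus_{n_1,\ldots,n_s>0}S_{(n_1,\ldots,n_s)}$. $\mathrm{Proj}\,S$ is the set of homogeneous prime ideals of $S$ not containing $S_{++}$, and for a finitely generated $\mathbb N^s$-graded $S$-module $X$, $\mathrm{Supp}_{++}X=\{P\in\mathrm{Proj}\,S : X_P\neq 0\}$; its dimension is the maximal length of chains of primes in it ($-\infty$ if it is empty). Mixed multiplicities: for $X$ (here $X=M$ or $X=S$) with $m=\dim\mathrm{Supp}_{++}X\ge 0$, the length $\ell_R(X_{(n_1,\ldots,n_s)})$ agrees for all large $n_1,\ldots,n_s$ with a polynomial of total degree $m$, whose terms of total degree $m$ are written as $$\sum_{k_1+\cdots+k_s=m}e(X;k_1,\ldots,k_s)\frac{n_1^{k_1}\cdots n_s^{k_s}}{k_1!\cdots k_s!}.$$ The number $e(X;\mathbf k)$ is the mixed multiplicity of $X$ of type $\mathbf k$. The asserted equality is understood to include that both sides are defined for the types $\mathbf k$ considered. *)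

theory Defs
  imports
    "HOL-Algebra.Module"
    "HOL-Algebra.Ideal"
    "HOL-Algebra.Generated_Groups"
    "HOL-Algebra.Generated_Rings"
    "HOL-Library.Extended_Nat"
    "HOL-Library.Extended_Real"
    "HOL-Library.Multiset"
    "HOL-Library.Poly_Mapping"
begin

section \<open>Rings and modules\<close>

locale artinian_ring = ring +
  assumes descending_chain:
    "\<lbrakk> \<And>k :: nat. ideal (I k) R; \<And>k. I (Suc k) \<subseteq> I k \<rbrakk> \<Longrightarrow> \<exists>N. \<forall>k\<ge>N. I k = I N"

locale local_cring = cring +
  fixes \<nn> :: "'a set"
  assumes maximal: "maximalideal \<nn> R"
    and unique: "maximalideal J R \<Longrightarrow> J = \<nn>"

definition radical :: "('a, 'c) ring_scheme \<Rightarrow> 'a set \<Rightarrow> 'a set" where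
  "radical A I = {a \<in> carrier A. \<exists>k :: nat. a [^]\<^bsub>A\<^esub> k \<in> I}"

definition regular_module :: "('a, 'c) ring_scheme \<Rightarrow> ('a, 'a) module" where
  "regular_module A = \<lparr>carrier = carrier A, monoid.mult = monoid.mult A, monoid.one = monoid.one A,
     ring.zero = ring.zero A, ring.add = ring.add A, smult = monoid.mult A\<rparr>"

definition annihilator :: "('a, 'c) ring_scheme \<Rightarrow> ('a, 'b, 'd) module_scheme \<Rightarrow> 'a set" where
  "annihilator A M = {a \<in> carrier A. \<forall>x \<in> carrier M. a \<odot>\<^bsub>M\<^esub> x = \<zero>\<^bsub>M\<^esub>}"

definition finitely_generated_module ::
  "('a, 'c) ring_scheme \<Rightarrow> ('a, 'b, 'd) module_scheme \<Rightarrow> bool" where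
  "finitely_generated_module A M \<longleftrightarrow>
     (\<exists>F. finite F \<and> F \<subseteq> carrier M \<and> (\<forall>N. submodule N A M \<and> F \<subseteq> N \<longrightarrow> N = carrier M))"

definition module_length ::
  "('a, 'c) ring_scheme \<Rightarrow> ('a, 'b, 'd) module_scheme \<Rightarrow> enat" where
  "module_length A M = Sup {enat l | l. \<exists>N :: nat \<Rightarrow> 'b set.
     (\<forall>i\<le>l. submodule (N i) A M) \<and> (\<forall>i<l. N i \<subset> N (Suc i))}"

definition free_of_rank ::
  "('a, 'c) ring_scheme \<Rightarrow> ('a, 'b, 'd) module_scheme \<Rightarrow> nat \<Rightarrow> bool" where
  "free_of_rank A M r \<longleftrightarrow> (\<exists>b. b \<in> {..<r} \<rightarrow> carrier M \<and>
     (\<forall>x \<in> carrier M. \<exists>!c. c \<in> {..<r} \<rightarrow>\<^sub>E carrier A \<and>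
        x = (\<Oplus>\<^bsub>M\<^esub>i\<in>{..<r}. c i \<odot>\<^bsub>M\<^esub> b i)))"


section \<open>Localization\<close>

text \<open>In the following, \<open>W\<close> is a multiplicatively closed subset of \<open>A\<close>, and the class of a pair
  \<open>(x, w)\<close> is the fraction \<open>x / w\<close>. Operations on fractions are given as a union over all
  representatives; all sets in such a union coincide.\<close>

definition frac_rel ::
  "'a set \<Rightarrow> ('a, 'b, 'd) module_scheme \<Rightarrow> (('b \<times> 'a) \<times> ('b \<times> 'a)) set" where
  "frac_rel W M = {((x, w), (y, v)). x \<in> carrier M \<and> w \<in> W \<and> y \<in> carrier M \<and> v \<in> W \<and>
     (\<exists>u \<in> W. u \<odot>\<^bsub>M\<^esub> (v \<odot>\<^bsub>M\<^esub> x) = u \<odot>\<^bsub>M\<^esub> (w \<odot>\<^bsub>M\<^esub> y))}"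

definition fraction :: "'a set \<Rightarrow> ('a, 'b, 'd) module_scheme \<Rightarrow> 'b \<Rightarrow> 'a \<Rightarrow> ('b \<times> 'a) set" where
  "fraction W M x w = frac_rel W M `` {(x, w)}"

text \<open>The scalars of \<open>localized_module A W M\<close> are the elements of \<open>localized_ring A W\<close> below. The
  record fields \<open>mult\<close> and \<open>one\<close> play no role for a module.\<close>

definition localized_module :: "('a, 'c) ring_scheme \<Rightarrow> 'a set \<Rightarrow> ('a, 'b, 'd) module_scheme \<Rightarrow>
    (('a \<times> 'a) set, ('b \<times> 'a) set) module" where
  "localized_module A W M = \<lparr>
     carrier = (carrier M \<times> W) // frac_rel W M,
     monoid.mult = undefined, monoid.one = undefined,
     ring.zero = fraction W M \<zero>\<^bsub>M\<^esub> \<one>\<^bsub>A\<^esub>,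
     ring.add = (\<lambda>C D. \<Union>(x, w)\<in>C. \<Union>(y, v)\<in>D.
              fraction W M (v \<odot>\<^bsub>M\<^esub> x \<oplus>\<^bsub>M\<^esub> w \<odot>\<^bsub>M\<^esub> y) (w \<otimes>\<^bsub>A\<^esub> v)),
     smult = (\<lambda>C D. \<Union>(a, w)\<in>C. \<Union>(y, v)\<in>D. fraction W M (a \<odot>\<^bsub>M\<^esub> y) (w \<otimes>\<^bsub>A\<^esub> v))\<rparr>"

definition localized_ring :: "('a, 'c) ring_scheme \<Rightarrow> 'a set \<Rightarrow> ('a \<times> 'a) set ring" where
  "localized_ring A W = (let L = localized_module A W (regular_module A) in
     \<lparr>carrier = carrier L, monoid.mult = smult L,
      monoid.one = fraction W (regular_module A) \<one>\<^bsub>A\<^esub> \<one>\<^bsub>A\<^esub>, ring.zero = ring.zero L, ring.add = ring.add L\<rparr>)"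

definition nonzerodivisors :: "('a, 'c) ring_scheme \<Rightarrow> 'a set" where
  "nonzerodivisors A =
     {a \<in> carrier A. \<forall>b \<in> carrier A. a \<otimes>\<^bsub>A\<^esub> b = \<zero>\<^bsub>A\<^esub> \<longrightarrow> b = \<zero>\<^bsub>A\<^esub>}"

definition total_fraction_ring :: "('a, 'c) ring_scheme \<Rightarrow> ('a \<times> 'a) set ring" where
  "total_fraction_ring A = localized_ring A (nonzerodivisors A)"

definition to_total_fraction_ring :: "('a, 'c) ring_scheme \<Rightarrow> 'a \<Rightarrow> ('a \<times> 'a) set" where
  "to_total_fraction_ring A a = fraction (nonzerodivisors A) (regular_module A) a \<one>\<^bsub>A\<^esub>"


section \<open>Tensor products and rank\<close>

text \<open>The tensor product of two \<open>A\<close>-modules \<open>M\<close> and \<open>N\<close>: the free commutative monoid on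
  \<open>carrier M \<times> carrier N\<close> (finite multisets of pairs, read as formal sums) modulo the congruence
  generated by the bilinearity relations. This is the usual quotient of the free abelian group:
  the class of \<open>{#(\<ominus> x, y)#}\<close> is an additive inverse of the class of \<open>{#(x, y)#}\<close>.\<close>

inductive tensor_eq :: "('a, 'c) ring_scheme \<Rightarrow> ('a, 'b, 'd) module_scheme \<Rightarrow>
    ('a, 'e, 'f) module_scheme \<Rightarrow> ('b \<times> 'e) multiset \<Rightarrow> ('b \<times> 'e) multiset \<Rightarrow> bool"
  for A and M and N where
    tensor_refl: "set_mset X \<subseteq> carrier M \<times> carrier N \<Longrightarrow> tensor_eq A M N X X"
  | tensor_sym: "tensor_eq A M N X Y \<Longrightarrow> tensor_eq A M N Y X"
  | tensor_trans: "\<lbrakk> tensor_eq A M N X Y; tensor_eq A M N Y Z \<rbrakk> \<Longrightarrow> tensor_eq A M N X Z"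
  | tensor_plus: "\<lbrakk> tensor_eq A M N X Y; tensor_eq A M N X' Y' \<rbrakk> \<Longrightarrow>
      tensor_eq A M N (X + X') (Y + Y')"
  | tensor_zero: "y \<in> carrier N \<Longrightarrow> tensor_eq A M N {#(\<zero>\<^bsub>M\<^esub>, y)#} {#}"
  | tensor_add_left: "\<lbrakk> x \<in> carrier M; x' \<in> carrier M; y \<in> carrier N \<rbrakk> \<Longrightarrow>
      tensor_eq A M N {#(x \<oplus>\<^bsub>M\<^esub> x', y)#} {#(x, y), (x', y)#}"
  | tensor_add_right: "\<lbrakk> x \<in> carrier M; y \<in> carrier N; y' \<in> carrier N \<rbrakk> \<Longrightarrow>
      tensor_eq A M N {#(x, y \<oplus>\<^bsub>N\<^esub> y')#} {#(x, y), (x, y')#}"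
  | tensor_balanced: "\<lbrakk> a \<in> carrier A; x \<in> carrier M; y \<in> carrier N \<rbrakk> \<Longrightarrow>
      tensor_eq A M N {#(a \<odot>\<^bsub>M\<^esub> x, y)#} {#(x, a \<odot>\<^bsub>N\<^esub> y)#}"

definition tensor_class :: "('a, 'c) ring_scheme \<Rightarrow> ('a, 'b, 'd) module_scheme \<Rightarrow>
    ('a, 'e, 'f) module_scheme \<Rightarrow> ('b \<times> 'e) multiset \<Rightarrow> ('b \<times> 'e) multiset set" where
  "tensor_class A M N X = {Y. tensor_eq A M N X Y}"

definition restrict_scalars :: "('a \<Rightarrow> 'e) \<Rightarrow> ('e, 'f) ring_scheme \<Rightarrow> ('a, 'e) module" where
  "restrict_scalars \<phi> B = \<lparr>carrier = carrier B, monoid.mult = monoid.mult B, monoid.one = monoid.one B,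
     ring.zero = ring.zero B, ring.add = ring.add B, smult = (\<lambda>a b. \<phi> a \<otimes>\<^bsub>B\<^esub> b)\<rparr>"

text \<open>The \<open>B\<close>-module \<open>M \<otimes>\<^sub>A B\<close> for a ring homomorphism \<open>\<phi>\<close> from \<open>A\<close> to \<open>B\<close>; \<open>B\<close> acts on the
  second factor.\<close>

definition base_change :: "('a, 'c) ring_scheme \<Rightarrow> ('a \<Rightarrow> 'e) \<Rightarrow> ('e, 'f) ring_scheme \<Rightarrow>
    ('a, 'b, 'd) module_scheme \<Rightarrow> ('e, ('b \<times> 'e) multiset set) module" where
  "base_change A \<phi> B M = (let cls = tensor_class A M (restrict_scalars \<phi> B) in
     \<lparr>carrier = cls ` {X. set_mset X \<subseteq> carrier M \<times> carrier B},
      monoid.mult = undefined, monoid.one = undefined,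
      ring.zero = cls {#},
      ring.add = (\<lambda>C D. \<Union>X\<in>C. \<Union>Y\<in>D. cls (X + Y)),
      smult = (\<lambda>q C. \<Union>X\<in>C. cls (image_mset (\<lambda>(x, b). (x, q \<otimes>\<^bsub>B\<^esub> b)) X))\<rparr>)"

definition has_rank ::
  "('a, 'c) ring_scheme \<Rightarrow> ('a, 'b, 'd) module_scheme \<Rightarrow> nat \<Rightarrow> bool" where
  "has_rank A M r \<longleftrightarrow> free_of_rank (total_fraction_ring A)
     (base_change A (to_total_fraction_ring A) (total_fraction_ring A) M) r"


section \<open>Multigraded algebras and modules\<close>

text \<open>The index set \<open>{1,\<dots>,s}\<close> is a finite type \<open>'s\<close>; a multidegree is a function
  \<open>'s \<Rightarrow> nat\<close>, and \<open>gr n\<close> is the homogeneous component of degree \<open>n\<close>.\<close>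

definition direct_sum_decomposition ::
  "('b, 'm) ring_scheme \<Rightarrow> (('s \<Rightarrow> nat) \<Rightarrow> 'b set) \<Rightarrow> bool" where
  "direct_sum_decomposition G gr \<longleftrightarrow>
     (\<forall>n. subgroup (gr n) (add_monoid G)) \<and>
     (\<forall>x \<in> carrier G. \<exists>!f. (\<forall>n. f n \<in> gr n) \<and> finite {n. f n \<noteq> \<zero>\<^bsub>G\<^esub>} \<and>
        x = (\<Oplus>\<^bsub>G\<^esub>n\<in>{n. f n \<noteq> \<zero>\<^bsub>G\<^esub>}. f n))"

definition standard_graded_algebra ::
  "'a ring \<Rightarrow> 'a ring \<Rightarrow> (('s::finite \<Rightarrow> nat) \<Rightarrow> 'a set) \<Rightarrow> bool" where
  "standard_graded_algebra R S gr \<longleftrightarrow>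
     cring S \<and> direct_sum_decomposition S gr \<and>
     (\<forall>n n'. \<forall>a \<in> gr n. \<forall>b \<in> gr n'. a \<otimes>\<^bsub>S\<^esub> b \<in> gr (\<lambda>i. n i + n' i)) \<and>
     R = S\<lparr>carrier := gr (\<lambda>_. 0)\<rparr> \<and>
     (\<exists>F. finite F \<and> F \<subseteq> (\<Union>n \<in> {n. (\<Sum>i\<in>UNIV. n i) = 1}. gr n) \<and>
        carrier S = generate_ring S (carrier R \<union> F))"

definition graded_module :: "'a ring \<Rightarrow> (('s \<Rightarrow> nat) \<Rightarrow> 'a set) \<Rightarrow>
    ('a, 'b) module \<Rightarrow> (('s \<Rightarrow> nat) \<Rightarrow> 'b set) \<Rightarrow> bool" where
  "graded_module S grS M grM \<longleftrightarrow>
     module S M \<and> direct_sum_decomposition M grM \<and>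
     (\<forall>n n'. \<forall>a \<in> grS n. \<forall>x \<in> grM n'. a \<odot>\<^bsub>M\<^esub> x \<in> grM (\<lambda>i. n i + n' i))"

text \<open>The set of finite sums of products \<open>a \<odot> x\<close> with \<open>a \<in> A\<close> and \<open>x \<in> X\<close>.\<close>

definition smult_span :: "('a, 'b, 'd) module_scheme \<Rightarrow> 'a set \<Rightarrow> 'b set \<Rightarrow> 'b set" where
  "smult_span M A X = generate (add_monoid M) {a \<odot>\<^bsub>M\<^esub> x | a x. a \<in> A \<and> x \<in> X}"

definition homogeneous_ideal ::
  "'a ring \<Rightarrow> (('s \<Rightarrow> nat) \<Rightarrow> 'a set) \<Rightarrow> 'a set \<Rightarrow> bool" where
  "homogeneous_ideal S gr I \<longleftrightarrow> ideal I S \<and> I = Idl\<^bsub>S\<^esub> (I \<inter> (\<Union>n. gr n))"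

definition S_plusplus :: "'a ring \<Rightarrow> (('s \<Rightarrow> nat) \<Rightarrow> 'a set) \<Rightarrow> 'a set" where
  "S_plusplus S gr = generate (add_monoid S) (\<Union>n \<in> {n. \<forall>i. n i > 0}. gr n)"

definition Proj :: "'a ring \<Rightarrow> (('s \<Rightarrow> nat) \<Rightarrow> 'a set) \<Rightarrow> 'a set set" where
  "Proj S gr = {P. primeideal P S \<and> homogeneous_ideal S gr P \<and> \<not> S_plusplus S gr \<subseteq> P}"

definition Supp_plusplus ::
  "'a ring \<Rightarrow> (('s \<Rightarrow> nat) \<Rightarrow> 'a set) \<Rightarrow> ('a, 'b) module \<Rightarrow> 'a set set" where
  "Supp_plusplus S gr X = {P \<in> Proj S gr.
     carrier (localized_module S (carrier S - P) X)
       \<noteq> {\<zero>\<^bsub>localized_module S (carrier S - P) X\<^esub>}}"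

text \<open>The supremum of the empty set in \<open>ereal\<close> is \<open>-\<infinity>\<close>.\<close>

definition chain_dimension :: "'a set set \<Rightarrow> ereal" where
  "chain_dimension V = Sup {ereal (real d) | d. \<exists>P :: nat \<Rightarrow> 'a set.
     (\<forall>i\<le>d. P i \<in> V) \<and> (\<forall>i<d. P i \<subset> P (Suc i))}"


section \<open>Mixed multiplicities\<close>

text \<open>A polynomial in the variables indexed by \<open>'s\<close> is the finitely supported map from exponent
  vectors to coefficients. The zero polynomial has total degree \<open>-\<infinity>\<close>.\<close>

type_synonym 's mpolynomial = "('s \<Rightarrow> nat) \<Rightarrow>\<^sub>0 real"

definition poly_value :: "('s::finite) mpolynomial \<Rightarrow> ('s \<Rightarrow> nat) \<Rightarrow> real" where
  "poly_value p n =
     (\<Sum>k\<in>Poly_Mapping.keys p. Poly_Mapping.lookup p k * (\<Prod>i\<in>UNIV. real (n i) ^ k i))"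

definition total_degree :: "('s::finite) mpolynomial \<Rightarrow> ereal" where
  "total_degree p = (SUP k\<in>Poly_Mapping.keys p. ereal (real (\<Sum>i\<in>UNIV. k i)))"

definition is_hilbert_polynomial :: "'a ring \<Rightarrow> ('a, 'b) module \<Rightarrow>
    (('s::finite \<Rightarrow> nat) \<Rightarrow> 'b set) \<Rightarrow> 's mpolynomial \<Rightarrow> bool" where
  "is_hilbert_polynomial R X gr p \<longleftrightarrow> (\<exists>N. \<forall>n. (\<forall>i. n i \<ge> N) \<longrightarrow>
     (\<exists>l. module_length R (X\<lparr>carrier := gr n\<rparr>) = enat l \<and> real l = poly_value p n))"

text \<open>The Hilbert polynomial is unique if it exists, because a polynomial is determined by its
  values at all large arguments.\<close>

definition hilbert_polynomial :: "'a ring \<Rightarrow> ('a, 'b) module \<Rightarrow>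
    (('s::finite \<Rightarrow> nat) \<Rightarrow> 'b set) \<Rightarrow> 's mpolynomial" where
  "hilbert_polynomial R X gr = (THE p. is_hilbert_polynomial R X gr p)"

text \<open>The coefficient of the monomial with exponent vector \<open>k\<close> is \<open>e(X; k) / (k\<^sub>1! \<cdots> k\<^sub>s!)\<close>.
  This is a mixed multiplicity only if \<open>mixed_multiplicity_defined\<close> holds, i.e. if \<open>k\<close> has total
  degree \<open>dim Supp\<^sub>+\<^sub>+ X\<close> and this is also the degree of the Hilbert polynomial of \<open>X\<close>.\<close>

definition mixed_multiplicity :: "'a ring \<Rightarrow> ('a, 'b) module \<Rightarrow>
    (('s::finite \<Rightarrow> nat) \<Rightarrow> 'b set) \<Rightarrow> ('s \<Rightarrow> nat) \<Rightarrow> real" where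
  "mixed_multiplicity R X gr k =
     Poly_Mapping.lookup (hilbert_polynomial R X gr) k * (\<Prod>i\<in>UNIV. fact (k i))"

definition mixed_multiplicity_defined :: "'a ring \<Rightarrow> 'a ring \<Rightarrow>
    (('s::finite \<Rightarrow> nat) \<Rightarrow> 'a set) \<Rightarrow> ('a, 'b) module \<Rightarrow> (('s \<Rightarrow> nat) \<Rightarrow> 'b set) \<Rightarrow>
    ('s \<Rightarrow> nat) \<Rightarrow> bool" where
  "mixed_multiplicity_defined R S grS X grX k \<longleftrightarrow>
     ereal (real (\<Sum>i\<in>UNIV. k i)) = chain_dimension (Supp_plusplus S grS X) \<and>
     (\<exists>p. is_hilbert_polynomial R X grX p \<and>
        total_degree p = chain_dimension (Supp_plusplus S grS X))"

end

theory Submission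
  imports Defs
begin

text \<open>Clearing denominators in a basis of \<open>M \<otimes> Q\<close> gives elements \<open>x\<^sub>1, \<dots>, x\<^sub>r\<close> of \<open>M\<close> that are linearly
  independent over \<open>S\<close>, and a nonzerodivisor \<open>w\<close> of \<open>S\<close> with \<open>w M \<subseteq> L = S x\<^sub>1 + \<cdots> + S x\<^sub>r\<close>. In particular \<open>M\<close> is
  faithful, so its support is all of \<open>Proj S\<close>. Neither the \<open>x\<^sub>j\<close> nor \<open>w\<close> need be homogeneous, but their
  degrees are bounded, so Hilbert functions can be compared after summation over boxes of
  multidegrees: \<open>S\<^sup>r \<cong> L \<subseteq> M\<close> bounds the sum for \<open>M\<close> from below. From above, multiplication by \<open>w\<close>
  maps the elements of \<open>L\<close> with degrees in a box injectively to combinations of the \<open>x\<^sub>j\<close> whose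
  coefficients have degrees in a slightly larger box, and \<open>M / L\<close> is a finitely generated module
  over \<open>S / w S\<close>, whose Hilbert function has smaller growth. Comparing leading terms gives the formula.
  That the Hilbert polynomial of \<open>S\<close> has degree \<open>dim Proj S\<close> follows from a prime filtration and from
  the drop of the degree along strict inclusions of relevant homogeneous primes.\<close>

section \<open>Eventually polynomial functions\<close>

text \<open>Polynomial growth is encoded by iterated differences because Hilbert functions produce
  it in this way: for a prime \<open>P\<close> of \<open>Proj\<close> and \<open>x\<close> of degree
  \<open>e_i\<close> outside \<open>P\<close>, multiplication by \<open>x\<close> is injective on
  \<open>S / P\<close>. So the difference in direction \<open>i\<close> of the Hilbert function of
  \<open>S / P\<close> is a translate of that of \<open>S / (P + x S)\<close>, and all primes above
  \<open>P + x S\<close> are strictly larger than \<open>P\<close>. No quotient module is formed: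
  the length of \<open>B / A\<close> is the supremum of the lengths of chains between
  \<open>A\<close> and \<open>B\<close>, and maps between quotients become strictly monotone maps
  between intervals. The constant \<open>d\<close> of the box estimates bounds all degrees occurring
  in the \<open>x_j\<close>, in \<open>w\<close> and in the coefficients of \<open>w m\<close> for
  the generators \<open>m\<close> of \<open>M\<close>. The slower growth of \<open>S / w S\<close>
  is obtained without dimension theory: over a box of size \<open>h\<close> its length is at most
  the sum for \<open>S\<close> over that box minus the sum over the box of size
  \<open>h - d\<close>, and the ratio of the numbers of points of the two boxes tends to 1 as
  \<open>h\<close> grows.\<close>

definition monomial_fun :: "('s::finite \<Rightarrow> nat) \<Rightarrow> ('s \<Rightarrow> nat) \<Rightarrow> real" where
  "monomial_fun k n = (\<Prod>i\<in>UNIV. real (n i) ^ k i)"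

definition tdeg :: "('s::finite \<Rightarrow> nat) \<Rightarrow> nat" where
  "tdeg k = (\<Sum>i\<in>UNIV. k i)"

text \<open>The bound on the degree is strict, so that \<open>e = 0\<close> leaves only the zero
  polynomial and a difference lowers \<open>e\<close> by exactly one, in step with
  \<open>ev_poly\<close>.\<close>

definition poly_fun :: "nat \<Rightarrow> (('s::finite \<Rightarrow> nat) \<Rightarrow> real) \<Rightarrow> bool" where
  "poly_fun e f \<longleftrightarrow> (\<exists>K c. finite K \<and> (\<forall>k\<in>K. tdeg k < e) \<and> f = (\<lambda>n. \<Sum>k\<in>K. c k * monomial_fun k n))"

definition shift :: "'s \<Rightarrow> ('s \<Rightarrow> nat) \<Rightarrow> ('s \<Rightarrow> nat)" where
  "shift i n = n(i := Suc (n i))"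

definition diff_at :: "'s \<Rightarrow> (('s \<Rightarrow> nat) \<Rightarrow> real) \<Rightarrow> ('s \<Rightarrow> nat) \<Rightarrow> real" where
  "diff_at i f n = f (shift i n) - f n"

definition ev_large :: "(('s \<Rightarrow> nat) \<Rightarrow> bool) \<Rightarrow> bool" where
  "ev_large Q \<longleftrightarrow> (\<exists>N. \<forall>n. (\<forall>i. N \<le> n i) \<longrightarrow> Q n)"

text \<open>\<open>ev_poly e f\<close> means that \<open>f\<close> eventually agrees with a polynomial of total degree less than \<open>e\<close>.\<close>

primrec ev_poly :: "nat \<Rightarrow> (('s::finite \<Rightarrow> nat) \<Rightarrow> real) \<Rightarrow> bool" where
  "ev_poly 0 f \<longleftrightarrow> ev_large (\<lambda>n. f n = 0)"
| "ev_poly (Suc e) f \<longleftrightarrow> (\<forall>i. ev_poly e (diff_at i f))"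

lemma ev_large_mono: "ev_large Q \<Longrightarrow> (\<And>n. Q n \<Longrightarrow> Q' n) \<Longrightarrow> ev_large Q'"
  unfolding ev_large_def by blast

lemma ev_large_conj: "ev_large Q \<Longrightarrow> ev_large Q' \<Longrightarrow> ev_large (\<lambda>n. Q n \<and> Q' n)"
proof -
  assume "ev_large Q" "ev_large Q'"
  then obtain N N' where N: "\<And>n. \<forall>i. N \<le> n i \<Longrightarrow> Q n" "\<And>n. \<forall>i. N' \<le> n i \<Longrightarrow> Q' n"
    unfolding ev_large_def by blast
  then show ?thesis unfolding ev_large_def by (intro exI[of _ "max N N'"]) simp
qed

lemma ev_large_all:
  fixes Q :: "'i::finite \<Rightarrow> ('s \<Rightarrow> nat) \<Rightarrow> bool"
  assumes "\<And>i. ev_large (Q i)" shows "ev_large (\<lambda>n. \<forall>i. Q i n)"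
proof -
  from assms obtain N where N: "\<And>i n. (\<forall>j. N i \<le> n j) \<Longrightarrow> Q i n"
    unfolding ev_large_def by metis
  show ?thesis unfolding ev_large_def
  proof (intro exI allI impI)
    fix n :: "'s \<Rightarrow> nat" and i assume n: "\<forall>j. Max (range N) \<le> n j"
    have "N i \<le> Max (range N)" by simp
    then show "Q i n" using N n le_trans by blast
  qed
qed

lemma ev_large_add: "ev_large Q \<Longrightarrow> ev_large (\<lambda>n. Q (\<lambda>i. n i + d i))"
  unfolding ev_large_def by (meson le_add1 le_trans)

lemma ev_large_sub:
  fixes d :: "'s::finite \<Rightarrow> nat"
  assumes "ev_large Q" shows "ev_large (\<lambda>n. Q (\<lambda>i. n i - d i))"
proof -
  obtain N where N: "\<And>n. (\<forall>i. N \<le> n i) \<Longrightarrow> Q n" using assms unfolding ev_large_def by blast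
  have "N \<le> n i - d i" if "\<forall>i. N + Max (range d) \<le> n i" for n i
  proof -
    have "d i \<le> Max (range d)" by simp
    then show ?thesis using that[rule_format, of i] by linarith
  qed
  then show ?thesis unfolding ev_large_def by (intro exI[of _ "N + Max (range d)"] allI impI N) simp
qed

lemma ev_large_ge: "ev_large (\<lambda>n. \<forall>i::'s::finite. d i \<le> n i)"
proof -
  have "d i \<le> n i" if "\<forall>i. Max (range d) \<le> n i" for n and i :: 's
    using that[rule_format, of i] Max_ge[of "range d" "d i"] by simp
  then show ?thesis unfolding ev_large_def by blast
qed

lemma ev_large_shift: "ev_large Q \<Longrightarrow> ev_large (\<lambda>n. Q (shift i n))"
proof -
  assume "ev_large Q"
  then obtain N where N: "\<And>n. \<forall>i. N \<le> n i \<Longrightarrow> Q n" unfolding ev_large_def by blast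
  show ?thesis unfolding ev_large_def shift_def
    by (intro exI[of _ N] allI impI N) (auto simp: le_SucI)
qed

lemma ev_poly_cong: "ev_poly e f \<Longrightarrow> ev_large (\<lambda>n. f n = g n) \<Longrightarrow> ev_poly e g"
proof (induction e arbitrary: f g)
  case 0
  then show ?case using ev_large_mono[OF ev_large_conj[of "\<lambda>n. f n = 0" "\<lambda>n. f n = g n"]]
    by simp
next
  case (Suc e)
  have "ev_poly e (diff_at i g)" for i
  proof (rule Suc.IH)
    show "ev_poly e (diff_at i f)" using Suc.prems(1) by simp
    show "ev_large (\<lambda>n. diff_at i f n = diff_at i g n)"
      using ev_large_conj[OF Suc.prems(2) ev_large_shift[OF Suc.prems(2), of i]]
      by (rule ev_large_mono) (simp add: diff_at_def)
  qed
  then show ?case by simp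
qed

lemma ev_poly_lincomb: "ev_poly e f \<Longrightarrow> ev_poly e g \<Longrightarrow> ev_poly e (\<lambda>n. a * f n + b * g n)"
proof (induction e arbitrary: f g)
  case 0
  then show ?case using ev_large_mono[OF ev_large_conj[of "\<lambda>n. f n = 0" "\<lambda>n. g n = 0"]]
    by simp
next
  case (Suc e)
  have "diff_at i (\<lambda>n. a * f n + b * g n) = (\<lambda>n. a * diff_at i f n + b * diff_at i g n)" for i
    by (auto simp: diff_at_def algebra_simps)
  with Suc show ?case by simp
qed

lemma ev_poly_add: "ev_poly e f \<Longrightarrow> ev_poly e g \<Longrightarrow> ev_poly e (\<lambda>n. f n + g n)"
  using ev_poly_lincomb[of e f g 1 1] by simp

lemma ev_poly_zero: "ev_poly e (\<lambda>n. 0)"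
  by (induction e) (auto simp: ev_large_def diff_at_def[abs_def])

lemma ev_poly_0_Suc: "ev_poly 0 f \<Longrightarrow> ev_poly e f"
  by (rule ev_poly_cong[OF ev_poly_zero]) (simp add: eq_commute[of 0])

lemma ev_poly_Suc: "ev_poly e f \<Longrightarrow> ev_poly (Suc e) f"
proof (induction e arbitrary: f)
  case 0
  then show ?case using ev_poly_0_Suc by blast
qed simp

lemma ev_poly_mono: "ev_poly e f \<Longrightarrow> e \<le> e' \<Longrightarrow> ev_poly e' f"
proof (induction "e' - e" arbitrary: e)
  case (Suc d)
  then have "d = e' - Suc e" "Suc e \<le> e'" by linarith+
  then show ?case using Suc.hyps(1) ev_poly_Suc[OF Suc.prems(1)] by blast
qed simp

lemma ev_poly_translate: "ev_poly e f \<Longrightarrow> ev_poly e (\<lambda>n. f (\<lambda>i. n i + d i))"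
proof (induction e arbitrary: f)
  case 0 then show ?case using ev_large_add[of "\<lambda>n. f n = 0" d] by simp
next
  case (Suc e)
  have "(\<lambda>j. shift i n j + d j) = shift i (\<lambda>j. n j + d j)" for i n
    by (auto simp: shift_def)
  then have "(\<lambda>n. diff_at i f (\<lambda>j. n j + d j)) = diff_at i (\<lambda>n. f (\<lambda>j. n j + d j))" for i
    by (simp add: diff_at_def[abs_def])
  moreover have "ev_poly e (\<lambda>n. diff_at i f (\<lambda>j. n j + d j))" for i
    using Suc by simp
  ultimately show ?case by simp
qed

text \<open>Truncated subtraction misbehaves only where some \<open>n i < d i\<close>; beyond
  \<open>d\<close> it commutes with \<open>shift\<close>, and \<open>ev_poly\<close> sees large
  arguments only.\<close>

lemma ev_poly_translate_back:
  "ev_poly e f \<Longrightarrow> ev_poly e (\<lambda>n. f (\<lambda>i. n i - d i))"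
proof (induction e arbitrary: f)
  case 0 then show ?case using ev_large_sub[of "\<lambda>n. f n = 0" d] by simp
next
  case (Suc e)
  have "ev_poly e (diff_at i (\<lambda>n. f (\<lambda>j. n j - d j)))" for i
  proof (rule ev_poly_cong[OF Suc.IH[of "diff_at i f"]])
    show "ev_poly e (diff_at i f)" using Suc.prems by simp
    show "ev_large (\<lambda>n. diff_at i f (\<lambda>j. n j - d j) = diff_at i (\<lambda>n. f (\<lambda>j. n j - d j)) n)"
    proof (rule ev_large_mono[OF ev_large_ge[of d]])
      fix n assume "\<forall>i. d i \<le> n i"
      then have "(\<lambda>j. shift i n j - d j) = shift i (\<lambda>j. n j - d j)"
        by (auto simp: shift_def Suc_diff_le)
      then show "diff_at i f (\<lambda>j. n j - d j) = diff_at i (\<lambda>n. f (\<lambda>j. n j - d j)) n"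
        by (simp add: diff_at_def)
    qed
  qed
  then show ?case by simp
qed

lemma ev_poly_translate_cancel:
  assumes "ev_poly e (\<lambda>n. f (\<lambda>i. n i + d i))" shows "ev_poly e f"
  by (rule ev_poly_cong[OF ev_poly_translate_back[OF assms, of d]])
    (rule ev_large_mono[OF ev_large_ge[of d]], simp)

text \<open>A translation by \<open>d\<close> is a composition of unit shifts, so the difference
  telescopes into translates of the functions \<open>diff_at i f\<close>; the induction peels off
  one unit at a time.\<close>

lemma ev_poly_Suc_translate_diff:
  assumes "ev_poly (Suc e) f" shows "ev_poly e (\<lambda>n. f (\<lambda>i. n i + d i) - f n)"
proof (induction "\<Sum>i\<in>UNIV. d i" arbitrary: d)
  case 0
  then have "d i = 0" for i by simp
  then have "(\<lambda>n. f (\<lambda>i. n i + d i) - f n) = (\<lambda>n. 0)" by simp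
  then show ?case using ev_poly_zero by metis
next
  case (Suc m)
  obtain i where i: "d i > 0" using Suc.hyps(2) by (metis gr0I nat.distinct(1) sum.neutral)
  define d' where "d' = d(i := d i - 1)"
  have dd: "d = shift i d'" using i by (auto simp: d'_def shift_def)
  have "(\<Sum>j\<in>UNIV. d j) = d i + (\<Sum>j\<in>UNIV - {i}. d j)" by (simp add: sum.remove)
  moreover have "(\<Sum>j\<in>UNIV. d' j) = d' i + (\<Sum>j\<in>UNIV - {i}. d' j)" by (simp add: sum.remove)
  moreover have "(\<Sum>j\<in>UNIV - {i}. d' j) = (\<Sum>j\<in>UNIV - {i}. d j)"
    by (rule sum.cong) (auto simp: d'_def)
  ultimately have "m = (\<Sum>j\<in>UNIV. d' j)" using Suc.hyps(2) i by (simp add: d'_def)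
  then have 1: "ev_poly e (\<lambda>n. f (\<lambda>j. n j + d' j) - f n)" by (rule Suc.hyps)
  have 2: "ev_poly e (\<lambda>n. diff_at i f (\<lambda>j. n j + d' j))"
    using ev_poly_translate[of e "diff_at i f" d'] assms by simp
  have "shift i (\<lambda>j. n j + d' j) = (\<lambda>j. n j + d j)" for n
    unfolding dd by (auto simp: shift_def)
  then have "diff_at i f (\<lambda>j. n j + d' j) + (f (\<lambda>j. n j + d' j) - f n) = f (\<lambda>j. n j + d j) - f n" for n
    by (simp add: diff_at_def)
  then show ?case using ev_poly_add[OF 2 1] by (simp only:)
qed

subsection \<open>Comparison with polynomials\<close>

lemma poly_fun_sum:
  assumes "finite K" "\<And>k. k \<in> K \<Longrightarrow> tdeg k < e"
  shows "poly_fun e (\<lambda>n. \<Sum>k\<in>K. c k * monomial_fun k n)"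
  using assms unfolding poly_fun_def by blast

lemma poly_fun_zero: "poly_fun e (\<lambda>n. 0)"
  using poly_fun_sum[of "{}" e "\<lambda>_. 0"] by simp

lemma poly_fun_monomial_fun: "tdeg k < e \<Longrightarrow> poly_fun e (monomial_fun k)"
  using poly_fun_sum[of "{k}" e "\<lambda>_. 1"] by simp

lemma poly_fun_lincomb:
  assumes "poly_fun e f" "poly_fun e g" shows "poly_fun e (\<lambda>n. a * f n + b * g n)"
proof -
  obtain K c where K: "finite K" "\<forall>k\<in>K. tdeg k < e" "f = (\<lambda>n. \<Sum>k\<in>K. c k * monomial_fun k n)"
    using assms(1) unfolding poly_fun_def by blast
  obtain L d where L: "finite L" "\<forall>k\<in>L. tdeg k < e" "g = (\<lambda>n. \<Sum>k\<in>L. d k * monomial_fun k n)"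
    using assms(2) unfolding poly_fun_def by blast
  define c' where "c' k = (if k \<in> K then c k else 0)" for k
  define d' where "d' k = (if k \<in> L then d k else 0)" for k
  have "f n = (\<Sum>k\<in>K\<union>L. c' k * monomial_fun k n)" for n
    unfolding K(3) c'_def using K(1) L(1) by (intro sum.mono_neutral_cong_left) auto
  moreover have "g n = (\<Sum>k\<in>K\<union>L. d' k * monomial_fun k n)" for n
    unfolding L(3) d'_def using K(1) L(1) by (intro sum.mono_neutral_cong_left) auto
  ultimately have "(\<lambda>n. a * f n + b * g n) = (\<lambda>n. \<Sum>k\<in>K\<union>L. (a * c' k + b * d' k) * monomial_fun k n)"
    by (simp add: sum_distrib_left sum.distrib[symmetric] algebra_simps)
  moreover have "poly_fun e (\<lambda>n. \<Sum>k\<in>K\<union>L. (a * c' k + b * d' k) * monomial_fun k n)"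
    by (rule poly_fun_sum) (use K L in auto)
  ultimately show ?thesis by simp
qed

lemma poly_fun_scale: "poly_fun e f \<Longrightarrow> poly_fun e (\<lambda>n. a * f n)"
  using poly_fun_lincomb[of e f f a 0] by simp

lemma poly_fun_add: "poly_fun e f \<Longrightarrow> poly_fun e g \<Longrightarrow> poly_fun e (\<lambda>n. f n + g n)"
  using poly_fun_lincomb[of e f g 1 1] by simp

lemma poly_fun_diff: "poly_fun e f \<Longrightarrow> poly_fun e g \<Longrightarrow> poly_fun e (\<lambda>n. f n - g n)"
  using poly_fun_lincomb[of e f g 1 "-1"] by simp

lemma poly_fun_sum_closed:
  "(\<And>j. j \<in> J \<Longrightarrow> poly_fun e (f j)) \<Longrightarrow> poly_fun e (\<lambda>n. \<Sum>j\<in>J. f j n)"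
  by (induction J rule: infinite_finite_induct) (auto intro: poly_fun_zero poly_fun_add)

lemma poly_fun_mono:
  assumes "poly_fun e f" "e \<le> e'" shows "poly_fun e' f"
proof -
  obtain K c where K: "finite K" "\<forall>k\<in>K. tdeg k < e" "f = (\<lambda>n. \<Sum>k\<in>K. c k * monomial_fun k n)"
    using assms(1) unfolding poly_fun_def by blast
  show ?thesis unfolding K(3) by (rule poly_fun_sum) (use K(1,2) assms(2) in fastforce)+
qed

lemma monomial_fun_upd: "monomial_fun (k(i := a)) n = real (n i) ^ a * (\<Prod>j\<in>UNIV - {i}. real (n j) ^ k j)"
proof -
  have "(\<Prod>j\<in>UNIV - {i}. real (n j) ^ (k(i := a)) j) = (\<Prod>j\<in>UNIV - {i}. real (n j) ^ k j)"
    by (rule prod.cong) auto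
  moreover have "monomial_fun (k(i := a)) n
      = real (n i) ^ (k(i := a)) i * (\<Prod>j\<in>UNIV - {i}. real (n j) ^ (k(i := a)) j)"
    unfolding monomial_fun_def by (rule prod.remove) auto
  ultimately show ?thesis by (simp only: fun_upd_same)
qed

lemma monomial_fun_split: "monomial_fun k n = real (n i) ^ k i * (\<Prod>j\<in>UNIV - {i}. real (n j) ^ k j)"
  using monomial_fun_upd[of k i "k i" n] by simp

lemma tdeg_upd: "tdeg (k(i := a)) + k i = tdeg k + a"
proof -
  have "tdeg (k(i := a)) = (k(i := a)) i + (\<Sum>j\<in>UNIV - {i}. (k(i := a)) j)"
    unfolding tdeg_def by (rule sum.remove) auto
  moreover have "(\<Sum>j\<in>UNIV - {i}. (k(i := a)) j) = (\<Sum>j\<in>UNIV - {i}. k j)"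
    by (rule sum.cong) auto
  moreover have "tdeg k = k i + (\<Sum>j\<in>UNIV - {i}. k j)"
    unfolding tdeg_def by (rule sum.remove) auto
  ultimately show ?thesis by simp
qed

text \<open>Binomial expansion of \<open>(n i + 1) ^ k i\<close>, whose top term cancels.\<close>

lemma diff_at_monomial_fun:
  "diff_at i (monomial_fun k) n = (\<Sum>j<k i. real (k i choose j) * monomial_fun (k(i := j)) n)"
proof -
  have "real (Suc (n i)) ^ k i = (\<Sum>j\<le>k i. real (k i choose j) * real (n i) ^ j)"
    using binomial_ring[of "real (n i)" 1 "k i"] by (simp add: add.commute)
  also have "\<dots> = (\<Sum>j<k i. real (k i choose j) * real (n i) ^ j) + real (n i) ^ k i"
    by (simp add: lessThan_Suc_atMost[symmetric])
  finally have *: "real (Suc (n i)) ^ k i - real (n i) ^ k i = (\<Sum>j<k i. real (k i choose j) * real (n i) ^ j)"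
    by simp
  have "diff_at i (monomial_fun k) n = (real (Suc (n i)) ^ k i - real (n i) ^ k i) * (\<Prod>j\<in>UNIV - {i}. real (n j) ^ k j)"
    unfolding diff_at_def monomial_fun_split[of k _ i] by (simp add: shift_def algebra_simps)
  also have "\<dots> = (\<Sum>j<k i. real (k i choose j) * monomial_fun (k(i := j)) n)"
    unfolding * monomial_fun_upd by (simp add: sum_distrib_right mult.assoc)
  finally show ?thesis .
qed

lemma poly_fun_diff_at_monomial_fun: "tdeg k \<le> e \<Longrightarrow> poly_fun e (diff_at i (monomial_fun k))"
proof -
  assume k: "tdeg k \<le> e"
  have "poly_fun e (\<lambda>n. real (k i choose j) * monomial_fun (k(i := j)) n)" if "j < k i" for j
    using tdeg_upd[of k i j] k that by (intro poly_fun_scale poly_fun_monomial_fun) linarith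
  then have "poly_fun e (\<lambda>n. \<Sum>j<k i. real (k i choose j) * monomial_fun (k(i := j)) n)"
    by (intro poly_fun_sum_closed) simp
  then show ?thesis by (simp add: diff_at_monomial_fun[abs_def])
qed

lemma diff_at_sum: "diff_at i (\<lambda>n. \<Sum>j\<in>J. c j * f j n) = (\<lambda>n. \<Sum>j\<in>J. c j * diff_at i (f j) n)"
  by (auto simp: diff_at_def sum_subtractf right_diff_distrib)

lemma poly_fun_diff_at: "poly_fun (Suc e) f \<Longrightarrow> poly_fun e (diff_at i f)"
  unfolding poly_fun_def[of "Suc e"]
  by (auto simp: diff_at_sum less_Suc_eq_le intro!: poly_fun_sum_closed poly_fun_scale poly_fun_diff_at_monomial_fun)

lemma poly_fun_0: "poly_fun 0 f \<longleftrightarrow> f = (\<lambda>n. 0)"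
  unfolding poly_fun_def by (force intro: exI[of _ "{}"])

lemma ev_poly_poly_fun: "poly_fun e f \<Longrightarrow> ev_poly e f"
  by (induction e arbitrary: f) (auto simp: poly_fun_0 ev_large_def poly_fun_diff_at)

text \<open>By the binomial formula, the difference of the monomial with exponent
  \<open>a + 1\<close> at \<open>i\<close> is \<open>a + 1\<close> times the given one plus
  monomials with smaller exponent at \<open>i\<close>, whose antidifferences are known by induction.
  This is the summation of powers, with control of the total degree.\<close>

lemma monomial_fun_antidifference:
  "\<exists>G. poly_fun (Suc (Suc (tdeg k))) G \<and> diff_at i G = monomial_fun k"
proof (induction "k i" arbitrary: k rule: less_induct)
  case less
  define a where "a = k i"
  have "\<forall>j\<in>{..<a}. \<exists>G. poly_fun (Suc (Suc (tdeg (k(i := j))))) G \<and> diff_at i G = monomial_fun (k(i := j))"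
    using less[of "k(i := _)"] unfolding a_def by simp
  then obtain G where G: "\<And>j. j < a \<Longrightarrow> poly_fun (Suc (Suc (tdeg (k(i := j))))) (G j)"
      "\<And>j. j < a \<Longrightarrow> diff_at i (G j) = monomial_fun (k(i := j))"
    by (metis lessThan_iff)
  define k' where "k' = k(i := Suc a)"
  \<comment> \<open>The monomial of the next higher exponent, corrected by antidifferences of the
    lower terms; division by \<open>a + 1\<close> finishes the construction.\<close>
  define H where "H n = monomial_fun k' n + (\<Sum>j<a. - real (Suc a choose j) * G j n)" for n
  have "diff_at i H n = diff_at i (monomial_fun k') n + (\<Sum>j<a. - real (Suc a choose j) * diff_at i (G j) n)" for n
    unfolding H_def[abs_def] by (simp add: diff_at_def sum_negf sum_subtractf right_diff_distrib)
  also have "\<dots> n = real (Suc a) * monomial_fun k n" for n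
  proof -
    have "diff_at i (monomial_fun k') n = (\<Sum>j<Suc a. real (Suc a choose j) * monomial_fun (k(i := j)) n)"
      unfolding diff_at_monomial_fun by (simp add: k'_def)
    also have "\<dots> = (\<Sum>j<a. real (Suc a choose j) * monomial_fun (k(i := j)) n) + real (Suc a) * monomial_fun k n"
      by (simp add: a_def)
    finally show ?thesis using G(2) by (simp add: sum_negf)
  qed
  finally have H: "diff_at i H n = real (Suc a) * monomial_fun k n" for n .
  have tk': "tdeg k' = Suc (tdeg k)" using tdeg_upd[of k i "Suc a"] by (simp add: k'_def a_def)
  have "poly_fun (Suc (Suc (tdeg k))) H"
  proof -
    have "poly_fun (Suc (Suc (tdeg k))) (\<lambda>n. - real (Suc a choose j) * G j n)" if "j < a" for j
      using tdeg_upd[of k i j] that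
      by (intro poly_fun_scale poly_fun_mono[OF G(1)[OF that]]) (simp add: a_def)
    then show ?thesis unfolding H_def
      by (intro poly_fun_add poly_fun_monomial_fun poly_fun_sum_closed) (auto simp: tk')
  qed
  then have "poly_fun (Suc (Suc (tdeg k))) (\<lambda>n. (1 / real (Suc a)) * H n)" by (rule poly_fun_scale)
  moreover have "diff_at i (\<lambda>n. (1 / real (Suc a)) * H n) n = (1 / real (Suc a)) * diff_at i H n" for n
    by (simp add: diff_at_def right_diff_distrib)
  then have "diff_at i (\<lambda>n. (1 / real (Suc a)) * H n) = monomial_fun k"
    unfolding H by (auto simp: fun_eq_iff simp del: of_nat_Suc)
  ultimately show ?case by blast
qed

lemma poly_fun_antidifference:
  assumes "poly_fun e g" shows "\<exists>G. poly_fun (Suc e) G \<and> diff_at i G = g"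
proof -
  obtain K c where K: "finite K" "\<forall>k\<in>K. tdeg k < e" "g = (\<lambda>n. \<Sum>k\<in>K. c k * monomial_fun k n)"
    using assms unfolding poly_fun_def by blast
  obtain G where G: "\<And>k. poly_fun (Suc (Suc (tdeg k))) (G k)" "\<And>k. diff_at i (G k) = monomial_fun k"
    using monomial_fun_antidifference by metis
  have "poly_fun (Suc e) (\<lambda>n. \<Sum>k\<in>K. c k * G k n)"
    using K(2) by (intro poly_fun_sum_closed poly_fun_scale poly_fun_mono[OF G(1)]) auto
  moreover have "diff_at i (\<lambda>n. \<Sum>k\<in>K. c k * G k n) = g" using K(3) G(2) by (simp add: diff_at_sum)
  ultimately show ?thesis by blast
qed

text \<open>Frozen coordinates contribute a constant factor to each monomial, so the total degree
  cannot grow. This produces polynomials that ignore the coordinates in \<open>I\<close>.\<close>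

lemma poly_fun_substitute:
  assumes "poly_fun e f" shows "poly_fun e (\<lambda>n. f (\<lambda>i. if i \<in> I then N else n i))"
proof -
  have m: "monomial_fun k (\<lambda>i. if i \<in> I then N else n i)
      = (\<Prod>i\<in>I. real N ^ k i) * monomial_fun (\<lambda>i. if i \<in> I then 0 else k i) n" for k n
  proof -
    have "monomial_fun k (\<lambda>i. if i \<in> I then N else n i)
      = (\<Prod>i\<in>UNIV. (if i \<in> I then real N ^ k i else 1) * real (n i) ^ (if i \<in> I then 0 else k i))"
      unfolding monomial_fun_def by (rule prod.cong) auto
    then show ?thesis unfolding monomial_fun_def by (simp add: prod.distrib prod.If_cases)
  qed
  have "tdeg (\<lambda>i. if i \<in> I then 0 else k i) \<le> tdeg k" for k
    unfolding tdeg_def by (intro sum_mono) auto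
  then have t: "tdeg (\<lambda>i. if i \<in> I then 0 else k i) < e" if "tdeg k < e" for k
    using that by (rule le_less_trans)
  obtain K c where K: "finite K" "\<forall>k\<in>K. tdeg k < e" "f = (\<lambda>n. \<Sum>k\<in>K. c k * monomial_fun k n)"
    using assms unfolding poly_fun_def by blast
  then show ?thesis
    by (auto simp: m mult.assoc[symmetric] intro!: poly_fun_sum_closed poly_fun_scale poly_fun_monomial_fun t)
qed

text \<open>A vanishing difference in direction \<open>i\<close> lets the coordinate
  \<open>i\<close> slide down to \<open>N\<close>; the directions in \<open>I\<close> are treated in
  turn.\<close>

lemma constant_along_coordinates:
  assumes "finite I"
    and "\<And>i n. i \<in> I \<Longrightarrow> \<forall>j. N \<le> n j \<Longrightarrow> diff_at i f n = 0"
    and "\<forall>j. N \<le> n j"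
  shows "f n = f (\<lambda>i. if i \<in> I then N else n i)"
  using assms
proof (induction I arbitrary: n rule: finite_induct)
  case (insert i I)
  have *: "f (n(i := N + m)) = f (n(i := N))" if "\<forall>j. N \<le> n j" for m n
  proof (induction m)
    case (Suc m)
    have "diff_at i f (n(i := N + m)) = 0" using insert.prems(1) that by simp
    moreover have "shift i (n(i := N + m)) = n(i := N + Suc m)" by (simp add: shift_def)
    ultimately have "f (n(i := N + Suc m)) = f (n(i := N + m))" by (simp only: diff_at_def)
    then show ?case using Suc by (simp only:)
  qed simp
  have "f n = f (\<lambda>i. if i \<in> I then N else n i)"
    using insert.IH insert.prems by blast
  also have "\<dots> = f ((\<lambda>i. if i \<in> I then N else n i)(i := N + (n i - N)))"
    using insert.prems(2) insert.hyps by (auto intro!: arg_cong[of _ _ f])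
  also have "\<dots> = f ((\<lambda>i. if i \<in> I then N else n i)(i := N))"
    by (rule *) (use insert.prems(2) in simp)
  also have "\<dots> = f (\<lambda>j. if j \<in> insert i I then N else n j)"
    by (auto intro!: arg_cong[of _ _ f])
  finally show ?case .
qed simp

text \<open>The polynomial is recovered by discrete integration. Antidifferences in different
  directions have to be compatible, so they are added one direction at a time in
  \<open>main\<close>, and each correction is chosen constant along the directions already
  settled.\<close>

lemma ev_poly_imp_poly_fun:
  "ev_poly e f \<Longrightarrow> \<exists>g. poly_fun e g \<and> ev_large (\<lambda>n. f n = g n)"
proof (induction e arbitrary: f)
  case 0
  then show ?case by (intro exI[of _ "\<lambda>n. 0"]) (simp add: poly_fun_zero)
next
  case (Suc e)
  have ex: "\<exists>g. poly_fun e g \<and> ev_large (\<lambda>n. diff_at i f n = g n)" for i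
    using Suc.IH[of "diff_at i f"] Suc.prems by simp
  \<comment> \<open>\<open>I\<close> is the set of directions in which the remainder
    \<open>f - G\<close> already has eventually vanishing difference.\<close>
  have main: "\<exists>G. poly_fun (Suc e) G \<and> (\<forall>i\<in>I. ev_large (\<lambda>n. diff_at i (\<lambda>n. f n - G n) n = 0))"
    if "finite I" for I
    using that
  proof (induction I rule: finite_induct)
    case empty
    then show ?case by (intro exI[of _ "\<lambda>n. 0"]) (simp add: poly_fun_zero)
  next
    case (insert i I)
    then obtain G where G: "poly_fun (Suc e) G"
      and GI: "\<And>j. j \<in> I \<Longrightarrow> ev_large (\<lambda>n. diff_at j (\<lambda>n. f n - G n) n = 0)" by blast
    obtain g0 where g0: "poly_fun e g0" "ev_large (\<lambda>n. diff_at i f n = g0 n)" using ex by blast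
    define g where "g n = g0 n - diff_at i G n" for n
    have g: "poly_fun e g" unfolding g_def using g0(1) G by (intro poly_fun_diff poly_fun_diff_at)
    define f' where "f' n = f n - G n" for n
    have gf: "ev_large (\<lambda>n. diff_at i f' n = g n)"
      by (rule ev_large_mono[OF g0(2)]) (simp add: g_def f'_def[abs_def] diff_at_def)
    have "ev_large (\<lambda>n. j \<in> I \<longrightarrow> diff_at j f' n = 0)" for j
      using GI[of j] unfolding f'_def[abs_def] ev_large_def by (cases "j \<in> I") auto
    then have "ev_large (\<lambda>n. \<forall>j. j \<in> I \<longrightarrow> diff_at j f' n = 0)" by (rule ev_large_all)
    from ev_large_conj[OF this gf] obtain N where N: "\<And>n j. \<forall>l. N \<le> n l \<Longrightarrow> j \<in> I \<Longrightarrow> diff_at j f' n = 0"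
        "\<And>n. \<forall>l. N \<le> n l \<Longrightarrow> diff_at i f' n = g n"
      unfolding ev_large_def by blast
    \<comment> \<open>\<open>\<sigma>\<close> freezes the settled coordinates at \<open>N\<close>.
      As \<open>f'\<close> does not depend on them for large arguments, composing the antidifference
      \<open>H\<close> with \<open>\<sigma>\<close> keeps the right difference in direction
      \<open>i\<close> and leaves the directions in \<open>I\<close> undisturbed.\<close>
    define \<sigma> where "\<sigma> n = (\<lambda>j. if j \<in> I then N else n j)" for n :: "'a \<Rightarrow> nat"
    obtain H where H: "poly_fun (Suc e) H" "diff_at i H = g" using poly_fun_antidifference[OF g] by blast
    define H' where "H' n = H (\<sigma> n)" for n
    have H': "poly_fun (Suc e) H'" unfolding H'_def \<sigma>_def by (rule poly_fun_substitute[OF H(1)])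
    have f\<sigma>: "f' n = f' (\<sigma> n)" if "\<forall>l. N \<le> n l" for n
      unfolding \<sigma>_def by (rule constant_along_coordinates[OF insert.hyps(1)]) (use N that in auto)
    have \<sigma>i: "\<sigma> (shift i n) = shift i (\<sigma> n)" for n using insert.hyps(2) by (auto simp: \<sigma>_def shift_def)
    have \<sigma>j: "\<sigma> (shift j n) = \<sigma> n" if "j \<in> I" for j n using that by (auto simp: \<sigma>_def shift_def)
    have sN: "\<forall>l. N \<le> shift i n l" if "\<forall>l. N \<le> n l" for n
      using that by (auto simp: shift_def le_SucI)
    have s\<sigma>: "\<forall>l. N \<le> \<sigma> n l" if "\<forall>l. N \<le> n l" for n using that by (auto simp: \<sigma>_def)
    have "diff_at j (\<lambda>n. f n - (G n + H' n)) n = 0" if "j \<in> insert i I" "\<forall>l. N \<le> n l" for j n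
    proof -
      have eq: "diff_at j (\<lambda>n. f n - (G n + H' n)) n = diff_at j f' n - diff_at j H' n"
        by (simp add: diff_at_def f'_def)
      show ?thesis
      proof (cases "j \<in> I")
        case True
        then show ?thesis using N(1)[OF that(2)] \<sigma>j[of j n] by (simp add: eq, simp add: diff_at_def H'_def)
      next
        case False
        then have j: "j = i" using that(1) by simp
        have "diff_at i H' n = g (\<sigma> n)" using fun_cong[OF H(2), of "\<sigma> n"]
          by (simp add: diff_at_def H'_def \<sigma>i)
        also have "\<dots> = diff_at i f' (\<sigma> n)" using N(2) s\<sigma>[OF that(2)] by simp
        also have "\<dots> = diff_at i f' n"
          using f\<sigma>[OF that(2)] f\<sigma>[OF sN[OF that(2)]] by (simp add: diff_at_def \<sigma>i)
        finally show ?thesis unfolding eq by (simp add: j)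
      qed
    qed
    then have "\<forall>j\<in>insert i I. ev_large (\<lambda>n. diff_at j (\<lambda>n. f n - (G n + H' n)) n = 0)"
      unfolding ev_large_def by (intro ballI exI[of _ N] allI impI)
    moreover have "poly_fun (Suc e) (\<lambda>n. G n + H' n)" using G H' by (rule poly_fun_add)
    ultimately show ?case by (intro exI[of _ "\<lambda>n. G n + H' n"] conjI)
  qed
  obtain G where G: "poly_fun (Suc e) G" "\<And>i. ev_large (\<lambda>n. diff_at i (\<lambda>n. f n - G n) n = 0)"
    using main[OF finite_UNIV] by blast
  have "ev_large (\<lambda>n. \<forall>i. diff_at i (\<lambda>n. f n - G n) n = 0)"
    by (rule ev_large_all) (rule G(2))
  then obtain N where N: "\<And>n i. \<forall>l. N \<le> n l \<Longrightarrow> diff_at i (\<lambda>n. f n - G n) n = 0"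
    unfolding ev_large_def by blast
  \<comment> \<open>All differences of the remainder vanish now, so it is the constant
    \<open>C\<close>.\<close>
  define C where "C = f (\<lambda>_. N) - G (\<lambda>_. N)"
  have "f n - G n = C" if "\<forall>l. N \<le> n l" for n
    using constant_along_coordinates[of UNIV N "\<lambda>n. f n - G n" n] N that by (simp add: C_def)
  then have "f n = G n + C * monomial_fun (\<lambda>_. 0) n" if "\<forall>l. N \<le> n l" for n
    using that by (simp add: monomial_fun_def diff_eq_eq add.commute)
  then have "ev_large (\<lambda>n. f n = G n + C * monomial_fun (\<lambda>_. 0) n)"
    unfolding ev_large_def by (intro exI[of _ N] allI impI)
  moreover have "poly_fun (Suc e) (\<lambda>n. G n + C * monomial_fun (\<lambda>_. 0) n)"
    by (intro poly_fun_add G poly_fun_scale poly_fun_monomial_fun) (simp add: tdeg_def)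
  ultimately show ?case
    by (intro exI[of _ "\<lambda>n. G n + C * monomial_fun (\<lambda>_. 0) n"] conjI)
qed


section \<open>Growth along rays and leading forms\<close>

lemma monomial_fun_ray_limit:
  assumes "tdeg k \<le> D"
  shows "(\<lambda>t::nat. monomial_fun k (\<lambda>i. t * a i + j i) / real t ^ D)
    \<longlonglongrightarrow> (if tdeg k = D then monomial_fun k a else 0)"
proof -
  have *: "(\<lambda>t::nat. real (t * x + y) / real t) \<longlonglongrightarrow> real x" for x y :: nat
  proof -
    have "(\<lambda>t::nat. real x + real y * (1 / real t)) \<longlonglongrightarrow> real x + real y * 0"
      by (intro tendsto_intros lim_1_over_n)
    moreover have "\<forall>\<^sub>F t::nat in sequentially. real x + real y * (1 / real t) = real (t * x + y) / real t"
      using eventually_gt_at_top[of 0] by eventually_elim (simp add: field_simps)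
    ultimately show ?thesis by (simp add: tendsto_cong)
  qed
  have "(\<lambda>t::nat. (\<Prod>i\<in>UNIV. (real (t * a i + j i) / real t) ^ k i) * (1 / real t) ^ (D - tdeg k))
      \<longlonglongrightarrow> (\<Prod>i\<in>UNIV. real (a i) ^ k i) * 0 ^ (D - tdeg k)"
    by (intro tendsto_intros * lim_1_over_n)
  moreover have "\<forall>\<^sub>F t::nat in sequentially.
      (\<Prod>i\<in>UNIV. (real (t * a i + j i) / real t) ^ k i) * (1 / real t) ^ (D - tdeg k)
      = monomial_fun k (\<lambda>i. t * a i + j i) / real t ^ D"
    using eventually_gt_at_top[of 0]
  proof eventually_elim
    case (elim t)
    have "(\<Prod>i\<in>UNIV. real t ^ k i) * real t ^ (D - tdeg k) = real t ^ D"
      using assms by (simp add: power_sum[symmetric] tdeg_def power_add[symmetric])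
    then show ?case using elim
      by (simp add: monomial_fun_def power_divide prod_dividef)
  qed
  ultimately show ?thesis using assms
    by (auto simp: monomial_fun_def tendsto_cong power_0_left)
qed

text \<open>Only terms of top degree survive the division by \<open>t ^ D\<close>, and the bounded
  offset \<open>j\<close> disappears. The offset is kept because the points of a box differ from its
  corner by such offsets.\<close>

lemma poly_sum_ray_limit:
  assumes "\<And>k. k \<in> K \<Longrightarrow> tdeg k \<le> D" and "finite K"
  shows "(\<lambda>t::nat. (\<Sum>k\<in>K. c k * monomial_fun k (\<lambda>i. t * a i + j i)) / real t ^ D)
    \<longlonglongrightarrow> (\<Sum>k\<in>{k\<in>K. tdeg k = D}. c k * monomial_fun k a)"
proof -
  have "(\<lambda>t::nat. \<Sum>k\<in>K. c k * (monomial_fun k (\<lambda>i. t * a i + j i) / real t ^ D))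
    \<longlonglongrightarrow> (\<Sum>k\<in>K. c k * (if tdeg k = D then monomial_fun k a else 0))"
    by (intro tendsto_intros monomial_fun_ray_limit assms)
  moreover have "(\<Sum>k\<in>K. c k * (if tdeg k = D then monomial_fun k a else 0))
      = (\<Sum>k\<in>{k\<in>K. tdeg k = D}. c k * monomial_fun k a)"
    using assms(2) by (simp add: sum.inter_filter if_distrib cong: if_cong)
  ultimately show ?thesis by (simp add: sum_divide_distrib)
qed

lemma real_polynomial_zero:
  fixes c :: "nat \<Rightarrow> real"
  assumes "\<And>x::nat. N \<le> x \<Longrightarrow> (\<Sum>j\<le>d. c j * real x ^ j) = 0" and "j \<le> d"
  shows "c j = 0"
proof (rule ccontr)
  assume "c j \<noteq> 0"
  then have "finite {z::real. (\<Sum>i\<le>d. c i * z ^ i) = 0}"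
    using polyfun_rootbound[of c j d] assms(2) by blast
  moreover have "real ` {N..} \<subseteq> {z. (\<Sum>i\<le>d. c i * z ^ i) = 0}" using assms(1) by auto
  ultimately have "finite (real ` {N..})" by (rule rev_finite_subset)
  then have "finite {N..}" by (rule finite_imageD) (simp add: inj_on_def)
  then show False by (simp add: infinite_Ici)
qed

text \<open>The powers of one variable are compared at a time. Monomials are restricted to the
  variables in \<open>I\<close>, so several exponent vectors may yield the same monomial, and only
  the sum of their coefficients can be determined.\<close>

lemma partial_monomial_sum_zero:
  fixes c :: "('s::finite \<Rightarrow> nat) \<Rightarrow> real"
  assumes "finite I" "finite K"
    and "\<And>n. \<forall>i. N \<le> n i \<Longrightarrow> (\<Sum>k\<in>K. c k * (\<Prod>i\<in>I. real (n i) ^ k i)) = 0"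
  shows "(\<Sum>k\<in>{k\<in>K. \<forall>i\<in>I. k i = \<kappa> i}. c k) = 0"
  using assms
proof (induction I arbitrary: K rule: finite_induct)
  case empty
  from empty.prems(2)[of "\<lambda>_. N"] show ?case by simp
next
  case (insert i I)
  define d where "d = Max (insert (\<kappa> i) ((\<lambda>k. k i) ` K))"
  have d: "k i \<le> d" if "k \<in> K" for k using that insert.prems(1) by (simp add: d_def)
  have dk: "\<kappa> i \<le> d" using insert.prems(1) by (simp add: d_def)
  \<comment> \<open>For fixed values of the other variables the sum is a polynomial in the value
    \<open>x\<close> of coordinate \<open>i\<close>; the expression claimed to vanish is its
    coefficient of index \<open>\<kappa> i\<close>.\<close>
  have z: "(\<Sum>k\<in>{k\<in>K. k i = \<kappa> i}. c k * (\<Prod>i\<in>I. real (n i) ^ k i)) = 0"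
    if n: "\<forall>i. N \<le> n i" for n
  proof (rule real_polynomial_zero[where N = N and d = d and c = "\<lambda>j. \<Sum>k\<in>{k\<in>K. k i = j}. c k * (\<Prod>i\<in>I. real (n i) ^ k i)"])
    fix x assume x: "N \<le> x"
    have "(\<Prod>l\<in>insert i I. real ((n(i := x)) l) ^ k l) = real x ^ k i * (\<Prod>l\<in>I. real (n l) ^ k l)" for k
    proof -
      have "(\<Prod>l\<in>I. real ((n(i := x)) l) ^ k l) = (\<Prod>l\<in>I. real (n l) ^ k l)"
        by (rule prod.cong) (use insert.hyps in auto)
      then show ?thesis by (simp only: prod.insert[OF insert.hyps] fun_upd_same)
    qed
    then have "0 = (\<Sum>k\<in>K. c k * (real x ^ k i * (\<Prod>l\<in>I. real (n l) ^ k l)))"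
      using insert.prems(2)[of "n(i := x)"] n x by simp
    also have "\<dots> = (\<Sum>j\<le>d. \<Sum>k\<in>{k\<in>K. k i = j}. c k * (real x ^ k i * (\<Prod>l\<in>I. real (n l) ^ k l)))"
      using insert.prems(1) d by (intro sum.group[symmetric]) auto
    also have "\<dots> = (\<Sum>j\<le>d. (\<Sum>k\<in>{k\<in>K. k i = j}. c k * (\<Prod>i\<in>I. real (n i) ^ k i)) * real x ^ j)"
      by (intro sum.cong refl) (simp add: sum_distrib_left mult_ac)
    finally show "(\<Sum>j\<le>d. (\<Sum>k\<in>{k\<in>K. k i = j}. c k * (\<Prod>i\<in>I. real (n i) ^ k i)) * real x ^ j) = 0"
      by simp
  qed (rule dk)
  have "(\<Sum>k\<in>{k\<in>{k\<in>K. k i = \<kappa> i}. \<forall>i\<in>I. k i = \<kappa> i}. c k) = 0"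
    by (rule insert.IH) (use insert.prems(1) z in auto)
  moreover have "{k\<in>{k\<in>K. k i = \<kappa> i}. \<forall>i\<in>I. k i = \<kappa> i} = {k\<in>K. \<forall>i\<in>insert i I. k i = \<kappa> i}" by auto
  ultimately show ?case by (simp only:)
qed

lemma poly_sum_zero_imp:
  assumes "finite K" "\<And>n. \<forall>i. N \<le> n i \<Longrightarrow> (\<Sum>k\<in>K. c k * monomial_fun k n) = 0" "\<kappa> \<in> K"
  shows "c \<kappa> = 0"
proof -
  have "{k\<in>K. \<forall>i\<in>UNIV. k i = \<kappa> i} = {\<kappa>}" using assms(3) by auto
  then show ?thesis
    using partial_monomial_sum_zero[of UNIV K N c \<kappa>] assms(1,2) by (simp add: monomial_fun_def)
qed

text \<open>Along the ray through \<open>a\<close> the limit is the value of the leading form at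
  \<open>a\<close>, and a polynomial that vanishes at all positive integral points has zero
  coefficients.\<close>

lemma top_form_zero_imp:
  assumes "finite K" "\<And>k. k \<in> K \<Longrightarrow> tdeg k \<le> D"
    and "\<And>a. \<forall>i. 0 < a i \<Longrightarrow> (\<lambda>t::nat. (\<Sum>k\<in>K. c k * monomial_fun k (\<lambda>i. t * a i)) / real t ^ D) \<longlonglongrightarrow> 0"
    and "\<kappa> \<in> K" "tdeg \<kappa> = D"
  shows "c \<kappa> = 0"
proof (rule poly_sum_zero_imp[where N = 1 and K = "{k\<in>K. tdeg k = D}"])
  fix a :: "'a \<Rightarrow> nat" assume "\<forall>i. 1 \<le> a i"
  then have "\<forall>i. 0 < a i" by (simp add: Suc_le_eq)
  moreover have "(\<lambda>t::nat. (\<Sum>k\<in>K. c k * monomial_fun k (\<lambda>i. t * a i)) / real t ^ D)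
      \<longlonglongrightarrow> (\<Sum>k\<in>{k\<in>K. tdeg k = D}. c k * monomial_fun k a)"
    using poly_sum_ray_limit[OF assms(2,1), where j = "\<lambda>_. 0"] by simp
  ultimately show "(\<Sum>k\<in>{k\<in>K. tdeg k = D}. c k * monomial_fun k a) = 0"
    using assms(3) LIMSEQ_unique by blast
qed (use assms in auto)

lemma ev_large_ray:
  assumes "ev_large Q" "\<forall>i. 0 < a i"
  shows "\<forall>\<^sub>F t::nat in sequentially. Q (\<lambda>i. t * a i + j i)"
proof -
  obtain N where N: "\<And>n. \<forall>i. N \<le> n i \<Longrightarrow> Q n" using assms(1) unfolding ev_large_def by blast
  show ?thesis using eventually_ge_at_top[of N]
  proof eventually_elim
    case (elim t)
    have "N \<le> t * a i + j i" for i
    proof -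
      have "N * 1 \<le> t * a i" using elim assms(2) by (intro mult_le_mono) (auto simp: Suc_le_eq)
      then show ?thesis by simp
    qed
    then show ?case by (intro N allI)
  qed
qed

lemma ev_poly_ray_limit_zero:
  assumes "ev_poly e g" "e \<le> D" "\<forall>i. 0 < a i"
  shows "(\<lambda>t::nat. g (\<lambda>i. t * a i) / real t ^ D) \<longlonglongrightarrow> 0"
proof -
  obtain g' where g': "poly_fun e g'" "ev_large (\<lambda>n. g n = g' n)"
    using ev_poly_imp_poly_fun[OF assms(1)] by blast
  obtain K c where K: "finite K" "\<And>k. k \<in> K \<Longrightarrow> tdeg k < e" "g' = (\<lambda>n. \<Sum>k\<in>K. c k * monomial_fun k n)"
    using g'(1) unfolding poly_fun_def by blast
  have le: "tdeg k \<le> D" if "k \<in> K" for k using K(2)[OF that] assms(2) by simp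
  have "\<not> (k \<in> K \<and> tdeg k = D)" for k using K(2)[of k] assms(2) by auto
  then have emp: "{k\<in>K. tdeg k = D} = {}" by blast
  then have "(\<lambda>t::nat. g' (\<lambda>i. t * a i) / real t ^ D) \<longlonglongrightarrow> 0"
    using poly_sum_ray_limit[OF le K(1), of c a "\<lambda>_. 0", unfolded emp]
    by (simp add: K(3))
  moreover have "\<forall>\<^sub>F t::nat in sequentially. g' (\<lambda>i. t * a i) / real t ^ D = g (\<lambda>i. t * a i) / real t ^ D"
    using ev_large_ray[OF g'(2) assms(3), where j = "\<lambda>_. 0"] by eventually_elim simp
  ultimately show ?thesis by (simp add: tendsto_cong)
qed

lemma ev_poly_drop_degree:
  assumes "ev_poly (Suc D) f"
    and "\<And>a. \<forall>i. 0 < a i \<Longrightarrow> (\<lambda>t::nat. f (\<lambda>i. t * a i) / real t ^ D) \<longlonglongrightarrow> 0"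
  shows "ev_poly D f"
proof -
  obtain f' where f': "poly_fun (Suc D) f'" "ev_large (\<lambda>n. f n = f' n)"
    using ev_poly_imp_poly_fun[OF assms(1)] by blast
  obtain K c where K: "finite K" "\<And>k. k \<in> K \<Longrightarrow> tdeg k < Suc D" "f' = (\<lambda>n. \<Sum>k\<in>K. c k * monomial_fun k n)"
    using f'(1) unfolding poly_fun_def by blast
  have z: "c k = 0" if "k \<in> K" "tdeg k = D" for k
  proof (rule top_form_zero_imp[where c = c and K = K and D = D and \<kappa> = k])
    fix a :: "'a \<Rightarrow> nat" assume a: "\<forall>i. 0 < a i"
    have "\<forall>\<^sub>F t::nat in sequentially. f (\<lambda>i. t * a i) / real t ^ D = f' (\<lambda>i. t * a i) / real t ^ D"
      using ev_large_ray[OF f'(2) a, where j = "\<lambda>_. 0"] by eventually_elim simp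
    from Lim_transform_eventually[OF assms(2)[OF a] this]
    show "(\<lambda>t::nat. (\<Sum>k\<in>K. c k * monomial_fun k (\<lambda>i. t * a i)) / real t ^ D) \<longlonglongrightarrow> 0"
      unfolding K(3) .
  qed (use K(1,2) that in \<open>simp_all add: less_Suc_eq_le\<close>)
  have "f' = (\<lambda>n. \<Sum>k\<in>{k\<in>K. tdeg k < D}. c k * monomial_fun k n)"
    unfolding K(3)
  proof (intro ext sum.mono_neutral_right ballI K(1))
    fix k n assume "k \<in> K - {k\<in>K. tdeg k < D}"
    then have "k \<in> K" "tdeg k = D" using K(2)[of k] by auto
    then show "c k * monomial_fun k n = 0" using z by simp
  qed auto
  moreover have "poly_fun D (\<lambda>n. \<Sum>k\<in>{k\<in>K. tdeg k < D}. c k * monomial_fun k n)"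
    by (rule poly_fun_sum) (use K(1) in auto)
  ultimately have "poly_fun D f'" by (simp only:)
  then have "ev_poly D f'" by (rule ev_poly_poly_fun)
  moreover have "ev_large (\<lambda>n. f' n = f n)" using f'(2) by (rule ev_large_mono) simp
  ultimately show ?thesis by (rule ev_poly_cong)
qed

text \<open>\<open>f\<close> is known to be eventually polynomial of some degree; domination by a
  function of smaller degree then removes its leading terms one degree at a time. The bound alone
  would not make \<open>f\<close> polynomial, hence the last assumption.\<close>

lemma ev_poly_le:
  assumes "ev_large (\<lambda>n. 0 \<le> f n \<and> f n \<le> g n)" "ev_poly e g" "ev_poly m f"
  shows "ev_poly e f"
  using assms(3)
proof (induction m)
  case 0 then show ?case by (rule ev_poly_0_Suc)
next
  case (Suc D)
  show ?case
  proof (cases "e \<le> D")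
    case False
    then show ?thesis using ev_poly_mono[OF Suc.prems, of e] by simp
  next
    case True
    have "ev_poly D f"
    proof (rule ev_poly_drop_degree[OF Suc.prems])
      fix a :: "'a \<Rightarrow> nat" assume a: "\<forall>i. 0 < a i"
      show "(\<lambda>t::nat. f (\<lambda>i. t * a i) / real t ^ D) \<longlonglongrightarrow> 0"
      proof (rule tendsto_sandwich[OF _ _ tendsto_const ev_poly_ray_limit_zero[OF assms(2) True a]])
        show "\<forall>\<^sub>F t in sequentially. 0 \<le> f (\<lambda>i. t * a i) / real t ^ D"
          using ev_large_ray[OF assms(1) a, where j = "\<lambda>_. 0"] by eventually_elim simp
        show "\<forall>\<^sub>F t in sequentially. f (\<lambda>i. t * a i) / real t ^ D \<le> g (\<lambda>i. t * a i) / real t ^ D"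
          using ev_large_ray[OF assms(1) a, where j = "\<lambda>_. 0"]
          by eventually_elim (simp add: divide_right_mono)
      qed
    qed
    then show ?thesis by (rule Suc.IH)
  qed
qed

subsection \<open>Multivariate polynomials\<close>

lemma poly_value_monomial_fun:
  "poly_value p n = (\<Sum>k\<in>Poly_Mapping.keys p. Poly_Mapping.lookup p k * monomial_fun k n)"
  by (simp add: poly_value_def monomial_fun_def)

lemma poly_fun_imp_poly_value:
  assumes "poly_fun e f"
  shows "\<exists>p. poly_value p = f \<and> (\<forall>k\<in>Poly_Mapping.keys p. tdeg k < e)"
proof -
  obtain K c where K: "finite K" "\<And>k. k \<in> K \<Longrightarrow> tdeg k < e" "f = (\<lambda>n. \<Sum>k\<in>K. c k * monomial_fun k n)"
    using assms unfolding poly_fun_def by blast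
  define p where "p = Abs_poly_mapping (\<lambda>k. if k \<in> K then c k else 0)"
  have "{k. (if k \<in> K then c k else 0) \<noteq> 0} \<subseteq> K"
    by (auto split: if_splits)
  then have "finite {k. (if k \<in> K then c k else 0) \<noteq> 0}" using K(1) by (rule finite_subset)
  then have l: "Poly_Mapping.lookup p = (\<lambda>k. if k \<in> K then c k else 0)"
    unfolding p_def by simp
  have keys: "Poly_Mapping.keys p \<subseteq> K" by (auto simp: in_keys_iff l split: if_splits)
  have "poly_value p = f" unfolding K(3) poly_value_monomial_fun
    by (intro ext sum.mono_neutral_cong_left K(1) keys) (use keys in \<open>auto simp: in_keys_iff l split: if_splits\<close>)
  with keys K(2) show ?thesis by blast
qed

lemma poly_value_eqI:
  assumes "ev_large (\<lambda>n. poly_value p n = poly_value q n)" shows "p = q"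
proof (rule poly_mapping_eqI)
  fix k
  define K where "K = Poly_Mapping.keys p \<union> Poly_Mapping.keys q \<union> {k}"
  have v: "poly_value p' n = (\<Sum>k\<in>K. Poly_Mapping.lookup p' k * monomial_fun k n)"
    if "Poly_Mapping.keys p' \<subseteq> K" for p' n
    unfolding poly_value_monomial_fun using that
    by (intro sum.mono_neutral_left) (auto simp: K_def in_keys_iff)
  have K: "Poly_Mapping.keys p \<subseteq> K" "Poly_Mapping.keys q \<subseteq> K" by (auto simp: K_def)
  obtain N where N: "\<And>n. \<forall>i. N \<le> n i \<Longrightarrow> poly_value p n = poly_value q n"
    using assms unfolding ev_large_def by blast
  have "Poly_Mapping.lookup p k - Poly_Mapping.lookup q k = 0"
  proof (rule poly_sum_zero_imp[of K N "\<lambda>k. Poly_Mapping.lookup p k - Poly_Mapping.lookup q k" k])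
    fix n :: "'a \<Rightarrow> nat" assume "\<forall>i. N \<le> n i"
    then show "(\<Sum>k\<in>K. (Poly_Mapping.lookup p k - Poly_Mapping.lookup q k) * monomial_fun k n) = 0"
      using N[of n] v[of p n, OF K(1)] v[of q n, OF K(2)]
      by (simp add: left_diff_distrib sum_subtractf)
  qed (auto simp: K_def)
  then show "Poly_Mapping.lookup p k = Poly_Mapping.lookup q k" by simp
qed


section \<open>Lengths of intervals of submodules\<close>

text \<open>A strict chain of \<open>l + 1\<close> sets above \<open>A\<close> whose last member is
  \<open>B\<close>. It need not start at \<open>A\<close>: \<open>base\<close> only asks for
  inclusion, so the top can be moved up freely and no case distinction on the bottom arises.\<close>

inductive sub_chain :: "('c set \<Rightarrow> bool) \<Rightarrow> 'c set \<Rightarrow> 'c set \<Rightarrow> nat \<Rightarrow> bool" for Q where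
  base: "Q A \<Longrightarrow> Q B \<Longrightarrow> A \<subseteq> B \<Longrightarrow> sub_chain Q A B 0"
| step: "sub_chain Q A B l \<Longrightarrow> B \<subset> C \<Longrightarrow> Q C \<Longrightarrow> sub_chain Q A C (Suc l)"

text \<open>For submodules this is the length of \<open>B / A\<close>, expressed without a quotient
  module; \<open>Q\<close> says which sets count as submodules.\<close>

definition len :: "('c set \<Rightarrow> bool) \<Rightarrow> 'c set \<Rightarrow> 'c set \<Rightarrow> enat" where
  "len Q A B = Sup {enat l | l. sub_chain Q A B l}"

lemma sub_chain_bounds: "sub_chain Q A B l \<Longrightarrow> Q A \<and> Q B \<and> A \<subseteq> B"
  by (induction rule: sub_chain.induct) auto

lemma sub_chain_extend: "sub_chain Q A B l \<Longrightarrow> B \<subseteq> C \<Longrightarrow> Q C \<Longrightarrow> sub_chain Q A C l"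
proof (induction rule: sub_chain.induct)
  case (step A B l D)
  then show ?case using sub_chain.step[of Q A B l C] by blast
qed (auto intro: sub_chain.base)

lemma sub_chain_trans: "sub_chain Q B C m \<Longrightarrow> sub_chain Q A B l \<Longrightarrow> sub_chain Q A C (l + m)"
  by (induction rule: sub_chain.induct) (auto intro: sub_chain_extend sub_chain.step)

lemma sub_chain_shorten: "sub_chain Q A B l \<Longrightarrow> m \<le> l \<Longrightarrow> sub_chain Q A B m"
proof (induction arbitrary: m rule: sub_chain.induct)
  case (step A B l C)
  then show ?case using sub_chain_extend[of Q A B m C] sub_chain.step[of Q A B l C]
    by (cases "m = Suc l") auto
qed (auto intro: sub_chain.base)

lemma sub_chain_map:
  assumes "sub_chain Q A B l"
    and "\<And>C. Q C \<Longrightarrow> A \<subseteq> C \<Longrightarrow> C \<subseteq> B \<Longrightarrow> Q' (f C) \<and> A' \<subseteq> f C"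
    and "\<And>C D. Q C \<Longrightarrow> Q D \<Longrightarrow> A \<subseteq> C \<Longrightarrow> C \<subset> D \<Longrightarrow> D \<subseteq> B \<Longrightarrow> f C \<subset> f D"
    and "Q' A'"
  shows "sub_chain Q' A' (f B) l"
  using assms
proof (induction rule: sub_chain.induct)
  case (base A B)
  then show ?case using sub_chain.base[of Q' A' "f B"] by blast
next
  case (step A B l C)
  note b = sub_chain_bounds[OF step.hyps(1)]
  have BC: "B \<subseteq> C" using step.hyps(2) by (rule psubset_imp_subset)
  have "sub_chain Q' A' (f B) l"
  proof (rule step.IH)
    show "Q' (f D) \<and> A' \<subseteq> f D" if "Q D" "A \<subseteq> D" "D \<subseteq> B" for D
      using step.prems(1)[OF that(1,2)] that(3) BC by (meson order_trans)
    show "f D \<subset> f E" if "Q D" "Q E" "A \<subseteq> D" "D \<subset> E" "E \<subseteq> B" for D E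
      using step.prems(2)[OF that(1-4)] that(5) BC by (meson order_trans)
  qed (rule step.prems(3))
  moreover have "f B \<subset> f C" using step.prems(2)[of B C] b step.hyps(2,3) by simp
  moreover have "Q' (f C)" using step.prems(1)[of C] b step.hyps(3) BC by (meson order_refl order_trans)
  ultimately show ?case by (rule sub_chain.step)
qed

text \<open>Links the inductive chains to the sequences of submodules in the definition of
  \<open>module_length\<close>.\<close>

lemma sub_chain_iff_sequence:
  assumes "Q A" "Q B" "A \<subseteq> B"
  shows "sub_chain Q A B l \<longleftrightarrow>
    (\<exists>N. (\<forall>i\<le>l. Q (N i) \<and> A \<subseteq> N i \<and> N i \<subseteq> B) \<and> (\<forall>i<l. N i \<subset> N (Suc i)))"
proof
  assume "sub_chain Q A B l"
  then show "\<exists>N. (\<forall>i\<le>l. Q (N i) \<and> A \<subseteq> N i \<and> N i \<subseteq> B) \<and> (\<forall>i<l. N i \<subset> N (Suc i))"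
  proof (induction rule: sub_chain.induct)
    case (base A B)
    then show ?case by (intro exI[of _ "\<lambda>_. A"]) auto
  next
    case (step A B l C)
    then obtain N where N: "\<forall>i\<le>l. Q (N i) \<and> A \<subseteq> N i \<and> N i \<subseteq> B" "\<forall>i<l. N i \<subset> N (Suc i)"
      by blast
    have b: "Q A" "A \<subseteq> B" using sub_chain_bounds[OF step.hyps(1)] by auto
    have "Q ((N(Suc l := C)) i) \<and> A \<subseteq> (N(Suc l := C)) i \<and> (N(Suc l := C)) i \<subseteq> C" if "i \<le> Suc l" for i
      using that N(1)[rule_format, of i] step.hyps(2,3) b by (cases "i = Suc l") auto
    moreover have "(N(Suc l := C)) i \<subset> (N(Suc l := C)) (Suc i)" if "i < Suc l" for i
      using that N(1)[rule_format, of i] N(2)[rule_format, of i] step.hyps(2) by (cases "i = l") auto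
    ultimately show ?case by blast
  qed
next
  assume "\<exists>N. (\<forall>i\<le>l. Q (N i) \<and> A \<subseteq> N i \<and> N i \<subseteq> B) \<and> (\<forall>i<l. N i \<subset> N (Suc i))"
  then obtain N where N: "\<And>i. i \<le> l \<Longrightarrow> Q (N i)" "\<And>i. i \<le> l \<Longrightarrow> A \<subseteq> N i" "\<And>i. i \<le> l \<Longrightarrow> N i \<subseteq> B"
    "\<And>i. i < l \<Longrightarrow> N i \<subset> N (Suc i)" by blast
  have "sub_chain Q A (N i) i" if "i \<le> l" for i
    using that
  proof (induction i)
    case 0
    then show ?case using N assms by (intro sub_chain.base) auto
  next
    case (Suc i)
    then show ?case using N(1)[of "Suc i"] N(4)[of i] by (intro sub_chain.step[of Q A "N i"]) auto
  qed
  from this[OF order_refl] show "sub_chain Q A B l" 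
    by (rule sub_chain_extend) (use N(3)[of l] assms(2) in auto)
qed

lemma len_le_iff: "len Q A B \<le> e \<longleftrightarrow> (\<forall>l. sub_chain Q A B l \<longrightarrow> enat l \<le> e)"
  unfolding len_def Sup_le_iff by blast

lemma sub_chain_le_len: "sub_chain Q A B l \<Longrightarrow> enat l \<le> len Q A B"
  using len_le_iff by blast

text \<open>The lengths of chains are closed downwards, so every natural number below the supremum
  is one of them, also when the supremum is infinite.\<close>

lemma le_len_imp_sub_chain:
  assumes "enat m \<le> len Q A B" "Q A" "Q B" "A \<subseteq> B"
  shows "sub_chain Q A B m"
proof (rule ccontr)
  assume n: "\<not> sub_chain Q A B m"
  then have m: "m \<noteq> 0" using assms sub_chain.base by metis
  have "len Q A B \<le> enat (m - 1)" unfolding len_le_iff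
  proof (intro allI impI)
    fix l assume "sub_chain Q A B l"
    then have "l < m" using n sub_chain_shorten by (meson not_le)
    then show "enat l \<le> enat (m - 1)" by simp
  qed
  then have "enat m \<le> enat (m - 1)" using assms(1) by (rule order_trans[rotated])
  then show False using m by simp
qed

text \<open>A strictly monotone map from one interval into another carries chains to chains of the
  same length; images and preimages under linear maps are the instances.\<close>

lemma len_map_le:
  assumes "\<And>C. Q C \<Longrightarrow> A \<subseteq> C \<Longrightarrow> C \<subseteq> B \<Longrightarrow> Q' (f C) \<and> A' \<subseteq> f C \<and> f C \<subseteq> B'"
    and "\<And>C D. Q C \<Longrightarrow> Q D \<Longrightarrow> A \<subseteq> C \<Longrightarrow> C \<subset> D \<Longrightarrow> D \<subseteq> B \<Longrightarrow> f C \<subset> f D"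
    and "Q' A'" "Q' B'"
  shows "len Q A B \<le> len Q' A' B'"
  unfolding len_le_iff
proof (intro allI impI)
  fix l assume l: "sub_chain Q A B l"
  have "sub_chain Q' A' (f B) l"
    by (rule sub_chain_map[OF l]) (use assms in auto)
  then have "sub_chain Q' A' B' l"
    by (rule sub_chain_extend) (use assms(1)[of B] assms(4) sub_chain_bounds[OF l] in auto)
  then show "enat l \<le> len Q' A' B'" by (rule sub_chain_le_len)
qed

lemma len_mono:
  assumes "A' \<subseteq> A" "B \<subseteq> B'" "Q A'" "Q B'" shows "len Q A B \<le> len Q A' B'"
  by (rule len_map_le[where f = id]) (use assms in auto)

lemma len_self [simp]: "len Q A A = 0"
proof -
  have "l = 0" if "sub_chain Q A B l" "B \<subseteq> A" for B l
    using that
  proof (cases rule: sub_chain.cases)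
    case (step B' l')
    then show ?thesis using sub_chain_bounds[OF step(2)] that(2) by blast
  qed
  then have "len Q A A \<le> 0" unfolding len_le_iff by (auto simp: zero_enat_def)
  then show ?thesis by simp
qed

subsection \<open>Additive subgroups closed under a set of scalars\<close>

text \<open>The scalars are an arbitrary set \<open>X\<close>. All of \<open>S\<close> gives the
  submodules, the degree-zero part gives the subgroups that lengths are measured with, and enlarging
  \<open>X\<close> by single ring elements serves the basis theorem.\<close>

definition closed_sub :: "('a, 'b, 'd) module_scheme \<Rightarrow> 'a set \<Rightarrow> 'b set \<Rightarrow> bool" where
  "closed_sub M X N \<longleftrightarrow> N \<subseteq> carrier M \<and> \<zero>\<^bsub>M\<^esub> \<in> N \<and> (\<forall>x\<in>N. \<forall>y\<in>N. x \<oplus>\<^bsub>M\<^esub> y \<in> N) \<and>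
     (\<forall>x\<in>N. \<ominus>\<^bsub>M\<^esub> x \<in> N) \<and> (\<forall>a\<in>X. \<forall>x\<in>N. a \<odot>\<^bsub>M\<^esub> x \<in> N)"

definition sum_sub :: "('a, 'b, 'd) module_scheme \<Rightarrow> 'b set \<Rightarrow> 'b set \<Rightarrow> 'b set" where
  "sum_sub M A B = {x \<oplus>\<^bsub>M\<^esub> y | x y. x \<in> A \<and> y \<in> B}"

definition lin_map ::
  "('a, 'c) ring_scheme \<Rightarrow> ('a, 'e, 'f) module_scheme \<Rightarrow> ('a, 'b, 'd) module_scheme \<Rightarrow> ('e \<Rightarrow> 'b) \<Rightarrow> bool" where
  "lin_map R G M \<phi> \<longleftrightarrow> (\<forall>x\<in>carrier G. \<phi> x \<in> carrier M) \<and>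
     (\<forall>x\<in>carrier G. \<forall>y\<in>carrier G. \<phi> (x \<oplus>\<^bsub>G\<^esub> y) = \<phi> x \<oplus>\<^bsub>M\<^esub> \<phi> y) \<and>
     (\<forall>a\<in>carrier R. \<forall>x\<in>carrier G. \<phi> (a \<odot>\<^bsub>G\<^esub> x) = a \<odot>\<^bsub>M\<^esub> \<phi> x)"

lemma closed_subD:
  assumes "closed_sub M X N"
  shows "N \<subseteq> carrier M" "\<zero>\<^bsub>M\<^esub> \<in> N" "\<And>x. x \<in> N \<Longrightarrow> x \<in> carrier M"
    "\<And>x y. x \<in> N \<Longrightarrow> y \<in> N \<Longrightarrow> x \<oplus>\<^bsub>M\<^esub> y \<in> N" "\<And>x. x \<in> N \<Longrightarrow> \<ominus>\<^bsub>M\<^esub> x \<in> N"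
    "\<And>a x. a \<in> X \<Longrightarrow> x \<in> N \<Longrightarrow> a \<odot>\<^bsub>M\<^esub> x \<in> N"
  using assms unfolding closed_sub_def by auto

lemma closed_subI:
  assumes "\<And>x. x \<in> N \<Longrightarrow> x \<in> carrier M" "\<zero>\<^bsub>M\<^esub> \<in> N"
    "\<And>x y. x \<in> N \<Longrightarrow> y \<in> N \<Longrightarrow> x \<oplus>\<^bsub>M\<^esub> y \<in> N" "\<And>x. x \<in> N \<Longrightarrow> \<ominus>\<^bsub>M\<^esub> x \<in> N"
    "\<And>a x. a \<in> X \<Longrightarrow> x \<in> N \<Longrightarrow> a \<odot>\<^bsub>M\<^esub> x \<in> N"
  shows "closed_sub M X N"
  using assms unfolding closed_sub_def by auto

lemma closed_sub_antimono: "closed_sub M X N \<Longrightarrow> Y \<subseteq> X \<Longrightarrow> closed_sub M Y N"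
  unfolding closed_sub_def by blast

lemma closed_sub_Int: "closed_sub M X A \<Longrightarrow> closed_sub M X B \<Longrightarrow> closed_sub M X (A \<inter> B)"
  unfolding closed_sub_def by blast

lemma sum_subI: "x \<in> A \<Longrightarrow> y \<in> B \<Longrightarrow> x \<oplus>\<^bsub>M\<^esub> y \<in> sum_sub M A B"
  unfolding sum_sub_def by blast

lemma sum_subE:
  assumes "z \<in> sum_sub M A B" obtains x y where "x \<in> A" "y \<in> B" "z = x \<oplus>\<^bsub>M\<^esub> y"
  using assms unfolding sum_sub_def by blast

lemma sum_sub_mono: "A \<subseteq> A' \<Longrightarrow> B \<subseteq> B' \<Longrightarrow> sum_sub M A B \<subseteq> sum_sub M A' B'"
  unfolding sum_sub_def by blast

context module
begin

lemma closed_sub_diff: "closed_sub M X N \<Longrightarrow> x \<in> N \<Longrightarrow> y \<in> N \<Longrightarrow> x \<ominus>\<^bsub>M\<^esub> y \<in> N"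
  unfolding a_minus_def by (intro closed_subD)

lemma closed_sub_zero: "X \<subseteq> carrier R \<Longrightarrow> closed_sub M X {\<zero>\<^bsub>M\<^esub>}"
  by (rule closed_subI) auto

lemma closed_sub_carrier: "X \<subseteq> carrier R \<Longrightarrow> closed_sub M X (carrier M)"
  by (rule closed_subI) auto

lemma closed_sub_sum_sub:
  assumes X: "X \<subseteq> carrier R" and A: "closed_sub M X A" and B: "closed_sub M X B"
  shows "closed_sub M X (sum_sub M A B)"
proof (rule closed_subI)
  note [simp] = closed_subD(3)[OF A] closed_subD(3)[OF B]
  note [simp] = closed_subD(4,5,6)[OF A] closed_subD(4,5,6)[OF B]
  show "x \<in> carrier M" if "x \<in> sum_sub M A B" for x using that by (auto elim!: sum_subE)
  have "\<zero>\<^bsub>M\<^esub> = \<zero>\<^bsub>M\<^esub> \<oplus>\<^bsub>M\<^esub> \<zero>\<^bsub>M\<^esub>" by simp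
  then show "\<zero>\<^bsub>M\<^esub> \<in> sum_sub M A B" using sum_subI[OF closed_subD(2)[OF A] closed_subD(2)[OF B], of M] by simp
  show "z \<oplus>\<^bsub>M\<^esub> z' \<in> sum_sub M A B" if h: "z \<in> sum_sub M A B" "z' \<in> sum_sub M A B" for z z'
  proof -
    obtain x y where z: "x \<in> A" "y \<in> B" "z = x \<oplus>\<^bsub>M\<^esub> y" using h(1) by (rule sum_subE)
    obtain x' y' where z': "x' \<in> A" "y' \<in> B" "z' = x' \<oplus>\<^bsub>M\<^esub> y'" using h(2) by (rule sum_subE)
    have "z \<oplus>\<^bsub>M\<^esub> z' = (x \<oplus>\<^bsub>M\<^esub> x') \<oplus>\<^bsub>M\<^esub> (y \<oplus>\<^bsub>M\<^esub> y')" using z z' by (simp add: M.a_ac)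
    then show ?thesis using z z' by (auto intro: sum_subI)
  qed
  show "\<ominus>\<^bsub>M\<^esub> z \<in> sum_sub M A B" if h: "z \<in> sum_sub M A B" for z
  proof -
    obtain x y where z: "x \<in> A" "y \<in> B" "z = x \<oplus>\<^bsub>M\<^esub> y" using h by (rule sum_subE)
    then have "\<ominus>\<^bsub>M\<^esub> z = \<ominus>\<^bsub>M\<^esub> x \<oplus>\<^bsub>M\<^esub> \<ominus>\<^bsub>M\<^esub> y" by (simp add: M.minus_add)
    then show ?thesis using z by (auto intro: sum_subI)
  qed
  show "a \<odot>\<^bsub>M\<^esub> z \<in> sum_sub M A B" if h: "a \<in> X" "z \<in> sum_sub M A B" for a z
  proof -
    obtain x y where z: "x \<in> A" "y \<in> B" "z = x \<oplus>\<^bsub>M\<^esub> y" using h(2) by (rule sum_subE)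
    then have "a \<odot>\<^bsub>M\<^esub> z = a \<odot>\<^bsub>M\<^esub> x \<oplus>\<^bsub>M\<^esub> a \<odot>\<^bsub>M\<^esub> y" using X \<open>a \<in> X\<close> by (auto intro!: smult_r_distr)
    then show ?thesis using z \<open>a \<in> X\<close> by (auto intro: sum_subI)
  qed
qed

lemma sum_sub_upper1: "closed_sub M X A \<Longrightarrow> closed_sub M Y B \<Longrightarrow> A \<subseteq> sum_sub M A B"
proof
  fix x assume *: "closed_sub M X A" "closed_sub M Y B" "x \<in> A"
  then have "x = x \<oplus>\<^bsub>M\<^esub> \<zero>\<^bsub>M\<^esub>" by (simp add: closed_subD(3))
  then show "x \<in> sum_sub M A B" using * sum_subI[of x A "\<zero>\<^bsub>M\<^esub>" B M] closed_subD(2)[of M Y B] by simp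
qed

lemma sum_sub_upper2: "closed_sub M X A \<Longrightarrow> closed_sub M Y B \<Longrightarrow> B \<subseteq> sum_sub M A B"
proof
  fix x assume *: "closed_sub M X A" "closed_sub M Y B" "x \<in> B"
  then have "x = \<zero>\<^bsub>M\<^esub> \<oplus>\<^bsub>M\<^esub> x" by (simp add: closed_subD(3))
  then show "x \<in> sum_sub M A B" using * sum_subI[of "\<zero>\<^bsub>M\<^esub>" A x B M] closed_subD(2)[of M X A] by simp
qed

lemma sum_sub_least: "closed_sub M X C \<Longrightarrow> A \<subseteq> C \<Longrightarrow> B \<subseteq> C \<Longrightarrow> sum_sub M A B \<subseteq> C"
  by (auto elim!: sum_subE intro!: closed_subD(4))

lemma sum_sub_absorb: "closed_sub M X B \<Longrightarrow> closed_sub M Y A \<Longrightarrow> A \<subseteq> B \<Longrightarrow> sum_sub M B A = B"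
  using sum_sub_least[of X B B A] sum_sub_upper1[of X B Y A] by blast

lemma sum_sub_assoc:
  assumes "A \<subseteq> carrier M" "B \<subseteq> carrier M" "C \<subseteq> carrier M"
  shows "sum_sub M (sum_sub M A B) C = sum_sub M A (sum_sub M B C)"
proof (intro equalityI subsetI)
  fix z assume "z \<in> sum_sub M (sum_sub M A B) C"
  then obtain a b c where h: "a \<in> A" "b \<in> B" "c \<in> C" "z = a \<oplus>\<^bsub>M\<^esub> b \<oplus>\<^bsub>M\<^esub> c" by (auto elim!: sum_subE)
  have z: "z = a \<oplus>\<^bsub>M\<^esub> (b \<oplus>\<^bsub>M\<^esub> c)" using h assms by (simp add: M.a_assoc subsetD)
  show "z \<in> sum_sub M A (sum_sub M B C)" unfolding z using h(1-3) by (intro sum_subI)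
next
  fix z assume "z \<in> sum_sub M A (sum_sub M B C)"
  then obtain a b c where h: "a \<in> A" "b \<in> B" "c \<in> C" "z = a \<oplus>\<^bsub>M\<^esub> (b \<oplus>\<^bsub>M\<^esub> c)" by (auto elim!: sum_subE)
  have z: "z = a \<oplus>\<^bsub>M\<^esub> b \<oplus>\<^bsub>M\<^esub> c" using h assms by (simp add: M.a_assoc subsetD)
  show "z \<in> sum_sub M (sum_sub M A B) C" unfolding z using h(1-3) by (intro sum_subI)
qed

lemma sum_sub_commute:
  assumes "A \<subseteq> carrier M" "B \<subseteq> carrier M"
  shows "sum_sub M A B = sum_sub M B A"
proof -
  have "sum_sub M A B \<subseteq> sum_sub M B A" if "A \<subseteq> carrier M" "B \<subseteq> carrier M" for A B
  proof
    fix z assume "z \<in> sum_sub M A B"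
    then obtain a b where h: "a \<in> A" "b \<in> B" "z = a \<oplus>\<^bsub>M\<^esub> b" by (rule sum_subE)
    have z: "z = b \<oplus>\<^bsub>M\<^esub> a" using h that by (simp add: M.a_comm subsetD)
    show "z \<in> sum_sub M B A" unfolding z using h(1,2) by (intro sum_subI)
  qed
  with assms show ?thesis by blast
qed

lemma sum_sub_zero: "A \<subseteq> carrier M \<Longrightarrow> sum_sub M {\<zero>\<^bsub>M\<^esub>} A = A" "A \<subseteq> carrier M \<Longrightarrow> sum_sub M A {\<zero>\<^bsub>M\<^esub>} = A"
  unfolding sum_sub_def by (force simp: subset_iff)+

lemma closed_sub_modular:
  assumes "closed_sub M X B" "closed_sub M X C" "closed_sub M X D" "C \<subseteq> D"
    and "D \<inter> B \<subseteq> C" "sum_sub M D B \<subseteq> sum_sub M C B"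
  shows "D \<subseteq> C"
proof
  fix d assume d: "d \<in> D"
  note [simp] = closed_subD(3)[OF assms(1)] closed_subD(3)[OF assms(2)] closed_subD(3)[OF assms(3)]
  have "d \<in> sum_sub M C B" using d sum_sub_upper1[OF assms(3,1)] assms(6) by blast
  then obtain c b where cb: "c \<in> C" "b \<in> B" "d = c \<oplus>\<^bsub>M\<^esub> b" by (rule sum_subE)
  have "d \<oplus>\<^bsub>M\<^esub> \<ominus>\<^bsub>M\<^esub> c = \<ominus>\<^bsub>M\<^esub> c \<oplus>\<^bsub>M\<^esub> (c \<oplus>\<^bsub>M\<^esub> b)" using cb d by (simp add: M.a_comm)
  then have "b = d \<ominus>\<^bsub>M\<^esub> c" using cb d unfolding a_minus_def by (simp add: M.r_neg1)
  then have "b \<in> D" using closed_sub_diff[OF assms(3) d] cb(1) assms(4) by auto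
  then have "b \<in> C" using cb(2) assms(5) by blast
  then show "d \<in> C" using cb closed_subD(4)[OF assms(2)] by simp
qed

text \<open>Additivity without simple factors: a chain from \<open>A\<close> to \<open>C\<close> is
  intersected with \<open>B\<close> and enlarged by \<open>B\<close>, and by the modular law each
  strict step stays strict in at least one of the two resulting chains. Conversely, chains on both
  sides of \<open>B\<close> are concatenated. Lengths may be infinite.\<close>

theorem len_add:
  assumes X: "X \<subseteq> carrier R"
    and A: "closed_sub M X A" and B: "closed_sub M X B" and C: "closed_sub M X C"
    and AB: "A \<subseteq> B" and BC: "B \<subseteq> C"
  shows "len (closed_sub M X) A C = len (closed_sub M X) A B + len (closed_sub M X) B C"
proof (rule antisym)
  let ?Q = "closed_sub M X"
  have split: "\<exists>l1 l2. l \<le> l1 + l2 \<and> sub_chain ?Q A' (D \<inter> B) l1 \<and> sub_chain ?Q B (sum_sub M D B) l2"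
    if "sub_chain ?Q A' D l" "A' = A" for A' D l
    using that
  proof (induction rule: sub_chain.induct)
    case (base A' D)
    then have "?Q (D \<inter> B)" "?Q (sum_sub M D B)" "B \<subseteq> sum_sub M D B" "A \<subseteq> D \<inter> B"
      using AB A B X closed_sub_Int[of M X D B] closed_sub_sum_sub[of X D B] sum_sub_upper2[of X D X B]
      by auto
    then have "sub_chain ?Q A (D \<inter> B) 0" "sub_chain ?Q B (sum_sub M D B) 0"
      using A B by (simp_all add: sub_chain.base)
    then show ?case using base.prems by (intro exI[of _ 0]) simp
  next
    case (step A' D l E)
    then obtain l1 l2 where l: "l \<le> l1 + l2" "sub_chain ?Q A (D \<inter> B) l1" "sub_chain ?Q B (sum_sub M D B) l2"
      by auto
    have D: "?Q D" using sub_chain_bounds[OF step.hyps(1)] by simp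
    have s: "sum_sub M D B \<subseteq> sum_sub M E B" using step.hyps(2) by (intro sum_sub_mono) auto
    have Q1: "?Q (E \<inter> B)" "?Q (sum_sub M E B)"
      using closed_sub_Int[OF step.hyps(3) B] closed_sub_sum_sub[OF X step.hyps(3) B] by auto
    show ?case
    proof (cases "E \<inter> B \<subseteq> D")
      case True
      then have "sum_sub M D B \<subset> sum_sub M E B"
        using closed_sub_modular[OF B D step.hyps(3)] step.hyps(2) s by blast
      then have "sub_chain ?Q B (sum_sub M E B) (Suc l2)" using l(3) Q1 by (intro sub_chain.step)
      moreover have "sub_chain ?Q A (E \<inter> B) l1" 
        by (rule sub_chain_extend[OF l(2)]) (use Q1 step.hyps(2) in auto)
      ultimately show ?thesis using l(1) step.prems by (intro exI[of _ l1] exI[of _ "Suc l2"]) auto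
    next
      case False
      then have "D \<inter> B \<subset> E \<inter> B" using step.hyps(2) by blast
      then have "sub_chain ?Q A (E \<inter> B) (Suc l1)" using l(2) Q1 by (intro sub_chain.step)
      moreover have "sub_chain ?Q B (sum_sub M E B) l2" 
        by (rule sub_chain_extend[OF l(3) s Q1(2)])
      ultimately show ?thesis using l(1) step.prems by (intro exI[of _ "Suc l1"] exI[of _ l2]) auto
    qed
  qed
  show "len ?Q A C \<le> len ?Q A B + len ?Q B C"
    unfolding len_le_iff[of ?Q A C]
  proof (intro allI impI)
    fix l assume "sub_chain ?Q A C l"
    then obtain l1 l2 where l: "l \<le> l1 + l2" "sub_chain ?Q A (C \<inter> B) l1" "sub_chain ?Q B (sum_sub M C B) l2"
      using split by blast
    then have "sub_chain ?Q A B l1" "sub_chain ?Q B C l2"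
      using BC sum_sub_absorb[OF C B BC] by (simp_all add: Int_absorb1)
    then have "enat l1 + enat l2 \<le> len ?Q A B + len ?Q B C"
      by (intro add_mono sub_chain_le_len)
    then show "enat l \<le> len ?Q A B + len ?Q B C"
      using l(1) by (metis enat_ord_simps(1) order_trans plus_enat_simps(1))
  qed
  have key: "enat (m1 + m2) \<le> len ?Q A C" if "enat m1 \<le> len ?Q A B" "enat m2 \<le> len ?Q B C" for m1 m2
    by (rule sub_chain_le_len[OF sub_chain_trans[OF le_len_imp_sub_chain[OF that(2) B C BC]
          le_len_imp_sub_chain[OF that(1) A B AB]]])
  have z: "enat 0 \<le> len ?Q A B" "enat 0 \<le> len ?Q B C" by (simp_all flip: zero_enat_def)
  show "len ?Q A B + len ?Q B C \<le> len ?Q A C"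
  \<comment> \<open>If one length is infinite, chains of every length exist on that side, and each
    is completed by a chain of length 0 on the other side.\<close>
  proof (cases "len ?Q A B = \<infinity> \<or> len ?Q B C = \<infinity>")
    case True
    then have "enat m \<le> len ?Q A C" for m using key[of m 0] key[of 0 m] z by auto
    then have "len ?Q A C \<noteq> enat n" for n using Suc_n_not_le_n enat_ord_simps(1) by metis
    then have "len ?Q A C = \<infinity>" by (cases "len ?Q A C") auto
    then show ?thesis by simp
  next
    case False
    then obtain m1 m2 where "len ?Q A B = enat m1" "len ?Q B C = enat m2" by auto
    then show ?thesis using key[of m1 m2] by simp
  qed
qed

end

section \<open>Linear maps and lengths of images\<close>

lemma lin_mapD:
  assumes "lin_map R G M \<phi>"
  shows "x \<in> carrier G \<Longrightarrow> \<phi> x \<in> carrier M"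
    "x \<in> carrier G \<Longrightarrow> y \<in> carrier G \<Longrightarrow> \<phi> (x \<oplus>\<^bsub>G\<^esub> y) = \<phi> x \<oplus>\<^bsub>M\<^esub> \<phi> y"
    "a \<in> carrier R \<Longrightarrow> x \<in> carrier G \<Longrightarrow> \<phi> (a \<odot>\<^bsub>G\<^esub> x) = a \<odot>\<^bsub>M\<^esub> \<phi> x"
  using assms unfolding lin_map_def by auto

lemma lin_map_zero_minus:
  assumes "module R G" "module R M" "lin_map R G M \<phi>"
  shows "\<phi> \<zero>\<^bsub>G\<^esub> = \<zero>\<^bsub>M\<^esub>" "x \<in> carrier G \<Longrightarrow> \<phi> (\<ominus>\<^bsub>G\<^esub> x) = \<ominus>\<^bsub>M\<^esub> \<phi> x"
proof -
  interpret G: module R G by fact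
  interpret M: module R M by fact
  note l = lin_mapD[OF assms(3)]
  show z: "\<phi> \<zero>\<^bsub>G\<^esub> = \<zero>\<^bsub>M\<^esub>"
    using l(3)[of "\<zero>\<^bsub>R\<^esub>" "\<zero>\<^bsub>G\<^esub>"] l(1)[of "\<zero>\<^bsub>G\<^esub>"] by simp
  assume x: "x \<in> carrier G"
  have "\<phi> (\<ominus>\<^bsub>G\<^esub> x) \<oplus>\<^bsub>M\<^esub> \<phi> x = \<zero>\<^bsub>M\<^esub>"
    using l(2)[of "\<ominus>\<^bsub>G\<^esub> x" x] x z by (simp add: G.M.l_neg)
  then show "\<phi> (\<ominus>\<^bsub>G\<^esub> x) = \<ominus>\<^bsub>M\<^esub> \<phi> x"
    using x l(1) by (simp add: M.M.minus_equality)
qed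

lemma closed_sub_image:
  assumes m: "module R G" "module R M" and l: "lin_map R G M \<phi>" and X: "X \<subseteq> carrier R"
    and B: "closed_sub G X B"
  shows "closed_sub M X (\<phi> ` B)"
proof (rule closed_subI)
  note [simp] = closed_subD(3)[OF B]
  note lD = lin_mapD[OF l] and z = lin_map_zero_minus[OF m l]
  show "x \<in> carrier M" if "x \<in> \<phi> ` B" for x using that lD(1) by auto
  show "\<zero>\<^bsub>M\<^esub> \<in> \<phi> ` B" using z(1) closed_subD(2)[OF B] by (metis imageI)
  show "x \<oplus>\<^bsub>M\<^esub> y \<in> \<phi> ` B" if "x \<in> \<phi> ` B" "y \<in> \<phi> ` B" for x y
    using that by (auto simp: lD(2)[symmetric] closed_subD(4)[OF B])
  show "\<ominus>\<^bsub>M\<^esub> x \<in> \<phi> ` B" if "x \<in> \<phi> ` B" for x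
    using that by (auto simp: z(2)[symmetric] closed_subD(5)[OF B])
  show "a \<odot>\<^bsub>M\<^esub> x \<in> \<phi> ` B" if "a \<in> X" "x \<in> \<phi> ` B" for a x
    using that X by (auto simp: lD(3)[symmetric] subsetD closed_subD(6)[OF B])
qed

lemma closed_sub_preimage:
  assumes m: "module R G" "module R M" and l: "lin_map R G M \<phi>" and X: "X \<subseteq> carrier R"
    and B: "closed_sub G X B" and A: "closed_sub M X A"
  shows "closed_sub G X {x\<in>B. \<phi> x \<in> A}"
proof (rule closed_subI)
  note [simp] = closed_subD(3)[OF B]
  note lD = lin_mapD[OF l] and z = lin_map_zero_minus[OF m l]
  show "a \<odot>\<^bsub>G\<^esub> x \<in> {x\<in>B. \<phi> x \<in> A}" if "a \<in> X" "x \<in> {x\<in>B. \<phi> x \<in> A}" for a x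
    using that X by (auto simp: lD(3) subsetD closed_subD(6)[OF B] closed_subD(6)[OF A])
qed (use closed_subD(2-5)[OF B] closed_subD(2,4,5)[OF A] lin_mapD(2)[OF l] lin_map_zero_minus[OF m l] in \<open>auto\<close>)

text \<open>\<open>\<phi>\<close> induces a surjection from \<open>B / A\<close> onto
  \<open>(A' + \<phi> B) / A'\<close>; chains are pulled back.\<close>

lemma len_image_le:
  assumes m: "module R G" "module R M" and l: "lin_map R G M \<phi>" and X: "X \<subseteq> carrier R"
    and A: "closed_sub G X A" and B: "closed_sub G X B" and AB: "A \<subseteq> B"
    and A': "closed_sub M X A'" and sub: "\<And>x. x \<in> A \<Longrightarrow> \<phi> x \<in> A'"
  shows "len (closed_sub M X) A' (sum_sub M A' (\<phi> ` B)) \<le> len (closed_sub G X) A B"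
proof -
  interpret M: module R M by fact
  note im = closed_sub_image[OF m l X B]
  show ?thesis
  proof (rule len_map_le[where f = "\<lambda>D. {x\<in>B. \<phi> x \<in> D}"])
    show "closed_sub G X {x \<in> B. \<phi> x \<in> C} \<and> A \<subseteq> {x \<in> B. \<phi> x \<in> C} \<and> {x \<in> B. \<phi> x \<in> C} \<subseteq> B"
      if "closed_sub M X C" "A' \<subseteq> C" for C
      using closed_sub_preimage[OF m l X B that(1)] that AB sub by blast
    fix C D assume CD: "closed_sub M X C" "closed_sub M X D" "A' \<subseteq> C" "C \<subset> D" "D \<subseteq> sum_sub M A' (\<phi> ` B)"
    obtain d where d: "d \<in> D" "d \<notin> C" using CD(4) by blast
    then obtain a b where ab: "a \<in> A'" "b \<in> B" "d = a \<oplus>\<^bsub>M\<^esub> \<phi> b" using CD(5) by (auto elim!: sum_subE)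
    note [simp] = closed_subD(3)[OF A'] lin_mapD(1)[OF l] closed_subD(3)[OF B]
    have "\<phi> b \<notin> C" using d ab CD(3) closed_subD(4)[OF CD(1), of a "\<phi> b"] by auto
    moreover have "\<phi> b = \<ominus>\<^bsub>M\<^esub> a \<oplus>\<^bsub>M\<^esub> d" using ab by (simp add: M.M.r_neg1)
    then have "\<phi> b \<in> D" using d(1) ab(1) CD(3,4) closed_subD(4,5)[OF CD(2)] by auto
    ultimately show "{x \<in> B. \<phi> x \<in> C} \<subset> {x \<in> B. \<phi> x \<in> D}" using ab(2) CD(4) by blast
  qed (use A B in auto)
qed

text \<open>\<open>A\<close> contains all elements of \<open>B\<close> that \<open>\<phi>\<close>
  maps into \<open>A'\<close>, so the images of a strict chain above \<open>A\<close> stay distinct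
  modulo \<open>A'\<close>; chains are pushed forward.\<close>

lemma len_image_ge:
  assumes m: "module R G" "module R M" and l: "lin_map R G M \<phi>" and X: "X \<subseteq> carrier R"
    and A: "closed_sub G X A" and B: "closed_sub G X B"
    and A': "closed_sub M X A'" and sub: "\<And>x. x \<in> B \<Longrightarrow> \<phi> x \<in> A' \<Longrightarrow> x \<in> A"
  shows "len (closed_sub G X) A B \<le> len (closed_sub M X) A' (sum_sub M A' (\<phi> ` B))"
proof -
  interpret G: module R G by fact
  interpret M: module R M by fact
  note im = closed_sub_image[OF m l X]
  show ?thesis
  proof (rule len_map_le[where f = "\<lambda>C. sum_sub M A' (\<phi> ` C)"])
    show "closed_sub M X (sum_sub M A' (\<phi> ` C)) \<and> A' \<subseteq> sum_sub M A' (\<phi> ` C)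
        \<and> sum_sub M A' (\<phi> ` C) \<subseteq> sum_sub M A' (\<phi> ` B)"
      if "closed_sub G X C" "C \<subseteq> B" for C
      using M.closed_sub_sum_sub[OF X A' im[OF that(1)]] M.sum_sub_upper1[OF A' im[OF that(1)]]
        sum_sub_mono[of A' A' "\<phi> ` C" "\<phi> ` B" M] that(2) by blast
    fix C D assume CD: "closed_sub G X C" "closed_sub G X D" "A \<subseteq> C" "C \<subset> D" "D \<subseteq> B"
    obtain d where d: "d \<in> D" "d \<notin> C" using CD(4) by blast
    note [simp] = closed_subD(3)[OF A'] lin_mapD(1)[OF l] closed_subD(3)[OF CD(1)] closed_subD(3)[OF CD(2)]
    have "\<phi> d \<notin> sum_sub M A' (\<phi> ` C)"
    proof
      assume "\<phi> d \<in> sum_sub M A' (\<phi> ` C)"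
      then obtain a c where ac: "a \<in> A'" "c \<in> C" "\<phi> d = a \<oplus>\<^bsub>M\<^esub> \<phi> c" by (auto elim!: sum_subE)
      have "\<phi> (d \<oplus>\<^bsub>G\<^esub> \<ominus>\<^bsub>G\<^esub> c) = a \<oplus>\<^bsub>M\<^esub> \<phi> c \<oplus>\<^bsub>M\<^esub> \<ominus>\<^bsub>M\<^esub> \<phi> c"
        using ac d lin_mapD(2)[OF l, of d "\<ominus>\<^bsub>G\<^esub> c"] lin_map_zero_minus(2)[OF m l, of c] by simp
      also have "\<dots> = a" using ac by (simp add: M.M.a_assoc M.M.r_neg)
      finally have "\<phi> (d \<oplus>\<^bsub>G\<^esub> \<ominus>\<^bsub>G\<^esub> c) \<in> A'" using ac by simp
      moreover have "d \<oplus>\<^bsub>G\<^esub> \<ominus>\<^bsub>G\<^esub> c \<in> D" using d ac CD(2,4) closed_subD(4,5) by (metis psubsetD)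
      ultimately have "d \<oplus>\<^bsub>G\<^esub> \<ominus>\<^bsub>G\<^esub> c \<in> C" using sub CD(3,5) by blast
      then have "(d \<oplus>\<^bsub>G\<^esub> \<ominus>\<^bsub>G\<^esub> c) \<oplus>\<^bsub>G\<^esub> c \<in> C" using ac(2) closed_subD(4)[OF CD(1)] by blast
      then show False using d ac by (simp add: G.M.a_assoc G.M.l_neg)
    qed
    moreover have "\<phi> d \<in> sum_sub M A' (\<phi> ` D)" using M.sum_sub_upper2[OF A' im[OF CD(2)]] d by blast
    ultimately show "sum_sub M A' (\<phi> ` C) \<subset> sum_sub M A' (\<phi> ` D)"
      using sum_sub_mono[of A' A' "\<phi> ` C" "\<phi> ` D" M] CD(4) by blast
  qed (use A' B im M.closed_sub_sum_sub[OF X] in auto)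
qed

lemma regular_module_simps [simp]:
  "carrier (regular_module A) = carrier A" "\<zero>\<^bsub>regular_module A\<^esub> = \<zero>\<^bsub>A\<^esub>"
  "x \<oplus>\<^bsub>regular_module A\<^esub> y = x \<oplus>\<^bsub>A\<^esub> y" "x \<odot>\<^bsub>regular_module A\<^esub> y = x \<otimes>\<^bsub>A\<^esub> y"
  "\<ominus>\<^bsub>regular_module A\<^esub> x = \<ominus>\<^bsub>A\<^esub> x"
  by (simp_all add: regular_module_def a_inv_def m_inv_def)

lemma (in cring) module_regular_module: "module R (regular_module R)"
proof (rule moduleI)
  show "abelian_group (regular_module R)"
    by (rule abelian_groupI) (auto simp: a_ac intro: l_neg bexI[of _ "\<ominus> _"])
qed (simp_all add: is_cring l_distr r_distr m_assoc)

section \<open>Spans with coefficients in a prescribed set\<close>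

context module
begin

lemma lin_map_smult_right: "x \<in> carrier M \<Longrightarrow> lin_map R (regular_module R) M (\<lambda>a. a \<odot>\<^bsub>M\<^esub> x)"
  unfolding lin_map_def by (auto simp: smult_l_distr smult_assoc1)

lemma lin_map_smult_left:
  assumes "a \<in> carrier R" shows "lin_map R M M (\<lambda>x. a \<odot>\<^bsub>M\<^esub> x)"
  unfolding lin_map_def
proof (intro conjI ballI)
  fix b x assume "b \<in> carrier R" "x \<in> carrier M"
  then show "a \<odot>\<^bsub>M\<^esub> (b \<odot>\<^bsub>M\<^esub> x) = b \<odot>\<^bsub>M\<^esub> (a \<odot>\<^bsub>M\<^esub> x)"
    using assms smult_assoc1[of a b x] smult_assoc1[of b a x] m_comm[of a b] by simp
qed (use assms in \<open>auto simp: smult_r_distr\<close>)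

text \<open>The coefficients come from a subset \<open>A\<close> of the ring, so that combinations
  with coefficients of bounded degree can be expressed.\<close>

primrec lin_span :: "'a set \<Rightarrow> 'c list \<Rightarrow> 'c set" where
  "lin_span A [] = {\<zero>\<^bsub>M\<^esub>}"
| "lin_span A (x # xs) = sum_sub M ((\<lambda>a. a \<odot>\<^bsub>M\<^esub> x) ` A) (lin_span A xs)"

text \<open>Linear independence in triangular form: no nonzero multiple of an entry lies in the span
  of the later ones. This is the form that an induction along the list uses.\<close>

primrec independent :: "'c list \<Rightarrow> bool" where
  "independent [] \<longleftrightarrow> True"
| "independent (x # xs) \<longleftrightarrow>
     (\<forall>a\<in>carrier R. a \<odot>\<^bsub>M\<^esub> x \<in> lin_span (carrier R) xs \<longrightarrow> a = \<zero>) \<and> independent xs"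

lemma closed_sub_smult_image:
  assumes "X \<subseteq> carrier R" "closed_sub (regular_module R) X A" "x \<in> carrier M"
  shows "closed_sub M X ((\<lambda>a. a \<odot>\<^bsub>M\<^esub> x) ` A)"
  by (rule closed_sub_image[OF module_regular_module module_axioms lin_map_smult_right]) (use assms in auto)

lemma closed_sub_lin_span:
  assumes "X \<subseteq> carrier R" "closed_sub (regular_module R) X A" "set xs \<subseteq> carrier M"
  shows "closed_sub M X (lin_span A xs)"
  using assms(3)
  by (induction xs) (auto intro!: closed_sub_zero closed_sub_sum_sub closed_sub_smult_image assms(1,2))

lemma lin_span_mono: "A \<subseteq> B \<Longrightarrow> lin_span A xs \<subseteq> lin_span B xs"
proof (induction xs)
  case (Cons x xs)
  then show ?case unfolding lin_span.simps by (intro sum_sub_mono image_mono)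
qed simp

lemma smult_mem_lin_span:
  assumes "X \<subseteq> carrier R" "closed_sub (regular_module R) X A" "set xs \<subseteq> carrier M" "x \<in> set xs" "a \<in> A"
  shows "a \<odot>\<^bsub>M\<^esub> x \<in> lin_span A xs"
  using assms(3,4)
proof (induction xs)
  case (Cons y ys)
  then have 1: "closed_sub M X ((\<lambda>a. a \<odot>\<^bsub>M\<^esub> y) ` A)" "closed_sub M X (lin_span A ys)"
    using closed_sub_smult_image[OF assms(1,2)] closed_sub_lin_span[OF assms(1,2)] by auto
  have 2: "a \<odot>\<^bsub>M\<^esub> x \<in> (\<lambda>a. a \<odot>\<^bsub>M\<^esub> y) ` A \<or> a \<odot>\<^bsub>M\<^esub> x \<in> lin_span A ys"
    using Cons assms(5) by auto
  then show ?case using sum_sub_upper1[OF 1] sum_sub_upper2[OF 1] by auto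
qed simp

lemma lin_span_least:
  assumes "closed_sub M X D" "\<And>a x. a \<in> A \<Longrightarrow> x \<in> set xs \<Longrightarrow> a \<odot>\<^bsub>M\<^esub> x \<in> D"
  shows "lin_span A xs \<subseteq> D"
  using assms(2)
proof (induction xs)
  case Nil then show ?case using closed_subD(2)[OF assms(1)] by simp
next
  case (Cons x xs)
  then show ?case by (simp del: sum_sub_def) (intro sum_sub_least[OF assms(1)]; auto)
qed

text \<open>Each entry \<open>x\<close> adds a cyclic step that is an image of
  \<open>A / A0\<close>, because \<open>A0 x\<close> already lies in \<open>D\<close>.
  \<open>A0\<close> will be zero, an annihilator, or a set of multiples of the denominator
  \<open>w\<close>.\<close>

theorem len_lin_span_le:
  assumes X: "X \<subseteq> carrier R"
    and A: "closed_sub (regular_module R) X A0" "closed_sub (regular_module R) X A" "A0 \<subseteq> A"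
    and xs: "set xs \<subseteq> carrier M"
    and D: "closed_sub M X D" and sub: "\<And>a x. a \<in> A0 \<Longrightarrow> x \<in> set xs \<Longrightarrow> a \<odot>\<^bsub>M\<^esub> x \<in> D"
  shows "len (closed_sub M X) D (sum_sub M D (lin_span A xs))
    \<le> of_nat (length xs) * len (closed_sub (regular_module R) X) A0 A"
  using xs D sub
proof (induction xs arbitrary: D)
  case Nil
  then show ?case by (simp add: sum_sub_zero closed_subD(1))
next
  case (Cons x xs)
  let ?Q = "closed_sub M X" and ?Ax = "(\<lambda>a. a \<odot>\<^bsub>M\<^esub> x) ` A"
  have Ax: "?Q ?Ax" using closed_sub_smult_image[OF X A(2)] Cons.prems(1) by simp
  have L: "?Q (lin_span A xs)" using closed_sub_lin_span[OF X A(2)] Cons.prems(1) by simp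
  define D' where "D' = sum_sub M D ?Ax"
  have D': "?Q D'" unfolding D'_def using closed_sub_sum_sub[OF X Cons.prems(2) Ax] .
  have DD': "D \<subseteq> D'" unfolding D'_def by (rule sum_sub_upper1[OF Cons.prems(2) Ax])
  have eq: "sum_sub M D (lin_span A (x # xs)) = sum_sub M D' (lin_span A xs)"
    unfolding D'_def using Cons.prems(2) Ax L by (simp add: sum_sub_assoc closed_subD(1))
  have E: "?Q (sum_sub M D' (lin_span A xs))" by (rule closed_sub_sum_sub[OF X D' L])
  have "len ?Q D D' \<le> len (closed_sub (regular_module R) X) A0 A"
    unfolding D'_def
    by (rule len_image_le[OF module_regular_module module_axioms lin_map_smult_right])
      (use Cons.prems X A in auto)
  moreover have "len ?Q D' (sum_sub M D' (lin_span A xs))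
      \<le> of_nat (length xs) * len (closed_sub (regular_module R) X) A0 A"
    by (rule Cons.IH) (use Cons.prems D' DD' in auto)
  ultimately have "len ?Q D (sum_sub M D' (lin_span A xs))
    \<le> len (closed_sub (regular_module R) X) A0 A + of_nat (length xs) * len (closed_sub (regular_module R) X) A0 A"
    unfolding len_add[OF X Cons.prems(2) D' E DD' sum_sub_upper1[OF D' L]] by (rule add_mono)
  then show ?case unfolding eq by (simp add: algebra_simps)
qed

text \<open>By independence, the map taking \<open>a\<close> to \<open>a x\<close> is injective
  modulo the span of the later entries, so every entry contributes the full length of
  \<open>A\<close>.\<close>

theorem len_lin_span_ge:
  assumes X: "X \<subseteq> carrier R" and A: "closed_sub (regular_module R) X A"
    and xs: "set xs \<subseteq> carrier M" "independent xs"
  shows "of_nat (length xs) * len (closed_sub (regular_module R) X) {\<zero>} A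
    \<le> len (closed_sub M X) {\<zero>\<^bsub>M\<^esub>} (lin_span A xs)"
  using xs
proof (induction xs)
  case (Cons x xs)
  let ?Q = "closed_sub M X" and ?Ax = "(\<lambda>a. a \<odot>\<^bsub>M\<^esub> x) ` A"
  interpret r: module R "regular_module R" by (rule module_regular_module)
  have z: "closed_sub (regular_module R) X {\<zero>}" using r.closed_sub_zero[OF X] by simp
  have Ac: "A \<subseteq> carrier R" using closed_subD(1)[OF A] by simp
  have Ax: "?Q ?Ax" using closed_sub_smult_image[OF X A] Cons.prems(1) by simp
  have L: "?Q (lin_span A xs)" using closed_sub_lin_span[OF X A] Cons.prems(1) by simp
  have eq: "lin_span A (x # xs) = sum_sub M (lin_span A xs) ?Ax"
    using Ax L by (simp add: sum_sub_commute closed_subD(1))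
  have "len (closed_sub (regular_module R) X) {\<zero>} A \<le> len ?Q (lin_span A xs) (lin_span A (x # xs))"
    unfolding eq
  proof (rule len_image_ge[OF module_regular_module module_axioms lin_map_smult_right _ z A L])
    fix a assume "a \<in> A" "a \<odot>\<^bsub>M\<^esub> x \<in> lin_span A xs"
    then show "a \<in> {\<zero>}" using Cons.prems(2) Ac lin_span_mono[OF Ac, of xs] by auto
  qed (use X Cons.prems in auto)
  moreover have "of_nat (length xs) * len (closed_sub (regular_module R) X) {\<zero>} A
      \<le> len ?Q {\<zero>\<^bsub>M\<^esub>} (lin_span A xs)"
    using Cons by simp
  ultimately have "len (closed_sub (regular_module R) X) {\<zero>} A + of_nat (length xs) * len (closed_sub (regular_module R) X) {\<zero>} A
    \<le> len ?Q {\<zero>\<^bsub>M\<^esub>} (lin_span A xs) + len ?Q (lin_span A xs) (lin_span A (x # xs))"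
    by (subst add.commute) (rule add_mono)
  also have "\<dots> = len ?Q {\<zero>\<^bsub>M\<^esub>} (lin_span A (x # xs))"
    unfolding eq using closed_sub_zero[OF X] L Ax closed_subD(2)[OF L]
    by (intro len_add[OF X, symmetric] sum_sub_upper1[OF L Ax] closed_sub_sum_sub[OF X]) auto
  finally show ?case by (simp add: algebra_simps)
qed simp

lemma submodule_iff_closed_sub:
  assumes "carrier R0 \<subseteq> carrier R" "closed_sub M Y N"
  shows "submodule H R0 (M\<lparr>carrier := N\<rparr>) \<longleftrightarrow> closed_sub M (carrier R0) H \<and> H \<subseteq> N"
proof -
  have N: "subgroup N (add_monoid M)"
    using assms(2) unfolding closed_sub_def subgroup_def by (simp add: a_inv_def)
  have eq: "add_monoid (M\<lparr>carrier := N\<rparr>) = (add_monoid M)\<lparr>carrier := N\<rparr>" by simp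
  have g: "subgroup H (add_monoid (M\<lparr>carrier := N\<rparr>)) \<longleftrightarrow> subgroup H (add_monoid M) \<and> H \<subseteq> N"
    unfolding eq using add.incl_subgroup[OF N, of H] add.subgroup_incl[OF _ N, of H]
      subgroup.subset[of H "(add_monoid M)\<lparr>carrier := N\<rparr>"] by auto
  show ?thesis unfolding submodule_def g submodule_axioms_def closed_sub_def
    by (auto simp: subgroup_def a_inv_def)
qed

text \<open>The submodules of \<open>N\<close> over \<open>R0\<close> are the closed sets between
  zero and \<open>N\<close>, so both notions of length count the same chains.\<close>

lemma module_length_eq_len:
  assumes "carrier R0 \<subseteq> carrier R" "closed_sub M (carrier R0) N"
  shows "module_length R0 (M\<lparr>carrier := N\<rparr>) = len (closed_sub M (carrier R0)) {\<zero>\<^bsub>M\<^esub>} N"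
proof -
  have "(\<exists>S. (\<forall>i\<le>l. submodule (S i) R0 (M\<lparr>carrier := N\<rparr>)) \<and> (\<forall>i<l. S i \<subset> S (Suc i)))
      \<longleftrightarrow> sub_chain (closed_sub M (carrier R0)) {\<zero>\<^bsub>M\<^esub>} N l" for l
  proof -
    have "closed_sub M (carrier R0) H \<and> H \<subseteq> N \<longleftrightarrow>
        closed_sub M (carrier R0) H \<and> {\<zero>\<^bsub>M\<^esub>} \<subseteq> H \<and> H \<subseteq> N" for H
      using closed_subD(2)[of M "carrier R0" H] by auto
    then show ?thesis unfolding submodule_iff_closed_sub[OF assms]
      using sub_chain_iff_sequence[of "closed_sub M (carrier R0)" "{\<zero>\<^bsub>M\<^esub>}" N l,
          OF closed_sub_zero[OF assms(1)] assms(2)] closed_subD(2)[OF assms(2)] by simp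
  qed
  then show ?thesis unfolding module_length_def len_def by simp
qed

end


section \<open>Chain conditions\<close>

definition acc_sub :: "('a, 'b, 'd) module_scheme \<Rightarrow> 'a set \<Rightarrow> 'b set \<Rightarrow> bool" where
  "acc_sub M X V \<longleftrightarrow> (\<forall>I :: nat \<Rightarrow> 'b set.
     (\<forall>k. closed_sub M X (I k) \<and> I k \<subseteq> V) \<and> (\<forall>k. I k \<subseteq> I (Suc k)) \<longrightarrow> (\<exists>K. \<forall>k\<ge>K. I k = I K))"

lemma acc_subD:
  assumes "acc_sub M X V" "\<And>k. closed_sub M X (I k)" "\<And>k. I k \<subseteq> V" "\<And>k. I k \<subseteq> I (Suc k)"
  obtains K where "\<And>k. K \<le> k \<Longrightarrow> I k = I K"
  using assms unfolding acc_sub_def by meson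

lemma acc_sub_antimono: "acc_sub M X V \<Longrightarrow> X \<subseteq> Y \<Longrightarrow> acc_sub M Y V"
  unfolding acc_sub_def using closed_sub_antimono by (meson order_trans)

lemma acc_sub_maximal:
  assumes "acc_sub M X V" "P N0" and P: "\<And>N. P N \<Longrightarrow> closed_sub M X N \<and> N \<subseteq> V"
  shows "\<exists>N. P N \<and> (\<forall>N'. P N' \<longrightarrow> N \<subseteq> N' \<longrightarrow> N' = N)"
proof (rule ccontr)
  assume "\<nexists>N. P N \<and> (\<forall>N'. P N' \<longrightarrow> N \<subseteq> N' \<longrightarrow> N' = N)"
  then have ex: "\<exists>N'. P N' \<and> N \<subset> N'" if "P N" for N using that by blast
  have "\<exists>I. \<forall>k. P (I k) \<and> I k \<subset> I (Suc k)"
    by (rule dependent_nat_choice) (use assms(2) ex in auto)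
  then obtain I where I: "\<And>k. P (I k)" "\<And>k. I k \<subset> I (Suc k)" by blast
  obtain K where "\<And>k. K \<le> k \<Longrightarrow> I k = I K"
    by (rule acc_subD[OF assms(1), of I]) (use I P in auto)
  from this[of "Suc K"] I(2)[of K] show False by simp
qed

text \<open>An ascending sequence that never stabilises contains strict chains of every
  length.\<close>

lemma finite_len_imp_acc_sub:
  fixes M :: "('a, 'b, 'd) module_scheme"
  assumes "len (closed_sub M X) A V \<noteq> \<infinity>" "closed_sub M X A" "closed_sub M X V"
    and "\<And>N. closed_sub M X N \<Longrightarrow> A \<subseteq> N"
  shows "acc_sub M X V"
  unfolding acc_sub_def
proof (intro allI impI, elim conjE, rule ccontr)
  fix I :: "nat \<Rightarrow> 'b set"
  assume I: "\<forall>k. closed_sub M X (I k) \<and> I k \<subseteq> V" "\<forall>k. I k \<subseteq> I (Suc k)"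
    and n: "\<nexists>K. \<forall>k\<ge>K. I k = I K"
  have mono: "I k \<subseteq> I k'" if "k \<le> k'" for k k' using I(2) that lift_Suc_mono_le by metis
  have "\<exists>k. sub_chain (closed_sub M X) A (I k) m" for m
  proof (induction m)
    case 0
    then show ?case using I assms(2,4) by (intro exI[of _ 0] sub_chain.base) auto
  next
    case (Suc m)
    then obtain k where k: "sub_chain (closed_sub M X) A (I k) m" by blast
    obtain k' where "k \<le> k'" "I k' \<noteq> I k" using n by blast
    then have "I k \<subset> I k'" using mono by blast
    then show ?case using sub_chain.step[OF k] I(1) by blast
  qed
  then have "sub_chain (closed_sub M X) A V m" for m
    using sub_chain_extend I(1) assms(3) by metis
  then have "enat m \<le> len (closed_sub M X) A V" for m by (rule sub_chain_le_len)
  then have "len (closed_sub M X) A V \<noteq> enat m" for m using Suc_n_not_le_n enat_ord_simps(1) by metis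
  with assms(1) show False by (cases "len (closed_sub M X) A V") auto
qed

subsection \<open>Artinian rings have finite length\<close>

lemma (in module) closed_sub_UN_chain:
  assumes "\<And>n::nat. closed_sub M X (W n)" "\<And>n. W n \<subseteq> W (Suc n)"
  shows "closed_sub M X (\<Union>n. W n)"
proof (rule closed_subI)
  have mono: "W n \<subseteq> W m" if "n \<le> m" for n m using assms(2) that lift_Suc_mono_le by metis
  show "x \<oplus>\<^bsub>M\<^esub> y \<in> (\<Union>n. W n)" if "x \<in> (\<Union>n. W n)" "y \<in> (\<Union>n. W n)" for x y
  proof -
    from that obtain n m where "x \<in> W n" "y \<in> W m" by blast
    then have "x \<in> W (max n m)" "y \<in> W (max n m)" using mono[of n "max n m"] mono[of m "max n m"] by auto
    then show ?thesis using closed_subD(4)[OF assms(1)] by blast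
  qed
  show "\<ominus>\<^bsub>M\<^esub> x \<in> (\<Union>n. W n)" if "x \<in> (\<Union>n. W n)" for x
  proof -
    from that obtain n where "x \<in> W n" by blast
    then show ?thesis using closed_subD(5)[OF assms(1)] by blast
  qed
  show "a \<odot>\<^bsub>M\<^esub> x \<in> (\<Union>n. W n)" if "a \<in> X" "x \<in> (\<Union>n. W n)" for a x
  proof -
    from that obtain n where "x \<in> W n" by blast
    then show ?thesis using closed_subD(6)[OF assms(1) that(1)] by blast
  qed
qed (use closed_subD(2,3)[OF assms(1)] in auto)

lemma (in module) lin_span_set_mono:
  assumes "X \<subseteq> carrier R" "closed_sub (regular_module R) X A" "set ys \<subseteq> carrier M" "set xs \<subseteq> set ys"
  shows "lin_span A xs \<subseteq> lin_span A ys"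
  by (rule lin_span_least[OF closed_sub_lin_span[OF assms(1-3)]])
    (use smult_mem_lin_span[OF assms(1-3)] assms(4) in blast)

lemma (in cring) ideal_iff_closed_sub:
  "ideal I R \<longleftrightarrow> closed_sub (regular_module R) (carrier R) I"
proof
  assume "ideal I R"
  then interpret ideal I R .
  show "closed_sub (regular_module R) (carrier R) I"
    by (rule closed_subI) (auto simp: I_l_closed)
next
  assume I: "closed_sub (regular_module R) (carrier R) I"
  show "ideal I R"
  proof (rule idealI[OF ring_axioms])
    show "subgroup I (add_monoid R)"
      using I unfolding closed_sub_def subgroup_def by (simp flip: a_inv_def)
    show "x \<otimes> a \<in> I" if "a \<in> I" "x \<in> carrier R" for a x
      using closed_subD(6)[OF I that(2,1)] by simp
    show "a \<otimes> x \<in> I" if "a \<in> I" "x \<in> carrier R" for a x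
      using closed_subD(6)[OF I that(2,1)] closed_subD(3)[OF I that(1)] that(2) by (simp add: m_comm)
  qed
qed

text \<open>Suppose the length is infinite and let \<open>I\<close> be minimal among the ideals of
  infinite length. Every \<open>a\<close> outside the annihilator of \<open>I\<close> acts
  surjectively on \<open>I\<close> and is then invertible modulo the annihilator. Hence
  \<open>I\<close> is a vector space of infinite dimension over a field, and the spans of the tails
  of an independent sequence in it never stabilise.\<close>

lemma (in cring) artinian_finite_length:
  assumes art: "artinian_ring R"
  shows "len (closed_sub (regular_module R) (carrier R)) {\<zero>} (carrier R) \<noteq> \<infinity>"
proof
  let ?M = "regular_module R"
  let ?Q = "closed_sub ?M (carrier R)"
  interpret r: module R ?M by (rule module_regular_module)
  have X: "carrier R \<subseteq> carrier R" by simp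
  have Q0: "?Q {\<zero>}" using r.closed_sub_zero[OF X] by simp
  have QR: "?Q (carrier R)" using r.closed_sub_carrier[OF X] by simp
  have dcc: "\<exists>N. \<forall>k\<ge>N. I k = I N" if "\<And>k. ?Q (I k)" "\<And>k. I (Suc k) \<subseteq> I k" for I
    using artinian_ring.descending_chain[OF art, of I] that by (simp add: ideal_iff_closed_sub)
  assume inf: "len ?Q {\<zero>} (carrier R) = \<infinity>"
  have "\<exists>I. ?Q I \<and> len ?Q {\<zero>} I = \<infinity> \<and> (\<forall>J. ?Q J \<longrightarrow> J \<subset> I \<longrightarrow> len ?Q {\<zero>} J \<noteq> \<infinity>)"
  proof (rule ccontr)
    assume "\<nexists>I. ?Q I \<and> len ?Q {\<zero>} I = \<infinity> \<and> (\<forall>J. ?Q J \<longrightarrow> J \<subset> I \<longrightarrow> len ?Q {\<zero>} J \<noteq> \<infinity>)"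
    then have ex: "\<exists>J. (?Q J \<and> len ?Q {\<zero>} J = \<infinity>) \<and> J \<subset> I" if "?Q I \<and> len ?Q {\<zero>} I = \<infinity>" for I
      using that by meson
    have "\<exists>I. \<forall>k::nat. (?Q (I k) \<and> len ?Q {\<zero>} (I k) = \<infinity>) \<and> I (Suc k) \<subset> I k"
      by (rule dependent_nat_choice) (use ex QR inf in auto)
    then obtain I where I: "\<And>k. ?Q (I k)" "\<And>k. I (Suc k) \<subset> I k" by blast
    then obtain N where "\<forall>k\<ge>N. I k = I N" using dcc[of I] by blast
    then show False using I(2)[of N] by (metis le_SucI order_refl psubset_eq)
  qed
  then obtain I where QI: "?Q I" and Iinf: "len ?Q {\<zero>} I = \<infinity>"
    and Imin: "\<And>J. ?Q J \<Longrightarrow> J \<subset> I \<Longrightarrow> len ?Q {\<zero>} J \<noteq> \<infinity>" by blast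
  note IR [simp] = closed_subD(3)[OF QI, simplified]
  define Ann where "Ann = {a\<in>carrier R. \<forall>x\<in>I. a \<otimes> x = \<zero>}"
  have QAnn: "?Q Ann" unfolding Ann_def
    by (rule closed_subI) (auto simp: l_distr l_minus m_assoc)
  \<comment> \<open>If \<open>a I\<close> were proper in \<open>I\<close>, both \<open>a I\<close>
    and the kernel \<open>K\<close> would have finite length by minimality, and their lengths add up
    to that of \<open>I\<close>.\<close>
  have aI: "(\<lambda>x. a \<otimes> x) ` I = I" if a: "a \<in> carrier R" "a \<notin> Ann" for a
  proof (rule ccontr)
    assume ne: "(\<lambda>x. a \<otimes> x) ` I \<noteq> I"
    have lin: "lin_map R ?M ?M (\<lambda>x. a \<otimes> x)" using r.lin_map_smult_left[OF a(1)] by simp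
    have QaI: "?Q ((\<lambda>x. a \<otimes> x) ` I)"
      by (rule closed_sub_image[OF r.module_axioms r.module_axioms lin X QI])
    have "(\<lambda>x. a \<otimes> x) ` I \<subseteq> I" using closed_subD(6)[OF QI a(1)] by auto
    then have fin1: "len ?Q {\<zero>} ((\<lambda>x. a \<otimes> x) ` I) \<noteq> \<infinity>" using Imin[OF QaI] ne by blast
    define K where "K = {x\<in>I. a \<otimes> x \<in> {\<zero>}}"
    have QK: "?Q K" unfolding K_def
      by (rule closed_sub_preimage[OF r.module_axioms r.module_axioms lin X QI Q0])
    have "K \<subset> I" using a unfolding K_def Ann_def by auto
    then have fin2: "len ?Q {\<zero>} K \<noteq> \<infinity>" using Imin[OF QK] by blast
    have "len ?Q K I \<le> len ?Q {\<zero>} (sum_sub ?M {\<zero>} ((\<lambda>x. a \<otimes> x) ` I))"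
      by (rule len_image_ge[OF r.module_axioms r.module_axioms lin X QK QI Q0]) (auto simp: K_def)
    also have "sum_sub ?M {\<zero>} ((\<lambda>x. a \<otimes> x) ` I) = (\<lambda>x. a \<otimes> x) ` I"
      using r.sum_sub_zero(1)[of "(\<lambda>x. a \<otimes> x) ` I"] closed_subD(1)[OF QaI] by simp
    finally have fin3: "len ?Q K I \<noteq> \<infinity>" using fin1 by (metis enat_ord_simps(5))
    have "len ?Q {\<zero>} I = len ?Q {\<zero>} K + len ?Q K I"
      by (rule r.len_add[OF X Q0 QK QI]) (use closed_subD(2)[OF QK] \<open>K \<subset> I\<close> in auto)
    then show False using fin2 fin3 Iinf by auto
  qed
  \<comment> \<open>The powers of \<open>a\<close> generate a descending chain of ideals, so
    \<open>a ^ k = a ^ (k + 1) b\<close> for some \<open>k\<close> and \<open>b\<close>; since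
    \<open>I = a ^ k I\<close>, the element \<open>1 - a b\<close> kills \<open>I\<close>.\<close>
  have unit: "\<exists>b\<in>carrier R. \<one> \<ominus> a \<otimes> b \<in> Ann" if a: "a \<in> carrier R" "a \<notin> Ann" for a
  proof -
    have pI: "\<exists>y\<in>I. x = a [^] k \<otimes> y" if "x \<in> I" for k :: nat and x
      using that
    proof (induction k arbitrary: x)
      case 0
      then show ?case by (intro bexI[of _ x]) simp_all
    next
      case (Suc k)
      then obtain y where y: "y \<in> I" "x = a [^] k \<otimes> y" by blast
      then obtain z where z: "z \<in> I" "y = a \<otimes> z" using aI[OF a] by blast
      then have "x = a [^] Suc k \<otimes> z" using y a(1) IR[OF z(1)] by (simp add: m_assoc)
      then show ?case using z(1) by blast
    qed
    have "?Q ((\<lambda>x. (a [^] k) \<otimes> x) ` carrier R)" for k :: nat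
      using closed_sub_image[OF r.module_axioms r.module_axioms r.lin_map_smult_left[of "a [^] k"] X QR] a(1) by simp
    moreover have "(\<lambda>x. (a [^] Suc k) \<otimes> x) ` carrier R \<subseteq> (\<lambda>x. (a [^] k) \<otimes> x) ` carrier R" for k :: nat
      using a(1) by (auto simp: m_assoc)
    ultimately obtain k :: nat where k: "\<forall>j\<ge>k. (\<lambda>x. (a [^] j) \<otimes> x) ` carrier R = (\<lambda>x. (a [^] k) \<otimes> x) ` carrier R"
      using dcc[of "\<lambda>k. (\<lambda>x. (a [^] k) \<otimes> x) ` carrier R"] by blast
    have "a [^] k \<in> (\<lambda>x. (a [^] k) \<otimes> x) ` carrier R" using a(1) by (intro image_eqI[of _ _ \<one>]) simp_all
    then have "a [^] k \<in> (\<lambda>x. (a [^] Suc k) \<otimes> x) ` carrier R" using k by (metis le_SucI order_refl)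
    then obtain b where b: "b \<in> carrier R" "a [^] k = a [^] k \<otimes> a \<otimes> b" by auto
    have "(\<one> \<ominus> a \<otimes> b) \<otimes> x = \<zero>" if x: "x \<in> I" for x
    proof -
      obtain y where y: "y \<in> I" "x = a [^] k \<otimes> y" using pI[OF x, of k] by blast
      have yR: "y \<in> carrier R" using y(1) by simp
      have "(\<one> \<ominus> a \<otimes> b) \<otimes> x = ((\<one> \<ominus> a \<otimes> b) \<otimes> a [^] k) \<otimes> y"
        using a(1) b(1) yR unfolding y(2) by (simp add: m_assoc)
      also have "(\<one> \<ominus> a \<otimes> b) \<otimes> a [^] k = a [^] k \<ominus> a [^] k \<otimes> a \<otimes> b"
      proof -
        have "(a \<otimes> b) \<otimes> a [^] k = a [^] k \<otimes> a \<otimes> b" using a(1) b(1) by (simp add: m_ac)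
        then show ?thesis using a(1) b(1) by (simp add: a_minus_def l_distr l_minus)
      qed
      also have "a [^] k \<ominus> a [^] k \<otimes> a \<otimes> b = \<zero>"
        using a(1) b(1) unfolding b(2)[symmetric] by (simp add: a_minus_def r_neg)
      also have "\<zero> \<otimes> y = \<zero>" using yR by simp
      finally show ?thesis .
    qed
    then show ?thesis using a(1) b(1) unfolding Ann_def by (intro bexI[of _ b]) auto
  qed
  \<comment> \<open>By invertibility modulo \<open>Ann\<close>, no ideal lies strictly between
    \<open>Ann\<close> and the whole ring.\<close>
  have Ann1: "len ?Q Ann (carrier R) \<le> enat 1"
    unfolding len_le_iff
  proof (intro allI impI)
    fix l assume l: "sub_chain ?Q Ann (carrier R) l"
    have full: "D = carrier R" if D: "?Q D" "Ann \<subset> D" for D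
    proof -
      note that = D
      note [simp] = closed_subD(3)[OF that(1), simplified]
      obtain a where a: "a \<in> D" "a \<notin> Ann" using D(2) by blast
      then obtain b where b: "b \<in> carrier R" "\<one> \<ominus> a \<otimes> b \<in> Ann" using unit[of a] by auto
      have "b \<otimes> a \<in> D" using closed_subD(6)[OF that(1) b(1) a(1)] by simp
      then have "(\<one> \<ominus> a \<otimes> b) \<oplus> b \<otimes> a \<in> D"
        using b(2) that(2) closed_subD(4)[OF that(1)] by auto
      moreover have "(\<one> \<ominus> a \<otimes> b) \<oplus> b \<otimes> a = \<one>"
        using a b(1) by (simp add: a_minus_def a_assoc m_comm[of b a] l_neg)
      ultimately have "x \<in> D" if "x \<in> carrier R" for x
        using closed_subD(6)[OF \<open>?Q D\<close> that, of \<one>] that by simp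
      then show ?thesis by auto
    qed
    show "enat l \<le> enat 1"
    proof (rule ccontr)
      assume "\<not> enat l \<le> enat 1"
      then have "sub_chain ?Q Ann (carrier R) (Suc (Suc 0))" using sub_chain_shorten[OF l] by simp
      then obtain B where B: "sub_chain ?Q Ann B (Suc 0)" "B \<subset> carrier R"
        by (cases rule: sub_chain.cases) auto
      from B(1) obtain A where A: "sub_chain ?Q Ann A 0" "A \<subset> B" by (cases rule: sub_chain.cases) auto
      then show False using B full[of B] sub_chain_bounds[OF B(1)] sub_chain_bounds[OF A(1)] by blast
    qed
  qed
  \<comment> \<open>A finite span in \<open>I\<close> has length at most the number of its
    generators, so it cannot be all of \<open>I\<close>.\<close>
  have spanI: "r.lin_span (carrier R) xs \<subset> I" if xs: "set xs \<subseteq> I" for xs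
  proof -
    have xsR: "set xs \<subseteq> carrier ?M" using xs by auto
    have sub: "r.lin_span (carrier R) xs \<subseteq> I"
      by (rule r.lin_span_least[OF QI]) (use closed_subD(6)[OF QI] xs in auto)
    have "len ?Q {\<zero>} (sum_sub ?M {\<zero>} (r.lin_span (carrier R) xs)) \<le> of_nat (length xs) * len ?Q Ann (carrier R)"
      by (rule r.len_lin_span_le[OF X QAnn QR _ xsR Q0]) (use xs in \<open>auto simp: Ann_def\<close>)
    also have "\<dots> \<le> of_nat (length xs) * enat 1" by (intro mult_left_mono Ann1) simp
    finally have "len ?Q {\<zero>} (sum_sub ?M {\<zero>} (r.lin_span (carrier R) xs)) \<noteq> \<infinity>"
      unfolding of_nat_eq_enat times_enat_simps by (metis enat_ord_simps(5) enat.distinct(1))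
    moreover have "sum_sub ?M {\<zero>} (r.lin_span (carrier R) xs) = r.lin_span (carrier R) xs"
      using r.sum_sub_zero(1)[of "r.lin_span (carrier R) xs"] sub IR by (simp add: subset_iff)
    ultimately show ?thesis using Iinf sub by auto
  qed
  \<comment> \<open>A sequence in \<open>I\<close> is chosen, each term outside the span of the
    earlier ones; \<open>L n\<close> lists the first \<open>n\<close> terms, the latest in
    front.\<close>
  define pick where "pick xs = (SOME x. x \<in> I \<and> x \<notin> r.lin_span (carrier R) xs)" for xs
  have pick: "pick xs \<in> I \<and> pick xs \<notin> r.lin_span (carrier R) xs" if "set xs \<subseteq> I" for xs
    unfolding pick_def by (rule someI_ex) (use spanI[OF that] in blast)
  define L where "L = rec_nat [] (\<lambda>_ xs. pick xs # xs)"
  have L: "L 0 = []" "L (Suc n) = pick (L n) # L n" for n by (simp_all add: L_def)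
  define x where "x n = pick (L n)" for n
  have LI: "set (L n) \<subseteq> I" for n by (induction n) (auto simp: L pick)
  have setL: "set (L n) = x ` {..<n}" for n by (induction n) (auto simp: L x_def lessThan_Suc)
  have xI: "x n \<in> I" and xn: "x n \<notin> r.lin_span (carrier R) (L n)" for n using pick[OF LI] by (simp_all add: x_def)
  \<comment> \<open>\<open>W k n\<close> is spanned by \<open>x k, ..., x (n - 1)\<close>, and its
    union \<open>T k\<close> over all \<open>n\<close> by the whole tail from index \<open>k\<close>
    on.\<close>
  define W where "W k n = r.lin_span (carrier R) (map x (rev [k..<n]))" for k n
  have c: "set (map x (rev [k..<n])) \<subseteq> carrier ?M" for k n using xI by auto
  have QW: "?Q (W k n)" for k n unfolding W_def by (rule r.closed_sub_lin_span[OF X QR c])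
  have Wmono: "W k n \<subseteq> W k' n'" if "k' \<le> k" "n \<le> n'" for k k' n n'
    unfolding W_def by (rule r.lin_span_set_mono[OF X QR c]) (use that in auto)
  define T where "T k = (\<Union>n. W k n)" for k
  have QT: "?Q (T k)" for k unfolding T_def by (rule r.closed_sub_UN_chain) (use QW Wmono in auto)
  have "T (Suc k) \<subseteq> T k" for k
    unfolding T_def by (rule UN_mono[OF subset_refl]) (rule Wmono, simp_all)
  from dcc[of T, OF QT this] obtain N where hN: "\<forall>k\<ge>N. T k = T N" by (elim exE)
  have N: "T (Suc N) = T N" by (rule hN[rule_format]) simp
  have "x N \<in> W N (Suc N)"
    using r.smult_mem_lin_span[OF X QR c, of "x N" N "Suc N" \<one>] xI unfolding W_def by simp
  then have "x N \<in> T N" unfolding T_def by (rule UN_I[OF UNIV_I])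
  then have "x N \<in> T (Suc N)" by (simp only: N)
  then obtain n0 where n0: "x N \<in> W (Suc N) n0" unfolding T_def by (elim UN_E)
  \<comment> \<open>By minimality of \<open>n\<close>, the coefficient of the last vector
    \<open>x m\<close> in the expression for \<open>x N\<close> is outside \<open>Ann\<close>, hence
    invertible modulo \<open>Ann\<close>; solving for \<open>x m\<close> puts it into the span of
    its predecessors.\<close>
  define n where "n = (LEAST n. x N \<in> W (Suc N) n)"
  have n: "x N \<in> W (Suc N) n" "\<And>m. m < n \<Longrightarrow> x N \<notin> W (Suc N) m"
    unfolding n_def by (rule LeastI[of "\<lambda>n. x N \<in> W (Suc N) n", OF n0])
      (rule not_less_Least[of _ "\<lambda>n. x N \<in> W (Suc N) n"])
  have LR: "set (L m) \<subseteq> carrier R" for m using LI IR by blast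
  have VQ: "?Q (r.lin_span (carrier R) (L m))" for m
    by (rule r.closed_sub_lin_span[OF X QR]) (use LR in simp)
  have Vx: "x j \<in> r.lin_span (carrier R) (L m)" if "j < m" for j m
    using r.smult_mem_lin_span[OF X QR, of "L m" "x j" \<one>] LR[of m] xI[of j] that by (simp add: setL)
  show False
  proof (cases "n \<le> Suc N")
    case True
    then have "x N = \<zero>" using n(1) by (simp add: W_def)
    then show False using xn[of N] closed_subD(2)[OF VQ] by simp
  next
    case False
    then obtain m where m: "n = Suc m" "N < m" by (cases n) auto
    then have "W (Suc N) n = sum_sub ?M ((\<lambda>a. a \<otimes> x m) ` carrier R) (W (Suc N) m)"
      by (simp add: W_def)
    then obtain a w where aw: "a \<in> carrier R" "w \<in> W (Suc N) m" "x N = a \<otimes> x m \<oplus> w"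
      using n(1) by (auto elim!: sum_subE)
    have wR: "w \<in> carrier R" using closed_subD(3)[OF QW aw(2)] by simp
    show False
    proof (cases "a \<in> Ann")
      case True
      then have "x N = w" using aw wR xI[of m] by (simp add: Ann_def)
      then show False using n(2)[of m] m aw(2) by simp
    next
      case False
      then obtain b where b: "b \<in> carrier R" "\<one> \<ominus> a \<otimes> b \<in> Ann" using unit aw(1) by blast
      have xm: "x m \<in> carrier R" using xI by simp
      have "W (Suc N) m \<subseteq> r.lin_span (carrier R) (L m)"
        unfolding W_def by (rule r.lin_span_set_mono[OF X QR]) (use LI[of m] in \<open>auto simp: setL\<close>)
      then have "x N \<ominus> w \<in> r.lin_span (carrier R) (L m)"
        using r.closed_sub_diff[OF VQ Vx[OF m(2)]] aw(2) by (auto simp: a_minus_def)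
      then have "b \<otimes> (x N \<ominus> w) \<in> r.lin_span (carrier R) (L m)"
        using closed_subD(6)[OF VQ b(1)] by simp
      moreover have "x N \<ominus> w = a \<otimes> x m"
        using aw wR xm by (simp add: a_minus_def a_assoc r_neg)
      moreover have "b \<otimes> (a \<otimes> x m) = x m"
      proof -
        have "(\<one> \<ominus> a \<otimes> b) \<otimes> x m = \<zero>" using b(2) xI unfolding Ann_def by blast
        have "x m \<ominus> b \<otimes> (a \<otimes> x m) = \<zero>"
        proof -
          have e: "(a \<otimes> b) \<otimes> x m = b \<otimes> (a \<otimes> x m)" using b(1) aw(1) xm by (simp add: m_ac)
          show ?thesis using \<open>(\<one> \<ominus> a \<otimes> b) \<otimes> x m = \<zero>\<close> b(1) aw(1) xm
            by (simp add: a_minus_def l_distr l_minus e)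
        qed
        then show ?thesis using b(1) aw(1) xm by (metis m_closed r_right_minus_eq)
      qed
      ultimately show False using xn[of m] by simp
    qed
  qed
qed

subsection \<open>Hilbert's basis theorem for modules\<close>

context module
begin

text \<open>The sums \<open>v_0 + x v_1 + ... + x^(d-1) v_(d-1)\<close> with all \<open>v_i\<close>
  in \<open>V\<close>: polynomials in \<open>x\<close> of degree less than \<open>d\<close>, where
  \<open>x\<close> is a ring element rather than an indeterminate.\<close>

primrec pow_span :: "'a \<Rightarrow> 'c set \<Rightarrow> nat \<Rightarrow> 'c set" where
  "pow_span x V 0 = {\<zero>\<^bsub>M\<^esub>}"
| "pow_span x V (Suc d) = sum_sub M (pow_span x V d) ((\<lambda>v. (x [^] d) \<odot>\<^bsub>M\<^esub> v) ` V)"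

text \<open>The possible leading coefficients at degree \<open>d\<close> of elements of
  \<open>I\<close>. An element may have several expressions in powers of \<open>x\<close>; only the
  existence of one is asked for.\<close>

definition lead_sub :: "'a \<Rightarrow> 'c set \<Rightarrow> nat \<Rightarrow> 'c set \<Rightarrow> 'c set" where
  "lead_sub x V d I = {v\<in>V. \<exists>w\<in>pow_span x V d. w \<oplus>\<^bsub>M\<^esub> (x [^] d) \<odot>\<^bsub>M\<^esub> v \<in> I}"

context
  fixes X x V
  assumes X: "X \<subseteq> carrier R" and x: "x \<in> carrier R" and V: "closed_sub M X V"
begin

lemma closed_sub_pow_image: "closed_sub M X ((\<lambda>v. (x [^] (d::nat)) \<odot>\<^bsub>M\<^esub> v) ` V)"
  by (rule closed_sub_image[OF module_axioms module_axioms lin_map_smult_left X V]) (use x in simp)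

lemma closed_sub_pow_span: "closed_sub M X (pow_span x V d)"
  by (induction d) (auto intro!: closed_sub_zero closed_sub_sum_sub X closed_sub_pow_image)

lemma pow_span_Suc: "pow_span x V d \<subseteq> pow_span x V (Suc d)"
  using sum_sub_upper1[OF closed_sub_pow_span closed_sub_pow_image] by simp

lemma smult_pow_span: "w \<in> pow_span x V d \<Longrightarrow> x \<odot>\<^bsub>M\<^esub> w \<in> pow_span x V (Suc d)"
proof (induction d arbitrary: w)
  case 0
  then show ?case using closed_subD(2)[OF closed_sub_pow_span[of "Suc 0"]] x by (simp del: pow_span.simps(2))
next
  case (Suc d)
  then obtain w' v where w: "w' \<in> pow_span x V d" "v \<in> V" "w = w' \<oplus>\<^bsub>M\<^esub> (x [^] d) \<odot>\<^bsub>M\<^esub> v"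
    by (auto elim!: sum_subE)
  have c: "w' \<in> carrier M" "v \<in> carrier M"
    using closed_subD(3)[OF closed_sub_pow_span w(1)] closed_subD(3)[OF V w(2)] .
  have "x \<odot>\<^bsub>M\<^esub> w = x \<odot>\<^bsub>M\<^esub> w' \<oplus>\<^bsub>M\<^esub> (x [^] Suc d) \<odot>\<^bsub>M\<^esub> v"
  proof -
    have "x \<odot>\<^bsub>M\<^esub> ((x [^] d) \<odot>\<^bsub>M\<^esub> v) = (x [^] Suc d) \<odot>\<^bsub>M\<^esub> v"
      using x c by (simp add: smult_assoc1[symmetric] m_comm)
    then show ?thesis using x c w(3) by (simp add: smult_r_distr)
  qed
  then show ?case using sum_subI[OF Suc.IH[OF w(1)] imageI[OF w(2)], of M "\<lambda>v. (x [^] Suc d) \<odot>\<^bsub>M\<^esub> v"]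
    by simp
qed

lemma closed_sub_UN_pow_span: "closed_sub M (insert x X) (\<Union>d. pow_span x V d)"
proof -
  have c: "closed_sub M X (\<Union>d. pow_span x V d)"
    by (rule closed_sub_UN_chain[where W = "pow_span x V"]) (rule closed_sub_pow_span pow_span_Suc)+
  show ?thesis
  proof (rule closed_subI)
    fix a v assume av: "a \<in> insert x X" "v \<in> (\<Union>d. pow_span x V d)"
    then obtain d where d: "v \<in> pow_span x V d" by blast
    show "a \<odot>\<^bsub>M\<^esub> v \<in> (\<Union>d. pow_span x V d)"
    proof (cases "a = x")
      case True
      then show ?thesis using smult_pow_span[OF d] by blast
    next
      case False
      then show ?thesis using av(1) closed_subD(6)[OF c _ av(2), of a] by simp
    qed
  qed (use closed_subD(2-5)[OF c] in simp_all)
qed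

lemma closed_sub_lead_sub: 
  assumes I: "closed_sub M X I" shows "closed_sub M X (lead_sub x V d I)"
proof (rule closed_subI)
  note [simp] = closed_subD(3)[OF V] closed_subD(3)[OF closed_sub_pow_span] closed_subD(3)[OF I]
  let ?W = "pow_span x V d"
  have xd: "x [^] d \<in> carrier R" using x by simp
  show "v \<in> carrier M" if "v \<in> lead_sub x V d I" for v using that by (simp add: lead_sub_def)
  show "\<zero>\<^bsub>M\<^esub> \<in> lead_sub x V d I"
    using closed_subD(2)[OF V] closed_subD(2)[OF closed_sub_pow_span[of d]] closed_subD(2)[OF I] xd
    unfolding lead_sub_def by (auto intro!: bexI[of _ "\<zero>\<^bsub>M\<^esub>"])
  show "v \<oplus>\<^bsub>M\<^esub> v' \<in> lead_sub x V d I" if vv: "v \<in> lead_sub x V d I" "v' \<in> lead_sub x V d I" for v v'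
  proof -
    obtain w w' where w: "w \<in> ?W" "w \<oplus>\<^bsub>M\<^esub> (x [^] d) \<odot>\<^bsub>M\<^esub> v \<in> I"
      "w' \<in> ?W" "w' \<oplus>\<^bsub>M\<^esub> (x [^] d) \<odot>\<^bsub>M\<^esub> v' \<in> I" using vv unfolding lead_sub_def by blast
    have v: "v \<in> V" "v' \<in> V" using vv unfolding lead_sub_def by auto
    have "(w \<oplus>\<^bsub>M\<^esub> w') \<oplus>\<^bsub>M\<^esub> (x [^] d) \<odot>\<^bsub>M\<^esub> (v \<oplus>\<^bsub>M\<^esub> v')
        = (w \<oplus>\<^bsub>M\<^esub> (x [^] d) \<odot>\<^bsub>M\<^esub> v) \<oplus>\<^bsub>M\<^esub> (w' \<oplus>\<^bsub>M\<^esub> (x [^] d) \<odot>\<^bsub>M\<^esub> v')"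
      using xd v w(1,3) by (simp add: smult_r_distr M.a_ac)
    then show ?thesis using closed_subD(4)[OF I w(2,4)] closed_subD(4)[OF closed_sub_pow_span w(1,3)]
        closed_subD(4)[OF V v] unfolding lead_sub_def by (auto intro!: bexI[of _ "w \<oplus>\<^bsub>M\<^esub> w'"])
  qed
  show "\<ominus>\<^bsub>M\<^esub> v \<in> lead_sub x V d I" if vv: "v \<in> lead_sub x V d I" for v
  proof -
    obtain w where w: "w \<in> ?W" "w \<oplus>\<^bsub>M\<^esub> (x [^] d) \<odot>\<^bsub>M\<^esub> v \<in> I" using vv unfolding lead_sub_def by blast
    have v: "v \<in> V" using vv unfolding lead_sub_def by auto
    have "\<ominus>\<^bsub>M\<^esub> w \<oplus>\<^bsub>M\<^esub> (x [^] d) \<odot>\<^bsub>M\<^esub> (\<ominus>\<^bsub>M\<^esub> v) = \<ominus>\<^bsub>M\<^esub> (w \<oplus>\<^bsub>M\<^esub> (x [^] d) \<odot>\<^bsub>M\<^esub> v)"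
      using xd v w(1) by (simp add: smult_r_minus M.minus_add)
    then show ?thesis using closed_subD(5)[OF I w(2)] closed_subD(5)[OF closed_sub_pow_span w(1)]
        closed_subD(5)[OF V v] unfolding lead_sub_def by (auto intro!: bexI[of _ "\<ominus>\<^bsub>M\<^esub> w"])
  qed
  show "a \<odot>\<^bsub>M\<^esub> v \<in> lead_sub x V d I" if a: "a \<in> X" and vv: "v \<in> lead_sub x V d I" for a v
  proof -
    obtain w where w: "w \<in> ?W" "w \<oplus>\<^bsub>M\<^esub> (x [^] d) \<odot>\<^bsub>M\<^esub> v \<in> I" using vv unfolding lead_sub_def by blast
    have v: "v \<in> V" using vv unfolding lead_sub_def by auto
    have aR: "a \<in> carrier R" using a X by blast
    have "a \<odot>\<^bsub>M\<^esub> w \<oplus>\<^bsub>M\<^esub> (x [^] d) \<odot>\<^bsub>M\<^esub> (a \<odot>\<^bsub>M\<^esub> v) = a \<odot>\<^bsub>M\<^esub> (w \<oplus>\<^bsub>M\<^esub> (x [^] d) \<odot>\<^bsub>M\<^esub> v)"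
      using xd v w(1) aR lin_mapD(3)[OF lin_map_smult_left[OF xd] aR, of v] by (simp add: smult_r_distr)
    then show ?thesis using closed_subD(6)[OF I a w(2)] closed_subD(6)[OF closed_sub_pow_span a w(1)]
        closed_subD(6)[OF V a v] unfolding lead_sub_def by (auto intro!: bexI[of _ "a \<odot>\<^bsub>M\<^esub> w"])
  qed
qed

lemma lead_sub_mono: "I \<subseteq> J \<Longrightarrow> lead_sub x V d I \<subseteq> lead_sub x V d J"
  unfolding lead_sub_def by blast

lemma lead_sub_Suc:
  assumes I: "closed_sub M (insert x X) I" shows "lead_sub x V d I \<subseteq> lead_sub x V (Suc d) I"
proof
  fix v assume "v \<in> lead_sub x V d I"
  then obtain w where v: "v \<in> V" and w: "w \<in> pow_span x V d" "w \<oplus>\<^bsub>M\<^esub> (x [^] d) \<odot>\<^bsub>M\<^esub> v \<in> I"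
    unfolding lead_sub_def by blast
  have c: "v \<in> carrier M" "w \<in> carrier M" "x [^] d \<in> carrier R"
    using closed_subD(3)[OF V v] closed_subD(3)[OF closed_sub_pow_span w(1)] x by auto
  have "x \<odot>\<^bsub>M\<^esub> (w \<oplus>\<^bsub>M\<^esub> (x [^] d) \<odot>\<^bsub>M\<^esub> v) = x \<odot>\<^bsub>M\<^esub> w \<oplus>\<^bsub>M\<^esub> (x [^] Suc d) \<odot>\<^bsub>M\<^esub> v"
    using x c by (simp add: smult_r_distr smult_assoc1[symmetric] m_comm)
  moreover have "x \<odot>\<^bsub>M\<^esub> (w \<oplus>\<^bsub>M\<^esub> (x [^] d) \<odot>\<^bsub>M\<^esub> v) \<in> I" using closed_subD(6)[OF I _ w(2), of x] by simp
  ultimately show "v \<in> lead_sub x V (Suc d) I" unfolding lead_sub_def using v smult_pow_span[OF w(1)] by auto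
qed

text \<open>Descent on the degree: an element of \<open>J\<close> is corrected by one of
  \<open>I\<close> with the same leading coefficient, and the difference lies in \<open>J\<close>
  and has smaller degree.\<close>

lemma lead_sub_eq_imp:
  assumes I: "closed_sub M X I" and J: "closed_sub M X J" and "I \<subseteq> J"
    and eq: "\<And>d. lead_sub x V d J \<subseteq> lead_sub x V d I"
  shows "J \<inter> pow_span x V d \<subseteq> I"
proof (induction d)
  case 0
  then show ?case using closed_subD(2)[OF I] by auto
next
  case (Suc d)
  show ?case
  proof
    fix z assume z: "z \<in> J \<inter> pow_span x V (Suc d)"
    then obtain w v where w: "w \<in> pow_span x V d" "v \<in> V" "z = w \<oplus>\<^bsub>M\<^esub> (x [^] d) \<odot>\<^bsub>M\<^esub> v"
      by (auto elim!: sum_subE)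
    then have "v \<in> lead_sub x V d J" using z unfolding lead_sub_def by auto
    then obtain w' where w': "w' \<in> pow_span x V d" "w' \<oplus>\<^bsub>M\<^esub> (x [^] d) \<odot>\<^bsub>M\<^esub> v \<in> I"
      using eq unfolding lead_sub_def by blast
    define z' where "z' = w' \<oplus>\<^bsub>M\<^esub> (x [^] d) \<odot>\<^bsub>M\<^esub> v"
    have c: "w \<in> carrier M" "w' \<in> carrier M" "(x [^] d) \<odot>\<^bsub>M\<^esub> v \<in> carrier M"
      using closed_subD(3)[OF V w(2)] closed_subD(3)[OF closed_sub_pow_span] w(1) w'(1) x by auto
    have zz: "z \<ominus>\<^bsub>M\<^esub> z' = w \<ominus>\<^bsub>M\<^esub> w'"
      using c unfolding w(3) z'_def a_minus_def by (simp add: M.minus_add M.a_ac M.r_neg1 M.r_neg2 M.r_neg)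
    have "z \<ominus>\<^bsub>M\<^esub> z' \<in> J" using closed_sub_diff[OF J] z w'(2) \<open>I \<subseteq> J\<close> unfolding z'_def by blast
    moreover have "z \<ominus>\<^bsub>M\<^esub> z' \<in> pow_span x V d"
      unfolding zz using closed_sub_diff[OF closed_sub_pow_span w(1) w'(1)] .
    ultimately have "z \<ominus>\<^bsub>M\<^esub> z' \<in> I" using Suc.IH by blast
    then have "(z \<ominus>\<^bsub>M\<^esub> z') \<oplus>\<^bsub>M\<^esub> z' \<in> I" using closed_subD(4)[OF I] w'(2) unfolding z'_def by blast
    moreover have "(z \<ominus>\<^bsub>M\<^esub> z') \<oplus>\<^bsub>M\<^esub> z' = z"
      using c unfolding w(3) z'_def a_minus_def by (simp add: M.a_assoc M.l_neg)
    ultimately show "z \<in> I" by simp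
  qed
qed

text \<open>Hilbert's argument: the sets of leading coefficients grow with the degree and with the
  index of the chain. The diagonal stabilises at \<open>K0\<close>, which settles all degrees from
  \<open>K0\<close> on, and the finitely many smaller degrees stabilise separately.\<close>

theorem acc_sub_pow_span:
  assumes acc: "acc_sub M X V"
  shows "acc_sub M (insert x X) (\<Union>d. pow_span x V d)"
  unfolding acc_sub_def
proof (intro allI impI, elim conjE)
  fix I :: "nat \<Rightarrow> 'c set"
  assume I: "\<forall>k. closed_sub M (insert x X) (I k) \<and> I k \<subseteq> (\<Union>d. pow_span x V d)"
    and Imono: "\<forall>k. I k \<subseteq> I (Suc k)"
  let ?L = "lead_sub x V"
  have cI: "closed_sub M (insert x X) (I k)" for k using I by blast
  have cI': "closed_sub M X (I k)" for k using closed_sub_antimono[OF cI] by blast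
  have mono: "I k \<subseteq> I k'" if "k \<le> k'" for k k' using Imono that lift_Suc_mono_le by metis
  have cL: "closed_sub M X (?L d (I k))" for d k by (rule closed_sub_lead_sub[OF cI'])
  have LV: "?L d (I k) \<subseteq> V" for d k unfolding lead_sub_def by blast
  have Lk: "?L d (I k) \<subseteq> ?L d (I k')" if "k \<le> k'" for d k k' by (rule lead_sub_mono[OF mono[OF that]])
  have Ld: "?L d (I k) \<subseteq> ?L d' (I k)" if "d \<le> d'" for d d' k
    using lift_Suc_mono_le[of "\<lambda>d. ?L d (I k)", OF lead_sub_Suc[OF cI] that] .
  obtain K0 where K0: "\<And>k. K0 \<le> k \<Longrightarrow> ?L k (I k) = ?L K0 (I K0)"
  proof (rule acc_subD[OF acc, of "\<lambda>k. ?L k (I k)"])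
    show "?L k (I k) \<subseteq> ?L (Suc k) (I (Suc k))" for k
      using Lk[of k "Suc k" k] Ld[of k "Suc k" "Suc k"] by auto
  qed (use cL LV in auto)
  have "\<exists>K. \<forall>k\<ge>K. ?L d (I k) = ?L d (I K)" for d
    using acc_subD[OF acc, of "\<lambda>k. ?L d (I k)"] cL LV Lk by (metis lessI less_imp_le)
  then obtain Kd where Kd: "\<And>d k. Kd d \<le> k \<Longrightarrow> ?L d (I k) = ?L d (I (Kd d))" by metis
  define K where "K = Max (insert K0 (Kd ` {..<K0}))"
  have "?L d (I k) \<subseteq> ?L d (I K)" if "K \<le> k" for d k
  proof (cases "d < K0")
    case True
    then have "Kd d \<le> K" unfolding K_def by simp
    then show ?thesis using Kd[of d k] Kd[of d K] that by simp
  next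
    case False
    have KK: "K0 \<le> K" unfolding K_def by simp
    \<comment> \<open>Both indices are raised to their maximum, where the diagonal is already
      constant.\<close>
    have "?L d (I k) \<subseteq> ?L (max d k) (I (max d k))" using Lk[of k "max d k" d] Ld[of d "max d k" "max d k"] by auto
    also have "\<dots> = ?L K0 (I K0)" using K0[of "max d k"] False by simp
    also have "\<dots> \<subseteq> ?L d (I K)" using Ld[of K0 d K0] Lk[OF KK, of d] False by auto
    finally show ?thesis .
  qed
  then have *: "I k \<inter> pow_span x V d \<subseteq> I K" if "K \<le> k" for d k
    using lead_sub_eq_imp[OF cI' cI' mono[OF that]] that by blast
  have "I k = I K" if "K \<le> k" for k
  proof
    show "I k \<subseteq> I K" using *[OF that] I[rule_format, of k] by blast
  qed (rule mono[OF that])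
  then show "\<exists>K. \<forall>k\<ge>K. I k = I K" by blast
qed

end

lemma acc_sub_adjoin:
  assumes "X \<subseteq> carrier R" "closed_sub M X V" "acc_sub M X V" "set xs \<subseteq> carrier R"
  shows "\<exists>V'. V \<subseteq> V' \<and> closed_sub M (set xs \<union> X) V' \<and> acc_sub M (set xs \<union> X) V'"
  using assms(4)
proof (induction xs)
  case Nil
  then show ?case using assms by auto
next
  case (Cons x xs)
  then obtain V' where V': "V \<subseteq> V'" "closed_sub M (set xs \<union> X) V'" "acc_sub M (set xs \<union> X) V'" by auto
  have X: "set xs \<union> X \<subseteq> carrier R" and x: "x \<in> carrier R" using Cons.prems assms(1) by auto
  let ?U = "\<Union>d. pow_span x V' d"
  have "V' \<subseteq> pow_span x V' (Suc 0)"
    using closed_subD(1)[OF V'(2)] sum_sub_zero(1)[of V'] by (auto simp: subset_iff)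
  then have "V' \<subseteq> ?U" by blast
  moreover have "insert x (set xs \<union> X) = set (x # xs) \<union> X" by simp
  ultimately show ?case
    using closed_sub_UN_pow_span[OF X x V'(2)] acc_sub_pow_span[OF X x V'(2,3)] V'(1)
    by (intro exI[of _ ?U]) auto
qed

text \<open>The scalars that map \<open>N\<close> into itself are closed under the ring
  operations.\<close>

lemma closed_sub_generate_ring:
  assumes "closed_sub M Y N" "Y \<subseteq> carrier R"
  shows "closed_sub M (generate_ring R Y) N"
proof (rule closed_subI)
  fix a x assume "a \<in> generate_ring R Y" "x \<in> N"
  then show "a \<odot>\<^bsub>M\<^esub> x \<in> N"
  proof (induction arbitrary: x rule: generate_ring.induct)
    note gc = generate_ring_incl[OF assms(2)]
    note Nc = closed_subD(3)[OF assms(1)]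
    { case one then show ?case using Nc by simp }
    { case (incl h) then show ?case using closed_subD(6)[OF assms(1)] by simp }
    { case (a_inv h)
      then have "h \<in> carrier R" using assms(2) gc by blast
      then show ?case using a_inv closed_subD(5)[OF assms(1)] Nc by (simp add: smult_l_minus) }
    { case (eng_add h1 h2)
      then have "h1 \<in> carrier R" "h2 \<in> carrier R" using gc by auto
      then show ?case using eng_add closed_subD(4)[OF assms(1)] Nc by (simp add: smult_l_distr) }
    { case (eng_mult h1 h2)
      then have "h1 \<in> carrier R" "h2 \<in> carrier R" using gc by auto
      then show ?case using eng_mult Nc by (simp add: smult_assoc1) }
  qed
qed (use closed_subD[OF assms(1)] in auto)

end


section \<open>Multigraded modules\<close>

text \<open>Only the additive structure enters, so the same facts about components apply to a graded
  ring and to a graded module.\<close>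

locale graded_group = abelian_group G for G (structure) +
  fixes gr :: "('s::finite \<Rightarrow> nat) \<Rightarrow> 'a set"
  assumes decomp: "direct_sum_decomposition G gr"
begin

definition component :: "'a \<Rightarrow> ('s \<Rightarrow> nat) \<Rightarrow> 'a" where
  "component x = (THE f. (\<forall>n. f n \<in> gr n) \<and> finite {n. f n \<noteq> \<zero>} \<and> x = (\<Oplus>n\<in>{n. f n \<noteq> \<zero>}. f n))"

lemma subgroup_gr: "subgroup (gr n) (add_monoid G)"
  using decomp unfolding direct_sum_decomposition_def by blast

lemma gr_closed [simp]: "x \<in> gr n \<Longrightarrow> x \<in> carrier G"
  using subgroup.subset[OF subgroup_gr] by auto

lemma gr_zero [simp]: "\<zero> \<in> gr n"
  using subgroup.one_closed[OF subgroup_gr] by simp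

lemma gr_add [simp]: "x \<in> gr n \<Longrightarrow> y \<in> gr n \<Longrightarrow> x \<oplus> y \<in> gr n"
  using subgroup.m_closed[OF subgroup_gr] by simp

lemma gr_minus [simp]: "x \<in> gr n \<Longrightarrow> \<ominus> x \<in> gr n"
  using subgroup.m_inv_closed[OF subgroup_gr, of x n] by (simp add: a_inv_def)

lemma component_ex1:
  assumes "x \<in> carrier G"
  shows "\<exists>!f. (\<forall>n. f n \<in> gr n) \<and> finite {n. f n \<noteq> \<zero>} \<and> x = (\<Oplus>n\<in>{n. f n \<noteq> \<zero>}. f n)"
  using decomp assms unfolding direct_sum_decomposition_def by blast

lemma component_props:
  assumes "x \<in> carrier G"
  shows "component x n \<in> gr n" "finite {n. component x n \<noteq> \<zero>}"
    "x = (\<Oplus>n\<in>{n. component x n \<noteq> \<zero>}. component x n)"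
  using theI'[OF component_ex1[OF assms]] unfolding component_def by blast+

lemma component_closed [simp]: "x \<in> carrier G \<Longrightarrow> component x n \<in> carrier G"
  by (rule gr_closed[OF component_props(1)])

lemma finsum_support:
  assumes "\<And>n. f n \<in> gr n" "finite A" "\<And>n. n \<notin> A \<Longrightarrow> f n = \<zero>"
  shows "(\<Oplus>n\<in>{n. f n \<noteq> \<zero>}. f n) = (\<Oplus>n\<in>A. f n)"
  by (rule add.finprod_mono_neutral_cong_left) (use assms(2,3) gr_closed[OF assms(1)] in auto)

lemma component_sum:
  assumes "x \<in> carrier G" "finite A" "\<And>n. n \<notin> A \<Longrightarrow> component x n = \<zero>"
  shows "x = (\<Oplus>n\<in>A. component x n)"
  using component_props(3)[OF assms(1)] finsum_support[of "component x" A] component_props(1)[OF assms(1)] assms(2,3)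
  by simp

lemma component_eqI:
  assumes f: "\<And>n. f n \<in> gr n" and A: "finite A" "\<And>n. n \<notin> A \<Longrightarrow> f n = \<zero>" and x: "x = (\<Oplus>n\<in>A. f n)"
  shows "component x = f"
proof -
  have xc: "x \<in> carrier G" unfolding x by (rule finsum_closed) (use gr_closed[OF f] in auto)
  have "{n. f n \<noteq> \<zero>} \<subseteq> A" using A(2) by auto
  then have "finite {n. f n \<noteq> \<zero>}" using A(1) by (rule finite_subset)
  moreover have "x = (\<Oplus>n\<in>{n. f n \<noteq> \<zero>}. f n)" using finsum_support[of f A] f A x by simp
  ultimately show ?thesis unfolding component_def
    by (intro the1_equality[OF component_ex1[OF xc]]) (use f in auto)
qed

lemma component_add:
  assumes x: "x \<in> carrier G" and y: "y \<in> carrier G"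
  shows "component (x \<oplus> y) n = component x n \<oplus> component y n"
proof -
  define A where "A = {n. component x n \<noteq> \<zero>} \<union> {n. component y n \<noteq> \<zero>}"
  have fin: "finite A" unfolding A_def using component_props(2) x y by simp
  have xs: "x = (\<Oplus>n\<in>A. component x n)" by (rule component_sum[OF x fin]) (auto simp: A_def)
  have ys: "y = (\<Oplus>n\<in>A. component y n)" by (rule component_sum[OF y fin]) (auto simp: A_def)
  have "x \<oplus> y = (\<Oplus>n\<in>A. component x n) \<oplus> (\<Oplus>n\<in>A. component y n)" using xs ys by simp
  also have "\<dots> = (\<Oplus>n\<in>A. component x n \<oplus> component y n)"
    by (rule finsum_addf[symmetric]) (use x y in auto)
  finally have "component (x \<oplus> y) = (\<lambda>n. component x n \<oplus> component y n)"
    by (intro component_eqI[OF _ fin]) (use x y component_props(1) in \<open>auto simp: A_def\<close>)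
  then show ?thesis by simp
qed

lemma component_homogeneous:
  assumes x: "x \<in> gr m" shows "component x n = (if n = m then x else \<zero>)"
proof -
  have "x = (\<Oplus>n\<in>{m}. if n = m then x else \<zero>)" using x by (simp add: finsum_insert)
  then have "component x = (\<lambda>n. if n = m then x else \<zero>)"
    by (intro component_eqI[of _ "{m}"]) (use x in auto)
  then show ?thesis by simp
qed

lemma component_component: "x \<in> carrier G \<Longrightarrow> component (component x m) n = (if n = m then component x n else \<zero>)"
  using component_homogeneous[OF component_props(1)] by simp

lemma component_zero [simp]: "component \<zero> n = \<zero>"
  using component_homogeneous[OF gr_zero, of n n] by simp

lemma component_minus: "x \<in> carrier G \<Longrightarrow> component (\<ominus> x) n = \<ominus> component x n"
proof -
  assume x: "x \<in> carrier G"
  have "component (\<ominus> x \<oplus> x) n = component (\<ominus> x) n \<oplus> component x n" using x by (intro component_add) auto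
  then have "component (\<ominus> x) n \<oplus> component x n = \<zero>" using x by (simp add: l_neg)
  then show ?thesis using x by (simp add: minus_equality)
qed

lemma component_eq_zero_imp: "x \<in> carrier G \<Longrightarrow> (\<And>n. component x n = \<zero>) \<Longrightarrow> x = \<zero>"
  using component_sum[of x "{}"] by simp

lemma component_induct:
  assumes x: "x \<in> carrier G" and z: "P \<zero>" and h: "\<And>n. P (component x n)"
    and a: "\<And>y z. y \<in> carrier G \<Longrightarrow> z \<in> carrier G \<Longrightarrow> P y \<Longrightarrow> P z \<Longrightarrow> P (y \<oplus> z)"
  shows "P x"
proof -
  have "P (\<Oplus>n\<in>A. component x n)" if "finite A" for A
    using that
  proof (induction A rule: finite_induct)
    case empty then show ?case using z by simp
  next
    case (insert n A)
    then have "(\<Oplus>n\<in>insert n A. component x n) = component x n \<oplus> (\<Oplus>n\<in>A. component x n)"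
      using x by (intro finsum_insert) auto
    then show ?case using insert x by (auto intro!: a h finsum_closed)
  qed
  then show ?thesis using component_props(2,3)[OF x] by metis
qed

lemma homogeneous_induct:
  assumes "x \<in> carrier G" "\<And>n y. y \<in> gr n \<Longrightarrow> P y"
    and "\<And>y z. y \<in> carrier G \<Longrightarrow> z \<in> carrier G \<Longrightarrow> P y \<Longrightarrow> P z \<Longrightarrow> P (y \<oplus> z)"
  shows "P x"
  by (rule component_induct[OF assms(1)]) (use assms component_props(1) gr_zero in blast)+

text \<open>The truncation to the degrees in \<open>B\<close>. For finite boxes \<open>B\<close> it
  takes over the role of the homogeneous components where elements are not homogeneous.\<close>

definition part :: "('s \<Rightarrow> nat) set \<Rightarrow> 'a set" where
  "part B = {x\<in>carrier G. \<forall>n. n \<notin> B \<longrightarrow> component x n = \<zero>}"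

lemma part_mono: "A \<subseteq> B \<Longrightarrow> part A \<subseteq> part B"
  unfolding part_def by blast

lemma part_empty: "part {} = {\<zero>}"
  unfolding part_def using component_eq_zero_imp by auto

lemma gr_subset_part: "n \<in> B \<Longrightarrow> gr n \<subseteq> part B"
  unfolding part_def using component_homogeneous by auto

lemma part_induct:
  assumes x: "x \<in> part B" and z: "P \<zero>" and h: "\<And>n y. n \<in> B \<Longrightarrow> y \<in> gr n \<Longrightarrow> P y"
    and a: "\<And>y z. y \<in> carrier G \<Longrightarrow> z \<in> carrier G \<Longrightarrow> P y \<Longrightarrow> P z \<Longrightarrow> P (y \<oplus> z)"
  shows "P x"
proof (rule component_induct)
  have xc: "x \<in> carrier G" using x unfolding part_def by blast
  then show "x \<in> carrier G" .
  show "P (component x n)" for n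
  proof (cases "n \<in> B")
    case True
    then show ?thesis using h component_props(1)[OF xc] by blast
  next
    case False
    then show ?thesis using x z unfolding part_def by simp
  qed
qed (use z a in blast)+

lemma finite_degree_bound:
  assumes "finite Y" "Y \<subseteq> carrier G"
  shows "\<exists>d. \<forall>y\<in>Y. y \<in> part {n. \<forall>i. n i \<le> d}"
proof -
  define D where "D = (\<Union>y\<in>Y. {n. component y n \<noteq> \<zero>})"
  have "finite D" unfolding D_def using assms component_props(2) by auto
  define d where "d = Max (insert 0 ((\<lambda>(n, i). n i) ` (D \<times> UNIV)))"
  have "n i \<le> d" if "n \<in> D" for n i
  proof -
    have "n i \<in> (\<lambda>(n, i). n i) ` (D \<times> UNIV)" using that by force
    then show ?thesis unfolding d_def using \<open>finite D\<close> by (intro Max_ge) auto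
  qed
  then have "component y n = \<zero>" if "y \<in> Y" "\<not> (\<forall>i. n i \<le> d)" for y n
    using that unfolding D_def by blast
  then show ?thesis using assms(2) unfolding part_def by (intro exI[of _ d]) auto
qed

end

section \<open>Graded modules, graded submodules and colon ideals\<close>

locale graded_mod = module R M + GR: graded_group R grR + GM: graded_group M grM
  for R :: "('a, 'm) ring_scheme" (structure) and grR :: "('s::finite \<Rightarrow> nat) \<Rightarrow> 'a set"
    and M :: "('a, 'b, 'd) module_scheme" (structure) and grM :: "('s \<Rightarrow> nat) \<Rightarrow> 'b set" +
  assumes gr_smult: "\<And>n n' a x. a \<in> grR n \<Longrightarrow> x \<in> grM n' \<Longrightarrow> a \<odot>\<^bsub>M\<^esub> x \<in> grM (\<lambda>i. n i + n' i)"
begin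

lemma gr_zero_smult: "a \<in> grR (\<lambda>_. 0) \<Longrightarrow> x \<in> grM n \<Longrightarrow> a \<odot>\<^bsub>M\<^esub> x \<in> grM n"
  using gr_smult[of a "\<lambda>_. 0" x n] by simp

lemma gr0_subset: "grR (\<lambda>_. 0) \<subseteq> carrier R" by auto

lemma closed_sub_gr: "closed_sub M (grR (\<lambda>_. 0)) (grM n)"
  by (rule closed_subI) (auto simp: gr_zero_smult)

lemma component_smult:
  assumes a: "a \<in> grR m" and x: "x \<in> carrier M"
  shows "GM.component (a \<odot>\<^bsub>M\<^esub> x) (\<lambda>i. m i + n i) = a \<odot>\<^bsub>M\<^esub> GM.component x n"
  using x
proof (induction x rule: GM.homogeneous_induct)
  case (2 n' y)
  have "(\<lambda>i. m i + n i) = (\<lambda>i. m i + n' i) \<longleftrightarrow> n = n'" by (auto simp: fun_eq_iff)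
  then show ?case using a 2
    by (simp add: GM.component_homogeneous[OF gr_smult[OF a 2(1)]] GM.component_homogeneous[OF 2(1)])
next
  case (3 y z)
  then show ?case using a by (simp add: smult_r_distr GM.component_add)
qed (rule x)

lemma component_smult_zero:
  assumes a: "a \<in> grR m" and x: "x \<in> carrier M" and n: "\<not> (\<forall>i. m i \<le> n i)"
  shows "GM.component (a \<odot>\<^bsub>M\<^esub> x) n = \<zero>\<^bsub>M\<^esub>"
  using x
proof (induction x rule: GM.homogeneous_induct)
  case (2 n' y)
  have "n \<noteq> (\<lambda>i. m i + n' i)" using n by (metis le_add1)
  then show ?case by (simp add: GM.component_homogeneous[OF gr_smult[OF a 2(1)]])
next
  case (3 y z)
  then show ?case using a by (simp add: smult_r_distr GM.component_add)
qed (rule x)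

lemma component_smult_right:
  assumes a: "a \<in> carrier R" and x: "x \<in> grM m"
  shows "GM.component (a \<odot>\<^bsub>M\<^esub> x) (\<lambda>i. m i + n i) = GR.component a n \<odot>\<^bsub>M\<^esub> x"
  using a
proof (induction a rule: GR.homogeneous_induct)
  case (2 n' y)
  have "(\<lambda>i. m i + n i) = (\<lambda>i. n' i + m i) \<longleftrightarrow> n = n'" by (auto simp: fun_eq_iff)
  then show ?case using x 2
    by (simp add: GM.component_homogeneous[OF gr_smult[OF 2(1) x]] GR.component_homogeneous[OF 2(1)])
next
  case (3 y z)
  then show ?case using x by (simp add: smult_l_distr GM.component_add GR.component_add)
qed (rule a)

lemma closed_sub_part: "closed_sub M (grR (\<lambda>_. 0)) (GM.part B)"
proof (rule closed_subI)
  show "a \<odot>\<^bsub>M\<^esub> x \<in> GM.part B" if "a \<in> grR (\<lambda>_. 0)" "x \<in> GM.part B" for a x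
    using component_smult[OF that(1), of x] that unfolding GM.part_def by auto
qed (auto simp: GM.part_def GM.component_add GM.component_minus)

lemma smult_part:
  assumes "a \<in> GR.part A" "x \<in> GM.part B" "\<And>m n. m \<in> A \<Longrightarrow> n \<in> B \<Longrightarrow> (\<lambda>i. m i + n i) \<in> C"
  shows "a \<odot>\<^bsub>M\<^esub> x \<in> GM.part C"
proof -
  note c = closed_subD[OF closed_sub_part[of C]]
  have xc: "x \<in> carrier M" using assms(2) unfolding GM.part_def by blast
  show ?thesis using assms(1)
  proof (rule GR.part_induct)
    fix m a assume a: "m \<in> A" "a \<in> grR m"
    show "a \<odot>\<^bsub>M\<^esub> x \<in> GM.part C" using assms(2)
    proof (rule GM.part_induct)
      fix n y assume y: "n \<in> B" "y \<in> grM n"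
      show "a \<odot>\<^bsub>M\<^esub> y \<in> GM.part C"
        using gr_smult[OF a(2) y(2)] GM.gr_subset_part[OF assms(3)[OF a(1) y(1)]] by blast
    qed (use a c in \<open>auto simp: smult_r_distr\<close>)
  qed (use xc c in \<open>auto simp: smult_l_distr\<close>)
qed

definition graded_sub :: "'b set \<Rightarrow> bool" where
  "graded_sub N \<longleftrightarrow> closed_sub M (carrier R) N \<and> (\<forall>x\<in>N. \<forall>n. GM.component x n \<in> N)"

lemma graded_subD:
  assumes "graded_sub N"
  shows "closed_sub M (carrier R) N" "closed_sub M (grR (\<lambda>_. 0)) N"
    "x \<in> N \<Longrightarrow> GM.component x n \<in> N"
  using assms closed_sub_antimono[OF _ gr0_subset] unfolding graded_sub_def by auto

lemma graded_sub_zero: "graded_sub {\<zero>\<^bsub>M\<^esub>}"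
  unfolding graded_sub_def using closed_sub_zero[OF subset_refl] by simp

lemma graded_sub_carrier: "graded_sub (carrier M)"
  unfolding graded_sub_def using closed_sub_carrier[OF subset_refl] by simp

lemma graded_sub_sum:
  assumes "graded_sub N" "graded_sub N'" shows "graded_sub (sum_sub M N N')"
proof -
  note D = graded_subD[OF assms(1)] graded_subD[OF assms(2)]
  show ?thesis unfolding graded_sub_def
  proof (intro conjI ballI allI)
    show "closed_sub M (carrier R) (sum_sub M N N')" by (rule closed_sub_sum_sub[OF subset_refl D(1,4)])
    fix z n assume "z \<in> sum_sub M N N'"
    then obtain x y where z: "x \<in> N" "y \<in> N'" "z = x \<oplus>\<^bsub>M\<^esub> y" by (rule sum_subE)
    then have "GM.component z n = GM.component x n \<oplus>\<^bsub>M\<^esub> GM.component y n"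
      using closed_subD(3)[OF D(1)] closed_subD(3)[OF D(4)] by (simp add: GM.component_add)
    then show "GM.component z n \<in> sum_sub M N N'" using z D(3,6) by (simp add: sum_subI)
  qed
qed

lemma graded_sub_multiples:
  assumes x: "x \<in> grM \<delta>" shows "graded_sub ((\<lambda>a. a \<odot>\<^bsub>M\<^esub> x) ` carrier R)"
proof -
  interpret r: module R "regular_module R" by (rule module_regular_module)
  have "closed_sub M (carrier R) ((\<lambda>a. a \<odot>\<^bsub>M\<^esub> x) ` carrier R)"
    using closed_sub_smult_image[OF subset_refl _ GM.gr_closed[OF x]] r.closed_sub_carrier[OF subset_refl] by simp
  moreover have "GM.component (a \<odot>\<^bsub>M\<^esub> x) n \<in> (\<lambda>a. a \<odot>\<^bsub>M\<^esub> x) ` carrier R" if a: "a \<in> carrier R" for a n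
  proof (cases "\<forall>i. \<delta> i \<le> n i")
    case True
    then have "n = (\<lambda>i. \<delta> i + (n i - \<delta> i))" by auto
    then have "GM.component (a \<odot>\<^bsub>M\<^esub> x) n = GR.component a (\<lambda>i. n i - \<delta> i) \<odot>\<^bsub>M\<^esub> x"
      using component_smult_right[OF a x, of "\<lambda>i. n i - \<delta> i"] by simp
    then show ?thesis using a by auto
  next
    case False
    have "GM.component (a \<odot>\<^bsub>M\<^esub> x) n = \<zero>\<^bsub>M\<^esub>" using a
    proof (induction a rule: GR.homogeneous_induct)
      case (2 m a)
      have "n \<noteq> (\<lambda>i. m i + \<delta> i)" using False by (metis le_add2)
      then show ?case by (simp add: GM.component_homogeneous[OF gr_smult[OF 2(1) x]])
    next
      case (3 a b)
      then show ?case using x by (simp add: smult_l_distr GM.component_add)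
    qed (rule a)
    then show ?thesis using x by (intro image_eqI[of _ _ \<zero>]) auto
  qed
  ultimately show ?thesis unfolding graded_sub_def by blast
qed

lemma graded_sub_Int_gr:
  assumes "graded_sub N" shows "closed_sub M (grR (\<lambda>_. 0)) (N \<inter> grM n)"
  by (rule closed_sub_Int[OF graded_subD(2)[OF assms] closed_sub_gr])

lemma graded_sub_sum_Int_gr:
  assumes "graded_sub N" "graded_sub N'"
  shows "sum_sub M N N' \<inter> grM n = sum_sub M (N \<inter> grM n) (N' \<inter> grM n)"
proof
  note D = graded_subD[OF assms(1)] graded_subD[OF assms(2)]
  show "sum_sub M N N' \<inter> grM n \<subseteq> sum_sub M (N \<inter> grM n) (N' \<inter> grM n)"
  proof
    fix z assume z: "z \<in> sum_sub M N N' \<inter> grM n"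
    then obtain x y where xy: "x \<in> N" "y \<in> N'" "z = x \<oplus>\<^bsub>M\<^esub> y" by (auto elim: sum_subE)
    have c: "x \<in> carrier M" "y \<in> carrier M" using xy closed_subD(3)[OF D(1)] closed_subD(3)[OF D(4)] by auto
    have "z = GM.component z n" using z GM.component_homogeneous[of z n n] by simp
    also have "\<dots> = GM.component x n \<oplus>\<^bsub>M\<^esub> GM.component y n" unfolding xy(3) by (rule GM.component_add[OF c])
    finally have e: "z = GM.component x n \<oplus>\<^bsub>M\<^esub> GM.component y n" .
    show "z \<in> sum_sub M (N \<inter> grM n) (N' \<inter> grM n)"
      by (subst e, rule sum_subI) (use xy D(3,6) GM.component_props(1) c in auto)
  qed
  show "sum_sub M (N \<inter> grM n) (N' \<inter> grM n) \<subseteq> sum_sub M N N' \<inter> grM n"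
    using sum_sub_mono[of "N \<inter> grM n" N "N' \<inter> grM n" N' M]
      sum_sub_least[OF closed_sub_gr[of n], of "N \<inter> grM n" "N' \<inter> grM n"] by blast
qed

lemma multiples_Int_gr:
  assumes x: "x \<in> grM \<delta>"
  shows "((\<lambda>a. a \<odot>\<^bsub>M\<^esub> x) ` carrier R) \<inter> grM (\<lambda>i. n i + \<delta> i) = (\<lambda>a. a \<odot>\<^bsub>M\<^esub> x) ` grR n"
proof
  show "((\<lambda>a. a \<odot>\<^bsub>M\<^esub> x) ` carrier R) \<inter> grM (\<lambda>i. n i + \<delta> i) \<subseteq> (\<lambda>a. a \<odot>\<^bsub>M\<^esub> x) ` grR n"
  proof
    fix z assume z: "z \<in> ((\<lambda>a. a \<odot>\<^bsub>M\<^esub> x) ` carrier R) \<inter> grM (\<lambda>i. n i + \<delta> i)"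
    then obtain a where a: "a \<in> carrier R" "z = a \<odot>\<^bsub>M\<^esub> x" by blast
    have "z = GM.component z (\<lambda>i. n i + \<delta> i)" using z GM.component_homogeneous[of z "\<lambda>i. n i + \<delta> i" "\<lambda>i. n i + \<delta> i"] by simp
    also have "\<dots> = GR.component a n \<odot>\<^bsub>M\<^esub> x"
      using component_smult_right[OF a(1) x, of n] a(2) by (simp add: add.commute)
    finally show "z \<in> (\<lambda>a. a \<odot>\<^bsub>M\<^esub> x) ` grR n" using GR.component_props(1)[OF a(1)] by blast
  qed
  show "(\<lambda>a. a \<odot>\<^bsub>M\<^esub> x) ` grR n \<subseteq> ((\<lambda>a. a \<odot>\<^bsub>M\<^esub> x) ` carrier R) \<inter> grM (\<lambda>i. n i + \<delta> i)"
    using gr_smult[OF _ x] by auto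
qed

definition colon :: "'b set \<Rightarrow> 'b \<Rightarrow> 'a set" where
  "colon N x = {a\<in>carrier R. a \<odot>\<^bsub>M\<^esub> x \<in> N}"

lemma closed_sub_colon:
  assumes "closed_sub M (carrier R) N" "x \<in> carrier M"
  shows "closed_sub (regular_module R) (carrier R) (colon N x)"
proof -
  interpret r: module R "regular_module R" by (rule module_regular_module)
  show ?thesis unfolding colon_def
    using closed_sub_preimage[OF module_regular_module module_axioms lin_map_smult_right[OF assms(2)] subset_refl _ assms(1)]
      r.closed_sub_carrier[OF subset_refl] by simp
qed

lemma component_colon:
  assumes "graded_sub N" "x \<in> grM \<delta>" "a \<in> colon N x"
  shows "GR.component a n \<in> colon N x"
proof -
  have a: "a \<in> carrier R" "a \<odot>\<^bsub>M\<^esub> x \<in> N" using assms(3) unfolding colon_def by auto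
  then have "GM.component (a \<odot>\<^bsub>M\<^esub> x) (\<lambda>i. \<delta> i + n i) \<in> N" using graded_subD(3)[OF assms(1)] by blast
  then show ?thesis unfolding colon_def using a component_smult_right[OF a(1) assms(2), of n] by simp
qed

end

text \<open>Finite subsets of a torsion-free grading group have a unique sum: choose the sum of the
  lexicographic maxima.\<close>

lemma unique_sum:
  fixes A B :: "('s::finite \<Rightarrow> nat) set"
  assumes "finite A" "A \<noteq> {}" "finite B" "B \<noteq> {}"
  shows "\<exists>a\<in>A. \<exists>b\<in>B. \<forall>a'\<in>A. \<forall>b'\<in>B. (\<lambda>i. a' i + b' i) = (\<lambda>i. a i + b i) \<longrightarrow> a' = a \<and> b' = b"
proof -
  have "\<exists>a\<in>A. \<exists>b\<in>B. \<forall>a'\<in>A. \<forall>b'\<in>B. (\<lambda>i. a' i + b' i) = (\<lambda>i. a i + b i) \<longrightarrow> (\<forall>i\<in>I. a' i = a i \<and> b' i = b i)"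
    if "finite I" for I
    using that assms
  proof (induction I arbitrary: A B rule: finite_induct)
    case empty
    then show ?case by auto
  next
    case (insert i I)
    \<comment> \<open>Only the faces on which the coordinate \<open>i\<close> is maximal are kept: a
      sum with coordinate \<open>p + q\<close> forces both summands onto these faces, and the
      induction hypothesis applies there.\<close>
    define p where "p = Max ((\<lambda>a. a i) ` A)"
    define q where "q = Max ((\<lambda>b. b i) ` B)"
    define A' where "A' = {a\<in>A. a i = p}"
    define B' where "B' = {b\<in>B. b i = q}"
    have "p \<in> (\<lambda>a. a i) ` A" unfolding p_def using insert.prems by (intro Max_in) auto
    then have A': "finite A'" "A' \<noteq> {}" "A' \<subseteq> A" unfolding A'_def using insert.prems by auto
    have "q \<in> (\<lambda>b. b i) ` B" unfolding q_def using insert.prems by (intro Max_in) auto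
    then have B': "finite B'" "B' \<noteq> {}" "B' \<subseteq> B" unfolding B'_def using insert.prems by auto
    obtain a b where ab: "a \<in> A'" "b \<in> B'"
      and u: "\<And>a' b'. a' \<in> A' \<Longrightarrow> b' \<in> B' \<Longrightarrow> (\<lambda>i. a' i + b' i) = (\<lambda>i. a i + b i) \<Longrightarrow> \<forall>i\<in>I. a' i = a i \<and> b' i = b i"
      using insert.IH[OF A'(1,2) B'(1,2)] by blast
    have "\<forall>j\<in>insert i I. a' j = a j \<and> b' j = b j"
      if h: "a' \<in> A" "b' \<in> B" "(\<lambda>i. a' i + b' i) = (\<lambda>i. a i + b i)" for a' b'
    proof -
      have "a' i \<le> p" unfolding p_def using h insert.prems by (intro Max_ge) auto
      moreover have "b' i \<le> q" unfolding q_def using h insert.prems by (intro Max_ge) auto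
      moreover have "a' i + b' i = p + q" using fun_cong[OF h(3), of i] ab by (simp add: A'_def B'_def)
      ultimately have "a' i = p" "b' i = q" by linarith+
      then show ?thesis using u[of a' b'] h ab by (auto simp: A'_def B'_def)
    qed
    then show ?case using ab A' B' by blast
  qed
  from this[OF finite_UNIV] show ?thesis by (simp add: fun_eq_iff) blast
qed


lemma (in module) smult_lin_span:
  assumes b: "b \<in> carrier R" and A: "A \<subseteq> carrier R" and xs: "set xs \<subseteq> carrier M"
    and C: "\<And>a. a \<in> A \<Longrightarrow> b \<otimes> a \<in> C" and y: "y \<in> lin_span A xs"
  shows "b \<odot>\<^bsub>M\<^esub> y \<in> lin_span C xs"
  using xs y
proof (induction xs arbitrary: y)
  case (Cons x xs)
  from Cons.prems(2) obtain u z where "u \<in> (\<lambda>a. a \<odot>\<^bsub>M\<^esub> x) ` A" "z \<in> lin_span A xs" "y = u \<oplus>\<^bsub>M\<^esub> z"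
    unfolding lin_span.simps by (rule sum_subE)
  then obtain a where az: "a \<in> A" "z \<in> lin_span A xs" "y = a \<odot>\<^bsub>M\<^esub> x \<oplus>\<^bsub>M\<^esub> z" by blast
  have "lin_span A xs \<subseteq> carrier M"
    by (rule lin_span_least[OF closed_sub_carrier[OF subset_refl]]) (use A Cons.prems(1) in auto)
  then have z: "z \<in> carrier M" using az(2) by blast
  have "b \<odot>\<^bsub>M\<^esub> y = (b \<otimes> a) \<odot>\<^bsub>M\<^esub> x \<oplus>\<^bsub>M\<^esub> b \<odot>\<^bsub>M\<^esub> z"
    using az A z b Cons.prems(1) by (auto simp: smult_r_distr smult_assoc1)
  then show ?case using Cons.IH[of z] Cons.prems(1) az C by (auto intro!: sum_subI)
qed (use b in simp)

lemma le_enat_imp_finite: "x \<le> enat k \<Longrightarrow> x \<noteq> \<infinity>"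
  by (cases x) auto

section \<open>Standard graded algebras and their homogeneous primes\<close>

definition unit_degree :: "'s \<Rightarrow> 's \<Rightarrow> nat" where
  "unit_degree i = (\<lambda>j. if j = i then 1 else 0)"

lemma degree_one_imp_unit_degree:
  fixes n :: "'s::finite \<Rightarrow> nat"
  assumes "(\<Sum>i\<in>UNIV. n i) = 1" shows "\<exists>i. n = unit_degree i"
proof -
  obtain i where i: "n i = 1" "\<forall>j\<in>UNIV. j \<noteq> i \<longrightarrow> n j = 0" using assms sum_eq_1_iff[of UNIV n] by auto
  then have "n = unit_degree i" by (auto simp: unit_degree_def)
  then show ?thesis ..
qed

lemma finsum_regular_module: "finsum (regular_module A) f B = finsum A f B"
  unfolding finsum_def finprod_def by (simp add: regular_module_def)

lemma subgroup_regular_module: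
  "subgroup H (add_monoid (regular_module A)) \<longleftrightarrow> subgroup H (add_monoid A)"
  unfolding subgroup_def a_inv_def[symmetric] by simp

lemma component_regular_module:
  fixes gr :: "('s::finite \<Rightarrow> nat) \<Rightarrow> 'a set"
  assumes "graded_group A gr" "graded_group (regular_module A) gr"
  shows "graded_group.component (regular_module A) gr = graded_group.component A gr"
  unfolding graded_group.component_def[OF assms(1)] graded_group.component_def[OF assms(2)]
  by (simp add: fun_eq_iff finsum_regular_module)

text \<open>Everything is stated for \<open>S\<close> and its degree-zero part; the Artinian
  hypothesis is present as the finite length of that part over itself. Viewing \<open>S\<close> as a
  graded module over itself turns homogeneous ideals into graded submodules.\<close>

locale standard_algebra = cring S for S :: "'a ring" (structure) +
  fixes grS :: "('s::finite \<Rightarrow> nat) \<Rightarrow> 'a set" and F :: "'a set"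
  assumes reg: "graded_mod S grS (regular_module S) grS"
    and one_gr0: "\<one> \<in> grS (\<lambda>_. 0)"
    and finite_len_gr0: "len (closed_sub (regular_module S) (grS (\<lambda>_. 0))) {\<zero>} (grS (\<lambda>_. 0)) \<noteq> \<infinity>"
    and F: "finite F" "F \<subseteq> (\<Union>n \<in> {n. (\<Sum>i\<in>UNIV. n i) = 1}. grS n)"
    and gen: "carrier S = generate_ring S (grS (\<lambda>_. 0) \<union> F)"

sublocale standard_algebra \<subseteq> A: graded_mod S grS "regular_module S" grS
  by (rule reg)

context standard_algebra
begin

abbreviation "S0 \<equiv> grS (\<lambda>_. 0)"
abbreviation "cmp \<equiv> A.GR.component"

lemma A_component [simp]: "A.GM.component = cmp"
  by (rule component_regular_module) (rule A.GR.graded_group_axioms A.GM.graded_group_axioms)+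

lemma mult_gr: "a \<in> grS n \<Longrightarrow> b \<in> grS m \<Longrightarrow> a \<otimes> b \<in> grS (\<lambda>i. n i + m i)"
  using A.gr_smult by simp

definition Fl :: "'s \<Rightarrow> 'a list" where
  "Fl i = (SOME xs. set xs = F \<inter> grS (unit_degree i))"

lemma set_Fl: "set (Fl i) = F \<inter> grS (unit_degree i)"
  unfolding Fl_def by (rule someI_ex) (simp add: finite_list F(1))

lemma set_Fl_carrier: "set (Fl i) \<subseteq> carrier (regular_module S)"
  unfolding set_Fl by auto

lemma closed_sub_lin_span_Fl: "closed_sub (regular_module S) S0 (A.lin_span (grS n) (Fl i))"
  by (rule A.closed_sub_lin_span[OF A.gr0_subset A.closed_sub_gr set_Fl_carrier])

text \<open>\<open>T\<close> collects the elements all of whose components satisfy the claim. It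
  contains the degree-zero part and \<open>F\<close> and is closed under the ring operations, so it
  is all of \<open>S\<close>. Thus finitely many generators govern a unit step in direction
  \<open>i\<close>.\<close>

lemma gr_generated:
  assumes "y \<in> grS (\<lambda>j. m j + unit_degree i j)"
  shows "y \<in> A.lin_span (grS m) (Fl i)"
proof -
  define T where "T = {y\<in>carrier S. \<forall>m i. cmp y (\<lambda>j. m j + unit_degree i j) \<in> A.lin_span (grS m) (Fl i)}"
  note L = closed_subD[OF closed_sub_lin_span_Fl, simplified]
  have T0: "\<zero> \<in> T" unfolding T_def using L(2) by simp
  have Tadd: "y \<oplus> z \<in> T" if "y \<in> T" "z \<in> T" for y z
    using that L(4) unfolding T_def by (simp add: A.GR.component_add)
  have Tminus: "\<ominus> y \<in> T" if "y \<in> T" for y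
    using that L(5) unfolding T_def by (simp add: A.GR.component_minus)
  have Tcomp: "cmp y n \<in> T" if y: "y \<in> T" for y n
  proof -
    have yc: "y \<in> carrier S" using y unfolding T_def by simp
    have "cmp (cmp y n) (\<lambda>j. m j + unit_degree i j) \<in> A.lin_span (grS m) (Fl i)" for m i
    proof (cases "(\<lambda>j. m j + unit_degree i j) = n")
      case True
      then have "cmp (cmp y n) (\<lambda>j. m j + unit_degree i j) = cmp y (\<lambda>j. m j + unit_degree i j)"
        by (simp add: A.GR.component_component[OF yc])
      then show ?thesis using y unfolding T_def by simp
    next
      case False
      then show ?thesis using L(2) by (simp add: A.GR.component_component[OF yc])
    qed
    then show ?thesis using yc unfolding T_def by simp
  qed
  have hT: "u \<in> A.lin_span (grS m) (Fl i)" if u: "u \<in> T" "u \<in> grS (\<lambda>j. m j + unit_degree i j)" for u m i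
  proof -
    have "cmp u (\<lambda>j. m j + unit_degree i j) \<in> A.lin_span (grS m) (Fl i)" using u(1) unfolding T_def by blast
    then show ?thesis by (simp add: A.GR.component_homogeneous[OF u(2)])
  qed
  have mem: "u \<otimes> v \<in> A.lin_span (grS (\<lambda>j. m j + b j)) (Fl i)"
    if "u \<in> T" "u \<in> grS (\<lambda>j. m j + unit_degree i j)" "v \<in> grS b" for u v m i b
  proof -
    have c: "u \<in> carrier S" "v \<in> carrier S" using that by auto
    have "v \<odot>\<^bsub>regular_module S\<^esub> u \<in> A.lin_span (grS (\<lambda>j. m j + b j)) (Fl i)"
    proof (rule A.smult_lin_span[OF c(2) _ set_Fl_carrier _ hT[OF that(1,2)]])
      show "v \<otimes> a \<in> grS (\<lambda>j. m j + b j)" if "a \<in> grS m" for a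
        using mult_gr[OF \<open>v \<in> grS b\<close> that] by (simp add: add.commute)
    qed auto
    then show ?thesis using c by (simp add: m_comm)
  qed
  have hmult: "u \<otimes> v \<in> T" if u: "u \<in> T" "u \<in> grS a" and v: "v \<in> T" "v \<in> grS b" for u v a b
  proof -
    have uv: "u \<otimes> v \<in> grS (\<lambda>j. a j + b j)" by (rule mult_gr[OF u(2) v(2)])
    have "cmp (u \<otimes> v) (\<lambda>j. m j + unit_degree i j) \<in> A.lin_span (grS m) (Fl i)" for m i
    proof (cases "(\<lambda>j. m j + unit_degree i j) = (\<lambda>j. a j + b j)")
      case True
      have "u \<otimes> v \<in> A.lin_span (grS m) (Fl i)"
      \<comment> \<open>The degree \<open>m + e_i\<close> of the product is positive at
        \<open>i\<close>, hence so is the degree of \<open>u\<close> or of \<open>v\<close>; that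
        factor is expanded in \<open>Fl i\<close> and the other one is absorbed into the
        coefficients.\<close>
      proof (cases "a i > 0")
        case ai: True
        define a' where "a' = (\<lambda>j. a j - unit_degree i j)"
        have a: "a = (\<lambda>j. a' j + unit_degree i j)" using ai by (auto simp: a'_def unit_degree_def)
        have "m = (\<lambda>j. a' j + b j)"
        proof
          fix j show "m j = a' j + b j" using fun_cong[OF True, of j] fun_cong[OF a, of j] by linarith
        qed
        moreover have "u \<in> grS (\<lambda>j. a' j + unit_degree i j)" using u(2) a by simp
        ultimately show ?thesis using mem[OF u(1) _ v(2)] by blast
      next
        case False
        then have bi: "b i > 0" using fun_cong[OF True, of i] by (simp add: unit_degree_def)
        define b' where "b' = (\<lambda>j. b j - unit_degree i j)"
        have b: "b = (\<lambda>j. b' j + unit_degree i j)" using bi by (auto simp: b'_def unit_degree_def)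
        have "m = (\<lambda>j. b' j + a j)"
        proof
          fix j show "m j = b' j + a j" using fun_cong[OF True, of j] fun_cong[OF b, of j] by linarith
        qed
        moreover have "v \<in> grS (\<lambda>j. b' j + unit_degree i j)" using v(2) b by simp
        ultimately have "v \<otimes> u \<in> A.lin_span (grS m) (Fl i)" using mem[OF v(1) _ u(2)] by blast
        then show ?thesis using u(2) v(2) by (simp add: m_comm)
      qed
      then show ?thesis using A.GR.component_homogeneous[OF uv] True by simp
    next
      case False
      then show ?thesis using A.GR.component_homogeneous[OF uv] L(2) by simp
    qed
    then show ?thesis using u(2) v(2) unfolding T_def by simp
  qed
  have Tc: "y \<in> carrier S" if "y \<in> T" for y using that unfolding T_def by simp
  have Tmult: "y \<otimes> z \<in> T" if yz: "y \<in> T" "z \<in> T" for y z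
  proof -
    have 1: "u \<otimes> z \<in> T" if u: "u \<in> T" "u \<in> grS a" for u a
      using Tc[OF yz(2)]
    proof (rule A.GR.component_induct)
      show "u \<otimes> cmp z n \<in> T" for n
        using hmult[OF u Tcomp[OF yz(2)] A.GR.component_props(1)[OF Tc[OF yz(2)]]] .
    qed (use u T0 Tadd in \<open>auto simp: r_distr\<close>)
    show ?thesis using Tc[OF yz(1)]
    proof (rule A.GR.component_induct)
      show "cmp y n \<otimes> z \<in> T" for n
        by (rule 1[OF Tcomp[OF yz(1)] A.GR.component_props(1)[OF Tc[OF yz(1)]]])
    qed (use Tc[OF yz(2)] T0 Tadd in \<open>auto simp: l_distr\<close>)
  qed
  have T00: "S0 \<subseteq> T"
  proof
    fix y assume y: "y \<in> S0"
    \<comment> \<open>Degree zero is never of the form \<open>m + e_i\<close>, so all components in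
      question are zero.\<close>
    have "(\<lambda>j. m j + unit_degree i j) \<noteq> (\<lambda>_. 0)" for m and i :: 's
      by (metis add_is_0 unit_degree_def zero_neq_one)
    then show "y \<in> T" using y L(2) unfolding T_def by (simp add: A.GR.component_homogeneous)
  qed
  have TF: "F \<subseteq> T"
  proof
    fix y assume y: "y \<in> F"
    then obtain k where k: "y \<in> grS (unit_degree k)" using F(2) degree_one_imp_unit_degree by blast
    have "cmp y (\<lambda>j. m j + unit_degree i j) \<in> A.lin_span (grS m) (Fl i)" for m i
    proof (cases "(\<lambda>j. m j + unit_degree i j) = unit_degree k")
      case True
      have "i = k" using fun_cong[OF True, of i] by (auto simp: unit_degree_def split: if_splits)
      have "m j = 0" for j using fun_cong[OF True, of j] \<open>i = k\<close> by (simp add: unit_degree_def split: if_splits)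
      then have "m = (\<lambda>_. 0)" by auto
      have "\<one> \<odot>\<^bsub>regular_module S\<^esub> y \<in> A.lin_span (grS m) (Fl i)"
        by (rule A.smult_mem_lin_span[OF A.gr0_subset A.closed_sub_gr set_Fl_carrier])
          (use y k \<open>i = k\<close> \<open>m = _\<close> one_gr0 in \<open>auto simp: set_Fl\<close>)
      then show ?thesis using True k by (simp add: A.GR.component_homogeneous)
    next
      case False
      then show ?thesis using k L(2) by (simp add: A.GR.component_homogeneous)
    qed
    then show "y \<in> T" using k unfolding T_def by simp
  qed
  have "y \<in> T" if "y \<in> generate_ring S (S0 \<union> F)" for y
    using that
    by (induction rule: generate_ring.induct) (use T00 TF one_gr0 Tminus Tadd Tmult in auto)
  moreover have "y \<in> carrier S" using assms by (rule A.GR.gr_closed)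
  ultimately have "y \<in> T" using gen by simp
  then show ?thesis using hT assms by blast
qed

text \<open>Each unit step in direction \<open>i\<close> multiplies the length by at most the number
  of generators of degree \<open>e_i\<close>.\<close>

lemma finite_len_gr: "len (closed_sub (regular_module S) S0) {\<zero>} (grS n) \<noteq> \<infinity>"
proof (induction "\<Sum>i\<in>UNIV. n i" arbitrary: n)
  case 0
  then have "n = (\<lambda>_. 0)" by auto
  then show ?case using finite_len_gr0 by simp
next
  case (Suc d)
  then obtain i where i: "n i > 0" by (metis gr0I nat.distinct(1) sum.neutral)
  define m where "m = (\<lambda>j. n j - unit_degree i j)"
  have n: "n = (\<lambda>j. m j + unit_degree i j)" using i by (auto simp: m_def unit_degree_def)
  have "(\<Sum>j\<in>UNIV. unit_degree i j) = 1" by (simp add: unit_degree_def)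
  then have "(\<Sum>j\<in>UNIV. n j) = (\<Sum>j\<in>UNIV. m j) + 1" by (subst n) (simp add: sum.distrib)
  then have IH: "len (closed_sub (regular_module S) S0) {\<zero>} (grS m) \<noteq> \<infinity>" using Suc by simp
  let ?L = "A.lin_span (grS m) (Fl i)"
  have z: "closed_sub (regular_module S) S0 {\<zero>}" using A.closed_sub_zero[OF A.gr0_subset] by simp
  have "len (closed_sub (regular_module S) S0) {\<zero>} (grS n) \<le> len (closed_sub (regular_module S) S0) {\<zero>} ?L"
    by (rule len_mono) (use gr_generated n closed_sub_lin_span_Fl z in auto)
  also have "?L = sum_sub (regular_module S) {\<zero>} ?L"
    using A.sum_sub_zero(1)[of ?L] closed_subD(1)[OF closed_sub_lin_span_Fl] by simp
  also have "len (closed_sub (regular_module S) S0) {\<zero>} (sum_sub (regular_module S) {\<zero>} ?L)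
      \<le> of_nat (length (Fl i)) * len (closed_sub (regular_module S) S0) {\<zero>} (grS m)"
    by (rule A.len_lin_span_le[OF A.gr0_subset z A.closed_sub_gr _ set_Fl_carrier z])
      (auto simp: set_Fl)
  finally have *: "len (closed_sub (regular_module S) S0) {\<zero>} (grS n)
      \<le> of_nat (length (Fl i)) * len (closed_sub (regular_module S) S0) {\<zero>} (grS m)" .
  obtain c where "len (closed_sub (regular_module S) S0) {\<zero>} (grS m) = enat c" using IH by auto
  then have "len (closed_sub (regular_module S) S0) {\<zero>} (grS n) \<le> enat (length (Fl i) * c)"
    using * by (simp add: of_nat_eq_enat)
  then show ?case by (rule le_enat_imp_finite)
qed

text \<open>The elements with all components in \<open>I\<close> form an ideal that contains the
  homogeneous generators; conversely every element of a graded ideal is the sum of its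
  components.\<close>

lemma homogeneous_ideal_iff: "homogeneous_ideal S grS I \<longleftrightarrow> A.graded_sub I"
proof
  assume h: "homogeneous_ideal S grS I"
  then have I: "ideal I S" and eq: "I = Idl (I \<inter> (\<Union>n. grS n))" unfolding homogeneous_ideal_def by auto
  have cI: "closed_sub (regular_module S) (carrier S) I" using I by (simp add: ideal_iff_closed_sub)
  note ID = closed_subD[OF cI, simplified]
  define J where "J = {x\<in>carrier S. \<forall>n. cmp x n \<in> I}"
  have "cmp (a \<otimes> x) n \<in> I" if a: "a \<in> carrier S" and x: "x \<in> J" for a x n
    using a
  proof (induction a rule: A.GR.homogeneous_induct)
    case (2 m a)
    have xc: "x \<in> carrier S" using x unfolding J_def by simp
    show ?case
    proof (cases "\<forall>i. m i \<le> n i")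
      case True
      then have "n = (\<lambda>i. m i + (n i - m i))" by auto
      then have "cmp (a \<otimes> x) n = a \<otimes> cmp x (\<lambda>i. n i - m i)"
        using A.component_smult[OF 2(1), of x "\<lambda>i. n i - m i"] xc by simp
      then show ?thesis using x 2 ID(6) unfolding J_def by simp
    next
      case False
      then show ?thesis using A.component_smult_zero[OF 2(1), of x n] xc ID(2) by simp
    qed
  next
    case (3 y z)
    then show ?case using x ID(4) unfolding J_def by (simp add: l_distr A.GR.component_add)
  qed (rule a)
  then have "closed_sub (regular_module S) (carrier S) J"
    by (intro closed_subI) (auto simp: J_def A.GR.component_add A.GR.component_minus ID)
  then have "ideal J S" by (simp add: ideal_iff_closed_sub)
  moreover have "I \<inter> (\<Union>n. grS n) \<subseteq> J"
    unfolding J_def by (auto simp: A.GR.component_homogeneous ID)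
  ultimately have "Idl (I \<inter> (\<Union>n. grS n)) \<subseteq> J" by (rule genideal_minimal)
  then have "I \<subseteq> J" using eq by simp
  then show "A.graded_sub I" unfolding A.graded_sub_def using cI by (auto simp: J_def)
next
  assume g: "A.graded_sub I"
  have cI: "closed_sub (regular_module S) (carrier S) I" by (rule A.graded_subD(1)[OF g])
  then have I: "ideal I S" by (simp add: ideal_iff_closed_sub)
  have sub: "I \<inter> (\<Union>n. grS n) \<subseteq> carrier S" by auto
  have J: "ideal (Idl (I \<inter> (\<Union>n. grS n))) S" by (rule genideal_ideal[OF sub])
  then have cJ: "closed_sub (regular_module S) (carrier S) (Idl (I \<inter> (\<Union>n. grS n)))"
    by (simp add: ideal_iff_closed_sub)
  have "x \<in> Idl (I \<inter> (\<Union>n. grS n))" if x: "x \<in> I" for x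
  proof -
    have xc: "x \<in> carrier S" using closed_subD(3)[OF cI x] by simp
    then show ?thesis
    proof (rule A.GR.component_induct)
      fix n
      have "cmp x n \<in> I \<inter> (\<Union>n. grS n)" using A.graded_subD(3)[OF g x] A.GR.component_props(1)[OF xc] by auto
      then show "cmp x n \<in> Idl (I \<inter> (\<Union>n. grS n))" using genideal_self[OF sub] by blast
    qed (use closed_subD(2,4)[OF cJ] in auto)
  qed
  moreover have "Idl (I \<inter> (\<Union>n. grS n)) \<subseteq> I" by (rule genideal_minimal[OF I]) auto
  ultimately show "homogeneous_ideal S grS I" unfolding homogeneous_ideal_def using I by auto
qed

lemma Proj_iff: "P \<in> Proj S grS \<longleftrightarrow> primeideal P S \<and> A.graded_sub P \<and> \<not> S_plusplus S grS \<subseteq> P"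
  unfolding Proj_def homogeneous_ideal_iff by simp

lemma ProjD:
  assumes "P \<in> Proj S grS"
  shows "A.graded_sub P" "primeideal P S" "closed_sub (regular_module S) (carrier S) P" "\<one> \<notin> P"
    "\<And>a b. a \<in> carrier S \<Longrightarrow> b \<in> carrier S \<Longrightarrow> a \<otimes> b \<in> P \<Longrightarrow> a \<in> P \<or> b \<in> P"
proof -
  show P: "A.graded_sub P" "primeideal P S" using assms by (simp_all add: Proj_iff)
  then show c: "closed_sub (regular_module S) (carrier S) P" using A.graded_subD(1) by blast
  show "\<one> \<notin> P"
  proof
    assume "\<one> \<in> P"
    then have "x \<in> P" if "x \<in> carrier S" for x using closed_subD(6)[OF c that] that by fastforce
    then have "P = carrier S" using closed_subD(1)[OF c] by auto
    then show False using primeideal.I_notcarr[OF P(2)] by simp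
  qed
  show "\<And>a b. a \<in> carrier S \<Longrightarrow> b \<in> carrier S \<Longrightarrow> a \<otimes> b \<in> P \<Longrightarrow> a \<in> P \<or> b \<in> P"
    using primeideal.I_prime[OF P(2)] .
qed

lemma S_plusplus_subset_iff:
  assumes "closed_sub (regular_module S) (carrier S) P"
  shows "S_plusplus S grS \<subseteq> P \<longleftrightarrow> (\<forall>n. (\<forall>i. n i > 0) \<longrightarrow> grS n \<subseteq> P)"
proof
  have "grS n \<subseteq> S_plusplus S grS" if "\<forall>i. n i > 0" for n
    unfolding S_plusplus_def using that by (auto intro: generate.incl)
  then show "S_plusplus S grS \<subseteq> P \<Longrightarrow> \<forall>n. (\<forall>i. n i > 0) \<longrightarrow> grS n \<subseteq> P" by blast
next
  assume h: "\<forall>n. (\<forall>i. n i > 0) \<longrightarrow> grS n \<subseteq> P"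
  have "subgroup P (add_monoid S)"
    by (rule additive_subgroup.a_subgroup[OF ideal.axioms(1)])
      (use assms in \<open>simp add: ideal_iff_closed_sub\<close>)
  then show "S_plusplus S grS \<subseteq> P"
    unfolding S_plusplus_def by (intro add.generate_subgroup_incl) (use h in auto)
qed

text \<open>Otherwise \<open>P\<close> contains the whole piece of degree \<open>e_i\<close>, hence
  by \<open>gr_generated\<close> every piece whose degree is positive at \<open>i\<close>, and so
  all of \<open>S_plusplus\<close>. Such elements \<open>x\<close> make differences in direction
  \<open>i\<close> computable.\<close>

lemma Proj_unit_degree:
  assumes "P \<in> Proj S grS" shows "\<exists>x\<in>grS (unit_degree i). x \<notin> P"
proof (rule ccontr)
  assume h: "\<not> (\<exists>x\<in>grS (unit_degree i). x \<notin> P)"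
  note P = ProjD[OF assms]
  have "grS n \<subseteq> P" if n: "\<forall>i. n i > 0" for n
  proof
    fix y assume "y \<in> grS n"
    moreover have "n = (\<lambda>j. (n j - unit_degree i j) + unit_degree i j)"
      using n by (auto simp: unit_degree_def fun_eq_iff Suc_le_eq)
    ultimately have "y \<in> A.lin_span (grS (\<lambda>j. n j - unit_degree i j)) (Fl i)" using gr_generated by metis
    moreover have "A.lin_span (grS (\<lambda>j. n j - unit_degree i j)) (Fl i) \<subseteq> P"
      by (rule A.lin_span_least[OF P(3)]) (use h closed_subD(6)[OF P(3)] in \<open>auto simp: set_Fl\<close>)
    ultimately show "y \<in> P" by blast
  qed
  then have "S_plusplus S grS \<subseteq> P" using S_plusplus_subset_iff[OF P(3)] by blast
  then show False using assms by (simp add: Proj_iff)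
qed

lemma Proj_gr:
  assumes P: "P \<in> Proj S grS" shows "\<exists>x\<in>grS n. x \<notin> P"
proof (induction "\<Sum>i\<in>UNIV. n i" arbitrary: n)
  case 0
  then have "n = (\<lambda>_. 0)" by auto
  then show ?case using one_gr0 ProjD(4)[OF P] by auto
next
  case (Suc d)
  then obtain i where i: "n i > 0" by (metis gr0I nat.distinct(1) sum.neutral)
  define m where "m = (\<lambda>j. n j - unit_degree i j)"
  have n: "n = (\<lambda>j. m j + unit_degree i j)" using i by (auto simp: m_def unit_degree_def)
  have "(\<Sum>j\<in>UNIV. unit_degree i j) = 1" by (simp add: unit_degree_def)
  then have "(\<Sum>j\<in>UNIV. n j) = (\<Sum>j\<in>UNIV. m j) + 1" by (subst n) (simp add: sum.distrib)
  then obtain x where x: "x \<in> grS m" "x \<notin> P" using Suc by fastforce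
  obtain y where y: "y \<in> grS (unit_degree i)" "y \<notin> P" using Proj_unit_degree[OF P] by blast
  have "x \<otimes> y \<in> grS n" using mult_gr[OF x(1) y(1)] n by simp
  moreover have "x \<otimes> y \<notin> P" using ProjD(5)[OF P, of x y] x y by auto
  ultimately show ?case by blast
qed

text \<open>If \<open>a\<close> and \<open>b\<close> are outside \<open>P\<close>, take components
  of degrees \<open>u\<close> and \<open>v\<close> outside \<open>P\<close> whose sum
  \<open>u + v\<close> is attained only once among such degrees. The component of \<open>a b\<close>
  in degree \<open>u + v\<close> is then \<open>a_u b_v\<close> modulo \<open>P\<close>. The
  hypothesis \<open>h\<close>, with one homogeneous factor, is what maximal colon ideals
  deliver.\<close>

lemma primeideal_if_homogeneous_prime:
  assumes g: "A.graded_sub P" and ne: "\<one> \<notin> P"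
    and h: "\<And>m a b. a \<in> grS m \<Longrightarrow> a \<notin> P \<Longrightarrow> b \<in> carrier S \<Longrightarrow> a \<otimes> b \<in> P \<Longrightarrow> b \<in> P"
  shows "primeideal P S"
proof (rule primeidealI)
  have cP: "closed_sub (regular_module S) (carrier S) P" by (rule A.graded_subD(1)[OF g])
  note PD = closed_subD[OF cP, simplified]
  note gP = A.graded_subD(3)[OF g, simplified]
  show "ideal P S" using cP by (simp add: ideal_iff_closed_sub)
  show "cring S" by (rule is_cring)
  show "carrier S \<noteq> P" using ne by auto
  fix a b assume a: "a \<in> carrier S" and b: "b \<in> carrier S" and ab: "a \<otimes> b \<in> P"
  show "a \<in> P \<or> b \<in> P"
  proof (rule ccontr)
    assume n: "\<not> (a \<in> P \<or> b \<in> P)"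
    define X where "X = {n. cmp a n \<notin> P}"
    define Y where "Y = {n. cmp b n \<notin> P}"
    have nz: "cmp x n \<notin> P \<Longrightarrow> cmp x n \<noteq> \<zero>" for x n using PD(2) by auto
    have fX: "finite X" unfolding X_def
      by (rule finite_subset[OF _ A.GR.component_props(2)[OF a]]) (use nz in auto)
    have fY: "finite Y" unfolding Y_def
      by (rule finite_subset[OF _ A.GR.component_props(2)[OF b]]) (use nz in auto)
    have inP: "x \<in> P" if "x \<in> carrier S" "\<And>n. cmp x n \<in> P" for x
      by (rule A.GR.component_induct[OF that(1)]) (use that PD in auto)
    have "X \<noteq> {}" "Y \<noteq> {}" using inP[OF a] inP[OF b] n unfolding X_def Y_def by blast+
    then obtain u v where uv: "u \<in> X" "v \<in> Y"
      and uniq: "\<And>u' v'. u' \<in> X \<Longrightarrow> v' \<in> Y \<Longrightarrow> (\<lambda>i. u' i + v' i) = (\<lambda>i. u i + v i) \<Longrightarrow> u' = u \<and> v' = v"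
      using unique_sum[OF fX _ fY] by blast
    let ?w = "\<lambda>i. u i + v i"
    \<comment> \<open>A component of \<open>a\<close> of degree other than \<open>u\<close>
      contributes to degree \<open>u + v\<close> at most a product with a factor in
      \<open>P\<close>.\<close>
    have other: "cmp (cmp a m \<otimes> b) ?w \<in> P" if "m \<noteq> u" for m
    proof (cases "\<forall>i. m i \<le> ?w i")
      case True
      define m' where "m' = (\<lambda>i. ?w i - m i)"
      have w: "?w = (\<lambda>i. m i + m' i)" using True by (auto simp: m'_def)
      have "cmp (cmp a m \<otimes> b) ?w = cmp a m \<otimes> cmp b m'"
        unfolding w using A.component_smult[OF A.GR.component_props(1)[OF a], of b m m'] b by simp
      moreover have "cmp a m \<in> P \<or> cmp b m' \<in> P"
        using uniq[of m m'] that w unfolding X_def Y_def by auto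
      ultimately show ?thesis using PD(6)[of "cmp a m" "cmp b m'"] PD(6)[of "cmp b m'" "cmp a m"] a b
        by (auto simp: m_comm)
    next
      case False
      then show ?thesis using A.component_smult_zero[OF A.GR.component_props(1)[OF a], of b m ?w] b PD(2) by simp
    qed
    have rest: "cmp ((\<Oplus>m\<in>K. cmp a m) \<otimes> b) ?w \<in> P" if "finite K" "u \<notin> K" for K
      using that
    proof (induction K rule: finite_induct)
      case empty
      then show ?case using b PD(2) by simp
    next
      case (insert m K)
      have c: "(\<Oplus>m\<in>K. cmp a m) \<in> carrier S" by (rule finsum_closed) (use a in auto)
      have "(\<Oplus>m\<in>insert m K. cmp a m) = cmp a m \<oplus> (\<Oplus>m\<in>K. cmp a m)"
        by (rule finsum_insert) (use insert a in auto)
      then have "cmp ((\<Oplus>m\<in>insert m K. cmp a m) \<otimes> b) ?w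
          = cmp (cmp a m \<otimes> b) ?w \<oplus> cmp ((\<Oplus>m\<in>K. cmp a m) \<otimes> b) ?w"
        using a b c by (simp add: l_distr A.GR.component_add)
      then show ?case using insert other[of m] PD(4) by auto
    qed
    define K where "K = {n. cmp a n \<noteq> \<zero>} - {u}"
    have fK: "finite K" unfolding K_def using A.GR.component_props(2)[OF a] by simp
    have "a = (\<Oplus>m\<in>insert u K. cmp a m)"
      by (rule A.GR.component_sum[OF a]) (use fK in \<open>auto simp: K_def\<close>)
    also have "\<dots> = cmp a u \<oplus> (\<Oplus>m\<in>K. cmp a m)"
      by (rule finsum_insert) (use fK a in \<open>auto simp: K_def\<close>)
    finally have aeq: "a = cmp a u \<oplus> (\<Oplus>m\<in>K. cmp a m)" .
    have c: "(\<Oplus>m\<in>K. cmp a m) \<in> carrier S" by (rule finsum_closed) (use a in auto)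
    have "a \<otimes> b = cmp a u \<otimes> b \<oplus> (\<Oplus>m\<in>K. cmp a m) \<otimes> b"
      by (subst aeq) (use a b c in \<open>simp add: l_distr\<close>)
    then have "cmp (a \<otimes> b) ?w = cmp (cmp a u \<otimes> b) ?w \<oplus> cmp ((\<Oplus>m\<in>K. cmp a m) \<otimes> b) ?w"
      using a b c by (simp add: A.GR.component_add)
    also have "cmp (cmp a u \<otimes> b) ?w = cmp a u \<otimes> cmp b v"
      using A.component_smult[OF A.GR.component_props(1)[OF a], of b u v] b by simp
    finally have e: "cmp (a \<otimes> b) ?w = cmp a u \<otimes> cmp b v \<oplus> cmp ((\<Oplus>m\<in>K. cmp a m) \<otimes> b) ?w" .
    let ?r = "cmp ((\<Oplus>m\<in>K. cmp a m) \<otimes> b) ?w"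
    have rP: "?r \<in> P" by (rule rest[OF fK]) (simp add: K_def)
    have "cmp (a \<otimes> b) ?w \<oplus> \<ominus> ?r \<in> P" using PD(4)[OF gP[OF ab] PD(5)[OF rP]] .
    moreover have "cmp (a \<otimes> b) ?w \<oplus> \<ominus> ?r = cmp a u \<otimes> cmp b v"
      unfolding e using a b c by (simp add: a_assoc r_neg)
    ultimately have "cmp a u \<otimes> cmp b v \<in> P" by simp
    then have "cmp b v \<in> P"
      using h[OF A.GR.component_props(1)[OF a]] uv(1) b unfolding X_def by auto
    then show False using uv(2) unfolding Y_def by simp
  qed
qed

end


section \<open>Hilbert functions\<close>

text \<open>The Hilbert function of \<open>N' / N\<close>. The conversion from \<open>enat\<close>
  loses nothing for graded submodules of a \<open>standard_module\<close>, since these lengths are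
  finite.\<close>

definition hilb :: "('a, 'b, 'd) module_scheme \<Rightarrow> 'a set \<Rightarrow> (('s \<Rightarrow> nat) \<Rightarrow> 'b set) \<Rightarrow>
    'b set \<Rightarrow> 'b set \<Rightarrow> ('s \<Rightarrow> nat) \<Rightarrow> real" where
  "hilb M X gr N N' n = real (the_enat (len (closed_sub M X) (N \<inter> gr n) (N' \<inter> gr n)))"

abbreviation (in standard_algebra) "HS \<equiv> hilb (regular_module S) S0 grS"

locale standard_module = standard_algebra S grS F + B: graded_mod S grS M grM
  for S :: "'a ring" (structure) and grS :: "('s::finite \<Rightarrow> nat) \<Rightarrow> 'a set" and F
    and M :: "('a, 'b, 'd) module_scheme" and grM :: "('s \<Rightarrow> nat) \<Rightarrow> 'b set" +
  fixes ms :: "'b list"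
  assumes ms: "set ms \<subseteq> grM (\<lambda>_. 0)"
    and gr_span: "grM n \<subseteq> B.lin_span (grS n) ms"
begin

abbreviation "Q \<equiv> closed_sub M S0"
abbreviation "QS \<equiv> closed_sub (regular_module S) S0"
abbreviation "H \<equiv> hilb M S0 grM"

lemma ms_carrier: "set ms \<subseteq> carrier M" using ms by auto

lemma Q_zero: "Q {\<zero>\<^bsub>M\<^esub>}" by (rule B.closed_sub_zero[OF A.gr0_subset])

lemma QS_zero: "QS {\<zero>}" using A.closed_sub_zero[OF A.gr0_subset] by simp

lemma Q_lin_span: "Q (B.lin_span (grS n) ms)"
  by (rule B.closed_sub_lin_span[OF A.gr0_subset A.closed_sub_gr ms_carrier])

lemma len_gr_le: "len Q {\<zero>\<^bsub>M\<^esub>} (grM n) \<le> of_nat (length ms) * len QS {\<zero>} (grS n)"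
proof -
  let ?L = "B.lin_span (grS n) ms"
  have "len Q {\<zero>\<^bsub>M\<^esub>} (grM n) \<le> len Q {\<zero>\<^bsub>M\<^esub>} ?L"
    by (rule len_mono) (use gr_span Q_lin_span Q_zero in auto)
  also have "?L = sum_sub M {\<zero>\<^bsub>M\<^esub>} ?L"
    using B.sum_sub_zero(1)[of ?L] closed_subD(1)[OF Q_lin_span] by simp
  also have "len Q {\<zero>\<^bsub>M\<^esub>} (sum_sub M {\<zero>\<^bsub>M\<^esub>} ?L) \<le> of_nat (length ms) * len QS {\<zero>} (grS n)"
    by (rule B.len_lin_span_le[OF A.gr0_subset QS_zero A.closed_sub_gr _ ms_carrier Q_zero])
      (use ms_carrier in auto)
  finally show ?thesis .
qed

lemma finite_len_grM: "len Q {\<zero>\<^bsub>M\<^esub>} (grM n) \<noteq> \<infinity>"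
proof -
  obtain c where "len QS {\<zero>} (grS n) = enat c" using finite_len_gr[of n] by auto
  then have "len Q {\<zero>\<^bsub>M\<^esub>} (grM n) \<le> enat (length ms * c)"
    using len_gr_le[of n] by (simp add: of_nat_eq_enat)
  then show ?thesis by (rule le_enat_imp_finite)
qed

lemma finite_len_Int:
  assumes "B.graded_sub N" "B.graded_sub N'"
  shows "len Q (N \<inter> grM n) (N' \<inter> grM n) \<noteq> \<infinity>"
proof -
  obtain c where c: "len Q {\<zero>\<^bsub>M\<^esub>} (grM n) = enat c" using finite_len_grM[of n] by auto
  have "len Q (N \<inter> grM n) (N' \<inter> grM n) \<le> len Q {\<zero>\<^bsub>M\<^esub>} (grM n)"
    by (rule len_mono) (use closed_subD(2)[OF B.graded_sub_Int_gr[OF assms(1), of n]] Q_zero B.closed_sub_gr in auto)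
  then show ?thesis unfolding c by (rule le_enat_imp_finite)
qed

lemma H_nonneg: "0 \<le> H N N' n" by (simp add: hilb_def)

lemma H_self: "H N N n = 0" by (simp add: hilb_def zero_enat_def)

lemma H_add:
  assumes "B.graded_sub N1" "B.graded_sub N2" "B.graded_sub N3" "N1 \<subseteq> N2" "N2 \<subseteq> N3"
  shows "H N1 N3 n = H N1 N2 n + H N2 N3 n"
proof -
  have "len Q (N1 \<inter> grM n) (N3 \<inter> grM n) = len Q (N1 \<inter> grM n) (N2 \<inter> grM n) + len Q (N2 \<inter> grM n) (N3 \<inter> grM n)"
    by (rule B.len_add[OF A.gr0_subset B.graded_sub_Int_gr B.graded_sub_Int_gr B.graded_sub_Int_gr]) (use assms in auto)
  moreover obtain a where "len Q (N1 \<inter> grM n) (N2 \<inter> grM n) = enat a" using finite_len_Int[OF assms(1,2), of n] by auto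
  moreover obtain b where "len Q (N2 \<inter> grM n) (N3 \<inter> grM n) = enat b" using finite_len_Int[OF assms(2,3), of n] by auto
  ultimately show ?thesis by (simp add: hilb_def)
qed

text \<open>The cyclic module \<open>(N + S x) / N\<close> is \<open>S / (N : x)\<close> with
  degrees shifted by \<open>\<delta>\<close>.\<close>

lemma H_quotient:
  assumes N: "B.graded_sub N" and x: "x \<in> grM \<delta>"
  shows "H N (sum_sub M N ((\<lambda>a. a \<odot>\<^bsub>M\<^esub> x) ` carrier S)) (\<lambda>i. n i + \<delta> i)
    = hilb (regular_module S) S0 grS (B.colon N x) (carrier S) n"
proof -
  let ?d = "\<lambda>i. n i + \<delta> i" and ?m = "\<lambda>a. a \<odot>\<^bsub>M\<^esub> x"
  have xc: "x \<in> carrier M" using x by simp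
  have e1: "sum_sub M N (?m ` carrier S) \<inter> grM ?d = sum_sub M (N \<inter> grM ?d) (?m ` grS n)"
    using B.graded_sub_sum_Int_gr[OF N B.graded_sub_multiples[OF x], of ?d] B.multiples_Int_gr[OF x, of n] by simp
  have e2: "carrier S \<inter> grS n = grS n" by auto
  have QA: "QS (B.colon N x \<inter> grS n)"
    by (rule closed_sub_Int[OF closed_sub_antimono[OF B.closed_sub_colon[OF B.graded_subD(1)[OF N] xc] A.gr0_subset] A.closed_sub_gr])
  have iff: "a \<odot>\<^bsub>M\<^esub> x \<in> N \<inter> grM ?d \<longleftrightarrow> a \<in> B.colon N x" if "a \<in> grS n" for a
    using that B.gr_smult[OF that x] unfolding B.colon_def by auto
  have "len Q (N \<inter> grM ?d) (sum_sub M (N \<inter> grM ?d) (?m ` grS n)) = len QS (B.colon N x \<inter> grS n) (grS n)"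
  proof (rule antisym)
    show "len Q (N \<inter> grM ?d) (sum_sub M (N \<inter> grM ?d) (?m ` grS n)) \<le> len QS (B.colon N x \<inter> grS n) (grS n)"
      by (rule len_image_le[OF module_regular_module B.module_axioms B.lin_map_smult_right[OF xc] A.gr0_subset QA
            A.closed_sub_gr _ B.graded_sub_Int_gr[OF N]]) (use iff in auto)
    show "len QS (B.colon N x \<inter> grS n) (grS n) \<le> len Q (N \<inter> grM ?d) (sum_sub M (N \<inter> grM ?d) (?m ` grS n))"
      by (rule len_image_ge[OF module_regular_module B.module_axioms B.lin_map_smult_right[OF xc] A.gr0_subset QA
            A.closed_sub_gr B.graded_sub_Int_gr[OF N]]) (use iff in auto)
  qed
  then show ?thesis unfolding hilb_def e1 e2 by simp
qed

text \<open>The degree-zero part of \<open>M\<close> has finite length, hence ascending chains in it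
  stabilise; adjoining the finite set \<open>F\<close> to the scalars carries the chain condition to
  all of \<open>M\<close>.\<close>

lemma acc: "acc_sub M (carrier S) (carrier M)"
proof -
  have "acc_sub M S0 (grM (\<lambda>_. 0))"
    by (rule finite_len_imp_acc_sub[OF finite_len_grM Q_zero B.closed_sub_gr]) (auto simp: closed_subD(2))
  moreover obtain fs where fs: "set fs = F" using finite_list[OF F(1)] by blast
  moreover have "F \<subseteq> carrier S" using F(2) by auto
  ultimately obtain V where V: "grM (\<lambda>_. 0) \<subseteq> V" "closed_sub M (F \<union> S0) V" "acc_sub M (F \<union> S0) V"
    using B.acc_sub_adjoin[OF A.gr0_subset B.closed_sub_gr, of "\<lambda>_. 0" fs] by blast
  have sub: "F \<union> S0 \<subseteq> carrier S" using \<open>F \<subseteq> carrier S\<close> by auto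
  have cV: "closed_sub M (carrier S) V"
    using B.closed_sub_generate_ring[OF V(2) sub] gen by (simp add: Un_commute)
  have "x \<in> V" if "x \<in> carrier M" for x
    using that
  proof (induction x rule: B.GM.homogeneous_induct)
    case (2 n y)
    have "B.lin_span (grS n) ms \<subseteq> V"
      by (rule B.lin_span_least[OF cV]) (use closed_subD(6)[OF cV] ms V(1) in auto)
    then show ?case using gr_span 2(1) by blast
  next
    case (3 y z)
    then show ?case using closed_subD(4)[OF cV] by blast
  qed (rule that)
  then have "V = carrier M" using closed_subD(1)[OF cV] by blast
  then show ?thesis using acc_sub_antimono[OF V(3) sub] by simp
qed

end

lemma (in standard_algebra) standard_module_regular: "standard_module S grS F (regular_module S) grS [\<one>]"
proof (intro standard_module.intro standard_module_axioms.intro standard_algebra_axioms A.graded_mod_axioms)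
  show "set [\<one>] \<subseteq> grS (\<lambda>_. 0)" using one_gr0 by simp
  show "grS n \<subseteq> A.lin_span (grS n) [\<one>]" for n
  proof
    fix y assume y: "y \<in> grS n"
    then have "y \<otimes> \<one> \<oplus> \<zero> \<in> sum_sub (regular_module S) ((\<lambda>a. a \<otimes> \<one>) ` grS n) {\<zero>}"
      using sum_subI[of "y \<otimes> \<one>" "(\<lambda>a. a \<otimes> \<one>) ` grS n" \<zero> "{\<zero>}" "regular_module S"] by simp
    then show "y \<in> A.lin_span (grS n) [\<one>]" using y by simp
  qed
qed

sublocale standard_algebra \<subseteq> AA: standard_module S grS F "regular_module S" grS "[\<one>]"
  by (rule standard_module_regular)

context standard_module
begin

lemma ev_poly_quotient:
  assumes N: "B.graded_sub N" and x: "x \<in> grM \<delta>" and P: "ev_poly e (HS (B.colon N x) (carrier S))"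
  shows "ev_poly e (H N (sum_sub M N ((\<lambda>a. a \<odot>\<^bsub>M\<^esub> x) ` carrier S)))"
proof (rule ev_poly_translate_cancel[where d = \<delta>])
  show "ev_poly e (\<lambda>n. H N (sum_sub M N ((\<lambda>a. a \<odot>\<^bsub>M\<^esub> x) ` carrier S)) (\<lambda>i. n i + \<delta> i))"
    unfolding H_quotient[OF N x] by (rule P)
qed

text \<open>Such a \<open>P\<close> contains all components of strictly positive degree. This
  disposes of the factors of a prime filtration that do not belong to \<open>Proj\<close>.\<close>

lemma HS_eventually_zero:
  assumes P: "A.graded_sub P" "S_plusplus S grS \<subseteq> P"
  shows "ev_poly e (HS P (carrier S))"
proof (rule ev_poly_0_Suc)
  have "HS P (carrier S) n = 0" if "\<forall>i. 1 \<le> n i" for n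
  proof -
    have "\<forall>i. n i > 0" using that by (simp add: Suc_le_eq)
    then have "grS n \<subseteq> P" using S_plusplus_subset_iff[OF A.graded_subD(1)[OF P(1)]] P(2) by blast
    then have "P \<inter> grS n = carrier S \<inter> grS n" by auto
    then show ?thesis by (simp add: hilb_def zero_enat_def)
  qed
  then show "ev_poly 0 (HS P (carrier S))" by (auto simp: ev_large_def)
qed

text \<open>Prime filtration: adjoin to a submodule \<open>N\<close> a homogeneous \<open>x\<close> whose colon ideal \<open>N : x\<close> is
  maximal, hence prime, and use that chains of submodules stabilise.\<close>

lemma maximal_colon_prime:
  assumes N: "B.graded_sub N" and L: "closed_sub M (carrier S) L" and x: "x \<in> grM \<delta>" "x \<in> L" "x \<notin> N"
    and max: "\<And>\<delta>' y. y \<in> grM \<delta>' \<Longrightarrow> y \<in> L \<Longrightarrow> y \<notin> N \<Longrightarrow> B.colon N x \<subseteq> B.colon N y \<Longrightarrow> B.colon N y = B.colon N x"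
  shows "primeideal (B.colon N x) S" "A.graded_sub (B.colon N x)"
proof -
  have xc: "x \<in> carrier M" using x by simp
  have c: "closed_sub (regular_module S) (carrier S) (B.colon N x)"
    by (rule B.closed_sub_colon[OF B.graded_subD(1)[OF N] xc])
  then show g: "A.graded_sub (B.colon N x)"
    unfolding A.graded_sub_def using B.component_colon[OF N x(1)] by simp
  show "primeideal (B.colon N x) S"
  proof (rule primeideal_if_homogeneous_prime[OF g])
    show "\<one> \<notin> B.colon N x" using x xc unfolding B.colon_def by simp
    fix m a b assume a: "a \<in> grS m" "a \<notin> B.colon N x" and b: "b \<in> carrier S" and ab: "a \<otimes> b \<in> B.colon N x"
    have ac: "a \<in> carrier S" using a by simp
    let ?y = "a \<odot>\<^bsub>M\<^esub> x"
    have y: "?y \<in> grM (\<lambda>i. m i + \<delta> i)" "?y \<in> L" "?y \<notin> N"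
      using B.gr_smult[OF a(1) x(1)] closed_subD(6)[OF L ac x(2)] a ac unfolding B.colon_def by auto
    have "B.colon N x \<subseteq> B.colon N ?y"
    proof
      fix z assume z: "z \<in> B.colon N x"
      then have zc: "z \<in> carrier S" "z \<odot>\<^bsub>M\<^esub> x \<in> N" unfolding B.colon_def by auto
      have "z \<odot>\<^bsub>M\<^esub> ?y = a \<odot>\<^bsub>M\<^esub> (z \<odot>\<^bsub>M\<^esub> x)"
        using zc ac xc by (simp add: B.smult_assoc1[symmetric] m_comm)
      then show "z \<in> B.colon N ?y"
        using zc closed_subD(6)[OF B.graded_subD(1)[OF N] ac zc(2)] unfolding B.colon_def by simp
    qed
    then have "B.colon N ?y = B.colon N x" by (rule max[OF y])
    moreover have "b \<odot>\<^bsub>M\<^esub> ?y = (a \<otimes> b) \<odot>\<^bsub>M\<^esub> x" using ac b xc by (simp add: B.smult_assoc1[symmetric] m_comm)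
    then have "b \<in> B.colon N ?y" using ab b unfolding B.colon_def by simp
    ultimately show "b \<in> B.colon N x" by simp
  qed
qed

text \<open>Instead of a filtration, a graded submodule \<open>N\<close> is taken maximal among
  those between \<open>N0\<close> and \<open>L\<close> for which the claim holds; a further cyclic
  step would contradict maximality. The set \<open>I\<close> kills \<open>L / N0\<close>, so it lies
  in every colon ideal that occurs, and only primes above \<open>I\<close> matter.\<close>

theorem ev_poly_if_primes:
  assumes N0: "B.graded_sub N0" and L: "B.graded_sub L" and sub: "N0 \<subseteq> L"
    and kill: "\<And>a x. a \<in> I \<Longrightarrow> x \<in> L \<Longrightarrow> a \<odot>\<^bsub>M\<^esub> x \<in> N0" and I: "I \<subseteq> carrier S"
    and primes: "\<And>P. P \<in> Proj S grS \<Longrightarrow> I \<subseteq> P \<Longrightarrow> ev_poly e (HS P (carrier S))"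
  shows "ev_poly e (H N0 L)"
proof -
  let ?P = "\<lambda>N. B.graded_sub N \<and> N0 \<subseteq> N \<and> N \<subseteq> L \<and> ev_poly e (H N0 N)"
  have "H N0 N0 = (\<lambda>n. 0)" by (simp add: fun_eq_iff H_self)
  then have P0: "?P N0" using N0 sub ev_poly_zero[of e] by simp
  have cl: "closed_sub M (carrier S) N \<and> N \<subseteq> carrier M" if "?P N" for N
    using that B.graded_subD(1)[of N] closed_subD(1)[of M "carrier S" N] by blast
  have "\<exists>N. ?P N \<and> (\<forall>N'. ?P N' \<longrightarrow> N \<subseteq> N' \<longrightarrow> N' = N)"
    by (rule acc_sub_maximal[where P = ?P, OF acc P0]) (rule cl)
  then obtain N where hN: "?P N \<and> (\<forall>N'. ?P N' \<longrightarrow> N \<subseteq> N' \<longrightarrow> N' = N)" by (elim exE)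
  note N = conjunct1[OF hN]
  have Nmax: "N' = N" if "?P N'" "N \<subseteq> N'" for N'
    using conjunct2[OF hN, rule_format, OF that] .
  have gN: "B.graded_sub N" using N by blast
  have "N = L"
  proof (rule ccontr)
    assume "N \<noteq> L"
    then obtain z where z: "z \<in> L" "z \<notin> N" using N by blast
    have zc: "z \<in> carrier M" using closed_subD(3)[OF B.graded_subD(1)[OF L] z(1)] .
    have "\<exists>n. B.GM.component z n \<notin> N"
    proof (rule ccontr)
      assume h: "\<nexists>n. B.GM.component z n \<notin> N"
      have "z \<in> N"
        by (rule B.GM.component_induct[OF zc]) (use h closed_subD(2,4)[OF B.graded_subD(1)[OF gN]] in auto)
      then show False using z(2) by simp
    qed
    then obtain n where n: "B.GM.component z n \<notin> N" by blast
    let ?C = "\<lambda>J. \<exists>\<delta> y. y \<in> grM \<delta> \<and> y \<in> L \<and> y \<notin> N \<and> J = B.colon N y"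
    have "?C (B.colon N (B.GM.component z n))"
      using B.GM.component_props(1)[OF zc] B.graded_subD(3)[OF L z(1)] n by blast
    moreover have "closed_sub (regular_module S) (carrier S) J \<and> J \<subseteq> carrier (regular_module S)" if "?C J" for J
    proof -
      from that obtain \<delta> y where y: "y \<in> grM \<delta>" "J = B.colon N y" by blast
      then have "y \<in> carrier M" by simp
      then show ?thesis using B.closed_sub_colon[OF B.graded_subD(1)[OF gN]] y(2) closed_subD(1) by blast
    qed
    ultimately obtain J where J: "?C J" and Jmax: "\<And>J'. ?C J' \<Longrightarrow> J \<subseteq> J' \<Longrightarrow> J' = J"
      using acc_sub_maximal[OF AA.acc, of ?C "B.colon N (B.GM.component z n)"] by blast
    obtain \<delta> x where x: "x \<in> grM \<delta>" "x \<in> L" "x \<notin> N" and Jx: "J = B.colon N x" using J by blast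
    have max: "B.colon N y = B.colon N x"
      if "y \<in> grM \<delta>'" "y \<in> L" "y \<notin> N" "B.colon N x \<subseteq> B.colon N y" for \<delta>' y
      using Jmax[of "B.colon N y"] that Jx by blast
    let ?P0 = "B.colon N x"
    have prime: "primeideal ?P0 S" "A.graded_sub ?P0"
      using maximal_colon_prime[OF gN B.graded_subD(1)[OF L] x] max by blast+
    have IP: "I \<subseteq> ?P0" using kill x(2) N I unfolding B.colon_def by blast
    have evP: "ev_poly e (HS ?P0 (carrier S))"
    proof (cases "S_plusplus S grS \<subseteq> ?P0")
      case True
      then show ?thesis by (rule HS_eventually_zero[OF prime(2)])
    next
      case False
      then have "?P0 \<in> Proj S grS" using prime by (simp add: Proj_iff)
      then show ?thesis using IP by (rule primes)
    qed
    let ?Sx = "(\<lambda>a. a \<odot>\<^bsub>M\<^esub> x) ` carrier S"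
    let ?N' = "sum_sub M N ?Sx"
    have gSx: "B.graded_sub ?Sx" by (rule B.graded_sub_multiples[OF x(1)])
    have gN': "B.graded_sub ?N'" by (rule B.graded_sub_sum[OF gN gSx])
    have NN': "N \<subseteq> ?N'" by (rule B.sum_sub_upper1[OF B.graded_subD(1)[OF gN] B.graded_subD(1)[OF gSx]])
    have SxN': "?Sx \<subseteq> ?N'" by (rule B.sum_sub_upper2[OF B.graded_subD(1)[OF gN] B.graded_subD(1)[OF gSx]])
    have "?Sx \<subseteq> L" using closed_subD(6)[OF B.graded_subD(1)[OF L] _ x(2)] by blast
    then have N'L: "?N' \<subseteq> L" using B.sum_sub_least[OF B.graded_subD(1)[OF L]] N by blast
    have "H N0 ?N' = (\<lambda>n. H N0 N n + H N ?N' n)"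
      using H_add[OF N0 gN gN' _ NN'] N by blast
    then have "ev_poly e (H N0 ?N')"
      using ev_poly_add[OF _ ev_poly_quotient[OF gN x(1) evP], of "H N0 N"] N by simp
    then have "?N' = N" using Nmax[of ?N'] gN' NN' N'L N by blast
    moreover have "x \<in> ?Sx" using x(1) by (intro image_eqI[of _ _ \<one>]) auto
    ultimately show False using SxN' x(3) by blast
  qed
  then show ?thesis using N by simp
qed

end

subsection \<open>The degree of the Hilbert polynomial of a homogeneous prime\<close>

text \<open>The first member is prescribed, so that lengths of chains can be bounded for one prime
  at a time.\<close>

definition chain_from :: "'a set set \<Rightarrow> 'a set \<Rightarrow> nat \<Rightarrow> bool" where
  "chain_from V P d \<longleftrightarrow> (\<exists>p. p 0 = P \<and> (\<forall>i\<le>d. p i \<in> V) \<and> (\<forall>i<d. p i \<subset> p (Suc i)))"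

lemma chain_from_Suc:
  assumes "P \<in> V" "P \<subset> P'" "chain_from V P' d" shows "chain_from V P (Suc d)"
proof -
  obtain p where p: "p 0 = P'" "\<forall>i\<le>d. p i \<in> V" "\<forall>i<d. p i \<subset> p (Suc i)"
    using assms(3) unfolding chain_from_def by blast
  let ?q = "\<lambda>i. case i of 0 \<Rightarrow> P | Suc j \<Rightarrow> p j"
  have "?q 0 = P" "\<forall>i\<le>Suc d. ?q i \<in> V" using assms(1) p(2) by (auto split: nat.split)
  moreover have "\<forall>i<Suc d. ?q i \<subset> ?q (Suc i)" using p(1,3) assms(2) by (auto split: nat.split)
  ultimately show ?thesis unfolding chain_from_def by blast
qed

lemma chain_from_SucD:
  assumes "chain_from V P (Suc d)" obtains P' where "P \<in> V" "P \<subset> P'" "chain_from V P' d"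
proof -
  obtain p where p: "p 0 = P" "\<forall>i\<le>Suc d. p i \<in> V" "\<forall>i<Suc d. p i \<subset> p (Suc i)"
    using assms unfolding chain_from_def by blast
  have "chain_from V (p 1) d" unfolding chain_from_def
    by (rule exI[of _ "\<lambda>i. p (Suc i)"]) (use p in auto)
  moreover have "P \<subset> p 1" using p(1,3) by fastforce
  moreover have "P \<in> V" using p(1,2) by force
  ultimately show thesis using that by blast
qed

context standard_algebra
begin

lemma colon_prime:
  assumes P: "P \<in> Proj S grS" and x: "x \<in> carrier S" "x \<notin> P"
  shows "A.colon P x = P"
proof
  show "A.colon P x \<subseteq> P" using ProjD(5)[OF P _ x(1)] x(2) unfolding A.colon_def by auto
  show "P \<subseteq> A.colon P x"
  proof
    fix a assume a: "a \<in> P"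
    then have "a \<in> carrier S" "x \<otimes> a \<in> P"
      using closed_subD(6)[OF ProjD(3)[OF P] x(1) a] closed_subD(3)[OF ProjD(3)[OF P] a] by auto
    then show "a \<in> A.colon P x" unfolding A.colon_def using x(1) by (simp add: m_comm)
  qed
qed

text \<open>Multiplication by \<open>x\<close> is injective on \<open>S / P\<close> and raises
  degrees by \<open>\<delta>\<close>; its cokernel is \<open>S / J\<close>.\<close>

lemma HS_prime_step:
  assumes P: "P \<in> Proj S grS" and x: "x \<in> grS \<delta>" "x \<notin> P"
  defines "J \<equiv> sum_sub (regular_module S) P ((\<lambda>a. a \<otimes> x) ` carrier S)"
  shows "A.graded_sub J" "P \<subseteq> J" "x \<in> J"
    "HS P (carrier S) (\<lambda>i. n i + \<delta> i) - HS P (carrier S) n = HS J (carrier S) (\<lambda>i. n i + \<delta> i)"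
proof -
  have gP: "A.graded_sub P" by (rule ProjD(1)[OF P])
  have xc: "x \<in> carrier S" using x by simp
  have gx: "A.graded_sub ((\<lambda>a. a \<otimes> x) ` carrier S)" using A.graded_sub_multiples[OF x(1)] by simp
  show gJ: "A.graded_sub J" unfolding J_def by (rule A.graded_sub_sum[OF gP gx])
  show PJ: "P \<subseteq> J" unfolding J_def by (rule A.sum_sub_upper1[OF A.graded_subD(1)[OF gP] A.graded_subD(1)[OF gx]])
  have "x \<in> (\<lambda>a. a \<otimes> x) ` carrier S" using xc by (intro image_eqI[of _ _ \<one>]) auto
  then show "x \<in> J" using A.sum_sub_upper2[OF A.graded_subD(1)[OF gP] A.graded_subD(1)[OF gx]] unfolding J_def by blast
  have gS: "A.graded_sub (carrier S)" using A.graded_sub_carrier by simp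
  have JS: "J \<subseteq> carrier S" using closed_subD(1)[OF A.graded_subD(1)[OF gJ]] by simp
  have "HS P J (\<lambda>i. n i + \<delta> i) = HS P (carrier S) n"
    using AA.H_quotient[OF gP x(1), of n] colon_prime[OF P xc x(2)] unfolding J_def by simp
  then show "HS P (carrier S) (\<lambda>i. n i + \<delta> i) - HS P (carrier S) n = HS J (carrier S) (\<lambda>i. n i + \<delta> i)"
    using AA.H_add[OF gP gJ gS PJ JS, of "\<lambda>i. n i + \<delta> i"] by simp
qed

text \<open>With \<open>x\<close> of degree \<open>e_i\<close> outside \<open>P\<close>, the
  difference in direction \<open>i\<close> is the shifted Hilbert function of \<open>S / J\<close>.
  Every prime of \<open>Proj\<close> above \<open>J\<close> contains \<open>P\<close> strictly, so
  the bound for chains starting there drops by one, and \<open>ev_poly_if_primes\<close> passes from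
  these primes to \<open>S / J\<close>.\<close>

theorem ev_poly_prime:
  assumes "P \<in> Proj S grS" "\<And>d. chain_from (Proj S grS) P d \<Longrightarrow> d \<le> e"
  shows "ev_poly (Suc e) (HS P (carrier S))"
  using assms
proof (induction e arbitrary: P rule: less_induct)
  case (less e)
  have gS: "A.graded_sub (carrier S)" using A.graded_sub_carrier by simp
  have "ev_poly e (diff_at i (HS P (carrier S)))" for i
  proof -
    obtain x where x: "x \<in> grS (unit_degree i)" "x \<notin> P" using Proj_unit_degree[OF less.prems(1)] by blast
    define J where "J = sum_sub (regular_module S) P ((\<lambda>a. a \<otimes> x) ` carrier S)"
    note J = HS_prime_step[OF less.prems(1) x, folded J_def]
    have cJ: "closed_sub (regular_module S) (carrier S) J" by (rule A.graded_subD(1)[OF J(1)])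
    have JS: "J \<subseteq> carrier S" using closed_subD(1)[OF cJ] by simp
    have "ev_poly e (HS J (carrier S))"
    proof (rule AA.ev_poly_if_primes[OF J(1) gS JS _ JS])
      show "a \<odot>\<^bsub>regular_module S\<^esub> y \<in> J" if "a \<in> J" "y \<in> carrier S" for a y
        using closed_subD(6)[OF cJ that(2,1)] that JS by (auto simp: m_comm)
      fix P' assume P': "P' \<in> Proj S grS" "J \<subseteq> P'"
      then have PP': "P \<subset> P'" using J(2,3) x(2) by blast
      have ch: "Suc d \<le> e" if "chain_from (Proj S grS) P' d" for d
        using less.prems(2)[OF chain_from_Suc[OF less.prems(1) PP' that]] .
      \<comment> \<open>The one-element chain at \<open>P'\<close> shows that \<open>e\<close> is
        positive; for \<open>e = 0\<close> there is no such \<open>P'\<close>.\<close>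
      have "chain_from (Proj S grS) P' 0" unfolding chain_from_def using P'(1) by (intro exI[of _ "\<lambda>_. P'"]) simp
      then obtain e' where e': "e = Suc e'" using ch by (cases e) auto
      have "ev_poly (Suc e') (HS P' (carrier S))"
        by (rule less.IH) (use e' P'(1) ch in auto)
      then show "ev_poly e (HS P' (carrier S))" using e' by simp
    qed
    then have "ev_poly e (\<lambda>n. HS J (carrier S) (\<lambda>j. n j + unit_degree i j))" by (rule ev_poly_translate)
    moreover have "(\<lambda>n. HS J (carrier S) (\<lambda>j. n j + unit_degree i j)) = diff_at i (HS P (carrier S))"
    proof
      fix n
      have "shift i n = (\<lambda>j. n j + unit_degree i j)" by (auto simp: shift_def unit_degree_def)
      then show "HS J (carrier S) (\<lambda>j. n j + unit_degree i j) = diff_at i (HS P (carrier S)) n"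
        using J(4)[of n] by (simp add: diff_at_def)
    qed
    ultimately show ?thesis by simp
  qed
  then show ?case by simp
qed

text \<open>\<open>P\<close> misses an element of every degree, so no component of
  \<open>S / P\<close> vanishes.\<close>

lemma HS_prime_not_zero:
  assumes P: "P \<in> Proj S grS" shows "\<not> ev_poly 0 (HS P (carrier S))"
proof
    assume "ev_poly 0 (HS P (carrier S))"
    then have "ev_large (\<lambda>n. HS P (carrier S) n = 0)" by simp
    then obtain N where N: "HS P (carrier S) (\<lambda>_. N) = 0" unfolding ev_large_def by auto
    have gP: "A.graded_sub P" by (rule ProjD(1)[OF P])
    have gS: "A.graded_sub (carrier S)" using A.graded_sub_carrier by simp
    let ?n = "\<lambda>_. N"
    obtain x where x: "x \<in> grS ?n" "x \<notin> P" using Proj_gr[OF P] by blast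
    have "sub_chain AA.Q (P \<inter> grS ?n) (carrier S \<inter> grS ?n) (Suc 0)"
    proof (rule sub_chain.step)
      show "sub_chain AA.Q (P \<inter> grS ?n) (P \<inter> grS ?n) 0"
        by (rule sub_chain.base) (use A.graded_sub_Int_gr[OF gP] in auto)
      show "P \<inter> grS ?n \<subset> carrier S \<inter> grS ?n" using x closed_subD(1)[OF A.graded_subD(1)[OF gP]] by auto
      show "AA.Q (carrier S \<inter> grS ?n)" by (rule A.graded_sub_Int_gr[OF gS])
    qed
    then have "enat (Suc 0) \<le> len AA.Q (P \<inter> grS ?n) (carrier S \<inter> grS ?n)" by (rule sub_chain_le_len)
    moreover obtain c where c: "len AA.Q (P \<inter> grS ?n) (carrier S \<inter> grS ?n) = enat c"
      using AA.finite_len_Int[OF gP gS, of ?n] by auto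
    ultimately show False using N by (simp add: hilb_def)
qed

text \<open>For \<open>P\<close> strictly below \<open>P'\<close> and a homogeneous \<open>x\<close>
  in \<open>P'\<close> outside \<open>P\<close>, the Hilbert function of \<open>S / P'\<close> is
  bounded by that of \<open>S / (P + x S)\<close>, which is a difference of the one of
  \<open>S / P\<close>; so the degree drops at every step of the chain. The bound \<open>D\<close>
  makes these functions eventually polynomial to begin with, as \<open>ev_poly_le\<close>
  demands.\<close>

theorem chain_length_less:
  assumes "chain_from (Proj S grS) P d" "ev_poly e (HS P (carrier S))"
    and bound: "\<And>P d. chain_from (Proj S grS) P d \<Longrightarrow> d \<le> D"
  shows "d < e"
  using assms(1,2)
proof (induction d arbitrary: P e)
  case 0
  then have P: "P \<in> Proj S grS" unfolding chain_from_def by auto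
  then have "e \<noteq> 0" using HS_prime_not_zero[OF P] 0(2) by (metis)
  then show ?case by simp
next
  case (Suc d)
  from Suc.prems(1) obtain P' where P': "P \<in> Proj S grS" "P \<subset> P'" "chain_from (Proj S grS) P' d"
    by (rule chain_from_SucD)
  have P'P: "P' \<in> Proj S grS" using P'(3) unfolding chain_from_def by auto
  note gP = ProjD(1)[OF P'(1)] and gP' = ProjD(1)[OF P'P]
  have gS: "A.graded_sub (carrier S)" using A.graded_sub_carrier by simp
  obtain y where y: "y \<in> P'" "y \<notin> P" using P'(2) by blast
  have yc: "y \<in> carrier S" using closed_subD(3)[OF A.graded_subD(1)[OF gP'] y(1)] by simp
  have "\<exists>n. cmp y n \<notin> P"
  proof (rule ccontr)
    assume h: "\<nexists>n. cmp y n \<notin> P"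
    have "y \<in> P"
      by (rule A.GR.component_induct[OF yc]) (use h closed_subD(2,4)[OF A.graded_subD(1)[OF gP]] in auto)
    then show False using y(2) by simp
  qed
  then obtain \<delta> where "cmp y \<delta> \<notin> P" by blast
  then obtain x where x: "x \<in> grS \<delta>" "x \<notin> P" "x \<in> P'"
    using A.graded_subD(3)[OF gP' y(1)] A.GR.component_props(1)[OF yc] by auto
  define J where "J = sum_sub (regular_module S) P ((\<lambda>a. a \<otimes> x) ` carrier S)"
  note J = HS_prime_step[OF P'(1) x(1,2), folded J_def]
  have "(\<lambda>a. a \<otimes> x) ` carrier S \<subseteq> P'" using closed_subD(6)[OF A.graded_subD(1)[OF gP'] _ x(3)] by auto
  then have JP': "J \<subseteq> P'" unfolding J_def using A.sum_sub_least[OF A.graded_subD(1)[OF gP']] P'(2) by blast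
  have P'S: "P' \<subseteq> carrier S" using closed_subD(1)[OF A.graded_subD(1)[OF gP']] by simp
  have le: "0 \<le> HS P' (carrier S) (\<lambda>i. n i + \<delta> i) \<and> HS P' (carrier S) (\<lambda>i. n i + \<delta> i)
      \<le> HS P (carrier S) (\<lambda>i. n i + \<delta> i) - HS P (carrier S) n" for n
    using J(4)[of n] AA.H_add[OF J(1) gP' gS JP' P'S, of "\<lambda>i. n i + \<delta> i"] AA.H_nonneg[of J P' "\<lambda>i. n i + \<delta> i"]
      AA.H_nonneg[of P' "carrier S" "\<lambda>i. n i + \<delta> i"] by simp
  have evP': "ev_poly (Suc D) (HS P' (carrier S))" by (rule ev_poly_prime[OF P'P bound])
  have "e \<noteq> 0" using HS_prime_not_zero[OF P'(1)] Suc.prems(2) by metis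
  then obtain e' where e': "e = Suc e'" by (cases e) auto
  have ev: "ev_poly e' (\<lambda>n. HS P (carrier S) (\<lambda>i. n i + \<delta> i) - HS P (carrier S) n)"
    by (rule ev_poly_Suc_translate_diff) (use Suc.prems(2) e' in simp)
  have "ev_poly e' (\<lambda>n. HS P' (carrier S) (\<lambda>i. n i + \<delta> i))"
    by (rule ev_poly_le[OF _ ev ev_poly_translate[OF evP']]) (use le in \<open>auto simp: ev_large_def\<close>)
  then have "ev_poly e' (HS P' (carrier S))" by (rule ev_poly_translate_cancel)
  then have "d < e'" by (rule Suc.IH[OF P'(3)])
  then show ?case using e' by simp
qed

end


section \<open>Modules with a rank\<close>

text \<open>Evaluates the unions over representatives by which operations on classes are
  given.\<close>

lemma UN_constant_eq: "C \<noteq> {} \<Longrightarrow> (\<And>p. p \<in> C \<Longrightarrow> f p = z) \<Longrightarrow> (\<Union>p\<in>C. f p) = z"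
  by auto

lemma UN_constant_eq2:
  assumes "C \<noteq> {}" "D \<noteq> {}" "\<And>x w y v. (x, w) \<in> C \<Longrightarrow> (y, v) \<in> D \<Longrightarrow> f x w y v = z"
  shows "(\<Union>(x, w)\<in>C. \<Union>(y, v)\<in>D. f x w y v) = z"
proof (rule UN_constant_eq[OF assms(1)])
  fix p assume p: "p \<in> C"
  have "(\<Union>(y, v)\<in>D. f (fst p) (snd p) y v) = z"
    by (rule UN_constant_eq[OF assms(2)]) (use p assms(3)[of "fst p" "snd p"] in auto)
  then show "(case p of (x, w) \<Rightarrow> \<Union>(y, v)\<in>D. f x w y v) = z" by (simp add: case_prod_unfold)
qed

lemma ex1_eqI: "\<exists>!x. P x \<Longrightarrow> P a \<Longrightarrow> P b \<Longrightarrow> a = b"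
  by blast

section \<open>Arithmetic in the total ring of fractions\<close>

context cring
begin

abbreviation "nzd \<equiv> nonzerodivisors R"
abbreviation "frc \<equiv> fraction (nonzerodivisors R) (regular_module R)"
abbreviation "tfr \<equiv> total_fraction_ring R"

lemma nzd_closed [simp]: "w \<in> nzd \<Longrightarrow> w \<in> carrier R"
  unfolding nonzerodivisors_def by simp

lemma nzdD: "w \<in> nzd \<Longrightarrow> b \<in> carrier R \<Longrightarrow> w \<otimes> b = \<zero> \<Longrightarrow> b = \<zero>"
  unfolding nonzerodivisors_def by simp

lemma one_nzd [simp]: "\<one> \<in> nzd"
  unfolding nonzerodivisors_def by simp

lemma mult_nzd [simp]:
  assumes "w \<in> nzd" "v \<in> nzd" shows "w \<otimes> v \<in> nzd"
proof -
  have "b = \<zero>" if b: "b \<in> carrier R" "w \<otimes> v \<otimes> b = \<zero>" for b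
  proof -
    have "w \<otimes> (v \<otimes> b) = \<zero>" using assms b by (simp add: m_assoc)
    then have "v \<otimes> b = \<zero>" using nzdD[OF assms(1)] assms(2) b(1) by simp
    then show ?thesis using nzdD[OF assms(2) b(1)] by simp
  qed
  moreover have "w \<otimes> v \<in> carrier R" using assms by simp
  ultimately show ?thesis unfolding nonzerodivisors_def by blast
qed

lemma nzd_cancel:
  assumes "w \<in> nzd" "a \<in> carrier R" "b \<in> carrier R" "w \<otimes> a = w \<otimes> b" shows "a = b"
proof -
  have "w \<otimes> (a \<ominus> b) = w \<otimes> a \<ominus> w \<otimes> b" using assms(1-3) by (simp add: a_minus_def r_distr r_minus)
  then have "w \<otimes> (a \<ominus> b) = \<zero>" using assms by (simp add: a_minus_def r_neg)
  then have "a \<ominus> b = \<zero>" using nzdD[OF assms(1)] assms(2,3) by simp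
  then show ?thesis using assms(2,3) by simp
qed

text \<open>Nonzerodivisors cancel, so equality of fractions reduces to cross
  multiplication.\<close>

lemma mem_frac_iff: "(b, v) \<in> frc a w \<longleftrightarrow>
    a \<in> carrier R \<and> w \<in> nzd \<and> b \<in> carrier R \<and> v \<in> nzd \<and> v \<otimes> a = w \<otimes> b"
  unfolding fraction_def frac_rel_def using nzd_cancel[of _ "v \<otimes> a" "w \<otimes> b"] by (auto intro!: bexI[of _ \<one>])

lemma frac_self: "a \<in> carrier R \<Longrightarrow> w \<in> nzd \<Longrightarrow> (a, w) \<in> frc a w"
  by (simp add: mem_frac_iff)

lemma frac_eq_iff:
  assumes "a \<in> carrier R" "w \<in> nzd" "b \<in> carrier R" "v \<in> nzd"
  shows "frc a w = frc b v \<longleftrightarrow> v \<otimes> a = w \<otimes> b"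
proof
  assume "frc a w = frc b v"
  then have "(b, v) \<in> frc a w" using frac_self[OF assms(3,4)] by simp
  then show "v \<otimes> a = w \<otimes> b" by (simp add: mem_frac_iff)
next
  assume e: "v \<otimes> a = w \<otimes> b"
  have "u \<otimes> a = w \<otimes> c \<longleftrightarrow> u \<otimes> b = v \<otimes> c" if "c \<in> carrier R" "u \<in> nzd" for c u
  proof
    assume h: "u \<otimes> a = w \<otimes> c"
    have "w \<otimes> (u \<otimes> b) = u \<otimes> (v \<otimes> a)" using e assms that by (simp add: m_lcomm[of w u])
    also have "\<dots> = v \<otimes> (w \<otimes> c)" using h assms that by (simp add: m_lcomm[of u v])
    also have "\<dots> = w \<otimes> (v \<otimes> c)" using assms that by (simp add: m_lcomm)
    finally show "u \<otimes> b = v \<otimes> c" using assms that nzd_cancel[of w "u \<otimes> b" "v \<otimes> c"] by simp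
  next
    assume h: "u \<otimes> b = v \<otimes> c"
    have "v \<otimes> (u \<otimes> a) = u \<otimes> (w \<otimes> b)" using e assms that by (simp add: m_lcomm[of v u])
    also have "\<dots> = w \<otimes> (v \<otimes> c)" using h assms that by (simp add: m_lcomm[of u w])
    also have "\<dots> = v \<otimes> (w \<otimes> c)" using assms that by (simp add: m_lcomm)
    finally show "u \<otimes> a = w \<otimes> c" using assms that nzd_cancel[of v "u \<otimes> a" "w \<otimes> c"] by simp
  qed
  then show "frc a w = frc b v" using assms by (auto simp: mem_frac_iff)
qed

lemma tfr_carrier: "carrier tfr = {frc a w | a w. a \<in> carrier R \<and> w \<in> nzd}"
  unfolding total_fraction_ring_def localized_ring_def localized_module_def quotient_def fraction_def
  by (auto simp: Let_def)

lemma frac_in_tfr [simp]: "a \<in> carrier R \<Longrightarrow> w \<in> nzd \<Longrightarrow> frc a w \<in> carrier tfr"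
  unfolding tfr_carrier by blast

lemma tfrE: assumes "q \<in> carrier tfr" obtains a w where "a \<in> carrier R" "w \<in> nzd" "q = frc a w"
  using assms unfolding tfr_carrier by blast

lemma tfr_add:
  assumes "a \<in> carrier R" "w \<in> nzd" "b \<in> carrier R" "v \<in> nzd"
  shows "frc a w \<oplus>\<^bsub>tfr\<^esub> frc b v = frc (v \<otimes> a \<oplus> w \<otimes> b) (w \<otimes> v)"
proof -
  have 1: "frc (v' \<otimes> x \<oplus> w' \<otimes> y) (w' \<otimes> v') = frc (v \<otimes> a \<oplus> w \<otimes> b) (w \<otimes> v)"
    if "(x, w') \<in> frc a w" "(y, v') \<in> frc b v" for x w' y v'
  proof -
    have h: "x \<in> carrier R" "w' \<in> nzd" "w' \<otimes> a = w \<otimes> x" "y \<in> carrier R" "v' \<in> nzd" "v' \<otimes> b = v \<otimes> y"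
      using that by (simp_all add: mem_frac_iff)
    have "(w \<otimes> v) \<otimes> (v' \<otimes> x \<oplus> w' \<otimes> y) = (v \<otimes> v') \<otimes> (w \<otimes> x) \<oplus> (w \<otimes> w') \<otimes> (v \<otimes> y)"
      using assms h(1,2,4,5) by (simp add: r_distr m_ac)
    also have "\<dots> = (v \<otimes> v') \<otimes> (w' \<otimes> a) \<oplus> (w \<otimes> w') \<otimes> (v' \<otimes> b)" using h by simp
    also have "\<dots> = (w' \<otimes> v') \<otimes> (v \<otimes> a \<oplus> w \<otimes> b)" using assms h(1,2,4,5) by (simp add: r_distr m_ac)
    finally show ?thesis using assms h by (subst frac_eq_iff) auto
  qed
  have "frc a w \<oplus>\<^bsub>tfr\<^esub> frc b v
      = (\<Union>(x, w')\<in>frc a w. \<Union>(y, v')\<in>frc b v. frc (v' \<otimes> x \<oplus> w' \<otimes> y) (w' \<otimes> v'))"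
    unfolding total_fraction_ring_def localized_ring_def localized_module_def by (simp add: Let_def)
  also have "\<dots> = frc (v \<otimes> a \<oplus> w \<otimes> b) (w \<otimes> v)"
    by (rule UN_constant_eq2) (use frac_self[OF assms(1,2)] frac_self[OF assms(3,4)] in blast, use frac_self[OF assms(3,4)] in blast, rule 1)
  finally show ?thesis .
qed

lemma tfr_mult:
  assumes "a \<in> carrier R" "w \<in> nzd" "b \<in> carrier R" "v \<in> nzd"
  shows "frc a w \<otimes>\<^bsub>tfr\<^esub> frc b v = frc (a \<otimes> b) (w \<otimes> v)"
proof -
  have 1: "frc (x \<otimes> y) (w' \<otimes> v') = frc (a \<otimes> b) (w \<otimes> v)"
    if "(x, w') \<in> frc a w" "(y, v') \<in> frc b v" for x w' y v'
  proof -
    have h: "x \<in> carrier R" "w' \<in> nzd" "w' \<otimes> a = w \<otimes> x" "y \<in> carrier R" "v' \<in> nzd" "v' \<otimes> b = v \<otimes> y"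
      using that by (simp_all add: mem_frac_iff)
    have "(w \<otimes> v) \<otimes> (x \<otimes> y) = (w \<otimes> x) \<otimes> (v \<otimes> y)" using assms h(1,2,4,5) by (simp add: m_ac)
    also have "\<dots> = (w' \<otimes> a) \<otimes> (v' \<otimes> b)" using h by simp
    also have "\<dots> = (w' \<otimes> v') \<otimes> (a \<otimes> b)" using assms h(1,2,4,5) by (simp add: m_ac)
    finally show ?thesis using assms h by (subst frac_eq_iff) auto
  qed
  have "frc a w \<otimes>\<^bsub>tfr\<^esub> frc b v
      = (\<Union>(x, w')\<in>frc a w. \<Union>(y, v')\<in>frc b v. frc (x \<otimes> y) (w' \<otimes> v'))"
    unfolding total_fraction_ring_def localized_ring_def localized_module_def by (simp add: Let_def)
  also have "\<dots> = frc (a \<otimes> b) (w \<otimes> v)"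
    by (rule UN_constant_eq2) (use frac_self[OF assms(1,2)] frac_self[OF assms(3,4)] in blast, use frac_self[OF assms(3,4)] in blast, rule 1)
  finally show ?thesis .
qed

lemma tfr_mult_closed: "p \<in> carrier tfr \<Longrightarrow> q \<in> carrier tfr \<Longrightarrow> p \<otimes>\<^bsub>tfr\<^esub> q \<in> carrier tfr"
  by (elim tfrE) (simp add: tfr_mult)

lemma tfr_r_distr:
  assumes "p \<in> carrier tfr" "q \<in> carrier tfr" "q' \<in> carrier tfr"
  shows "p \<otimes>\<^bsub>tfr\<^esub> (q \<oplus>\<^bsub>tfr\<^esub> q') = p \<otimes>\<^bsub>tfr\<^esub> q \<oplus>\<^bsub>tfr\<^esub> p \<otimes>\<^bsub>tfr\<^esub> q'"
proof -
  obtain a w b v c u where h: "a \<in> carrier R" "w \<in> nzd" "p = frc a w" "b \<in> carrier R" "v \<in> nzd" "q = frc b v"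
      "c \<in> carrier R" "u \<in> nzd" "q' = frc c u"
    using assms by (elim tfrE)
  show ?thesis unfolding h(3,6,9) using h(1,2,4,5,7,8)
    by (simp add: tfr_add tfr_mult frac_eq_iff r_distr m_ac)
qed

lemma tfr_mult_lcomm:
  assumes "p \<in> carrier tfr" "q \<in> carrier tfr" "q' \<in> carrier tfr"
  shows "p \<otimes>\<^bsub>tfr\<^esub> (q \<otimes>\<^bsub>tfr\<^esub> q') = q \<otimes>\<^bsub>tfr\<^esub> (p \<otimes>\<^bsub>tfr\<^esub> q')"
proof -
  obtain a w b v c u where h: "a \<in> carrier R" "w \<in> nzd" "p = frc a w" "b \<in> carrier R" "v \<in> nzd" "q = frc b v"
      "c \<in> carrier R" "u \<in> nzd" "q' = frc c u"
    using assms by (elim tfrE)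
  show ?thesis unfolding h(3,6,9) using h(1,2,4,5,7,8)
    by (simp add: tfr_mult frac_eq_iff m_ac)
qed

lemma to_tfr: "to_total_fraction_ring R a = frc a \<one>"
  unfolding to_total_fraction_ring_def by simp

definition frac_scalars :: "('a, ('a \<times> 'a) set) module" where
  "frac_scalars = restrict_scalars (to_total_fraction_ring R) tfr"

lemma frac_scalars_simps [simp]:
  "carrier frac_scalars = carrier tfr" "p \<oplus>\<^bsub>frac_scalars\<^esub> q = p \<oplus>\<^bsub>tfr\<^esub> q"
  "a \<odot>\<^bsub>frac_scalars\<^esub> q = frc a \<one> \<otimes>\<^bsub>tfr\<^esub> q"
  unfolding frac_scalars_def restrict_scalars_def by (simp_all add: to_tfr)

definition dens :: "'a \<Rightarrow> ('a \<times> 'a) set set" where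
  "dens t = {frc a t | a. a \<in> carrier R}"

definition numer :: "'a \<Rightarrow> ('a \<times> 'a) set \<Rightarrow> 'a" where
  "numer t q = (THE a. a \<in> carrier R \<and> q = frc a t)"

lemma numer_frac: assumes "t \<in> nzd" "a \<in> carrier R" shows "numer t (frc a t) = a"
  unfolding numer_def
proof (rule the_equality)
  fix b assume b: "b \<in> carrier R \<and> frc a t = frc b t"
  then have "t \<otimes> a = t \<otimes> b" using assms frac_eq_iff[of a t b t] by simp
  then show "b = a" using nzd_cancel[OF assms, of b] b by simp
qed (use assms in simp)

lemma densE: assumes "q \<in> dens t" obtains a where "a \<in> carrier R" "q = frc a t"
  using assms unfolding dens_def by blast

lemma frac_expand: "a \<in> carrier R \<Longrightarrow> t \<in> nzd \<Longrightarrow> s \<in> nzd \<Longrightarrow> frc a t = frc (s \<otimes> a) (s \<otimes> t)"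
  by (simp add: frac_eq_iff m_ac)

lemma dens_mult: "q \<in> dens t \<Longrightarrow> t \<in> nzd \<Longrightarrow> s \<in> nzd \<Longrightarrow> q \<in> dens (s \<otimes> t)"
proof (elim densE)
  fix a assume a: "t \<in> nzd" "s \<in> nzd" "a \<in> carrier R" "q = frc a t"
  have "q = frc (s \<otimes> a) (s \<otimes> t)" unfolding a(4) by (rule frac_expand[OF a(3,1,2)])
  then show "q \<in> dens (s \<otimes> t)" unfolding dens_def using a by auto
qed

end

text \<open>A relation between formal sums of tensors can be checked after clearing denominators: \<open>tval t X\<close>
  is \<open>t\<close> times the image of the formal sum \<open>X\<close> in the localization of \<open>M\<close>.\<close>

context module
begin

abbreviation "teq \<equiv> tensor_eq R M frac_scalars"

text \<open>The guard makes the step total and leaves \<open>m\<close> unchanged on pairs without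
  denominator \<open>t\<close>; steps then commute on all arguments, as a fold over multisets
  demands.\<close>

definition tval_step :: "'a \<Rightarrow> 'c \<times> ('a \<times> 'a) set \<Rightarrow> 'c \<Rightarrow> 'c" where
  "tval_step t p m = (if fst p \<in> carrier M \<and> snd p \<in> dens t \<and> m \<in> carrier M
     then numer t (snd p) \<odot>\<^bsub>M\<^esub> fst p \<oplus>\<^bsub>M\<^esub> m else m)"

definition tval :: "'a \<Rightarrow> ('c \<times> ('a \<times> 'a) set) multiset \<Rightarrow> 'c" where
  "tval t X = fold_mset (tval_step t) \<zero>\<^bsub>M\<^esub> X"

definition dens_ok :: "'a \<Rightarrow> ('c \<times> ('a \<times> 'a) set) multiset \<Rightarrow> bool" where
  "dens_ok t X \<longleftrightarrow> set_mset X \<subseteq> carrier M \<times> dens t"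

lemma numer_closed: "t \<in> nzd \<Longrightarrow> q \<in> dens t \<Longrightarrow> numer t q \<in> carrier R"
  by (elim densE) (simp add: numer_frac)

lemma comp_fun_commute_tval_step: "t \<in> nzd \<Longrightarrow> comp_fun_commute (tval_step t)"
  by unfold_locales (auto simp: fun_eq_iff tval_step_def numer_closed M.a_lcomm)

lemma tval_empty [simp]: "tval t {#} = \<zero>\<^bsub>M\<^esub>" by (simp add: tval_def)

lemma tval_add_mset: "t \<in> nzd \<Longrightarrow> tval t (add_mset p X) = tval_step t p (tval t X)"
  unfolding tval_def using comp_fun_commute.fold_mset_add_mset[OF comp_fun_commute_tval_step] .

lemma tval_closed [simp]: "t \<in> nzd \<Longrightarrow> tval t X \<in> carrier M"
  by (induction X) (auto simp: tval_add_mset tval_step_def numer_closed)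

lemma tval_add_frac [simp]:
  assumes "t \<in> nzd" "x \<in> carrier M" "a \<in> carrier R"
  shows "tval t (add_mset (x, frc a t) X) = a \<odot>\<^bsub>M\<^esub> x \<oplus>\<^bsub>M\<^esub> tval t X"
  using assms by (auto simp: tval_add_mset tval_step_def numer_frac dens_def)

lemma dens_ok_add_msetE:
  assumes "dens_ok t (add_mset p X)"
  obtains x a where "p = (x, frc a t)" "x \<in> carrier M" "a \<in> carrier R" "dens_ok t X"
  using assms unfolding dens_ok_def by (cases p) (auto elim!: densE)

lemma tval_union:
  assumes "t \<in> nzd" "dens_ok t X" shows "tval t (X + Y) = tval t X \<oplus>\<^bsub>M\<^esub> tval t Y"
  using assms(2)
proof (induction X)
  case (add p X)
  from add.prems obtain x a where p: "p = (x, frc a t)" "x \<in> carrier M" "a \<in> carrier R" "dens_ok t X"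
    by (rule dens_ok_add_msetE)
  then show ?case using add.IH assms(1) by (simp add: M.a_assoc)
qed (use assms(1) in simp)

text \<open>Makes values for different denominators comparable, as the transitivity and sum rules of
  the congruence demand.\<close>

lemma tval_scale:
  assumes "t \<in> nzd" "s \<in> nzd" "dens_ok t X"
  shows "dens_ok (s \<otimes> t) X \<and> tval (s \<otimes> t) X = s \<odot>\<^bsub>M\<^esub> tval t X"
  using assms(3)
proof (induction X)
  case empty
  then show ?case using assms by (simp add: dens_ok_def)
next
  case (add p X)
  from add.prems obtain x a where p: "p = (x, frc a t)" "x \<in> carrier M" "a \<in> carrier R" "dens_ok t X"
    by (rule dens_ok_add_msetE)
  have e: "frc a t = frc (s \<otimes> a) (s \<otimes> t)" by (rule frac_expand[OF p(3) assms(1,2)])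
  have "tval (s \<otimes> t) (add_mset p X) = (s \<otimes> a) \<odot>\<^bsub>M\<^esub> x \<oplus>\<^bsub>M\<^esub> s \<odot>\<^bsub>M\<^esub> tval t X"
    unfolding p(1) e using assms p add.IH by simp
  also have "\<dots> = s \<odot>\<^bsub>M\<^esub> tval t (add_mset p X)"
    unfolding p(1) using assms p by (simp add: smult_assoc1 smult_r_distr)
  finally have "tval (s \<otimes> t) (add_mset p X) = s \<odot>\<^bsub>M\<^esub> tval t (add_mset p X)" .
  moreover have "dens_ok (s \<otimes> t) (add_mset p X)"
    using add.IH p assms dens_mult[of "frc a t" t s] unfolding dens_ok_def dens_def by auto
  ultimately show ?case by simp
qed

lemma ex_dens_ok: "set_mset X \<subseteq> carrier M \<times> carrier tfr \<Longrightarrow> \<exists>t\<in>nzd. dens_ok t X"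
proof (induction X)
  case empty
  then show ?case by (intro bexI[of _ \<one>]) (simp_all add: dens_ok_def)
next
  case (add p X)
  then obtain t where t: "t \<in> nzd" "dens_ok t X" by auto
  from add.prems obtain x a w where p: "p = (x, frc a w)" "x \<in> carrier M" "a \<in> carrier R" "w \<in> nzd"
    by (cases p) (auto elim!: tfrE)
  have "dens_ok (w \<otimes> t) X" using tval_scale[OF t(1) p(4) t(2)] by simp
  moreover have "frc a w \<in> dens (t \<otimes> w)" by (rule dens_mult) (use p t in \<open>auto simp: dens_def\<close>)
  ultimately have "dens_ok (w \<otimes> t) (add_mset p X)"
    using p t by (simp add: dens_ok_def m_comm)
  then show ?case using p(4) t(1) by (intro bexI[of _ "w \<otimes> t"]) auto
qed

text \<open>Induction over the congruence: each generating relation becomes an identity in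
  \<open>M\<close> once denominators are cleared. This replaces the map from the tensor product to
  the localization of \<open>M\<close> and is the device that extracts equalities in
  \<open>M\<close> from equalities of tensors.\<close>

theorem tensor_eq_tval:
  assumes "teq X Y"
  shows "\<exists>t\<in>nzd. dens_ok t X \<and> dens_ok t Y \<and> tval t X = tval t Y"
  using assms
proof (induction rule: tensor_eq.induct)
  case (tensor_refl X)
  then show ?case using ex_dens_ok by auto
next
  case (tensor_sym X Y)
  then show ?case by metis
next
  case (tensor_trans X Y Z)
  then obtain t s where t: "t \<in> nzd" "dens_ok t X" "dens_ok t Y" "tval t X = tval t Y"
    and s: "s \<in> nzd" "dens_ok s Y" "dens_ok s Z" "tval s Y = tval s Z" by blast
  have st: "s \<otimes> t = t \<otimes> s" using t(1) s(1) by (simp add: m_comm)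
  have "tval (s \<otimes> t) X = tval (s \<otimes> t) Y" using tval_scale[OF t(1) s(1)] t by simp
  also have "\<dots> = tval (t \<otimes> s) Z" unfolding st using tval_scale[OF s(1) t(1)] s by simp
  finally have "tval (s \<otimes> t) X = tval (s \<otimes> t) Z" unfolding st .
  then show ?case using tval_scale[OF t(1) s(1) t(2)] tval_scale[OF s(1) t(1) s(3)] st t(1) s(1)
    by (intro bexI[of _ "s \<otimes> t"]) auto
next
  case (tensor_plus X Y X' Y')
  then obtain t s where t: "t \<in> nzd" "dens_ok t X" "dens_ok t Y" "tval t X = tval t Y"
    and s: "s \<in> nzd" "dens_ok s X'" "dens_ok s Y'" "tval s X' = tval s Y'" by blast
  have st: "t \<otimes> s = s \<otimes> t" using t(1) s(1) by (simp add: m_comm)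
  note ok = tval_scale[OF t(1) s(1) t(2)] tval_scale[OF t(1) s(1) t(3)]
    tval_scale[OF s(1) t(1) s(2), unfolded st] tval_scale[OF s(1) t(1) s(3), unfolded st]
  have n: "s \<otimes> t \<in> nzd" using s t by simp
  have "dens_ok (s \<otimes> t) (X + X')" "dens_ok (s \<otimes> t) (Y + Y')" using ok by (auto simp: dens_ok_def)
  moreover have "tval (s \<otimes> t) (X + X') = tval (s \<otimes> t) (Y + Y')"
    using ok n t(4) s(4) by (simp add: tval_union)
  ultimately show ?case using n by blast
next
  case (tensor_zero y)
  then obtain a w where y: "a \<in> carrier R" "w \<in> nzd" "y = frc a w" by (auto elim: tfrE)
  show ?case by (rule bexI[OF _ y(2)]) (use y in \<open>auto simp: dens_ok_def dens_def\<close>)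
next
  case (tensor_add_left x x' y)
  then obtain a w where y: "a \<in> carrier R" "w \<in> nzd" "y = frc a w" by (auto elim: tfrE)
  show ?case by (rule bexI[OF _ y(2)])
    (use y tensor_add_left in \<open>auto simp: dens_ok_def dens_def smult_r_distr M.a_assoc\<close>)
next
  case (tensor_add_right x y y')
  then obtain a w where y: "a \<in> carrier R" "w \<in> nzd" "y = frc a w" by (auto elim: tfrE)
  obtain b v where y': "b \<in> carrier R" "v \<in> nzd" "y' = frc b v" using tensor_add_right by (auto elim: tfrE)
  have n: "w \<otimes> v \<in> nzd" using y y' by simp
  have e: "y = frc (v \<otimes> a) (w \<otimes> v)" "y' = frc (w \<otimes> b) (w \<otimes> v)"
    using y y' frac_expand[of a w v] frac_expand[of b v w] by (simp_all add: m_comm)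
  have s: "y \<oplus>\<^bsub>frac_scalars\<^esub> y' = frc (v \<otimes> a \<oplus> w \<otimes> b) (w \<otimes> v)" using y y' by (simp add: tfr_add)
  show ?case unfolding s unfolding e
    by (rule bexI[OF _ n])
      (use n y(1,2) y'(1,2) tensor_add_right(1) in \<open>auto simp: dens_ok_def dens_def smult_l_distr M.a_assoc\<close>)
next
  case (tensor_balanced a x y)
  then obtain b v where y: "b \<in> carrier R" "v \<in> nzd" "y = frc b v" by (auto elim: tfrE)
  have e: "a \<odot>\<^bsub>frac_scalars\<^esub> y = frc (a \<otimes> b) v" using y tensor_balanced by (simp add: tfr_mult)
  have c: "b \<odot>\<^bsub>M\<^esub> (a \<odot>\<^bsub>M\<^esub> x) = (a \<otimes> b) \<odot>\<^bsub>M\<^esub> x"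
    using y tensor_balanced by (simp add: smult_assoc1[symmetric] m_comm)
  show ?case unfolding e unfolding y(3)
    by (rule bexI[OF _ y(2)]) (use y(1,2) tensor_balanced c in \<open>auto simp: dens_ok_def dens_def\<close>)
qed

subsection \<open>The module over the total ring of fractions\<close>

abbreviation "tvalid X \<equiv> set_mset X \<subseteq> carrier M \<times> carrier tfr"
abbreviation "tcls \<equiv> tensor_class R M frac_scalars"
abbreviation "tmod \<equiv> base_change R (to_total_fraction_ring R) tfr M"

lemma tcls_eqI: "teq X Y \<Longrightarrow> tcls X = tcls Y"
  unfolding tensor_class_def by (blast intro: tensor_trans tensor_sym)

lemma teq_refl: "tvalid X \<Longrightarrow> teq X X"
  by (rule tensor_refl) simp

lemma tcls_eqD: "tcls X = tcls Y \<Longrightarrow> tvalid Y \<Longrightarrow> teq X Y"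
  unfolding tensor_class_def using teq_refl[of Y] by blast

lemma tmod_simps:
  "carrier tmod = tcls ` {X. tvalid X}" "\<zero>\<^bsub>tmod\<^esub> = tcls {#}"
  "ring.add tmod = (\<lambda>C D. \<Union>X\<in>C. \<Union>Y\<in>D. tcls (X + Y))"
  "smult tmod = (\<lambda>q C. \<Union>X\<in>C. tcls (image_mset (\<lambda>(x, b). (x, q \<otimes>\<^bsub>tfr\<^esub> b)) X))"
  unfolding base_change_def frac_scalars_def[symmetric] by (simp_all add: Let_def)

lemma tmod_add:
  assumes "tvalid X" "tvalid Y" shows "tcls X \<oplus>\<^bsub>tmod\<^esub> tcls Y = tcls (X + Y)"
proof -
  have ne: "tcls X \<noteq> {}" "tcls Y \<noteq> {}" using teq_refl assms unfolding tensor_class_def by blast+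
  have "tcls (X' + Y') = tcls (X + Y)" if "X' \<in> tcls X" "Y' \<in> tcls Y" for X' Y'
  proof -
    have "teq X X'" "teq Y Y'" using that unfolding tensor_class_def by auto
    then show ?thesis by (intro tcls_eqI[symmetric] tensor_plus)
  qed
  then have "(\<Union>Y'\<in>tcls Y. tcls (X' + Y')) = tcls (X + Y)" if "X' \<in> tcls X" for X'
    using that by (intro UN_constant_eq ne(2))
  then show ?thesis unfolding tmod_simps by (rule UN_constant_eq[OF ne(1)])
qed

lemma teq_scale:
  assumes "teq X Y" "q \<in> carrier tfr"
  shows "teq (image_mset (\<lambda>(x, b). (x, q \<otimes>\<^bsub>tfr\<^esub> b)) X) (image_mset (\<lambda>(x, b). (x, q \<otimes>\<^bsub>tfr\<^esub> b)) Y)"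
  using assms(1)
proof (induction rule: tensor_eq.induct)
  case (tensor_refl X)
  then show ?case by (intro tensor_eq.tensor_refl) (auto simp: tfr_mult_closed assms(2))
next
  case (tensor_trans X Y Z)
  then show ?case by (blast intro: tensor_eq.tensor_trans)
next
  case (tensor_zero y)
  then show ?case using tensor_eq.tensor_zero[of "q \<otimes>\<^bsub>tfr\<^esub> y" frac_scalars R M] by (simp add: tfr_mult_closed assms(2))
next
  case (tensor_add_left x x' y)
  then show ?case using tensor_eq.tensor_add_left[of x M x' "q \<otimes>\<^bsub>tfr\<^esub> y" frac_scalars R]
    by (simp add: tfr_mult_closed assms(2))
next
  case (tensor_add_right x y y')
  then show ?case using tensor_eq.tensor_add_right[of x M "q \<otimes>\<^bsub>tfr\<^esub> y" frac_scalars "q \<otimes>\<^bsub>tfr\<^esub> y'" R]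
    by (simp add: tfr_mult_closed assms(2) tfr_r_distr)
next
  case (tensor_balanced a x y)
  then show ?case using tensor_eq.tensor_balanced[of a R x M "q \<otimes>\<^bsub>tfr\<^esub> y" frac_scalars]
    by (simp add: tfr_mult_closed assms(2) tfr_mult_lcomm[OF assms(2)])
qed (auto intro: tensor_sym tensor_plus)

lemma tmod_smult:
  assumes "tvalid X" "q \<in> carrier tfr"
  shows "q \<odot>\<^bsub>tmod\<^esub> tcls X = tcls (image_mset (\<lambda>(x, b). (x, q \<otimes>\<^bsub>tfr\<^esub> b)) X)"
proof -
  have "tcls (image_mset (\<lambda>(x, b). (x, q \<otimes>\<^bsub>tfr\<^esub> b)) X') = tcls (image_mset (\<lambda>(x, b). (x, q \<otimes>\<^bsub>tfr\<^esub> b)) X)"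
    if "X' \<in> tcls X" for X'
  proof -
    have "teq X X'" using that unfolding tensor_class_def by auto
    then show ?thesis by (intro tcls_eqI[symmetric] teq_scale assms(2))
  qed
  moreover have "tcls X \<noteq> {}" using teq_refl assms(1) unfolding tensor_class_def by blast
  ultimately show ?thesis unfolding tmod_simps by (intro UN_constant_eq)
qed

lemma abelian_monoid_tmod: "abelian_monoid tmod"
proof (rule abelian_monoidI)
  fix x y z assume "x \<in> carrier tmod" "y \<in> carrier tmod" "z \<in> carrier tmod"
  then obtain X Y Z where h: "tvalid X" "x = tcls X" "tvalid Y" "y = tcls Y" "tvalid Z" "z = tcls Z"
    unfolding tmod_simps(1) by blast
  show "x \<oplus>\<^bsub>tmod\<^esub> y \<in> carrier tmod" using h unfolding tmod_simps(1) by (auto simp: tmod_add)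
  show "x \<oplus>\<^bsub>tmod\<^esub> y \<oplus>\<^bsub>tmod\<^esub> z = x \<oplus>\<^bsub>tmod\<^esub> (y \<oplus>\<^bsub>tmod\<^esub> z)" using h by (simp add: tmod_add add.assoc)
next
  show "\<zero>\<^bsub>tmod\<^esub> \<in> carrier tmod" by (auto simp: tmod_simps(1,2))
next
  fix x assume "x \<in> carrier tmod"
  then obtain X where h: "tvalid X" "x = tcls X" unfolding tmod_simps(1) by blast
  then show "\<zero>\<^bsub>tmod\<^esub> \<oplus>\<^bsub>tmod\<^esub> x = x" using tmod_add[of "{#}" X] by (simp add: tmod_simps(2))
next
  fix x y assume "x \<in> carrier tmod" "y \<in> carrier tmod"
  then obtain X Y where h: "tvalid X" "x = tcls X" "tvalid Y" "y = tcls Y" unfolding tmod_simps(1) by blast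
  then show "x \<oplus>\<^bsub>tmod\<^esub> y = y \<oplus>\<^bsub>tmod\<^esub> x" by (simp add: tmod_add add.commute)
qed

lemma tmod_finsum:
  assumes "finite I" "\<And>i. i \<in> I \<Longrightarrow> tvalid (X i)"
  shows "(\<Oplus>\<^bsub>tmod\<^esub>i\<in>I. tcls (X i)) = tcls (\<Sum>i\<in>I. X i)"
  using assms
proof (induction I rule: finite_induct)
  interpret T: abelian_monoid tmod by (rule abelian_monoid_tmod)
  {
    case empty
    then show ?case by (simp add: tmod_simps(2))
  next
    case (insert i I)
    have c: "tcls (X j) \<in> carrier tmod" if "j \<in> insert i I" for j
      using insert.prems[OF that] unfolding tmod_simps(1) by blast
    have v: "tvalid (\<Sum>i\<in>I. X i)" using insert.hyps(1) insert.prems by (auto simp: set_mset_sum)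
    have "(\<Oplus>\<^bsub>tmod\<^esub>i\<in>insert i I. tcls (X i)) = tcls (X i) \<oplus>\<^bsub>tmod\<^esub> (\<Oplus>\<^bsub>tmod\<^esub>i\<in>I. tcls (X i))"
      by (rule T.finsum_insert) (use insert.hyps c in auto)
    then show ?case using insert tmod_add[OF _ v, of "X i"] by simp
  }
qed

lemma teq_sum_same:
  assumes "finite I" "\<And>i. i \<in> I \<Longrightarrow> y i \<in> carrier M" "q \<in> carrier tfr"
  shows "teq (\<Sum>i\<in>I. {#(y i, q)#}) {#(\<Oplus>\<^bsub>M\<^esub>i\<in>I. y i, q)#}"
  using assms(1,2)
proof (induction I rule: finite_induct)
  case empty
  then show ?case using tensor_sym[OF tensor_zero[of q frac_scalars R M]] assms(3) by simp
next
  case (insert i I)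
  have s: "(\<Oplus>\<^bsub>M\<^esub>i\<in>I. y i) \<in> carrier M" by (rule M.finsum_closed) (use insert in auto)
  have e: "(\<Oplus>\<^bsub>M\<^esub>i\<in>insert i I. y i) = y i \<oplus>\<^bsub>M\<^esub> (\<Oplus>\<^bsub>M\<^esub>i\<in>I. y i)"
    by (rule M.finsum_insert) (use insert in auto)
  have "teq (\<Sum>i\<in>insert i I. {#(y i, q)#}) ({#(y i, q)#} + {#(\<Oplus>\<^bsub>M\<^esub>i\<in>I. y i, q)#})"
    unfolding sum.insert[OF insert.hyps]
    by (rule tensor_plus) (use insert assms(3) in \<open>auto intro!: teq_refl\<close>)
  moreover have "teq ({#(y i, q)#} + {#(\<Oplus>\<^bsub>M\<^esub>i\<in>I. y i, q)#}) {#(\<Oplus>\<^bsub>M\<^esub>i\<in>insert i I. y i, q)#}"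
    unfolding e using tensor_sym[OF tensor_add_left[of "y i" M "\<Oplus>\<^bsub>M\<^esub>i\<in>I. y i" q frac_scalars R]] insert.prems s assms(3)
    by (simp add: add_mset_commute)
  ultimately show ?case by (rule tensor_trans)
qed

lemma teq_sum:
  assumes "finite I" "\<And>i. i \<in> I \<Longrightarrow> teq (X i) (Y i)"
  shows "teq (\<Sum>i\<in>I. X i) (\<Sum>i\<in>I. Y i)"
  using assms by (induction I rule: finite_induct) (auto intro: tensor_plus teq_refl)

lemma teq_move:
  assumes "a \<in> carrier R" "x \<in> carrier M" "b \<in> carrier R" "w \<in> nzd"
  shows "teq {#(x, frc (a \<otimes> b) w)#} {#(a \<odot>\<^bsub>M\<^esub> x, frc b w)#}"
  using tensor_sym[OF tensor_balanced[of a R x M "frc b w" frac_scalars]] assms by (simp add: tfr_mult)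

text \<open>Every tensor is pure, of the form \<open>x \<otimes> 1/w\<close>: over a common
  denominator all numerators move to the left factor, where they can be added.\<close>

lemma teq_common_denominator:
  "tvalid X \<Longrightarrow> \<exists>x\<in>carrier M. \<exists>w\<in>nzd. teq X {#(x, frc \<one> w)#}"
proof (induction X)
  case empty
  have "teq {#} {#(\<zero>\<^bsub>M\<^esub>, frc \<one> \<one>)#}" using tensor_sym[OF tensor_zero[of "frc \<one> \<one>" frac_scalars R M]] by simp
  then show ?case by (intro bexI[of _ "\<zero>\<^bsub>M\<^esub>"] bexI[of _ \<one>]) auto
next
  case (add p X)
  then obtain x w where x: "x \<in> carrier M" "w \<in> nzd" "teq X {#(x, frc \<one> w)#}" by auto
  from add.prems obtain m a v where p: "p = (m, frc a v)" "m \<in> carrier M" "a \<in> carrier R" "v \<in> nzd"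
    by (cases p) (auto elim!: tfrE)
  have n: "v \<otimes> w \<in> nzd" using x p by simp
  have e1: "frc a v = frc ((a \<otimes> w) \<otimes> \<one>) (v \<otimes> w)" "frc \<one> w = frc (v \<otimes> \<one>) (v \<otimes> w)"
    using x p by (simp_all add: frac_eq_iff m_ac)
  have c: "a \<otimes> w \<in> carrier R" "v \<in> carrier R" using x p by auto
  have 1: "teq {#p#} {#((a \<otimes> w) \<odot>\<^bsub>M\<^esub> m, frc \<one> (v \<otimes> w))#}"
    unfolding p(1) e1(1) by (rule teq_move[OF c(1) p(2) one_closed n])
  have 2: "teq X {#(v \<odot>\<^bsub>M\<^esub> x, frc \<one> (v \<otimes> w))#}"
    using tensor_trans[OF x(3)] teq_move[OF c(2) x(1) one_closed n] unfolding e1(2) by simp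
  have 3: "teq ({#((a \<otimes> w) \<odot>\<^bsub>M\<^esub> m, frc \<one> (v \<otimes> w))#} + {#(v \<odot>\<^bsub>M\<^esub> x, frc \<one> (v \<otimes> w))#})
      {#((a \<otimes> w) \<odot>\<^bsub>M\<^esub> m \<oplus>\<^bsub>M\<^esub> v \<odot>\<^bsub>M\<^esub> x, frc \<one> (v \<otimes> w))#}"
    using tensor_sym[OF tensor_add_left[of "(a \<otimes> w) \<odot>\<^bsub>M\<^esub> m" M "v \<odot>\<^bsub>M\<^esub> x" "frc \<one> (v \<otimes> w)" frac_scalars R]] c p x n
    by (simp add: add_mset_commute)
  have "teq (add_mset p X) {#((a \<otimes> w) \<odot>\<^bsub>M\<^esub> m \<oplus>\<^bsub>M\<^esub> v \<odot>\<^bsub>M\<^esub> x, frc \<one> (v \<otimes> w))#}"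
    using tensor_trans[OF tensor_plus[OF 1 2] 3] by simp
  then show ?case using c p x n by (intro bexI[of _ "(a \<otimes> w) \<odot>\<^bsub>M\<^esub> m \<oplus>\<^bsub>M\<^esub> v \<odot>\<^bsub>M\<^esub> x"] bexI[of _ "v \<otimes> w"]) auto
qed

lemma ex_common_denominator:
  assumes "\<And>i::nat. i < r \<Longrightarrow> q i \<in> carrier tfr"
  shows "\<exists>t\<in>nzd. \<forall>i<r. q i \<in> dens t"
  using assms
proof (induction r)
  case 0
  then show ?case by (intro bexI[of _ \<one>]) simp_all
next
  case (Suc r)
  then obtain t where t: "t \<in> nzd" "\<And>i. i < r \<Longrightarrow> q i \<in> dens t" by auto
  obtain a w where q: "a \<in> carrier R" "w \<in> nzd" "q r = frc a w" using Suc.prems[of r] by (auto elim: tfrE)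
  have "q r \<in> dens (t \<otimes> w)" by (rule dens_mult) (use q t in \<open>auto simp: dens_def\<close>)
  moreover have "q i \<in> dens (w \<otimes> t)" if "i < r" for i by (rule dens_mult[OF t(2)[OF that] t(1) q(2)])
  ultimately show ?case using t(1) q(2) by (intro bexI[of _ "t \<otimes> w"]) (auto simp: less_Suc_eq m_comm)
qed

text \<open>The basis vectors are \<open>x_i \<otimes> 1/w_i\<close>, where \<open>1/w_i\<close> is
  a unit. Independence of the \<open>x_i\<close> comes from the uniqueness of the coordinates of
  zero, the last claim from the coordinates of \<open>m \<otimes> 1\<close> after clearing
  denominators.\<close>

theorem free_basis:
  assumes "has_rank R M r"
  obtains x :: "nat \<Rightarrow> 'c" where "\<And>i. i < r \<Longrightarrow> x i \<in> carrier M"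
    "\<And>a. (\<And>i. i < r \<Longrightarrow> a i \<in> carrier R) \<Longrightarrow> (\<Oplus>\<^bsub>M\<^esub>i\<in>{..<r}. a i \<odot>\<^bsub>M\<^esub> x i) = \<zero>\<^bsub>M\<^esub> \<Longrightarrow> \<forall>i<r. a i = \<zero>"
    "\<And>m. m \<in> carrier M \<Longrightarrow> \<exists>t\<in>nzd. \<exists>a. (\<forall>i<r. a i \<in> carrier R) \<and> t \<odot>\<^bsub>M\<^esub> m = (\<Oplus>\<^bsub>M\<^esub>i\<in>{..<r}. a i \<odot>\<^bsub>M\<^esub> x i)"
proof -
  interpret T: abelian_monoid tmod by (rule abelian_monoid_tmod)
  obtain b where b0: "b \<in> {..<r} \<rightarrow> carrier tmod \<and> (\<forall>z\<in>carrier tmod. \<exists>!c. c \<in> {..<r} \<rightarrow>\<^sub>E carrier tfr \<and>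
      z = (\<Oplus>\<^bsub>tmod\<^esub>i\<in>{..<r}. c i \<odot>\<^bsub>tmod\<^esub> b i))"
    using assms unfolding has_rank_def free_of_rank_def by (elim exE)
  note b = conjunct1[OF b0]
  note ex1 = conjunct2[OF b0, THEN bspec]
  have "\<exists>x w. i < r \<longrightarrow> x \<in> carrier M \<and> w \<in> nzd \<and> b i = tcls {#(x, frc \<one> w)#}" for i
  proof (cases "i < r")
    case True
    then have "b i \<in> carrier tmod" using b by auto
    then obtain X where X: "tvalid X" "b i = tcls X" unfolding tmod_simps(1) by blast
    obtain y v where yv: "y \<in> carrier M" "v \<in> nzd" "teq X {#(y, frc \<one> v)#}"
      using teq_common_denominator[OF X(1)] by blast
    have "b i = tcls {#(y, frc \<one> v)#}" unfolding X(2) by (rule tcls_eqI[OF yv(3)])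
    then show ?thesis using yv(1,2) by blast
  qed simp
  then obtain x w where xw: "\<And>i. i < r \<Longrightarrow> x i \<in> carrier M" "\<And>i. i < r \<Longrightarrow> w i \<in> nzd"
    "\<And>i. i < r \<Longrightarrow> b i = tcls {#(x i, frc \<one> (w i))#}" by metis
  have scal: "frc a v \<odot>\<^bsub>tmod\<^esub> b i = tcls {#(x i, frc a (v \<otimes> w i))#}"
    if "i < r" "a \<in> carrier R" "v \<in> nzd" for a v i
    using that xw by (simp add: tmod_smult tfr_mult)
  have cv: "tvalid {#(x i, frc a (v \<otimes> w i))#}" if "i < r" "a \<in> carrier R" "v \<in> nzd" for a v i
    using that xw by simp
  show thesis
  proof (rule that[of x])
    show "x i \<in> carrier M" if "i < r" for i using xw that by blast
  next
    fix a assume a: "\<And>i. i < r \<Longrightarrow> a i \<in> carrier R" and z: "(\<Oplus>\<^bsub>M\<^esub>i\<in>{..<r}. a i \<odot>\<^bsub>M\<^esub> x i) = \<zero>\<^bsub>M\<^esub>"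
    \<comment> \<open>The factor \<open>w i\<close> cancels the denominator of \<open>b i\<close>,
      so the \<open>i\<close>-th term is \<open>a i x_i \<otimes> 1\<close>. Both \<open>c\<close>
      and the trivial \<open>c0\<close> are coordinates of zero.\<close>
    define c where "c = (\<lambda>i\<in>{..<r}. frc (a i \<otimes> w i) \<one>)"
    define c0 where "c0 = (\<lambda>i\<in>{..<r}. frc \<zero> \<one>)"
    have cE: "c \<in> {..<r} \<rightarrow>\<^sub>E carrier tfr" "c0 \<in> {..<r} \<rightarrow>\<^sub>E carrier tfr"
      unfolding c_def c0_def using a xw by auto
    have "(\<Oplus>\<^bsub>tmod\<^esub>i\<in>{..<r}. c i \<odot>\<^bsub>tmod\<^esub> b i) = (\<Oplus>\<^bsub>tmod\<^esub>i\<in>{..<r}. tcls {#(a i \<odot>\<^bsub>M\<^esub> x i, frc \<one> \<one>)#})"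
    proof (rule T.finsum_cong')
      show "(\<lambda>i. tcls {#(a i \<odot>\<^bsub>M\<^esub> x i, frc \<one> \<one>)#}) \<in> {..<r} \<rightarrow> carrier tmod"
        using a xw by (auto simp: tmod_simps(1))
      fix i assume "i \<in> {..<r}"
      then have i: "i < r" by simp
      have "c i \<odot>\<^bsub>tmod\<^esub> b i = tcls {#(x i, frc (a i \<otimes> w i) (\<one> \<otimes> w i))#}"
        unfolding c_def using scal[OF i, of "a i \<otimes> w i" \<one>] a xw i by simp
      also have "frc (a i \<otimes> w i) (\<one> \<otimes> w i) = frc (a i \<otimes> \<one>) \<one>"
        using a[OF i] xw(2)[OF i] by (simp add: frac_eq_iff m_comm)
      also have "tcls {#(x i, frc (a i \<otimes> \<one>) \<one>)#} = tcls {#(a i \<odot>\<^bsub>M\<^esub> x i, frc \<one> \<one>)#}"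
        by (rule tcls_eqI[OF teq_move]) (use a[OF i] xw(1)[OF i] in auto)
      finally show "c i \<odot>\<^bsub>tmod\<^esub> b i = tcls {#(a i \<odot>\<^bsub>M\<^esub> x i, frc \<one> \<one>)#}" .
    qed simp
    also have "\<dots> = tcls (\<Sum>i\<in>{..<r}. {#(a i \<odot>\<^bsub>M\<^esub> x i, frc \<one> \<one>)#})"
      by (rule tmod_finsum) (use a xw in auto)
    also have "\<dots> = tcls {#(\<Oplus>\<^bsub>M\<^esub>i\<in>{..<r}. a i \<odot>\<^bsub>M\<^esub> x i, frc \<one> \<one>)#}"
      by (rule tcls_eqI[OF teq_sum_same]) (use a xw in auto)
    also have "\<dots> = tcls {#}" unfolding z
      by (rule tcls_eqI[OF tensor_zero]) simp
    finally have 1: "tcls {#} = (\<Oplus>\<^bsub>tmod\<^esub>i\<in>{..<r}. c i \<odot>\<^bsub>tmod\<^esub> b i)" by simp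
    have "(\<Oplus>\<^bsub>tmod\<^esub>i\<in>{..<r}. c0 i \<odot>\<^bsub>tmod\<^esub> b i) = (\<Oplus>\<^bsub>tmod\<^esub>i\<in>{..<r}. tcls {#(\<zero>\<^bsub>M\<^esub>, frc \<one> \<one>)#})"
    proof (rule T.finsum_cong')
      show "(\<lambda>i. tcls {#(\<zero>\<^bsub>M\<^esub>, frc \<one> \<one>)#}) \<in> {..<r} \<rightarrow> carrier tmod"
        by (auto simp: tmod_simps(1))
      fix i assume "i \<in> {..<r}"
      then have i: "i < r" by simp
      have "c0 i \<odot>\<^bsub>tmod\<^esub> b i = tcls {#(x i, frc \<zero> (\<one> \<otimes> w i))#}"
        unfolding c0_def using scal[OF i, of \<zero> \<one>] i by simp
      also have "frc \<zero> (\<one> \<otimes> w i) = frc (\<zero> \<otimes> \<one>) \<one>"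
        using xw(2)[OF i] by (simp add: frac_eq_iff)
      also have "tcls {#(x i, frc (\<zero> \<otimes> \<one>) \<one>)#} = tcls {#(\<zero> \<odot>\<^bsub>M\<^esub> x i, frc \<one> \<one>)#}"
        by (rule tcls_eqI[OF teq_move]) (use xw(1)[OF i] in auto)
      finally show "c0 i \<odot>\<^bsub>tmod\<^esub> b i = tcls {#(\<zero>\<^bsub>M\<^esub>, frc \<one> \<one>)#}" using xw(1)[OF i] by simp
    qed simp
    also have "\<dots> = tcls (\<Sum>i\<in>{..<r}. {#(\<zero>\<^bsub>M\<^esub>, frc \<one> \<one>)#})"
      by (rule tmod_finsum) auto
    also have "\<dots> = tcls (\<Sum>i\<in>{..<r}. {#})"
      by (rule tcls_eqI[OF teq_sum]) (auto intro!: tensor_zero)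
    finally have 2: "tcls {#} = (\<Oplus>\<^bsub>tmod\<^esub>i\<in>{..<r}. c0 i \<odot>\<^bsub>tmod\<^esub> b i)" by simp
    have "tcls {#} \<in> carrier tmod" by (auto simp: tmod_simps(1))
    from ex1[OF this] have "c = c0" by (rule ex1_eqI) (rule conjI[OF cE(1) 1], rule conjI[OF cE(2) 2])
    show "\<forall>i<r. a i = \<zero>"
    proof (intro allI impI)
      fix i assume i: "i < r"
      have "frc (a i \<otimes> w i) \<one> = frc \<zero> \<one>" using fun_cong[OF \<open>c = c0\<close>, of i] i by (simp add: c_def c0_def)
      then have "w i \<otimes> a i = \<zero>" using a[OF i] xw(2)[OF i] by (simp add: frac_eq_iff m_comm)
      then show "a i = \<zero>" using nzdD[OF xw(2)[OF i] a[OF i]] by simp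
    qed
  next
    fix m assume m: "m \<in> carrier M"
    have "tcls {#(m, frc \<one> \<one>)#} \<in> carrier tmod" using m by (auto simp: tmod_simps(1))
    from ex1_implies_ex[OF ex1[OF this]] obtain c where c: "c \<in> {..<r} \<rightarrow>\<^sub>E carrier tfr"
      "tcls {#(m, frc \<one> \<one>)#} = (\<Oplus>\<^bsub>tmod\<^esub>i\<in>{..<r}. c i \<odot>\<^bsub>tmod\<^esub> b i)"
      by (elim exE conjE)
    have "c i \<otimes>\<^bsub>tfr\<^esub> frc \<one> (w i) \<in> carrier tfr" if "i < r" for i
      using c(1) xw(2)[OF that] that by (intro tfr_mult_closed) auto
    then have "\<exists>u\<in>nzd. \<forall>i<r. c i \<otimes>\<^bsub>tfr\<^esub> frc \<one> (w i) \<in> dens u"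
      by (rule ex_common_denominator)
    then obtain u where u: "u \<in> nzd" "\<forall>i<r. c i \<otimes>\<^bsub>tfr\<^esub> frc \<one> (w i) \<in> dens u" by blast
    \<comment> \<open>\<open>\<beta> i / u\<close> is the coordinate of \<open>m \<otimes> 1\<close>
      with respect to \<open>x_i \<otimes> 1\<close>, over a denominator \<open>u\<close> common to
      all \<open>i\<close>.\<close>
    define \<beta> where "\<beta> i = numer u (c i \<otimes>\<^bsub>tfr\<^esub> frc \<one> (w i))" for i
    have \<beta>: "\<beta> i \<in> carrier R" "c i \<otimes>\<^bsub>tfr\<^esub> frc \<one> (w i) = frc (\<beta> i) u" if i: "i < r" for i
    proof -
      obtain a where "a \<in> carrier R" "c i \<otimes>\<^bsub>tfr\<^esub> frc \<one> (w i) = frc a u"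
        using u(2)[rule_format, OF i] by (rule densE)
      then show "\<beta> i \<in> carrier R" "c i \<otimes>\<^bsub>tfr\<^esub> frc \<one> (w i) = frc (\<beta> i) u"
        unfolding \<beta>_def using u(1) by (simp_all add: numer_frac)
    qed
    have "(\<Oplus>\<^bsub>tmod\<^esub>i\<in>{..<r}. c i \<odot>\<^bsub>tmod\<^esub> b i) = (\<Oplus>\<^bsub>tmod\<^esub>i\<in>{..<r}. tcls {#(\<beta> i \<odot>\<^bsub>M\<^esub> x i, frc \<one> u)#})"
    proof (rule T.finsum_cong')
      show "(\<lambda>i. tcls {#(\<beta> i \<odot>\<^bsub>M\<^esub> x i, frc \<one> u)#}) \<in> {..<r} \<rightarrow> carrier tmod"
        using \<beta>(1) xw(1) u(1) by (auto simp: tmod_simps(1))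
      fix i assume "i \<in> {..<r}"
      then have i: "i < r" by simp
      have "c i \<odot>\<^bsub>tmod\<^esub> b i = tcls {#(x i, c i \<otimes>\<^bsub>tfr\<^esub> frc \<one> (w i))#}"
        using c(1) i xw by (subst xw(3)[OF i], subst tmod_smult) auto
      also have "\<dots> = tcls {#(x i, frc (\<beta> i \<otimes> \<one>) u)#}" using \<beta>[OF i] by simp
      also have "\<dots> = tcls {#(\<beta> i \<odot>\<^bsub>M\<^esub> x i, frc \<one> u)#}"
        by (rule tcls_eqI[OF teq_move]) (use \<beta>(1)[OF i] xw(1)[OF i] u(1) in auto)
      finally show "c i \<odot>\<^bsub>tmod\<^esub> b i = tcls {#(\<beta> i \<odot>\<^bsub>M\<^esub> x i, frc \<one> u)#}" .
    qed simp
    also have "\<dots> = tcls (\<Sum>i\<in>{..<r}. {#(\<beta> i \<odot>\<^bsub>M\<^esub> x i, frc \<one> u)#})"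
      by (rule tmod_finsum) (use \<beta>(1) xw(1) u(1) in auto)
    also have "\<dots> = tcls {#(\<Oplus>\<^bsub>M\<^esub>i\<in>{..<r}. \<beta> i \<odot>\<^bsub>M\<^esub> x i, frc \<one> u)#}"
      by (rule tcls_eqI[OF teq_sum_same]) (use \<beta>(1) xw(1) u(1) in auto)
    finally have e: "tcls {#(m, frc \<one> \<one>)#} = tcls {#(\<Oplus>\<^bsub>M\<^esub>i\<in>{..<r}. \<beta> i \<odot>\<^bsub>M\<^esub> x i, frc \<one> u)#}" using c(2) by simp
    let ?y = "\<Oplus>\<^bsub>M\<^esub>i\<in>{..<r}. \<beta> i \<odot>\<^bsub>M\<^esub> x i"
    have y: "?y \<in> carrier M" by (rule M.finsum_closed) (use \<beta>(1) xw(1) in auto)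
    have "teq {#(m, frc \<one> \<one>)#} {#(?y, frc \<one> u)#}" by (rule tcls_eqD[OF e]) (use y u(1) in simp)
    then obtain t where t: "t \<in> nzd" "dens_ok t {#(m, frc \<one> \<one>)#}" "dens_ok t {#(?y, frc \<one> u)#}"
      "tval t {#(m, frc \<one> \<one>)#} = tval t {#(?y, frc \<one> u)#}" using tensor_eq_tval by blast
    \<comment> \<open>Over the denominator \<open>t\<close> the left tensor has numerator
      \<open>t\<close> and the right one some \<open>p\<close>, so the identity of tensors becomes
      \<open>t m = p y\<close>.\<close>
    have e1: "frc \<one> \<one> = frc t t" using t(1) by (simp add: frac_eq_iff)
    have "frc \<one> u \<in> dens t" using t(3) unfolding dens_ok_def by simp
    then obtain p where p: "p \<in> carrier R" "frc \<one> u = frc p t" by (rule densE)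
    have "t \<odot>\<^bsub>M\<^esub> m = p \<odot>\<^bsub>M\<^esub> ?y" using t(4) unfolding e1 p(2) using t(1) m y p(1) by simp
    also have "\<dots> = (\<Oplus>\<^bsub>M\<^esub>i\<in>{..<r}. p \<odot>\<^bsub>M\<^esub> (\<beta> i \<odot>\<^bsub>M\<^esub> x i))"
      by (rule finsum_smult_ldistr) (use p(1) \<beta>(1) xw(1) in auto)
    also have "\<dots> = (\<Oplus>\<^bsub>M\<^esub>i\<in>{..<r}. (p \<otimes> \<beta> i) \<odot>\<^bsub>M\<^esub> x i)"
      by (rule M.finsum_cong') (use p(1) \<beta>(1) xw(1) in \<open>auto simp: smult_assoc1\<close>)
    finally show "\<exists>t\<in>nzd. \<exists>a. (\<forall>i<r. a i \<in> carrier R) \<and> t \<odot>\<^bsub>M\<^esub> m = (\<Oplus>\<^bsub>M\<^esub>i\<in>{..<r}. a i \<odot>\<^bsub>M\<^esub> x i)"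
      using t(1) p(1) \<beta>(1) by (intro bexI[of _ t] exI[of _ "\<lambda>i. p \<otimes> \<beta> i"]) auto
  qed
qed

text \<open>The indices are listed in decreasing order so that passing from \<open>n\<close> to
  \<open>n + 1\<close> puts \<open>x n\<close> at the head of the list, in step with the recursion
  of \<open>lin_span\<close>.\<close>

lemma lin_span_imp_finsum:
  assumes "y \<in> lin_span (carrier R) (map x (rev [0..<n]))" "\<And>i. i < n \<Longrightarrow> x i \<in> carrier M"
  shows "\<exists>a. (\<forall>i<n. a i \<in> carrier R) \<and> y = (\<Oplus>\<^bsub>M\<^esub>i\<in>{..<n}. a i \<odot>\<^bsub>M\<^esub> x i)"
  using assms
proof (induction n arbitrary: y)
  case 0
  then show ?case by simp
next
  case (Suc n)
  from Suc.prems(1) have "y \<in> sum_sub M ((\<lambda>a. a \<odot>\<^bsub>M\<^esub> x n) ` carrier R) (lin_span (carrier R) (map x (rev [0..<n])))"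
    by simp
  then obtain u z where "u \<in> (\<lambda>a. a \<odot>\<^bsub>M\<^esub> x n) ` carrier R" and z: "z \<in> lin_span (carrier R) (map x (rev [0..<n]))"
    and y: "y = u \<oplus>\<^bsub>M\<^esub> z" by (rule sum_subE)
  then obtain b where b: "b \<in> carrier R" "u = b \<odot>\<^bsub>M\<^esub> x n" by blast
  obtain a where a: "\<forall>i<n. a i \<in> carrier R" "z = (\<Oplus>\<^bsub>M\<^esub>i\<in>{..<n}. a i \<odot>\<^bsub>M\<^esub> x i)"
    using Suc.IH[OF z] Suc.prems(2) by auto
  let ?a = "a(n := b)"
  have "(\<Oplus>\<^bsub>M\<^esub>i\<in>{..<Suc n}. ?a i \<odot>\<^bsub>M\<^esub> x i) = ?a n \<odot>\<^bsub>M\<^esub> x n \<oplus>\<^bsub>M\<^esub> (\<Oplus>\<^bsub>M\<^esub>i\<in>{..<n}. ?a i \<odot>\<^bsub>M\<^esub> x i)"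
    unfolding lessThan_Suc by (rule M.finsum_insert) (use a(1) b Suc.prems(2) in auto)
  also have "(\<Oplus>\<^bsub>M\<^esub>i\<in>{..<n}. ?a i \<odot>\<^bsub>M\<^esub> x i) = z"
    unfolding a(2) by (rule M.finsum_cong') (use a(1) Suc.prems(2) in auto)
  finally have "y = (\<Oplus>\<^bsub>M\<^esub>i\<in>{..<Suc n}. ?a i \<odot>\<^bsub>M\<^esub> x i)" using y b by simp
  then show ?case using a(1) b(1) by (intro exI[of _ ?a]) (auto simp: less_Suc_eq)
qed

text \<open>A multiple \<open>b x_n\<close> in the span of the elements of smaller index is a
  relation among all \<open>r\<close> elements after padding with zeros, and \<open>- b\<close> is
  its coefficient at \<open>n\<close>.\<close>

lemma independent_if_finsum:
  assumes x: "\<And>i. i < r \<Longrightarrow> x i \<in> carrier M"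
    and ind: "\<And>a. (\<And>i. i < r \<Longrightarrow> a i \<in> carrier R) \<Longrightarrow> (\<Oplus>\<^bsub>M\<^esub>i\<in>{..<r}. a i \<odot>\<^bsub>M\<^esub> x i) = \<zero>\<^bsub>M\<^esub> \<Longrightarrow> \<forall>i<r. a i = \<zero>"
  shows "n \<le> r \<Longrightarrow> independent (map x (rev [0..<n]))"
proof (induction n)
  case (Suc n)
  have "b = \<zero>" if b: "b \<in> carrier R" "b \<odot>\<^bsub>M\<^esub> x n \<in> lin_span (carrier R) (map x (rev [0..<n]))" for b
  proof -
    obtain a where a: "\<forall>i<n. a i \<in> carrier R" "b \<odot>\<^bsub>M\<^esub> x n = (\<Oplus>\<^bsub>M\<^esub>i\<in>{..<n}. a i \<odot>\<^bsub>M\<^esub> x i)"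
      using lin_span_imp_finsum[OF b(2)] x Suc.prems by auto
    define c where "c i = (if i < n then a i else if i = n then \<ominus> b else \<zero>)" for i
    have cR: "c i \<in> carrier R" for i using a(1) b(1) by (simp add: c_def)
    have "(\<Oplus>\<^bsub>M\<^esub>i\<in>{..<r}. c i \<odot>\<^bsub>M\<^esub> x i) = (\<Oplus>\<^bsub>M\<^esub>i\<in>{..<Suc n}. c i \<odot>\<^bsub>M\<^esub> x i)"
    proof (rule M.add.finprod_mono_neutral_cong_right)
      show "c i \<odot>\<^bsub>M\<^esub> x i = \<zero>\<^bsub>M\<^esub>" if "i \<in> {..<r} - {..<Suc n}" for i
        using that x[of i] by (simp add: c_def)
      show "(\<lambda>i. c i \<odot>\<^bsub>M\<^esub> x i) \<in> {..<r} \<rightarrow> carrier M" using cR x by simp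
    qed (use Suc.prems in auto)
    also have "\<dots> = c n \<odot>\<^bsub>M\<^esub> x n \<oplus>\<^bsub>M\<^esub> (\<Oplus>\<^bsub>M\<^esub>i\<in>{..<n}. c i \<odot>\<^bsub>M\<^esub> x i)"
      unfolding lessThan_Suc by (rule M.finsum_insert) (use Suc.prems cR x in simp_all)
    also have "(\<Oplus>\<^bsub>M\<^esub>i\<in>{..<n}. c i \<odot>\<^bsub>M\<^esub> x i) = b \<odot>\<^bsub>M\<^esub> x n"
      unfolding a(2) by (rule M.finsum_cong') (use Suc.prems a(1) x in \<open>auto simp: c_def\<close>)
    also have "c n \<odot>\<^bsub>M\<^esub> x n \<oplus>\<^bsub>M\<^esub> b \<odot>\<^bsub>M\<^esub> x n = \<zero>\<^bsub>M\<^esub>"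
      using b(1) x[of n] Suc.prems by (simp add: c_def smult_l_minus M.l_neg)
    finally have s0: "(\<Oplus>\<^bsub>M\<^esub>i\<in>{..<r}. c i \<odot>\<^bsub>M\<^esub> x i) = \<zero>\<^bsub>M\<^esub>" .
    have "\<forall>i<r. c i = \<zero>" by (rule ind[OF _ s0]) (rule cR)
    then have "c n = \<zero>" using Suc.prems by simp
    then have mb: "\<ominus> b = \<zero>" by (simp add: c_def)
    have "b \<oplus> \<ominus> b = \<zero>" using b(1) by (rule R.r_neg)
    then show "b = \<zero>" unfolding mb using b(1) by simp
  qed
  then show ?case using Suc by simp
qed simp

lemma finsum_mem_lin_span:
  assumes "\<And>i. i < n \<Longrightarrow> x i \<in> carrier M" "\<And>i. i < n \<Longrightarrow> a i \<in> carrier R"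
  shows "(\<Oplus>\<^bsub>M\<^esub>i\<in>{..<n}. a i \<odot>\<^bsub>M\<^esub> x i) \<in> lin_span (carrier R) (map x (rev [0..<n]))"
  using assms
proof (induction n)
  case (Suc n)
  have "(\<Oplus>\<^bsub>M\<^esub>i\<in>{..<Suc n}. a i \<odot>\<^bsub>M\<^esub> x i) = a n \<odot>\<^bsub>M\<^esub> x n \<oplus>\<^bsub>M\<^esub> (\<Oplus>\<^bsub>M\<^esub>i\<in>{..<n}. a i \<odot>\<^bsub>M\<^esub> x i)"
    unfolding lessThan_Suc by (rule M.finsum_insert) (use Suc.prems in auto)
  then show ?case using Suc by (auto intro!: sum_subI)
qed simp

text \<open>Finitely many generators have finitely many denominators, and their product
  \<open>w\<close> serves for all of them; the elements \<open>m\<close> with \<open>w m\<close> in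
  the span form a submodule that contains the generators.\<close>

theorem rank_basis:
  assumes "has_rank R M r" "finitely_generated_module R M"
  obtains xs w where "length xs = r" "set xs \<subseteq> carrier M" "independent xs" "w \<in> nzd"
    "\<And>m. m \<in> carrier M \<Longrightarrow> w \<odot>\<^bsub>M\<^esub> m \<in> lin_span (carrier R) xs"
proof -
  obtain x :: "nat \<Rightarrow> 'c" where x: "\<And>i. i < r \<Longrightarrow> x i \<in> carrier M"
    and ind: "\<And>a. (\<And>i. i < r \<Longrightarrow> a i \<in> carrier R) \<Longrightarrow> (\<Oplus>\<^bsub>M\<^esub>i\<in>{..<r}. a i \<odot>\<^bsub>M\<^esub> x i) = \<zero>\<^bsub>M\<^esub> \<Longrightarrow> \<forall>i<r. a i = \<zero>"
    and sp: "\<And>m. m \<in> carrier M \<Longrightarrow> \<exists>t\<in>nzd. \<exists>a. (\<forall>i<r. a i \<in> carrier R) \<and> t \<odot>\<^bsub>M\<^esub> m = (\<Oplus>\<^bsub>M\<^esub>i\<in>{..<r}. a i \<odot>\<^bsub>M\<^esub> x i)"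
    using free_basis[OF assms(1)] by blast
  interpret r: module R "regular_module R" by (rule module_regular_module)
  define xs where "xs = map x (rev [0..<r])"
  have xs: "length xs = r" "set xs \<subseteq> carrier M" "independent xs"
    unfolding xs_def using x independent_if_finsum[OF x ind order_refl] by auto
  let ?F = "lin_span (carrier R) xs"
  have F: "closed_sub M (carrier R) ?F"
    by (rule closed_sub_lin_span[OF subset_refl _ xs(2)]) (use r.closed_sub_carrier[OF subset_refl] in simp)
  have tF: "\<exists>t\<in>nzd. t \<odot>\<^bsub>M\<^esub> m \<in> ?F" if m: "m \<in> carrier M" for m
  proof -
    obtain t a where ta: "t \<in> nzd" "\<forall>i<r. a i \<in> carrier R"
      "t \<odot>\<^bsub>M\<^esub> m = (\<Oplus>\<^bsub>M\<^esub>i\<in>{..<r}. a i \<odot>\<^bsub>M\<^esub> x i)" using sp[OF m] by blast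
    have "t \<odot>\<^bsub>M\<^esub> m \<in> ?F" unfolding ta(3) xs_def by (rule finsum_mem_lin_span) (use x ta(2) in simp_all)
    then show ?thesis using ta(1) by blast
  qed
  obtain G where G: "finite G" "G \<subseteq> carrier M"
    "\<And>N. submodule N R M \<Longrightarrow> G \<subseteq> N \<Longrightarrow> N = carrier M"
    using assms(2) unfolding finitely_generated_module_def by blast
  have "\<exists>w\<in>nzd. \<forall>g\<in>G. w \<odot>\<^bsub>M\<^esub> g \<in> ?F"
    using G(1,2)
  proof (induction G rule: finite_induct)
    case empty
    then show ?case by (intro bexI[of _ \<one>]) simp_all
  next
    case (insert g G)
    then obtain w where w: "w \<in> nzd" "\<forall>g\<in>G. w \<odot>\<^bsub>M\<^esub> g \<in> ?F" by auto
    obtain t where t: "t \<in> nzd" "t \<odot>\<^bsub>M\<^esub> g \<in> ?F" using tF insert.prems by blast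
    have "(w \<otimes> t) \<odot>\<^bsub>M\<^esub> h \<in> ?F" if "h \<in> insert g G" for h
    proof (cases "h = g")
      case True
      then show ?thesis using t w insert.prems closed_subD(6)[OF F, of w "t \<odot>\<^bsub>M\<^esub> g"] by (simp add: smult_assoc1)
    next
      case False
      have "(w \<otimes> t) \<odot>\<^bsub>M\<^esub> h = t \<odot>\<^bsub>M\<^esub> (w \<odot>\<^bsub>M\<^esub> h)"
        using t w insert.prems that by (auto simp: smult_assoc1[symmetric] m_comm)
      then show ?thesis using t w False that closed_subD(6)[OF F, of t "w \<odot>\<^bsub>M\<^esub> h"] by simp
    qed
    then show ?case using w t by (intro bexI[of _ "w \<otimes> t"]) auto
  qed
  then obtain w where w: "w \<in> nzd" "\<forall>g\<in>G. w \<odot>\<^bsub>M\<^esub> g \<in> ?F" by blast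
  define N where "N = {m\<in>carrier M. w \<odot>\<^bsub>M\<^esub> m \<in> ?F}"
  have "closed_sub M (carrier R) N" unfolding N_def
    by (rule closed_sub_preimage[OF module_axioms module_axioms lin_map_smult_left subset_refl closed_sub_carrier[OF subset_refl] F])
      (use w(1) in simp)
  then have "submodule N R M"
    using submodule_iff_closed_sub[OF subset_refl closed_sub_carrier[OF subset_refl], of N] closed_subD(1) by fastforce
  then have "N = carrier M" using G(3)[of N] w(2) G(2) unfolding N_def by blast
  then show thesis using that[OF xs w(1)] unfolding N_def by blast
qed

end


section \<open>Comparison of Hilbert functions on boxes\<close>

definition cube :: "nat \<Rightarrow> ('s::finite \<Rightarrow> nat) set" where
  "cube h = {j. \<forall>i. j i \<le> h}"

text \<open>Corner \<open>a\<close>, with \<open>h + 1\<close> values in each direction. Moving the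
  corner to infinity with \<open>h\<close> fixed brings the whole box into the range where Hilbert
  polynomials are valid.\<close>

definition box :: "('s::finite \<Rightarrow> nat) \<Rightarrow> nat \<Rightarrow> ('s \<Rightarrow> nat) set" where
  "box a h = (\<lambda>j i. a i + j i) ` cube h"

lemma cube_eq_PiE: "cube h = PiE UNIV (\<lambda>_. {..h})"
  unfolding cube_def by (auto simp: PiE_UNIV_domain)

lemma finite_cube: "finite (cube h)"
  unfolding cube_eq_PiE by (rule finite_PiE) auto

lemma card_cube: "card (cube h :: ('s::finite \<Rightarrow> nat) set) = Suc h ^ card (UNIV :: 's set)"
  unfolding cube_eq_PiE by (subst card_PiE) auto

lemma finite_box: "finite (box a h)"
  unfolding box_def by (rule finite_imageI[OF finite_cube])

lemma sum_box: "(\<Sum>n\<in>box a h. f n) = (\<Sum>j\<in>cube h. f (\<lambda>i. a i + j i))"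
  unfolding box_def by (subst sum.reindex) (auto simp: inj_on_def fun_eq_iff)

lemma box_add_cube:
  assumes "n \<in> box a h" "m \<in> cube d" shows "(\<lambda>i. n i + m i) \<in> box a (h + d)"
proof -
  obtain j where j: "j \<in> cube h" "n = (\<lambda>i. a i + j i)" using assms(1) unfolding box_def by blast
  have "(\<lambda>i. j i + m i) \<in> cube (h + d)" using j(1) assms(2) unfolding cube_def by (simp add: add_mono)
  then show ?thesis unfolding box_def j(2) by (auto simp: add.assoc)
qed

text \<open>All points of the box lie at bounded distance from \<open>t a\<close>, so each of them
  contributes the same value of the leading form at \<open>a\<close>.\<close>

lemma poly_value_box_limit:
  assumes "ev_large (\<lambda>n. f n = poly_value p n)" "\<And>k. k \<in> Poly_Mapping.keys p \<Longrightarrow> tdeg k \<le> D"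
    and a: "\<forall>i. 0 < a i"
  shows "(\<lambda>t::nat. (\<Sum>j\<in>cube h. f (\<lambda>i. t * a i + j i)) / real t ^ D) \<longlonglongrightarrow>
    real (Suc h ^ card (UNIV :: 's set)) *
      (\<Sum>k\<in>{k\<in>Poly_Mapping.keys p. tdeg k = D}. Poly_Mapping.lookup p k * monomial_fun k (a :: 's::finite \<Rightarrow> nat))"
    (is "_ \<longlonglongrightarrow> _ * ?T")
proof -
  have "(\<lambda>t::nat. f (\<lambda>i. t * a i + j i) / real t ^ D) \<longlonglongrightarrow> ?T" for j
  proof (rule Lim_transform_eventually)
    show "(\<lambda>t::nat. poly_value p (\<lambda>i. t * a i + j i) / real t ^ D) \<longlonglongrightarrow> ?T"
      unfolding poly_value_monomial_fun by (rule poly_sum_ray_limit[OF assms(2)]) auto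
    show "\<forall>\<^sub>F t in sequentially. poly_value p (\<lambda>i. t * a i + j i) / real t ^ D = f (\<lambda>i. t * a i + j i) / real t ^ D"
      using ev_large_ray[OF assms(1) a, of j] by eventually_elim simp
  qed
  then have "(\<lambda>t::nat. \<Sum>j\<in>cube h. f (\<lambda>i. t * a i + j i) / real t ^ D) \<longlonglongrightarrow> (\<Sum>j\<in>(cube h :: ('s \<Rightarrow> nat) set). ?T)"
    by (intro tendsto_sum)
  then show ?thesis by (simp add: sum_divide_distrib card_cube)
qed

lemma cube_ratio_limit:
  "(\<lambda>h. real (Suc (h + c) ^ s) / real (Suc h ^ s)) \<longlonglongrightarrow> 1"
proof -
  have "(\<lambda>h. 1 + real c * inverse (real (Suc h))) \<longlonglongrightarrow> 1 + real c * 0"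
    by (intro tendsto_intros LIMSEQ_inverse_real_of_nat)
  then have "(\<lambda>h. (1 + real c * inverse (real (Suc h))) ^ s) \<longlonglongrightarrow> (1 + real c * 0) ^ s"
    by (rule tendsto_power)
  moreover have "(1 + real c * inverse (real (Suc h))) ^ s = real (Suc (h + c) ^ s) / real (Suc h ^ s)" for h
  proof -
    have "1 + real c * inverse (real (Suc h)) = real (Suc (h + c)) / real (Suc h)" by (simp add: field_simps)
    then show ?thesis by (simp add: power_divide)
  qed
  ultimately show ?thesis by simp
qed

text \<open>The scale \<open>t\<close> of the position of the box goes to infinity first, its side \<open>h\<close> afterwards; the
  second limit makes the bounded shift \<open>d\<close> negligible.\<close>

lemma top_coefficients_of_box_inequalities:
  fixes f g :: "('s::finite \<Rightarrow> nat) \<Rightarrow> real"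
  assumes f: "ev_large (\<lambda>n. f n = poly_value p n)" "\<And>k. k \<in> Poly_Mapping.keys p \<Longrightarrow> tdeg k \<le> D"
    and g: "ev_large (\<lambda>n. g n = poly_value q n)" "\<And>k. k \<in> Poly_Mapping.keys q \<Longrightarrow> tdeg k \<le> D"
    and lower: "\<And>a h. d \<le> h \<Longrightarrow> r * (\<Sum>n\<in>box a h. f n) \<le> (\<Sum>n\<in>box a (h + d). g n)"
    and upper: "\<And>a h. d \<le> h \<Longrightarrow> (\<Sum>n\<in>box a h. g n) + c * (\<Sum>n\<in>box a (h - d). f n)
      \<le> r * (\<Sum>n\<in>box a (h + d). f n) + c * (\<Sum>n\<in>box a h. f n)"
    and k: "tdeg k = D"
  shows "Poly_Mapping.lookup q k = r * Poly_Mapping.lookup p k"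
proof -
  define N where "N h = real (Suc h ^ card (UNIV :: 's set))" for h
  have Npos: "N h > 0" for h unfolding N_def by simp
  have key: "(\<Sum>k\<in>{k\<in>Poly_Mapping.keys q. tdeg k = D}. Poly_Mapping.lookup q k * monomial_fun k a)
      = r * (\<Sum>k\<in>{k\<in>Poly_Mapping.keys p. tdeg k = D}. Poly_Mapping.lookup p k * monomial_fun k a)"
    (is "?\<mu> = r * ?\<sigma>")
    if a: "\<forall>i. 0 < a i" for a :: "'s \<Rightarrow> nat"
  proof -
    define F where "F h t = (\<Sum>j\<in>cube h. f (\<lambda>i. t * a i + j i)) / real t ^ D" for h t
    define G where "G h t = (\<Sum>j\<in>cube h. g (\<lambda>i. t * a i + j i)) / real t ^ D" for h t
    have F: "F h \<longlonglongrightarrow> N h * ?\<sigma>" for h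
      unfolding F_def N_def by (rule poly_value_box_limit[OF f a])
    have G: "G h \<longlonglongrightarrow> N h * ?\<mu>" for h
      unfolding G_def N_def by (rule poly_value_box_limit[OF g a])
    have l1: "r * F h t \<le> G (h + d) t" if "d \<le> h" for h t
    proof -
      have "r * (\<Sum>n\<in>box (\<lambda>i. t * a i) h. f n) / real t ^ D \<le> (\<Sum>n\<in>box (\<lambda>i. t * a i) (h + d). g n) / real t ^ D"
        by (intro divide_right_mono lower that) simp
      then show ?thesis unfolding F_def G_def sum_box by simp
    qed
    have u1: "G h t + c * F (h - d) t \<le> r * F (h + d) t + c * F h t" if "d \<le> h" for h t
    proof -
      have "((\<Sum>n\<in>box (\<lambda>i. t * a i) h. g n) + c * (\<Sum>n\<in>box (\<lambda>i. t * a i) (h - d). f n)) / real t ^ D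
          \<le> (r * (\<Sum>n\<in>box (\<lambda>i. t * a i) (h + d). f n) + c * (\<Sum>n\<in>box (\<lambda>i. t * a i) h. f n)) / real t ^ D"
        by (intro divide_right_mono upper that) simp
      then show ?thesis unfolding F_def G_def sum_box by (simp add: add_divide_distrib)
    qed
    \<comment> \<open>Letting \<open>t\<close> tend to infinity with \<open>h\<close> fixed turns
      the estimates into inequalities between values of the leading forms.\<close>
    have l2: "r * (N h * ?\<sigma>) \<le> N (h + d) * ?\<mu>" if "d \<le> h" for h
      by (rule LIMSEQ_le[OF tendsto_mult_left[OF F] G]) (use l1 that in blast)
    have u2: "N h * ?\<mu> + c * (N (h - d) * ?\<sigma>) \<le> r * (N (h + d) * ?\<sigma>) + c * (N h * ?\<sigma>)" if "d \<le> h" for h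
      by (rule LIMSEQ_le[OF tendsto_add[OF G tendsto_mult_left[OF F]] tendsto_add[OF tendsto_mult_left[OF F] tendsto_mult_left[OF F]]])
        (use u1 that in blast)
    have R: "(\<lambda>h. N (h + e) / N h) \<longlonglongrightarrow> 1" for e unfolding N_def by (rule cube_ratio_limit)
    have "r * ?\<sigma> \<le> 1 * ?\<mu>"
    proof (rule LIMSEQ_le[OF tendsto_const tendsto_mult_right[OF R[of d]]])
      have "r * ?\<sigma> \<le> N (h + d) / N h * ?\<mu>" if "d \<le> h" for h
        using l2[OF that] Npos[of h] by (simp add: field_simps)
      then show "\<exists>N'. \<forall>h\<ge>N'. r * ?\<sigma> \<le> N (h + d) / N h * ?\<mu>" by blast
    qed
    \<comment> \<open>The upper estimate is applied at \<open>h + d\<close>, so that the truncated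
      difference becomes \<open>h\<close>; this is the source of \<open>2 * d\<close>. In the limit
      the terms with \<open>c\<close> cancel.\<close>
    moreover have "1 * ?\<mu> + c * ?\<sigma> \<le> r * (1 * ?\<sigma>) + c * (1 * ?\<sigma>)"
    proof (rule LIMSEQ_le[OF tendsto_add[OF tendsto_mult_right[OF R[of d]] tendsto_const]
            tendsto_add[OF tendsto_mult_left[OF tendsto_mult_right[OF R[of "2 * d"]]] tendsto_mult_left[OF tendsto_mult_right[OF R[of d]]]]])
      have "N (h + d) / N h * ?\<mu> + c * ?\<sigma> \<le> r * (N (h + 2 * d) / N h * ?\<sigma>) + c * (N (h + d) / N h * ?\<sigma>)" for h
      proof -
        have "N (h + d) * ?\<mu> + c * (N h * ?\<sigma>) \<le> r * (N (h + 2 * d) * ?\<sigma>) + c * (N (h + d) * ?\<sigma>)"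
          using u2[of "h + d"] by (simp add: mult_2 add.assoc)
        then have "(N (h + d) * ?\<mu> + c * (N h * ?\<sigma>)) / N h \<le> (r * (N (h + 2 * d) * ?\<sigma>) + c * (N (h + d) * ?\<sigma>)) / N h"
          using Npos[of h] by (intro divide_right_mono) simp_all
        then show ?thesis using Npos[of h] by (simp add: add_divide_distrib)
      qed
      then show "\<exists>N'. \<forall>h\<ge>N'. N (h + d) / N h * ?\<mu> + c * ?\<sigma>
          \<le> r * (N (h + 2 * d) / N h * ?\<sigma>) + c * (N (h + d) / N h * ?\<sigma>)" by blast
    qed
    ultimately show ?thesis by simp
  qed
  \<comment> \<open>\<open>k\<close> is inserted explicitly, since it may be missing from both
    supports.\<close>
  define K where "K = {k'\<in>insert k (Poly_Mapping.keys p \<union> Poly_Mapping.keys q). tdeg k' = D}"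
  have finK: "finite K" unfolding K_def by simp
  have ext: "(\<Sum>k\<in>{k\<in>Poly_Mapping.keys p'. tdeg k = D}. Poly_Mapping.lookup p' k * monomial_fun k a)
      = (\<Sum>k\<in>K. Poly_Mapping.lookup p' k * monomial_fun k a)"
    if "Poly_Mapping.keys p' \<subseteq> insert k (Poly_Mapping.keys p \<union> Poly_Mapping.keys q)" for p' a
    using that by (intro sum.mono_neutral_left finK) (auto simp: K_def in_keys_iff)
  have "Poly_Mapping.lookup q k - r * Poly_Mapping.lookup p k = 0"
  proof (rule poly_sum_zero_imp[where K = K and N = 1 and \<kappa> = k and c = "\<lambda>k. Poly_Mapping.lookup q k - r * Poly_Mapping.lookup p k"])
    fix a :: "'s \<Rightarrow> nat" assume "\<forall>i. 1 \<le> a i"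
    then have a: "\<forall>i. 0 < a i" by (simp add: Suc_le_eq)
    have "(\<Sum>k\<in>K. Poly_Mapping.lookup q k * monomial_fun k a) = r * (\<Sum>k\<in>K. Poly_Mapping.lookup p k * monomial_fun k a)"
      using key[OF a] unfolding ext[OF subset_trans[OF Un_upper1 subset_insertI]] ext[OF subset_trans[OF Un_upper2 subset_insertI]] .
    then show "(\<Sum>k\<in>K. (Poly_Mapping.lookup q k - r * Poly_Mapping.lookup p k) * monomial_fun k a) = 0"
      by (simp add: left_diff_distrib sum_subtractf sum_distrib_left mult.assoc)
  qed (auto simp: K_def k)
  then show ?thesis by simp
qed

text \<open>The coordinates of \<open>w y\<close> are those of \<open>y\<close> multiplied by
  \<open>w\<close>, and \<open>w\<close> is a nonzerodivisor.\<close>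

lemma (in module) smult_independent_inj:
  assumes "set xs \<subseteq> carrier M" "independent xs" "w \<in> nzd" "y \<in> lin_span (carrier R) xs" "w \<odot>\<^bsub>M\<^esub> y = \<zero>\<^bsub>M\<^esub>"
  shows "y = \<zero>\<^bsub>M\<^esub>"
  using assms
proof (induction xs arbitrary: y)
  case (Cons x xs)
  interpret r: module R "regular_module R" by (rule module_regular_module)
  have L: "closed_sub M (carrier R) (lin_span (carrier R) xs)"
    by (rule closed_sub_lin_span[OF subset_refl]) (use r.closed_sub_carrier[OF subset_refl] Cons.prems(1) in auto)
  from Cons.prems(4) obtain u z where "u \<in> (\<lambda>a. a \<odot>\<^bsub>M\<^esub> x) ` carrier R" and z: "z \<in> lin_span (carrier R) xs"
    and y: "y = u \<oplus>\<^bsub>M\<^esub> z" unfolding lin_span.simps by (rule sum_subE)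
  then obtain a where a: "a \<in> carrier R" "u = a \<odot>\<^bsub>M\<^esub> x" by blast
  have c: "x \<in> carrier M" "z \<in> carrier M" "w \<in> carrier R" using Cons.prems(1,3) closed_subD(3)[OF L z] by auto
  have e: "(w \<otimes> a) \<odot>\<^bsub>M\<^esub> x \<oplus>\<^bsub>M\<^esub> w \<odot>\<^bsub>M\<^esub> z = \<zero>\<^bsub>M\<^esub>"
    using Cons.prems(5) a c unfolding y a(2) by (simp add: smult_r_distr smult_assoc1)
  then have "(w \<otimes> a) \<odot>\<^bsub>M\<^esub> x = \<ominus>\<^bsub>M\<^esub> (w \<odot>\<^bsub>M\<^esub> z)"
    using a c by (intro M.minus_equality[symmetric]) auto
  moreover have "\<ominus>\<^bsub>M\<^esub> (w \<odot>\<^bsub>M\<^esub> z) \<in> lin_span (carrier R) xs"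
    by (intro closed_subD(5)[OF L] closed_subD(6)[OF L] c z)
  ultimately have "w \<otimes> a = \<zero>" using Cons.prems(2) a c by simp
  then have "a = \<zero>" using nzdD[OF Cons.prems(3) a(1)] by simp
  then have yz: "y = z" unfolding y a(2) using c by simp
  have "z = \<zero>\<^bsub>M\<^esub>" by (rule Cons.IH) (use Cons.prems z yz in auto)
  then show ?case using yz by simp
qed simp

section \<open>Lengths of the parts of a module in a box of degrees\<close>

context standard_module
begin

definition lm :: "('s \<Rightarrow> nat) \<Rightarrow> nat" where
  "lm n = the_enat (len Q {\<zero>\<^bsub>M\<^esub>} (grM n))"

lemma len_gr: "len Q {\<zero>\<^bsub>M\<^esub>} (grM n) = enat (lm n)"
  unfolding lm_def using finite_len_grM[of n] by auto

lemma lin_map_id: "lin_map S M M (\<lambda>x. x)"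
  unfolding lin_map_def by simp

text \<open>Pieces of distinct degrees meet only in zero, so each further degree adds exactly its
  own length.\<close>

lemma len_part:
  assumes "finite B" shows "len Q {\<zero>\<^bsub>M\<^esub>} (B.GM.part B) = enat (\<Sum>n\<in>B. lm n)"
  using assms
proof (induction B rule: finite_induct)
  case empty
  then show ?case by (simp add: B.GM.part_empty zero_enat_def)
next
  case (insert n B)
  let ?P = "B.GM.part B"
  have P: "Q ?P" by (rule B.closed_sub_part)
  have eq: "B.GM.part (insert n B) = sum_sub M ?P ((\<lambda>x. x) ` grM n)"
  proof
    show "B.GM.part (insert n B) \<subseteq> sum_sub M ?P ((\<lambda>x. x) ` grM n)"
    proof
      fix x assume x: "x \<in> B.GM.part (insert n B)"
      then have xc: "x \<in> carrier M" unfolding B.GM.part_def by simp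
      let ?y = "B.GM.component x n"
      have y: "?y \<in> grM n" using B.GM.component_props(1)[OF xc] by auto
      then have yc: "?y \<in> carrier M" by (rule B.GM.gr_closed)
      have "x \<oplus>\<^bsub>M\<^esub> \<ominus>\<^bsub>M\<^esub> ?y \<in> ?P"
        using x xc y yc unfolding B.GM.part_def
        by (auto simp: B.GM.component_add B.GM.component_minus B.GM.component_homogeneous[OF y(1)] B.M.r_neg)
      moreover have "x = (x \<oplus>\<^bsub>M\<^esub> \<ominus>\<^bsub>M\<^esub> ?y) \<oplus>\<^bsub>M\<^esub> ?y" using xc yc by (simp add: B.M.a_assoc B.M.l_neg)
      ultimately show "x \<in> sum_sub M ?P ((\<lambda>x. x) ` grM n)"
        using sum_subI[of "x \<oplus>\<^bsub>M\<^esub> \<ominus>\<^bsub>M\<^esub> ?y" ?P ?y "(\<lambda>x. x) ` grM n" M] y(1) by simp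
    qed
    show "sum_sub M ?P ((\<lambda>x. x) ` grM n) \<subseteq> B.GM.part (insert n B)"
      by (rule B.sum_sub_least[OF B.closed_sub_part])
        (use B.GM.part_mono[of B "insert n B"] B.GM.gr_subset_part[of n "insert n B"] in auto)
  qed
  have disj: "x = \<zero>\<^bsub>M\<^esub>" if "x \<in> grM n" "x \<in> ?P" for x
    using that insert.hyps(2) B.GM.component_homogeneous[OF that(1), of n] unfolding B.GM.part_def by auto
  have "len Q ?P (sum_sub M ?P ((\<lambda>x. x) ` grM n)) = len Q {\<zero>\<^bsub>M\<^esub>} (grM n)"
  proof (rule antisym)
    show "len Q ?P (sum_sub M ?P ((\<lambda>x. x) ` grM n)) \<le> len Q {\<zero>\<^bsub>M\<^esub>} (grM n)"
      by (rule len_image_le[OF B.module_axioms B.module_axioms lin_map_id A.gr0_subset Q_zero B.closed_sub_gr _ P])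
        (use closed_subD(2)[OF P] in auto)
    show "len Q {\<zero>\<^bsub>M\<^esub>} (grM n) \<le> len Q ?P (sum_sub M ?P ((\<lambda>x. x) ` grM n))"
      by (rule len_image_ge[OF B.module_axioms B.module_axioms lin_map_id A.gr0_subset Q_zero B.closed_sub_gr P])
        (use disj in auto)
  qed
  moreover have "len Q {\<zero>\<^bsub>M\<^esub>} (B.GM.part (insert n B)) = len Q {\<zero>\<^bsub>M\<^esub>} ?P + len Q ?P (B.GM.part (insert n B))"
    by (rule B.len_add[OF A.gr0_subset Q_zero P B.closed_sub_part])
      (use closed_subD(2)[OF P] B.GM.part_mono[of B "insert n B"] in auto)
  ultimately show ?case using insert len_gr[of n] eq by (simp add: add.commute)
qed

lemma part_subset_lin_span: "B.GM.part B \<subseteq> B.lin_span (A.GR.part B) ms"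
proof
  fix x assume "x \<in> B.GM.part B"
  have P: "closed_sub (regular_module S) S0 (A.GR.part B)"
    using A.closed_sub_part[of B] unfolding A.GM.part_def A.GR.part_def by simp
  have L: "Q (B.lin_span (A.GR.part B) ms)"
    by (rule B.closed_sub_lin_span[OF A.gr0_subset P ms_carrier])
  show "x \<in> B.lin_span (A.GR.part B) ms" using \<open>x \<in> B.GM.part B\<close>
  proof (rule B.GM.part_induct)
    fix n y assume "n \<in> B" "y \<in> grM n"
    then show "y \<in> B.lin_span (A.GR.part B) ms"
      using gr_span[of n] B.lin_span_mono[OF A.GR.gr_subset_part[of n B], of ms] by blast
  qed (use closed_subD(2,4)[OF L] in auto)
qed

end

context standard_module
begin

definition ls :: "('s \<Rightarrow> nat) \<Rightarrow> nat" where
  "ls n = the_enat (len QS {\<zero>} (grS n))"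

abbreviation "SP B \<equiv> A.GR.part B"
abbreviation "MP B \<equiv> B.GM.part B"

lemma len_SP: "finite B \<Longrightarrow> len QS {\<zero>} (SP B) = enat (\<Sum>n\<in>B. ls n)"
  using AA.len_part[of B] unfolding AA.lm_def[abs_def] ls_def[abs_def] A.GM.part_def A.GR.part_def by simp

lemma closed_sub_SP: "QS (SP B)"
  using A.closed_sub_part[of B] unfolding A.GM.part_def A.GR.part_def by simp

lemma SP_subset: "SP B \<subseteq> carrier S"
  unfolding A.GR.part_def by blast

lemma mult_SP_cube:
  assumes "a \<in> SP (box b h)" "c \<in> SP (cube d)" shows "a \<otimes> c \<in> SP (box b (h + d))"
  using A.smult_part[of a "box b h" c "cube d" "box b (h + d)", OF _ _ box_add_cube] assms
  unfolding A.GM.part_def A.GR.part_def by simp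

lemma lin_span_bounded:
  assumes "set xs \<subseteq> carrier M" "y \<in> B.lin_span (carrier S) xs"
  shows "\<exists>d. y \<in> B.lin_span (SP (cube d)) xs"
  using assms
proof (induction xs arbitrary: y)
  case (Cons x xs)
  from Cons.prems(2) obtain u z where "u \<in> (\<lambda>a. a \<odot>\<^bsub>M\<^esub> x) ` carrier S" and z: "z \<in> B.lin_span (carrier S) xs"
    and y: "y = u \<oplus>\<^bsub>M\<^esub> z" unfolding B.lin_span.simps by (rule sum_subE)
  then obtain a where a: "a \<in> carrier S" "u = a \<odot>\<^bsub>M\<^esub> x" by blast
  obtain d where d: "z \<in> B.lin_span (SP (cube d)) xs" using Cons.IH z Cons.prems(1) by auto
  obtain e where e: "a \<in> SP (cube e)" using A.GR.finite_degree_bound[of "{a}"] a(1) unfolding cube_def by auto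
  have sub: "cube d \<subseteq> cube (max d e)" "cube e \<subseteq> cube (max d e)" unfolding cube_def by (auto simp: le_max_iff_disj)
  have "a \<in> SP (cube (max d e))" using A.GR.part_mono[OF sub(2)] e by blast
  moreover have "z \<in> B.lin_span (SP (cube (max d e))) xs"
    using B.lin_span_mono[OF A.GR.part_mono[OF sub(1)], of xs] d by blast
  ultimately have "y \<in> B.lin_span (SP (cube (max d e))) (x # xs)"
    unfolding y a(2) B.lin_span.simps by (intro sum_subI imageI)
  then show ?case ..
qed simp

lemma cube_mono: "d \<le> e \<Longrightarrow> cube d \<subseteq> cube e"
  unfolding cube_def by (auto intro: order_trans)

text \<open>One \<open>d\<close> for all inhomogeneous data: the elements of \<open>xs\<close>, the
  denominator \<open>w\<close>, and the coefficients of \<open>w m\<close> for the generators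
  \<open>m\<close>.\<close>

lemma ex_degree_bound:
  assumes xs: "set xs \<subseteq> carrier M" and w: "w \<in> carrier S"
    and span: "\<And>m. m \<in> carrier M \<Longrightarrow> w \<odot>\<^bsub>M\<^esub> m \<in> B.lin_span (carrier S) xs"
  obtains d where "set xs \<subseteq> MP (cube d)" "w \<in> SP (cube d)"
    "\<And>m. m \<in> set ms \<Longrightarrow> w \<odot>\<^bsub>M\<^esub> m \<in> B.lin_span (SP (cube d)) xs"
proof -
  obtain d1 where d1: "\<forall>x\<in>set xs. x \<in> MP (cube d1)"
    using B.GM.finite_degree_bound[of "set xs"] xs unfolding cube_def by auto
  obtain d2 where d2: "w \<in> SP (cube d2)"
    using A.GR.finite_degree_bound[of "{w}"] w unfolding cube_def by auto
  have "\<exists>d. \<forall>m\<in>set ys. w \<odot>\<^bsub>M\<^esub> m \<in> B.lin_span (SP (cube d)) xs" if "set ys \<subseteq> carrier M" for ys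
    using that
  proof (induction ys)
    case (Cons y ys)
    then obtain d where d: "\<forall>m\<in>set ys. w \<odot>\<^bsub>M\<^esub> m \<in> B.lin_span (SP (cube d)) xs" by auto
    obtain e where e: "w \<odot>\<^bsub>M\<^esub> y \<in> B.lin_span (SP (cube e)) xs"
      using lin_span_bounded[OF xs span] Cons.prems by auto
    have "B.lin_span (SP (cube d)) xs \<subseteq> B.lin_span (SP (cube (max d e))) xs"
      "B.lin_span (SP (cube e)) xs \<subseteq> B.lin_span (SP (cube (max d e))) xs"
      by (intro B.lin_span_mono A.GR.part_mono cube_mono; simp)+
    then show ?case using d e by (intro exI[of _ "max d e"]) auto
  qed simp
  then obtain d3 where d3: "\<forall>m\<in>set ms. w \<odot>\<^bsub>M\<^esub> m \<in> B.lin_span (SP (cube d3)) xs" using ms_carrier by blast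
  define d where "d = max d1 (max d2 d3)"
  have le: "d1 \<le> d" "d2 \<le> d" "d3 \<le> d" unfolding d_def by auto
  show thesis
  proof (rule that[of d])
    show "set xs \<subseteq> MP (cube d)" using d1 B.GM.part_mono[OF cube_mono[OF le(1)]] by blast
    show "w \<in> SP (cube d)" using d2 A.GR.part_mono[OF cube_mono[OF le(2)]] by blast
    show "w \<odot>\<^bsub>M\<^esub> m \<in> B.lin_span (SP (cube d)) xs" if "m \<in> set ms" for m
      using d3 that B.lin_span_mono[OF A.GR.part_mono[OF cube_mono[OF le(3)]], of xs] by blast
  qed
qed

text \<open>Below: combinations of \<open>xs\<close> with coefficients in a box stay in the box
  enlarged by \<open>d\<close>, and independence counts the coefficients \<open>length xs\<close>
  times. Above: the part of \<open>M\<close> in the box is split by the span of \<open>xs\<close>.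
  Inside the span, \<open>w\<close> acts injectively, with values in combinations whose coefficients
  come from the enlarged box. Outside, the quotient is controlled by \<open>ms\<close> over the
  truncation of \<open>S / w S\<close>. The subtracted sum stands on the left because the sums are
  natural numbers.\<close>

theorem box_inequalities:
  assumes xs: "set xs \<subseteq> carrier M" "B.independent xs" and w: "w \<in> nzd"
    and span: "\<And>m. m \<in> carrier M \<Longrightarrow> w \<odot>\<^bsub>M\<^esub> m \<in> B.lin_span (carrier S) xs"
  shows "\<exists>d. \<forall>a h. d \<le> h \<longrightarrow>
    length xs * (\<Sum>n\<in>box a h. ls n) \<le> (\<Sum>n\<in>box a (h + d). lm n) \<and>
    (\<Sum>n\<in>box a h. lm n) + length ms * (\<Sum>n\<in>box a (h - d). ls n)
      \<le> length xs * (\<Sum>n\<in>box a (h + d). ls n) + length ms * (\<Sum>n\<in>box a h. ls n)"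
proof -
  have wc: "w \<in> carrier S" using w by simp
  obtain d where dx: "set xs \<subseteq> MP (cube d)" and dw: "w \<in> SP (cube d)"
    and dm: "\<And>m. m \<in> set ms \<Longrightarrow> w \<odot>\<^bsub>M\<^esub> m \<in> B.lin_span (SP (cube d)) xs"
    using ex_degree_bound[OF xs(1) wc span] by blast
  let ?F = "B.lin_span (carrier S) xs"
  have cF: "closed_sub M (carrier S) ?F"
    by (rule B.closed_sub_lin_span[OF subset_refl _ xs(1)]) (use A.closed_sub_carrier[OF subset_refl] in simp)
  have QF: "Q ?F" by (rule closed_sub_antimono[OF cF A.gr0_subset])
  have QL: "Q (B.lin_span (SP B) ys)" if "set ys \<subseteq> carrier M" for B ys
    by (rule B.closed_sub_lin_span[OF A.gr0_subset closed_sub_SP that])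
  have lin_w: "lin_map S M M (\<lambda>x. w \<odot>\<^bsub>M\<^esub> x)" by (rule B.lin_map_smult_left[OF wc])
  have upper_xs: "len Q {\<zero>\<^bsub>M\<^esub>} (B.lin_span (SP B) xs) \<le> of_nat (length xs) * len QS {\<zero>} (SP B)" for B
  proof -
    have "len Q {\<zero>\<^bsub>M\<^esub>} (sum_sub M {\<zero>\<^bsub>M\<^esub>} (B.lin_span (SP B) xs)) \<le> of_nat (length xs) * len QS {\<zero>} (SP B)"
      by (rule B.len_lin_span_le[OF A.gr0_subset QS_zero closed_sub_SP _ xs(1) Q_zero])
        (use xs(1) closed_subD(2)[OF closed_sub_SP] in auto)
    then show ?thesis using B.sum_sub_zero(1)[OF closed_subD(1)[OF QL[OF xs(1)]]] by simp
  qed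
  have first: "length xs * (\<Sum>n\<in>box a h. ls n) \<le> (\<Sum>n\<in>box a (h + d). lm n)" for a h
  proof -
    have "B.lin_span (SP (box a h)) xs \<subseteq> MP (box a (h + d))"
      by (rule B.lin_span_least[OF B.closed_sub_part]) (use B.smult_part[OF _ _ box_add_cube] dx in blast)
    then have "len Q {\<zero>\<^bsub>M\<^esub>} (B.lin_span (SP (box a h)) xs) \<le> len Q {\<zero>\<^bsub>M\<^esub>} (MP (box a (h + d)))"
      by (intro len_mono B.closed_sub_part Q_zero) auto
    moreover have "of_nat (length xs) * len QS {\<zero>} (SP (box a h)) \<le> len Q {\<zero>\<^bsub>M\<^esub>} (B.lin_span (SP (box a h)) xs)"
      by (rule B.len_lin_span_ge[OF A.gr0_subset closed_sub_SP xs])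
    ultimately have "of_nat (length xs) * len QS {\<zero>} (SP (box a h)) \<le> len Q {\<zero>\<^bsub>M\<^esub>} (MP (box a (h + d)))"
      by (rule order_trans[rotated])
    then show ?thesis by (simp add: len_SP[OF finite_box] len_part[OF finite_box] of_nat_eq_enat)
  qed
  have second: "(\<Sum>n\<in>box a h. lm n) + length ms * (\<Sum>n\<in>box a (h - d). ls n)
      \<le> length xs * (\<Sum>n\<in>box a (h + d). ls n) + length ms * (\<Sum>n\<in>box a h. ls n)" if h: "d \<le> h" for a h
  proof -
    let ?V = "MP (box a h)" and ?A = "SP (box a h)" and ?A' = "SP (box a (h - d))"
    let ?L = "B.lin_span (SP (box a (h + d))) xs"
    have QV: "Q ?V" by (rule B.closed_sub_part)
    have QVF: "Q (?V \<inter> ?F)" by (rule closed_sub_Int[OF QV QF])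
    \<comment> \<open>\<open>v\<close> is a combination of \<open>ms\<close> with coefficients in
      the box, and \<open>w m\<close> is one of \<open>xs\<close> with coefficients in
      \<open>cube d\<close>; multiplying the coefficients enlarges the box by
      \<open>d\<close>.\<close>
    have wV: "w \<odot>\<^bsub>M\<^esub> v \<in> ?L" if "v \<in> ?V" for v
    proof -
      have "B.lin_span ?A ms \<subseteq> {v\<in>carrier M. w \<odot>\<^bsub>M\<^esub> v \<in> ?L}"
      proof (rule B.lin_span_least)
        show "Q {v\<in>carrier M. w \<odot>\<^bsub>M\<^esub> v \<in> ?L}"
          by (rule closed_sub_preimage[OF B.module_axioms B.module_axioms lin_w A.gr0_subset
                B.closed_sub_carrier[OF A.gr0_subset] QL[OF xs(1)]])
        fix b m assume b: "b \<in> ?A" and m: "m \<in> set ms"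
        have bc: "b \<in> carrier S" and mc: "m \<in> carrier M" using b SP_subset m ms_carrier by blast+
        have "b \<odot>\<^bsub>M\<^esub> (w \<odot>\<^bsub>M\<^esub> m) \<in> ?L"
          by (rule B.smult_lin_span[OF bc SP_subset xs(1) mult_SP_cube[OF b] dm[OF m]])
        moreover have "w \<odot>\<^bsub>M\<^esub> (b \<odot>\<^bsub>M\<^esub> m) = b \<odot>\<^bsub>M\<^esub> (w \<odot>\<^bsub>M\<^esub> m)"
          using bc mc wc by (simp add: B.smult_assoc1[symmetric] m_comm)
        ultimately show "b \<odot>\<^bsub>M\<^esub> m \<in> {v\<in>carrier M. w \<odot>\<^bsub>M\<^esub> v \<in> ?L}" using bc mc by simp
      qed
      then show ?thesis using part_subset_lin_span that by blast
    qed
    have "len Q {\<zero>\<^bsub>M\<^esub>} (?V \<inter> ?F) \<le> len Q {\<zero>\<^bsub>M\<^esub>} (sum_sub M {\<zero>\<^bsub>M\<^esub>} ((\<lambda>x. w \<odot>\<^bsub>M\<^esub> x) ` (?V \<inter> ?F)))"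
      by (rule len_image_ge[OF B.module_axioms B.module_axioms lin_w A.gr0_subset Q_zero QVF Q_zero])
        (use B.smult_independent_inj[OF xs w] in auto)
    also have "\<dots> \<le> len Q {\<zero>\<^bsub>M\<^esub>} ?L"
    proof (rule len_mono)
      show "sum_sub M {\<zero>\<^bsub>M\<^esub>} ((\<lambda>x. w \<odot>\<^bsub>M\<^esub> x) ` (?V \<inter> ?F)) \<subseteq> ?L"
        by (rule B.sum_sub_least[OF QL[OF xs(1)]]) (use wV closed_subD(2)[OF QL[OF xs(1)]] in auto)
    qed (use Q_zero QL[OF xs(1)] in auto)
    also have "\<dots> \<le> of_nat (length xs) * len QS {\<zero>} (SP (box a (h + d)))" by (rule upper_xs)
    finally have 1: "len Q {\<zero>\<^bsub>M\<^esub>} (?V \<inter> ?F) \<le> enat (length xs * (\<Sum>n\<in>box a (h + d). ls n))"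
      by (simp add: len_SP[OF finite_box] of_nat_eq_enat)
    \<comment> \<open>Multiplication by \<open>w\<close> raises degrees by at most \<open>d\<close>,
      so the multiples of \<open>w\<close> coming from the box of size \<open>h - d\<close> stay in
      the given box. As \<open>w\<close> is a nonzerodivisor, they have the full length of the
      smaller box.\<close>
    let ?W = "(\<lambda>x. w \<odot>\<^bsub>regular_module S\<^esub> x) ` ?A'"
    have lin_wS: "lin_map S (regular_module S) (regular_module S) (\<lambda>x. w \<odot>\<^bsub>regular_module S\<^esub> x)"
      by (rule A.lin_map_smult_left[OF wc])
    have QA0: "QS ?W"
      by (rule closed_sub_image[OF module_regular_module module_regular_module lin_wS A.gr0_subset closed_sub_SP])
    have A0A: "?W \<subseteq> ?A"
    proof
      fix z assume "z \<in> ?W"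
      then obtain x where x: "x \<in> ?A'" "z = w \<otimes> x" by auto
      have "x \<otimes> w \<in> SP (box a (h - d + d))" by (rule mult_SP_cube[OF x(1) dw])
      then show "z \<in> ?A" using x wc SP_subset h by (simp add: m_comm subset_iff)
    qed
    have "len QS {\<zero>} ?A' \<le> len QS {\<zero>} (sum_sub (regular_module S) {\<zero>} ?W)"
      by (rule len_image_ge[OF module_regular_module module_regular_module lin_wS A.gr0_subset QS_zero closed_sub_SP QS_zero])
        (use nzdD[OF w] SP_subset in auto)
    moreover have "sum_sub (regular_module S) {\<zero>} ?W = ?W"
      using A.sum_sub_zero(1)[OF closed_subD(1)[OF QA0]] by simp
    moreover have "len QS {\<zero>} ?A = len QS {\<zero>} ?W + len QS ?W ?A"
      by (rule A.len_add[OF A.gr0_subset QS_zero QA0 closed_sub_SP _ A0A]) (use closed_subD(2)[OF QA0] in auto)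
    ultimately have "len QS {\<zero>} ?A' + len QS ?W ?A \<le> len QS {\<zero>} ?A"
      by (simp add: add_right_mono)
    then have le2: "enat (\<Sum>n\<in>box a (h - d). ls n) + len QS ?W ?A \<le> enat (\<Sum>n\<in>box a h. ls n)"
      by (simp add: len_SP[OF finite_box])
    then obtain c where c: "len QS ?W ?A = enat c" by (cases "len QS ?W ?A") auto
    have c2: "(\<Sum>n\<in>box a (h - d). ls n) + c \<le> (\<Sum>n\<in>box a h. ls n)" using le2 unfolding c by simp
    \<comment> \<open>The quotient of \<open>?V\<close> by its intersection with \<open>?F\<close>
      embeds into the quotient of \<open>?F\<close> plus the span of \<open>ms\<close> by
      \<open>?F\<close>; there \<open>?W\<close> acts as zero, because \<open>w\<close> maps
      \<open>ms\<close> into \<open>?F\<close>.\<close>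
    have "len Q (?V \<inter> ?F) ?V \<le> len Q ?F (sum_sub M ?F ((\<lambda>x. x) ` ?V))"
      by (rule len_image_ge[OF B.module_axioms B.module_axioms lin_map_id A.gr0_subset QVF QV QF]) auto
    also have "\<dots> \<le> len Q ?F (sum_sub M ?F (B.lin_span ?A ms))"
    proof (rule len_mono)
      show "sum_sub M ?F ((\<lambda>x. x) ` ?V) \<subseteq> sum_sub M ?F (B.lin_span ?A ms)"
        by (rule sum_sub_mono) (use part_subset_lin_span in auto)
    qed (use QF B.closed_sub_sum_sub[OF A.gr0_subset QF QL[OF ms_carrier]] in auto)
    also have "\<dots> \<le> of_nat (length ms) * len QS ?W ?A"
    proof (rule B.len_lin_span_le[OF A.gr0_subset QA0 closed_sub_SP A0A ms_carrier QF])
      fix b m assume "b \<in> ?W" and m: "m \<in> set ms"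
      then obtain x where x: "x \<in> ?A'" "b = w \<otimes> x" by auto
      have xc: "x \<in> carrier S" and mc: "m \<in> carrier M" using x SP_subset m ms_carrier by blast+
      have "b \<odot>\<^bsub>M\<^esub> m = x \<odot>\<^bsub>M\<^esub> (w \<odot>\<^bsub>M\<^esub> m)"
        using xc mc wc unfolding x(2) by (simp add: B.smult_assoc1[symmetric] m_comm)
      then show "b \<odot>\<^bsub>M\<^esub> m \<in> ?F" using closed_subD(6)[OF cF xc span[OF mc]] by simp
    qed
    finally have 2: "len Q (?V \<inter> ?F) ?V \<le> enat (length ms * c)" unfolding c by (simp add: of_nat_eq_enat)
    have "enat (\<Sum>n\<in>box a h. lm n) = len Q {\<zero>\<^bsub>M\<^esub>} (?V \<inter> ?F) + len Q (?V \<inter> ?F) ?V"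
      unfolding len_part[OF finite_box, symmetric]
      by (rule B.len_add[OF A.gr0_subset Q_zero QVF QV]) (use closed_subD(2)[OF QVF] in auto)
    also have "\<dots> \<le> enat (length xs * (\<Sum>n\<in>box a (h + d). ls n)) + enat (length ms * c)"
      by (rule add_mono[OF 1 2])
    finally have "(\<Sum>n\<in>box a h. lm n) \<le> length xs * (\<Sum>n\<in>box a (h + d). ls n) + length ms * c" by simp
    moreover have "length ms * (\<Sum>n\<in>box a (h - d). ls n) + length ms * c \<le> length ms * (\<Sum>n\<in>box a h. ls n)"
      using mult_le_mono2[OF c2, of "length ms"] by (simp add: algebra_simps)
    ultimately show ?thesis by linarith
  qed
  show ?thesis using first second by blast
qed

end


section \<open>Mixed multiplicities and rank\<close>

text \<open>A finite supremum of chain lengths is attained, since lengths are integers.\<close>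

lemma chain_dimension_realD:
  assumes "chain_dimension V = ereal (real D)"
  shows "chain_from V P d \<Longrightarrow> d \<le> D" and "\<exists>P. chain_from V P D"
proof -
  let ?A = "{ereal (real d) | d. \<exists>P :: nat \<Rightarrow> 'a set. (\<forall>i\<le>d. P i \<in> V) \<and> (\<forall>i<d. P i \<subset> P (Suc i))}"
  have Sup: "Sup ?A = ereal (real D)" using assms unfolding chain_dimension_def .
  show le: "d \<le> D" if "chain_from V P d" for P d
  proof -
    have "ereal (real d) \<in> ?A" using that unfolding chain_from_def by auto
    then have "ereal (real d) \<le> ereal (real D)" unfolding Sup[symmetric] by (rule Sup_upper)
    then show ?thesis by simp
  qed
  \<comment> \<open>Among the lengths, all at most \<open>D\<close>, only \<open>D\<close> itself
    exceeds \<open>D - 1 / 2\<close>.\<close>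
  have "ereal (real D - 1 / 2) < Sup ?A" unfolding Sup by simp
  then obtain d and p :: "nat \<Rightarrow> 'a set" where d: "real D - 1 / 2 < real d"
    and p: "\<forall>i\<le>d. p i \<in> V" "\<forall>i<d. p i \<subset> p (Suc i)"
    unfolding less_Sup_iff by auto
  have "chain_from V (p 0) d" unfolding chain_from_def using p by blast
  moreover from this have "d = D" using le d by fastforce
  ultimately show "\<exists>P. chain_from V P D" by blast
qed

text \<open>An element \<open>f\<close> that no nonzero scalar kills stays nonzero in the
  localization at every prime, and one such element suffices for full support.\<close>

lemma Supp_plusplus_eq_Proj:
  assumes "module S X" and f: "f \<in> carrier X"
    and faithful: "\<And>a. a \<in> carrier S \<Longrightarrow> a \<odot>\<^bsub>X\<^esub> f = \<zero>\<^bsub>X\<^esub> \<Longrightarrow> a = \<zero>\<^bsub>S\<^esub>"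
  shows "Supp_plusplus S grS X = Proj S grS"
proof -
  interpret module S X by (rule assms(1))
  have "carrier (localized_module S (carrier S - P) X) \<noteq> {\<zero>\<^bsub>localized_module S (carrier S - P) X\<^esub>}"
    if "P \<in> Proj S grS" for P
  proof
    let ?W = "carrier S - P"
    interpret primeideal P S using that unfolding Proj_def by blast
    have one: "\<one>\<^bsub>S\<^esub> \<in> ?W" using I_notcarr one_imp_carrier by auto
    assume "carrier (localized_module S ?W X) = {\<zero>\<^bsub>localized_module S ?W X\<^esub>}"
    moreover have "fraction ?W X f \<one>\<^bsub>S\<^esub> \<in> carrier (localized_module S ?W X)"
      unfolding localized_module_def fraction_def using f one by (simp add: quotientI)
    ultimately have "fraction ?W X f \<one>\<^bsub>S\<^esub> = fraction ?W X \<zero>\<^bsub>X\<^esub> \<one>\<^bsub>S\<^esub>"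
      by (simp add: localized_module_def)
    moreover have "(f, \<one>\<^bsub>S\<^esub>) \<in> fraction ?W X f \<one>\<^bsub>S\<^esub>"
      unfolding fraction_def frac_rel_def using f one by auto
    ultimately have "(f, \<one>\<^bsub>S\<^esub>) \<in> fraction ?W X \<zero>\<^bsub>X\<^esub> \<one>\<^bsub>S\<^esub>" by simp
    then obtain u where u: "u \<in> ?W" "u \<odot>\<^bsub>X\<^esub> (\<one>\<^bsub>S\<^esub> \<odot>\<^bsub>X\<^esub> \<zero>\<^bsub>X\<^esub>) = u \<odot>\<^bsub>X\<^esub> (\<one>\<^bsub>S\<^esub> \<odot>\<^bsub>X\<^esub> f)"
      unfolding fraction_def frac_rel_def by auto
    then have "u \<odot>\<^bsub>X\<^esub> f = \<zero>\<^bsub>X\<^esub>" using f by (simp add: smult_r_null)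
    then have "u = \<zero>\<^bsub>S\<^esub>" using faithful u(1) by blast
    then show False using u(1) additive_subgroup.zero_closed[OF additive_subgroup_axioms] by blast
  qed
  then show ?thesis unfolding Supp_plusplus_def by blast
qed

section \<open>From the hypotheses to finite lengths and finite generation in degree zero\<close>

lemma standard_algebra_if_standard_graded:
  assumes "standard_graded_algebra R S grS" "artinian_ring R" "cring R"
  obtains F where "standard_algebra S grS F"
proof -
  have S: "cring S" and dec: "direct_sum_decomposition S grS"
    and mult: "\<And>n n' a b. a \<in> grS n \<Longrightarrow> b \<in> grS n' \<Longrightarrow> a \<otimes>\<^bsub>S\<^esub> b \<in> grS (\<lambda>i. n i + n' i)"
    and R: "R = S\<lparr>carrier := grS (\<lambda>_. 0)\<rparr>"
    using assms(1) unfolding standard_graded_algebra_def by blast+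
  obtain F where F: "finite F" "F \<subseteq> (\<Union>n \<in> {n. (\<Sum>i\<in>UNIV. n i) = 1}. grS n)"
    and gen: "carrier S = generate_ring S (carrier R \<union> F)"
    using assms(1) unfolding standard_graded_algebra_def by blast
  interpret S: cring S by (rule S)
  interpret R: cring R by (rule assms(3))
  have mod: "module S (regular_module S)" by (rule S.module_regular_module)
  then interpret r: module S "regular_module S" .
  have dec': "direct_sum_decomposition (regular_module S) grS"
    using dec unfolding direct_sum_decomposition_def finsum_regular_module subgroup_regular_module by simp
  let ?S0 = "grS (\<lambda>_. 0)"
  have carR: "carrier R = ?S0" unfolding R by simp
  interpret GS: graded_group S grS
    by (intro graded_group.intro graded_group_axioms.intro dec S.abelian_group_axioms)
  interpret GR: graded_group "regular_module S" grS
    by (intro graded_group.intro graded_group_axioms.intro dec' r.M.abelian_group_axioms)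
  have "standard_algebra S grS F"
  proof (intro standard_algebra.intro standard_algebra_axioms.intro S F)
    show "graded_mod S grS (regular_module S) grS"
      by (intro graded_mod.intro graded_mod_axioms.intro mod GS.graded_group_axioms GR.graded_group_axioms)
        (simp add: mult)
    show "\<one>\<^bsub>S\<^esub> \<in> ?S0" using R.one_closed unfolding R by simp
    \<comment> \<open>The closed subsets of the degree-zero part are ideals of \<open>R\<close>. The
      two rings differ only in the carrier, but negation is defined through the carrier and has to
      be compared separately.\<close>
    have "len (closed_sub (regular_module S) ?S0) {\<zero>\<^bsub>S\<^esub>} ?S0
        \<le> len (closed_sub (regular_module R) (carrier R)) {\<zero>\<^bsub>R\<^esub>} (carrier R)"
    proof (rule len_map_le[where f = "\<lambda>C. C"])
      fix C assume C: "closed_sub (regular_module S) ?S0 C" "{\<zero>\<^bsub>S\<^esub>} \<subseteq> C" "C \<subseteq> ?S0"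
      note c = closed_subD[OF C(1)]
      have "closed_sub (regular_module R) (carrier R) C"
      proof (rule closed_subI)
        show "\<ominus>\<^bsub>regular_module R\<^esub> x \<in> C" if x: "x \<in> C" for x
        proof -
          have y: "\<ominus>\<^bsub>S\<^esub> x \<in> C" using c(5)[OF x] by simp
          have "\<ominus>\<^bsub>S\<^esub> x \<oplus>\<^bsub>S\<^esub> x = \<zero>\<^bsub>S\<^esub>" using c(3)[OF x] by (simp add: S.l_neg)
          then have "\<ominus>\<^bsub>R\<^esub> x = \<ominus>\<^bsub>S\<^esub> x"
            using R.minus_equality[of "\<ominus>\<^bsub>S\<^esub> x" x] x y C(3) unfolding carR by (auto simp: R)
          then show ?thesis using y by simp
        qed
      qed (use C c(2,4,6) in \<open>auto simp: R\<close>)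
      then show "closed_sub (regular_module R) (carrier R) C \<and> {\<zero>\<^bsub>R\<^esub>} \<subseteq> C \<and> C \<subseteq> carrier R"
        using C by (simp add: R)
    next
      show "closed_sub (regular_module R) (carrier R) {\<zero>\<^bsub>R\<^esub>}"
        using module.closed_sub_zero[OF R.module_regular_module subset_refl] by simp
      show "closed_sub (regular_module R) (carrier R) (carrier R)"
        using module.closed_sub_carrier[OF R.module_regular_module subset_refl] by simp
    qed
    moreover obtain c where "len (closed_sub (regular_module R) (carrier R)) {\<zero>\<^bsub>R\<^esub>} (carrier R) = enat c"
      using R.artinian_finite_length[OF assms(2)] by blast
    ultimately show "len (closed_sub (regular_module S) ?S0) {\<zero>\<^bsub>S\<^esub>} ?S0 \<noteq> \<infinity>"
      using le_enat_imp_finite by simp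
    show "carrier S = generate_ring S (?S0 \<union> F)" using gen carR by simp
  qed
  then show thesis by (rule that)
qed

text \<open>The degree-zero component of \<open>a y\<close> is the product of those of
  \<open>a\<close> and \<open>y\<close>, so the elements whose degree-zero component lies in the
  span of \<open>ms\<close> form a submodule. It contains the generators of \<open>M\<close>; hence
  \<open>ms\<close>, their degree-zero components, span the degree-zero part, and the hypothesis
  \<open>span\<close> carries this to all degrees.\<close>

lemma (in standard_algebra) standard_module_if_generated_in_degree_0:
  assumes "graded_module S grS M grM" "finitely_generated_module S M"
    and span: "\<And>n. grM n = smult_span M (grS n) (grM (\<lambda>_. 0))"
  obtains ms where "standard_module S grS F M grM ms"
proof -
  have mod: "module S M" and dec: "direct_sum_decomposition M grM"
    and mult: "\<And>n n' a x. a \<in> grS n \<Longrightarrow> x \<in> grM n' \<Longrightarrow> a \<odot>\<^bsub>M\<^esub> x \<in> grM (\<lambda>i. n i + n' i)"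
    using assms(1) unfolding graded_module_def by blast+
  have gg: "graded_group M grM"
    by (intro graded_group.intro graded_group_axioms.intro dec module.axioms(2)[OF mod])
  have ax: "graded_mod_axioms grS M grM" by (rule graded_mod_axioms.intro) (rule mult)
  have gm: "graded_mod S grS M grM"
    by (rule graded_mod.intro[OF mod A.GR.graded_group_axioms gg ax])
  interpret B: graded_mod S grS M grM by (rule gm)
  obtain G where G: "finite G" "G \<subseteq> carrier M" "\<And>N. submodule N S M \<Longrightarrow> G \<subseteq> N \<Longrightarrow> N = carrier M"
    using assms(2) unfolding finitely_generated_module_def by blast
  obtain ms where ms: "set ms = (\<lambda>g. B.GM.component g (\<lambda>_. 0)) ` G" 
    using finite_list[OF finite_imageI[OF G(1), of "\<lambda>g. B.GM.component g (\<lambda>_. 0)"]] by (elim exE)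
  have ms0: "set ms \<subseteq> grM (\<lambda>_. 0)" unfolding ms using G(2) B.GM.component_props(1) by blast
  then have msc: "set ms \<subseteq> carrier M" by auto
  let ?L = "B.lin_span S0 ms"
  have L: "closed_sub M S0 ?L" by (rule B.closed_sub_lin_span[OF A.gr0_subset A.closed_sub_gr msc])
  define N where "N = {y\<in>carrier M. B.GM.component y (\<lambda>_. 0) \<in> ?L}"
  have "closed_sub M (carrier S) N"
  proof (rule closed_subI)
    fix a y assume a: "a \<in> carrier S" and y: "y \<in> N"
    have yc: "y \<in> carrier M" "B.GM.component y (\<lambda>_. 0) \<in> ?L" using y unfolding N_def by auto
    have "B.GM.component (a \<odot>\<^bsub>M\<^esub> y) (\<lambda>_. 0) \<in> ?L"
      using a
    proof (induction a rule: A.GR.homogeneous_induct)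
      case 1
      then show ?case by (rule a)
    next
      case (2 n b)
      show ?case
      proof (cases "n = (\<lambda>_. 0)")
        case True
        then show ?thesis using B.component_smult[of b n y "\<lambda>_. 0"] 2 yc closed_subD(6)[OF L] by simp
      next
        case False
        then have "\<not> (\<forall>i. n i \<le> 0)" by (auto simp: fun_eq_iff)
        then show ?thesis using B.component_smult_zero[of b n y "\<lambda>_. 0"] 2 yc(1) closed_subD(2)[OF L] by simp
      qed
    next
      case (3 b c)
      then show ?case using yc(1) closed_subD(4)[OF L] by (simp add: B.smult_l_distr B.GM.component_add)
    qed
    then show "a \<odot>\<^bsub>M\<^esub> y \<in> N" using a yc(1) unfolding N_def by simp
  qed (use closed_subD(2,4,5)[OF L] in \<open>auto simp: N_def B.GM.component_add B.GM.component_minus\<close>)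
  then have "submodule N S M"
    using B.submodule_iff_closed_sub[of S "carrier S" "carrier M" N] B.closed_sub_carrier[OF subset_refl]
    unfolding N_def by auto
  moreover have "G \<subseteq> N"
  proof
    fix g assume g: "g \<in> G"
    then have "B.GM.component g (\<lambda>_. 0) \<in> set ms" unfolding ms by blast
    then have "\<one> \<odot>\<^bsub>M\<^esub> B.GM.component g (\<lambda>_. 0) \<in> ?L"
      using B.smult_mem_lin_span[OF A.gr0_subset A.closed_sub_gr msc _ one_gr0] by blast
    then show "g \<in> N" using g G(2) unfolding N_def by auto
  qed
  ultimately have "N = carrier M" by (rule G(3))
  have gr0: "x \<in> ?L" if "x \<in> grM (\<lambda>_. 0)" for x
  proof -
    have "x \<in> N" unfolding \<open>N = carrier M\<close> using that by simp
    then show ?thesis using B.GM.component_homogeneous[OF that, of "\<lambda>_. 0"] unfolding N_def by simp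
  qed
  have "standard_module S grS F M grM ms"
  proof (intro standard_module.intro standard_module_axioms.intro standard_algebra_axioms B.graded_mod_axioms ms0)
    fix n
    have L: "closed_sub M S0 (B.lin_span (grS n) ms)"
      by (rule B.closed_sub_lin_span[OF A.gr0_subset A.closed_sub_gr msc])
    show "grM n \<subseteq> B.lin_span (grS n) ms"
      unfolding span[of n] smult_span_def
    proof (rule B.M.add.generate_subgroup_incl)
      show "{a \<odot>\<^bsub>M\<^esub> x | a x. a \<in> grS n \<and> x \<in> grM (\<lambda>_. 0)} \<subseteq> B.lin_span (grS n) ms"
      proof clarify
        fix a x assume a: "a \<in> grS n" and x: "x \<in> grM (\<lambda>_. 0)"
        show "a \<odot>\<^bsub>M\<^esub> x \<in> B.lin_span (grS n) ms"
          by (rule B.smult_lin_span[OF _ A.gr0_subset msc _ gr0[OF x]]) (use a mult_gr[OF a, of _ "\<lambda>_. 0"] in auto)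
      qed
      show "subgroup (B.lin_span (grS n) ms) (add_monoid M)"
        using L unfolding closed_sub_def subgroup_def by (simp add: a_inv_def)
    qed
  qed
  then show thesis by (rule that)
qed

section \<open>Hilbert polynomials and their degree\<close>

lemma total_degree_eqI:
  assumes "\<And>k. k \<in> Poly_Mapping.keys p \<Longrightarrow> tdeg k \<le> D" "k \<in> Poly_Mapping.keys p" "tdeg k = D"
  shows "total_degree p = ereal (real D)"
  unfolding total_degree_def tdeg_def[symmetric]
proof (rule antisym)
  show "(SUP k\<in>Poly_Mapping.keys p. ereal (real (tdeg k))) \<le> ereal (real D)"
    using assms(1) by (intro SUP_least) simp
  show "ereal (real D) \<le> (SUP k\<in>Poly_Mapping.keys p. ereal (real (tdeg k)))"
    using assms(2,3) by (intro SUP_upper2[of k]) simp_all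
qed

text \<open>A polynomial is determined by its values at large arguments, so the definite description
  in \<open>hilbert_polynomial\<close> denotes \<open>p\<close>.\<close>

lemma hilbert_polynomialI:
  fixes S R :: "'a ring" and M :: "('a, 'b) module"
  assumes "standard_module S grS F M grM ms" "carrier R = grS (\<lambda>_. 0)"
    and p: "ev_large (\<lambda>n. real (standard_module.lm grS M grM n) = poly_value p n)"
  shows "is_hilbert_polynomial R M grM p" "hilbert_polynomial R M grM = p"
proof -
  interpret standard_module S grS F M grM ms by (rule assms(1))
  have len: "module_length R (M\<lparr>carrier := grM n\<rparr>) = enat (lm n)" for n
    using B.module_length_eq_len[of R "grM n"] B.closed_sub_gr[of n] len_gr[of n] A.gr0_subset
    unfolding assms(2) by simp
  then have iff: "is_hilbert_polynomial R M grM q \<longleftrightarrow> ev_large (\<lambda>n. real (lm n) = poly_value q n)" for q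
    unfolding is_hilbert_polynomial_def ev_large_def by auto
  show h: "is_hilbert_polynomial R M grM p" using p unfolding iff .
  show "hilbert_polynomial R M grM = p" unfolding hilbert_polynomial_def
  proof (rule the_equality, rule h)
    fix q assume "is_hilbert_polynomial R M grM q"
    then have "ev_large (\<lambda>n. real (lm n) = poly_value q n)" unfolding iff .
    with p have "ev_large (\<lambda>n. real (lm n) = poly_value p n \<and> real (lm n) = poly_value q n)"
      by (rule ev_large_conj)
    then have "ev_large (\<lambda>n. poly_value q n = poly_value p n)" by (rule ev_large_mono) auto
    then show "q = p" by (rule poly_value_eqI)
  qed
qed

context standard_module
begin

lemma H_eq_lm: "H {\<zero>\<^bsub>M\<^esub>} (carrier M) n = real (lm n)"
proof -
  have "{\<zero>\<^bsub>M\<^esub>} \<inter> grM n = {\<zero>\<^bsub>M\<^esub>}" "carrier M \<inter> grM n = grM n" by auto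
  then show ?thesis by (simp add: hilb_def lm_def)
qed

lemma ex_poly_lm:
  assumes "\<forall>P d. chain_from (Proj S grS) P d \<longrightarrow> d \<le> D"
  obtains p where "ev_large (\<lambda>n. real (lm n) = poly_value p n)" "\<And>k. k \<in> Poly_Mapping.keys p \<Longrightarrow> tdeg k \<le> D"
proof -
  have "ev_poly (Suc D) (H {\<zero>\<^bsub>M\<^esub>} (carrier M))"
  proof (rule ev_poly_if_primes[where I = "{}"])
    show "ev_poly (Suc D) (HS P (carrier S))" if "P \<in> Proj S grS" for P
      by (rule ev_poly_prime[OF that]) (use assms in blast)
  qed (auto simp: B.graded_sub_zero B.graded_sub_carrier)
  then have "ev_poly (Suc D) (\<lambda>n. real (lm n))" unfolding H_eq_lm[abs_def] .
  then obtain g where "poly_fun (Suc D) g" "ev_large (\<lambda>n. real (lm n) = g n)"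
    using ev_poly_imp_poly_fun by blast
  moreover from this obtain p where "poly_value p = g" "\<forall>k\<in>Poly_Mapping.keys p. tdeg k < Suc D"
    using poly_fun_imp_poly_value by blast
  ultimately show thesis using that[of p] by (metis less_Suc_eq_le)
qed

end

text \<open>Let \<open>P\<close> begin a chain of the maximal length \<open>D\<close>. Without a
  term of degree \<open>D\<close> in the polynomial of \<open>S\<close>, the Hilbert function of the
  quotient \<open>S / P\<close> would have degree below \<open>D\<close> as well, although a chain
  of length \<open>D\<close> forces degree at least \<open>D\<close>.\<close>

lemma (in standard_algebra) ex_top_key:
  assumes bound: "\<forall>P d. chain_from (Proj S grS) P d \<longrightarrow> d \<le> D" and P: "chain_from (Proj S grS) P D"
    and p: "ev_large (\<lambda>n. real (AA.lm n) = poly_value p n)" "\<And>k. k \<in> Poly_Mapping.keys p \<Longrightarrow> tdeg k \<le> D"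
  shows "\<exists>k\<in>Poly_Mapping.keys p. tdeg k = D"
proof (rule ccontr)
  assume "\<not> ?thesis"
  then have "\<And>k. k \<in> Poly_Mapping.keys p \<Longrightarrow> tdeg k < D" using p(2) by force
  then have "poly_fun D (poly_value p)"
    unfolding poly_fun_def poly_value_monomial_fun[abs_def]
    by (intro exI[of _ "Poly_Mapping.keys p"] exI[of _ "Poly_Mapping.lookup p"]) simp
  then have ev: "ev_poly D (\<lambda>n. real (AA.lm n))" 
    by (rule ev_poly_cong[OF ev_poly_poly_fun]) (rule ev_large_mono[OF p(1)], simp)
  have PP: "P \<in> Proj S grS" using P unfolding chain_from_def by auto
  have gP: "A.graded_sub P" by (rule ProjD(1)[OF PP])
  have g: "A.graded_sub {\<zero>}" "A.graded_sub (carrier S)" "{\<zero>} \<subseteq> P" "P \<subseteq> carrier S"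
    using A.graded_sub_zero A.graded_sub_carrier closed_subD(1,2)[OF A.graded_subD(1)[OF gP]] by simp_all
  have "0 \<le> HS P (carrier S) n \<and> HS P (carrier S) n \<le> real (AA.lm n)" for n
  proof -
    have "real (AA.lm n) = HS {\<zero>} P n + HS P (carrier S) n"
      using AA.H_eq_lm[of n] AA.H_add[OF g(1) gP g(2-4), of n] unfolding regular_module_simps by (rule trans[OF sym])
    then show ?thesis using AA.H_nonneg[of "{\<zero>}" P n] AA.H_nonneg[of P "carrier S" n] by linarith
  qed
  then have "ev_poly D (HS P (carrier S))"
    using ev_poly_le[OF _ ev ev_poly_prime[OF PP]] bound by (auto simp: ev_large_def)
  then have "D < D" by (rule chain_length_less[OF P]) (use bound in blast)
  then show False by simp
qed

theorem theorem3p1: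
  fixes R S :: "'a ring" and \<nn> :: "'a set"
    and grS :: "('s::finite \<Rightarrow> nat) \<Rightarrow> 'a set"
    and M :: "('a, 'b) module" and grM :: "('s \<Rightarrow> nat) \<Rightarrow> 'b set"
    and r :: nat and k :: "'s \<Rightarrow> nat"
  assumes "artinian_ring R" and "local_cring R \<nn>"
    and "standard_graded_algebra R S grS"
    and "graded_module S grS M grM"
    and "finitely_generated_module S M"
    and "\<And>n. grM n = smult_span M (grS n) (grM (\<lambda>_. 0))"
    and "has_rank S M r" and "r > 0"
    and "\<not> grS (\<lambda>_. 1) \<subseteq> radical S (annihilator S M)"
    and "ereal (real (\<Sum>i\<in>UNIV. k i)) = chain_dimension (Supp_plusplus S grS M)"
  shows "mixed_multiplicity_defined R S grS M grM k \<and>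
    mixed_multiplicity_defined R S grS (regular_module S) grS k \<and>
    mixed_multiplicity R M grM k = mixed_multiplicity R (regular_module S) grS k * real r"
proof -
  interpret R: local_cring R \<nn> by (rule assms(2))
  obtain F where "standard_algebra S grS F"
    using standard_algebra_if_standard_graded[OF assms(3,1) R.cring_axioms] by blast
  then interpret standard_algebra S grS F .
  obtain ms where sm: "standard_module S grS F M grM ms"
    using standard_module_if_generated_in_degree_0[OF assms(4-6)] by blast
  then interpret standard_module S grS F M grM ms .
  have carR: "carrier R = grS (\<lambda>_. 0)" using assms(3) unfolding standard_graded_algebra_def by auto
  obtain xs w where xs: "length xs = r" "set xs \<subseteq> carrier M" "B.independent xs" and w: "w \<in> nonzerodivisors S"
    and span: "\<And>m. m \<in> carrier M \<Longrightarrow> w \<odot>\<^bsub>M\<^esub> m \<in> B.lin_span (carrier S) xs"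
    using B.rank_basis[OF assms(7,5)] by blast
  \<comment> \<open>As \<open>r\<close> is positive there is a basis element \<open>x\<close>; by
    independence no nonzero scalar kills it, and this gives full support.\<close>
  obtain x xs' where x: "xs = x # xs'" using xs(1) assms(8) by (cases xs) auto
  have "closed_sub M (carrier S) (B.lin_span (carrier S) xs')"
    by (rule B.closed_sub_lin_span[OF subset_refl]) (use A.closed_sub_carrier[OF subset_refl] xs(2) x in auto)
  then have "a = \<zero>\<^bsub>S\<^esub>" if "a \<in> carrier S" "a \<odot>\<^bsub>M\<^esub> x = \<zero>\<^bsub>M\<^esub>" for a
    using that xs(3) closed_subD(2) unfolding x by force
  then have suppM: "Supp_plusplus S grS M = Proj S grS"
    using Supp_plusplus_eq_Proj[OF B.module_axioms, of x] xs(2) x by auto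
  have suppS: "Supp_plusplus S grS (regular_module S) = Proj S grS"
    by (rule Supp_plusplus_eq_Proj[OF module_regular_module, of "\<one>\<^bsub>S\<^esub>"]) auto
  have dim: "chain_dimension (Proj S grS) = ereal (real (tdeg k))"
    using assms(10) unfolding suppM tdeg_def by simp
  have bound: "\<forall>P d. chain_from (Proj S grS) P d \<longrightarrow> d \<le> tdeg k"
    using chain_dimension_realD(1)[OF dim] by blast
  obtain P where P: "chain_from (Proj S grS) P (tdeg k)" using chain_dimension_realD(2)[OF dim] by blast
  obtain pM where pM: "ev_large (\<lambda>n. real (lm n) = poly_value pM n)"
    "\<And>k'. k' \<in> Poly_Mapping.keys pM \<Longrightarrow> tdeg k' \<le> tdeg k"
    using ex_poly_lm[OF bound] by blast
  obtain pS where pS: "ev_large (\<lambda>n. real (AA.lm n) = poly_value pS n)"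
    "\<And>k'. k' \<in> Poly_Mapping.keys pS \<Longrightarrow> tdeg k' \<le> tdeg k"
    using AA.ex_poly_lm[OF bound] by blast
  have ls: "ls = AA.lm" by (simp add: fun_eq_iff ls_def AA.lm_def)
  from box_inequalities[OF xs(2,3) w span] obtain d where d: "\<And>a h. d \<le> h \<Longrightarrow>
      r * (\<Sum>n\<in>box a h. AA.lm n) \<le> (\<Sum>n\<in>box a (h + d). lm n)"
    "\<And>a h. d \<le> h \<Longrightarrow> (\<Sum>n\<in>box a h. lm n) + length ms * (\<Sum>n\<in>box a (h - d). AA.lm n)
      \<le> r * (\<Sum>n\<in>box a (h + d). AA.lm n) + length ms * (\<Sum>n\<in>box a h. AA.lm n)"
    unfolding xs(1) ls by blast
  have coeff: "Poly_Mapping.lookup pM k' = real r * Poly_Mapping.lookup pS k'" if "tdeg k' = tdeg k" for k'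
  proof (rule top_coefficients_of_box_inequalities[OF pS pM _ _ that, where d = d and c = "real (length ms)"])
    show "real r * (\<Sum>n\<in>box a h. real (AA.lm n)) \<le> (\<Sum>n\<in>box a (h + d). real (lm n))" if "d \<le> h" for a h
      using d(1)[OF that, of a] unfolding of_nat_sum[symmetric] of_nat_mult[symmetric] of_nat_le_iff .
    show "(\<Sum>n\<in>box a h. real (lm n)) + real (length ms) * (\<Sum>n\<in>box a (h - d). real (AA.lm n))
        \<le> real r * (\<Sum>n\<in>box a (h + d). real (AA.lm n)) + real (length ms) * (\<Sum>n\<in>box a h. real (AA.lm n))"
      if "d \<le> h" for a h
      using d(2)[OF that, of a]
      unfolding of_nat_sum[symmetric] of_nat_mult[symmetric] of_nat_add[symmetric] of_nat_le_iff .
  qed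
  \<comment> \<open>A nonzero coefficient of top degree in the polynomial of \<open>S\<close> stays
    nonzero after multiplication by \<open>r > 0\<close>, so the polynomial of \<open>M\<close> has
    the same degree.\<close>
  obtain k' where k': "k' \<in> Poly_Mapping.keys pS" "tdeg k' = tdeg k" using ex_top_key[OF bound P pS] by blast
  then have "k' \<in> Poly_Mapping.keys pM" using coeff[OF k'(2)] assms(8) by (simp add: in_keys_iff)
  then have degM: "total_degree pM = ereal (real (tdeg k))" using pM(2) k'(2) by (intro total_degree_eqI)
  have degS: "total_degree pS = ereal (real (tdeg k))" using pS(2) k' by (intro total_degree_eqI)
  note hM = hilbert_polynomialI[OF sm carR pM(1)]
  note hS = hilbert_polynomialI[OF standard_module_regular carR pS(1)]
  have "mixed_multiplicity_defined R S grS M grM k"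
    unfolding mixed_multiplicity_defined_def suppM dim tdeg_def[symmetric] using hM(1) degM by blast
  moreover have "mixed_multiplicity_defined R S grS (regular_module S) grS k"
    unfolding mixed_multiplicity_defined_def suppS dim tdeg_def[symmetric] using hS(1) degS by blast
  moreover have "mixed_multiplicity R M grM k = mixed_multiplicity R (regular_module S) grS k * real r"
    unfolding mixed_multiplicity_def hM(2) hS(2) coeff[OF refl] by simp
  ultimately show ?thesis by blast
qed

end
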